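(* (a) Every $\mathfrak{g}$-module in category $\mathcal{J}$ is a polynomial module. (b) There is a one-to-one correspondence between indecomposable $\mathfrak{g}$-modules in category $\mathcal{J}$ and pairs $(\lambda,U)$, where $\lambda\in\mathbb{C}^n/\mathbb{Z}^n$ and $U$ is a finite-dimensional indecomposable module (with representation $\rho$) for the Lie algebra $\mathfrak{g}^+$. To the pair $(\lambda,U)$ corresponds $J=\mathcal{F}(\mathbb{T}^n)\otimes U$, where $\mathcal{F}(\mathbb{T}^n)$ acts by multiplication on the first factor and $$d_j(s)(e_m\otimes v)=(m_j+\lambda_j)\,e_{m+s}\otimes v+\sum_{\beta\in\mathbb{Z}_+^n\setminus\{0\}}\frac{s^\beta}{\beta!}\,e_{m+s}\otimes\rho\Big(z^\beta\frac{\partial}{\partial z_j}\Big)v,$$ $$(e_s\otimes g)(e_m\otimes v)=\sum_{\beta\in\mathbb{Z}_+^n}\frac{s^\beta}{\beta!}\,e_{m+s}\otimes\rho(z^\beta g)v,$$ for $g\in\dot{\mathfrak{g}}$ and $v\in U$. In both sums only finitely many terms are nonzero. (c) Irreducible $\mathfrak{g}$-modules in category $\mathcal{J}$ are in one-to-one correspondence with pairs $(\lambda,V)$, where $\lambda\in\mathbb{C}^n/\mathbb{Z}^n$ and $V$ is a finite-dimensional irreducible $\mathfrak{gl}_n(\mathbb{C})\oplus\dot{\mathfrak{g}}$-module. The corresponding module is $J=\mathcal{F}(\mathbb{T}^n)\otimes V$, where $\mathcal{F}(\mathbb{T}^n)$ acts by multiplication on the first factor and $$d_j(s)(e_m\otimes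 v)=(m_j+\lambda_j)\,e_{m+s}\otimes v+\sum_{p=1}^ns_p\,e_{m+s}\otimes E^p_jv,$$ $$(e_s\otimes g)(e_m\otimes v)=e_{m+s}\otimes gv\qquad(g\in\dot{\mathfrak{g}},\ v\in V).$$
   Context: Let $n\ge 1$. Let $\mathcal{F}(\mathbb{T}^n)$ be the commutative algebra with $\mathbb{C}$-basis $e_m=e^{2\pi i m\cdot x}$, $m\in\mathbb{Z}^n$, and $e_me_k=e_{m+k}$. Let $W_n$ be the Lie algebra with $\mathbb{C}$-basis $d_j(s)=\frac{1}{2\pi i}e^{2\pi i s\cdot x}\frac{\partial}{\partial x^j}$, for $j=1,\dots,n$ and $s\in\mathbb{Z}^n$, and bracket $$[d_j(s),d_k(m)]=m_jd_k(s+m)-s_kd_j(s+m).$$ $W_n$ acts on $\mathcal{F}(\mathbb{T}^n)$ by derivations via $d_j(s)e_m=m_je_{m+s}$. Write $d_j=d_j(0)$. Let $\dot{\mathfrak{g}}$ be a finite-dimensional complex Lie algebra. Let $\tilde{\mathfrak{g}}=\mathcal{F}(\mathbb{T}^n)\otimes\dot{\mathfrak{g}}$ with bracket $[f\otimes a,h\otimes b]=fh\otimes[a,b]$. Let $\mathfrak{g}=W_n\oplus\tilde{\mathfrak{g}}$ be the semidirect product with $[u,f\otimes a]=(uf)\otimes a$. Category $\mathcal{J}$ (for $\mathfrak{g}$) consists of $\mathfrak{g}$-modules $J$ that are also $\mathcal{F}(\mathbb{T}^n)$-modules and satisfy: (J1) each $d_j$ acts diagonalizably; (J2) $J$ is a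 free $\mathcal{F}(\mathbb{T}^n)$-module of finite rank; (J3) $u(fw)=(uf)w+f(uw)$ for $u\in W_n$, $f\in\mathcal{F}(\mathbb{T}^n)$, $w\in J$; (J4) $\tilde g(fw)=f(\tilde gw)$ for $\tilde g\in\tilde{\mathfrak{g}}$, $f\in\mathcal{F}(\mathbb{T}^n)$, $w\in J$. Submodules are invariant under $\mathfrak{g}$ and $\mathcal{F}(\mathbb{T}^n)$. Indecomposable modules are nonzero. Correspondences are up to isomorphism, and $\lambda$ denotes any representative of its class. A module $J$ in $\mathcal{J}$ is a polynomial module if there is an $\mathcal{F}(\mathbb{T}^n)$-basis $v_1,\dots,v_k$ of $J$ such that, for all $s,m\in\mathbb{Z}^n$, $$d_j(s)(e_mv_r)=\sum_\ell f_{jr\ell}(s,m)\,e_{m+s}v_\ell,\qquad (e_s\otimes a)(e_mv_r)=\sum_\ell h_{ar\ell}(s,m)\,e_{m+s}v_\ell,$$ with all structure constants $f_{jr\ell}$ and $h_{ar\ell}$ polynomial in $s,m$, for each $a\in\dot{\mathfrak{g}}$. Notation: $\mathbb{Z}_+$ denotes the nonnegative integers, $\epsilon_j$ the standard basis of $\mathbb{Z}^n$, $s^\beta=\prod_i s_i^{\beta_i}$ and $\beta!=\prod_i\beta_i!$. $W_n^+$ is the Lie algebra spanned by $z^\alpha\frac{\partial}{\partial z_j}$ with $\alpha\in\mathbb{Z}_+^n\setminus\{0\}$, acting as derivations of $\mathbb{C}[z_1,\dots,z_n]$. $\mathfrak{g}^+=W_n^+\oplus\mathbb{C}[z_1,\dots,z_n]\otimes\dot{\mathfrak{g}}$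 is the semidirect product with brackets $$\Big[z^\alpha\frac{\partial}{\partial z_j},z^\beta a\Big]=\beta_jz^{\alpha+\beta-\epsilon_j}a,\qquad [z^\alpha a,z^\beta b]=z^{\alpha+\beta}[a,b].$$ $E^p_q\in\mathfrak{gl}_n(\mathbb{C})$ is the matrix with $1$ in position $(p,q)$ and $0$ elsewhere. *)

theory Defs
  imports Complex_Main "HOL-Library.Poly_Mapping" "HOL-Library.Function_Algebras"
begin

definition vs_on :: "(complex \<Rightarrow> 'a::ab_group_add \<Rightarrow> 'a) \<Rightarrow> 'a set \<Rightarrow> bool" where
  "vs_on sc M \<longleftrightarrow> 0 \<in> M \<and> (\<forall>x\<in>M. \<forall>y\<in>M. x + y \<in> M) \<and> (\<forall>c. \<forall>x\<in>M. sc c x \<in> M)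
     \<and> (\<forall>a. \<forall>x\<in>M. \<forall>y\<in>M. sc a (x + y) = sc a x + sc a y)
     \<and> (\<forall>a b. \<forall>x\<in>M. sc (a + b) x = sc a x + sc b x)
     \<and> (\<forall>a b. \<forall>x\<in>M. sc a (sc b x) = sc (a * b) x)
     \<and> (\<forall>x\<in>M. sc 1 x = x)"

definition subsp :: "(complex \<Rightarrow> 'a::ab_group_add \<Rightarrow> 'a) \<Rightarrow> 'a set \<Rightarrow> 'a set \<Rightarrow> bool" where
  "subsp sc M N \<longleftrightarrow> N \<subseteq> M \<and> 0 \<in> N \<and> (\<forall>x\<in>N. \<forall>y\<in>N. x + y \<in> N) \<and> (\<forall>c. \<forall>x\<in>N. sc c x \<in> N)"

definition span_fam :: "(complex \<Rightarrow> 'a::ab_group_add \<Rightarrow> 'a) \<Rightarrow> ('i \<Rightarrow> 'a) \<Rightarrow> 'i set \<Rightarrow> 'a set" where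
  "span_fam sc f I = {(\<Sum>i\<in>A. sc (c i) (f i)) | A c. finite A \<and> A \<subseteq> I}"

definition indep_fam :: "(complex \<Rightarrow> 'a::ab_group_add \<Rightarrow> 'a) \<Rightarrow> ('i \<Rightarrow> 'a) \<Rightarrow> 'i set \<Rightarrow> bool" where
  "indep_fam sc f I \<longleftrightarrow> (\<forall>A c. finite A \<and> A \<subseteq> I \<and> (\<Sum>i\<in>A. sc (c i) (f i)) = 0 \<longrightarrow> (\<forall>i\<in>A. c i = 0))"

definition fin_dim :: "(complex \<Rightarrow> 'a::ab_group_add \<Rightarrow> 'a) \<Rightarrow> 'a set \<Rightarrow> bool" where
  "fin_dim sc M \<longleftrightarrow> (\<exists>B. finite B \<and> B \<subseteq> M \<and> M \<subseteq> span_fam sc id B)"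

definition lin_on :: "(complex \<Rightarrow> 'a::ab_group_add \<Rightarrow> 'a) \<Rightarrow> 'a set \<Rightarrow> ('a \<Rightarrow> 'a) \<Rightarrow> bool" where
  "lin_on sc M T \<longleftrightarrow> (\<forall>x\<in>M. T x \<in> M) \<and> (\<forall>x\<in>M. \<forall>y\<in>M. T (x + y) = T x + T y)
     \<and> (\<forall>c. \<forall>x\<in>M. T (sc c x) = sc c (T x))"

definition lie_algebra :: "(complex \<Rightarrow> 'g::ab_group_add \<Rightarrow> 'g) \<Rightarrow> ('g \<Rightarrow> 'g \<Rightarrow> 'g) \<Rightarrow> bool" where
  "lie_algebra sg lb \<longleftrightarrow> vs_on sg UNIV \<and> fin_dim sg UNIV
     \<and> (\<forall>x y z. lb (x + y) z = lb x z + lb y z)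
     \<and> (\<forall>c x y. lb (sg c x) y = sg c (lb x y))
     \<and> (\<forall>x y z. lb x (y + z) = lb x y + lb x z)
     \<and> (\<forall>c x y. lb x (sg c y) = sg c (lb x y))
     \<and> (\<forall>x. lb x x = 0)
     \<and> (\<forall>x y z. lb x (lb y z) + lb y (lb z x) + lb z (lb x y) = 0)"

section \<open>Modules for \<open>\<g> = W_n \<ltimes> \<F>(\<T>^n) \<otimes> \<dot>\<g>\<close> that are also \<open>\<F>(\<T>^n)\<close>-modules\<close>

text \<open>Z^n is represented as 'n \<Rightarrow> int for a finite index type 'n (n = CARD('n)).
  jE m is the action of e_m in F(T^n) (F(T^n) is spanned by the e_m);
  jD j s is the action of d_j(s); jG s a is the action of e_s \<otimes> a.\<close>
record ('n, 'g, 'j) Jmod =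
  jcar :: "'j set"
  jsc :: "complex \<Rightarrow> 'j \<Rightarrow> 'j"
  jE :: "('n \<Rightarrow> int) \<Rightarrow> 'j \<Rightarrow> 'j"
  jD :: "'n \<Rightarrow> ('n \<Rightarrow> int) \<Rightarrow> 'j \<Rightarrow> 'j"
  jG :: "('n \<Rightarrow> int) \<Rightarrow> 'g \<Rightarrow> 'j \<Rightarrow> 'j"

text \<open>(J2): v 0, ..., v (k-1) is a free F(T^n)-basis, i.e. the e_m v_r form a C-basis.\<close>
definition free_basis :: "('n, 'g, 'j::ab_group_add) Jmod \<Rightarrow> nat \<Rightarrow> (nat \<Rightarrow> 'j) \<Rightarrow> bool" where
  "free_basis M k v \<longleftrightarrow> (\<forall>r<k. v r \<in> jcar M)
     \<and> indep_fam (jsc M) (\<lambda>(m, r). jE M m (v r)) (UNIV \<times> {..<k})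
     \<and> jcar M \<subseteq> span_fam (jsc M) (\<lambda>(m, r). jE M m (v r)) (UNIV \<times> {..<k})"

definition diagonalizable :: "(complex \<Rightarrow> 'a::ab_group_add \<Rightarrow> 'a) \<Rightarrow> 'a set \<Rightarrow> ('a \<Rightarrow> 'a) \<Rightarrow> bool" where
  "diagonalizable sc M T \<longleftrightarrow> M \<subseteq> span_fam sc id {v \<in> M. \<exists>c. T v = sc c v}"

definition eps :: "'n \<Rightarrow> ('n \<Rightarrow> 'a::{zero,one})" where
  "eps j = (\<lambda>i. if i = j then 1 else 0)"

definition catJ :: "(complex \<Rightarrow> 'g::ab_group_add \<Rightarrow> 'g) \<Rightarrow> ('g \<Rightarrow> 'g \<Rightarrow> 'g)
    \<Rightarrow> ('n::finite, 'g, 'j::ab_group_add) Jmod \<Rightarrow> bool" where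
  "catJ sg lb M \<longleftrightarrow>
     vs_on (jsc M) (jcar M)
     \<comment> \<open>F(T^n)-module structure\<close>
     \<and> (\<forall>m. lin_on (jsc M) (jcar M) (jE M m))
     \<and> (\<forall>w\<in>jcar M. jE M 0 w = w)
     \<and> (\<forall>m k. \<forall>w\<in>jcar M. jE M m (jE M k w) = jE M (m + k) w)
     \<comment> \<open>g-module structure\<close>
     \<and> (\<forall>j s. lin_on (jsc M) (jcar M) (jD M j s))
     \<and> (\<forall>s a. lin_on (jsc M) (jcar M) (jG M s a))
     \<and> (\<forall>s a b. \<forall>w\<in>jcar M. jG M s (a + b) w = jG M s a w + jG M s b w)
     \<and> (\<forall>s c a. \<forall>w\<in>jcar M. jG M s (sg c a) w = jsc M c (jG M s a w))
     \<and> (\<forall>j k s m. \<forall>w\<in>jcar M. jD M j s (jD M k m w) - jD M k m (jD M j s w)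
            = jsc M (of_int (m j)) (jD M k (s + m) w) - jsc M (of_int (s k)) (jD M j (s + m) w))
     \<and> (\<forall>j s m a. \<forall>w\<in>jcar M. jD M j s (jG M m a w) - jG M m a (jD M j s w)
            = jsc M (of_int (m j)) (jG M (s + m) a w))
     \<and> (\<forall>s m a b. \<forall>w\<in>jcar M. jG M s a (jG M m b w) - jG M m b (jG M s a w)
            = jG M (s + m) (lb a b) w)
     \<comment> \<open>(J1)\<close>
     \<and> (\<forall>j. diagonalizable (jsc M) (jcar M) (jD M j 0))
     \<comment> \<open>(J2)\<close>
     \<and> (\<exists>k v. free_basis M k v)
     \<comment> \<open>(J3)\<close>
     \<and> (\<forall>j s m. \<forall>w\<in>jcar M. jD M j s (jE M m w) = jsc M (of_int (m j)) (jE M (m + s) w) + jE M m (jD M j s w))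
     \<comment> \<open>(J4)\<close>
     \<and> (\<forall>s a m. \<forall>w\<in>jcar M. jG M s a (jE M m w) = jE M m (jG M s a w))"

definition Jsub :: "('n, 'g, 'j::ab_group_add) Jmod \<Rightarrow> 'j set \<Rightarrow> bool" where
  "Jsub M N \<longleftrightarrow> subsp (jsc M) (jcar M) N \<and> (\<forall>m. \<forall>w\<in>N. jE M m w \<in> N)
     \<and> (\<forall>j s. \<forall>w\<in>N. jD M j s w \<in> N) \<and> (\<forall>s a. \<forall>w\<in>N. jG M s a w \<in> N)"

definition Jindec :: "('n, 'g, 'j::ab_group_add) Jmod \<Rightarrow> bool" where
  "Jindec M \<longleftrightarrow> jcar M \<noteq> {0} \<and> \<not> (\<exists>N1 N2. Jsub M N1 \<and> Jsub M N2 \<and> N1 \<noteq> {0} \<and> N2 \<noteq> {0}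
      \<and> N1 \<inter> N2 = {0} \<and> (\<forall>w\<in>jcar M. \<exists>x\<in>N1. \<exists>y\<in>N2. w = x + y))"

definition Jirred :: "('n, 'g, 'j::ab_group_add) Jmod \<Rightarrow> bool" where
  "Jirred M \<longleftrightarrow> jcar M \<noteq> {0} \<and> (\<forall>N. Jsub M N \<longrightarrow> N = {0} \<or> N = jcar M)"

definition Jiso :: "('n, 'g, 'j::ab_group_add) Jmod \<Rightarrow> ('n, 'g, 'k::ab_group_add) Jmod \<Rightarrow> bool" where
  "Jiso M1 M2 \<longleftrightarrow> (\<exists>\<phi>. bij_betw \<phi> (jcar M1) (jcar M2)
     \<and> (\<forall>x\<in>jcar M1. \<forall>y\<in>jcar M1. \<phi> (x + y) = \<phi> x + \<phi> y)
     \<and> (\<forall>c. \<forall>x\<in>jcar M1. \<phi> (jsc M1 c x) = jsc M2 c (\<phi> x))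
     \<and> (\<forall>m. \<forall>x\<in>jcar M1. \<phi> (jE M1 m x) = jE M2 m (\<phi> x))
     \<and> (\<forall>j s. \<forall>x\<in>jcar M1. \<phi> (jD M1 j s x) = jD M2 j s (\<phi> x))
     \<and> (\<forall>s a. \<forall>x\<in>jcar M1. \<phi> (jG M1 s a x) = jG M2 s a (\<phi> x)))"

definition mpow :: "('n::finite \<Rightarrow> int) \<Rightarrow> ('n \<Rightarrow> nat) \<Rightarrow> complex" where
  "mpow s \<beta> = (\<Prod>i\<in>UNIV. (of_int (s i)) ^ (\<beta> i))"

definition mfact :: "('n::finite \<Rightarrow> nat) \<Rightarrow> complex" where
  "mfact \<beta> = (\<Prod>i\<in>UNIV. of_nat (fact (\<beta> i)))"

definition polyfun :: "(('n::finite \<Rightarrow> int) \<Rightarrow> ('n \<Rightarrow> int) \<Rightarrow> complex) \<Rightarrow> bool" where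
  "polyfun p \<longleftrightarrow> (\<exists>A c. finite A \<and>
     (\<forall>s m. p s m = (\<Sum>(\<alpha>, \<beta>)\<in>A. c \<alpha> \<beta> * mpow s \<alpha> * mpow m \<beta>)))"

definition poly_module :: "('n::finite, 'g, 'j::ab_group_add) Jmod \<Rightarrow> bool" where
  "poly_module M \<longleftrightarrow> (\<exists>k v f h. free_basis M k v
     \<and> (\<forall>j r l. polyfun (f j r l)) \<and> (\<forall>a r l. polyfun (h a r l))
     \<and> (\<forall>j s m. \<forall>r<k. jD M j s (jE M m (v r)) = (\<Sum>l<k. jsc M (f j r l s m) (jE M (m + s) (v l))))
     \<and> (\<forall>a s m. \<forall>r<k. jG M s a (jE M m (v r)) = (\<Sum>l<k. jsc M (h a r l s m) (jE M (m + s) (v l)))))"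

text \<open>uR \<alpha> j is the action of z^\<alpha> d/dz_j (only meaningful for \<alpha> \<noteq> 0);
  uP \<beta> a is the action of z^\<beta> a.\<close>
record ('n, 'g, 'u) Pmod =
  ucar :: "'u set"
  usc :: "complex \<Rightarrow> 'u \<Rightarrow> 'u"
  uR :: "('n \<Rightarrow> nat) \<Rightarrow> 'n \<Rightarrow> 'u \<Rightarrow> 'u"
  uP :: "('n \<Rightarrow> nat) \<Rightarrow> 'g \<Rightarrow> 'u \<Rightarrow> 'u"

definition gplus_fdmod :: "(complex \<Rightarrow> 'g::ab_group_add \<Rightarrow> 'g) \<Rightarrow> ('g \<Rightarrow> 'g \<Rightarrow> 'g)
    \<Rightarrow> ('n::finite, 'g, 'u::ab_group_add) Pmod \<Rightarrow> bool" where
  "gplus_fdmod sg lb U \<longleftrightarrow>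
     vs_on (usc U) (ucar U) \<and> fin_dim (usc U) (ucar U)
     \<and> (\<forall>\<alpha> j. \<alpha> \<noteq> 0 \<longrightarrow> lin_on (usc U) (ucar U) (uR U \<alpha> j))
     \<and> (\<forall>\<beta> a. lin_on (usc U) (ucar U) (uP U \<beta> a))
     \<and> (\<forall>\<beta> a b. \<forall>v\<in>ucar U. uP U \<beta> (a + b) v = uP U \<beta> a v + uP U \<beta> b v)
     \<and> (\<forall>\<beta> c a. \<forall>v\<in>ucar U. uP U \<beta> (sg c a) v = usc U c (uP U \<beta> a v))
     \<and> (\<forall>\<alpha> \<gamma> j k. \<alpha> \<noteq> 0 \<longrightarrow> \<gamma> \<noteq> 0 \<longrightarrow> (\<forall>v\<in>ucar U.
          uR U \<alpha> j (uR U \<gamma> k v) - uR U \<gamma> k (uR U \<alpha> j v)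
          = usc U (of_nat (\<gamma> j)) (uR U (\<alpha> + \<gamma> - eps j) k v)
            - usc U (of_nat (\<alpha> k)) (uR U (\<alpha> + \<gamma> - eps k) j v)))
     \<and> (\<forall>\<alpha> \<beta> j a. \<alpha> \<noteq> 0 \<longrightarrow> (\<forall>v\<in>ucar U.
          uR U \<alpha> j (uP U \<beta> a v) - uP U \<beta> a (uR U \<alpha> j v)
          = usc U (of_nat (\<beta> j)) (uP U (\<alpha> + \<beta> - eps j) a v)))
     \<and> (\<forall>\<alpha> \<beta> a b. \<forall>v\<in>ucar U.
          uP U \<alpha> a (uP U \<beta> b v) - uP U \<beta> b (uP U \<alpha> a v) = uP U (\<alpha> + \<beta>) (lb a b) v)"

definition Psub :: "('n::finite, 'g, 'u::ab_group_add) Pmod \<Rightarrow> 'u set \<Rightarrow> bool" where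
  "Psub U N \<longleftrightarrow> subsp (usc U) (ucar U) N
     \<and> (\<forall>\<alpha> j. \<alpha> \<noteq> 0 \<longrightarrow> (\<forall>v\<in>N. uR U \<alpha> j v \<in> N)) \<and> (\<forall>\<beta> a. \<forall>v\<in>N. uP U \<beta> a v \<in> N)"

definition Pindec :: "('n::finite, 'g, 'u::ab_group_add) Pmod \<Rightarrow> bool" where
  "Pindec U \<longleftrightarrow> ucar U \<noteq> {0} \<and> \<not> (\<exists>N1 N2. Psub U N1 \<and> Psub U N2 \<and> N1 \<noteq> {0} \<and> N2 \<noteq> {0}
      \<and> N1 \<inter> N2 = {0} \<and> (\<forall>w\<in>ucar U. \<exists>x\<in>N1. \<exists>y\<in>N2. w = x + y))"

definition Piso :: "('n::finite, 'g, 'u::ab_group_add) Pmod \<Rightarrow> ('n, 'g, 'w::ab_group_add) Pmod \<Rightarrow> bool" where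
  "Piso U1 U2 \<longleftrightarrow> (\<exists>\<phi>. bij_betw \<phi> (ucar U1) (ucar U2)
     \<and> (\<forall>x\<in>ucar U1. \<forall>y\<in>ucar U1. \<phi> (x + y) = \<phi> x + \<phi> y)
     \<and> (\<forall>c. \<forall>x\<in>ucar U1. \<phi> (usc U1 c x) = usc U2 c (\<phi> x))
     \<and> (\<forall>\<alpha> j. \<alpha> \<noteq> 0 \<longrightarrow> (\<forall>x\<in>ucar U1. \<phi> (uR U1 \<alpha> j x) = uR U2 \<alpha> j (\<phi> x)))
     \<and> (\<forall>\<beta> a. \<forall>x\<in>ucar U1. \<phi> (uP U1 \<beta> a x) = uP U2 \<beta> a (\<phi> x)))"

text \<open>vA p q is the action of the matrix unit E^p_q; vB a the action of a in \<dot>\<g>.\<close>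
record ('n, 'g, 'v) GLmod =
  vcar :: "'v set"
  vsc :: "complex \<Rightarrow> 'v \<Rightarrow> 'v"
  vA :: "'n \<Rightarrow> 'n \<Rightarrow> 'v \<Rightarrow> 'v"
  vB :: "'g \<Rightarrow> 'v \<Rightarrow> 'v"

definition gl_fdmod :: "(complex \<Rightarrow> 'g::ab_group_add \<Rightarrow> 'g) \<Rightarrow> ('g \<Rightarrow> 'g \<Rightarrow> 'g)
    \<Rightarrow> ('n::finite, 'g, 'v::ab_group_add) GLmod \<Rightarrow> bool" where
  "gl_fdmod sg lb V \<longleftrightarrow>
     vs_on (vsc V) (vcar V) \<and> fin_dim (vsc V) (vcar V)
     \<and> (\<forall>p q. lin_on (vsc V) (vcar V) (vA V p q))
     \<and> (\<forall>a. lin_on (vsc V) (vcar V) (vB V a))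
     \<and> (\<forall>a b. \<forall>v\<in>vcar V. vB V (a + b) v = vB V a v + vB V b v)
     \<and> (\<forall>c a. \<forall>v\<in>vcar V. vB V (sg c a) v = vsc V c (vB V a v))
     \<and> (\<forall>p q r t. \<forall>v\<in>vcar V. vA V p q (vA V r t v) - vA V r t (vA V p q v)
          = (if q = r then vA V p t v else 0) - (if t = p then vA V r q v else 0))
     \<and> (\<forall>p q a. \<forall>v\<in>vcar V. vA V p q (vB V a v) - vB V a (vA V p q v) = 0)
     \<and> (\<forall>a b. \<forall>v\<in>vcar V. vB V a (vB V b v) - vB V b (vB V a v) = vB V (lb a b) v)"

definition GLsub :: "('n, 'g, 'v::ab_group_add) GLmod \<Rightarrow> 'v set \<Rightarrow> bool" where
  "GLsub V N \<longleftrightarrow> subsp (vsc V) (vcar V) N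
     \<and> (\<forall>p q. \<forall>v\<in>N. vA V p q v \<in> N) \<and> (\<forall>a. \<forall>v\<in>N. vB V a v \<in> N)"

definition GLirred :: "('n, 'g, 'v::ab_group_add) GLmod \<Rightarrow> bool" where
  "GLirred V \<longleftrightarrow> vcar V \<noteq> {0} \<and> (\<forall>N. GLsub V N \<longrightarrow> N = {0} \<or> N = vcar V)"

definition GLiso :: "('n, 'g, 'v::ab_group_add) GLmod \<Rightarrow> ('n, 'g, 'w::ab_group_add) GLmod \<Rightarrow> bool" where
  "GLiso V1 V2 \<longleftrightarrow> (\<exists>\<phi>. bij_betw \<phi> (vcar V1) (vcar V2)
     \<and> (\<forall>x\<in>vcar V1. \<forall>y\<in>vcar V1. \<phi> (x + y) = \<phi> x + \<phi> y)
     \<and> (\<forall>c. \<forall>x\<in>vcar V1. \<phi> (vsc V1 c x) = vsc V2 c (\<phi> x))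
     \<and> (\<forall>p q. \<forall>x\<in>vcar V1. \<phi> (vA V1 p q x) = vA V2 p q (\<phi> x))
     \<and> (\<forall>a. \<forall>x\<in>vcar V1. \<phi> (vB V1 a x) = vB V2 a (\<phi> x)))"

text \<open>F(T^n) \<otimes> U is realised as finitely supported functions Z^n \<Rightarrow> U, where
  e_m \<otimes> v is Poly_Mapping.single m v. An operator given on pure tensors
  e_m \<otimes> v is extended additively.\<close>
definition tens_ext :: "(('n \<Rightarrow> int) \<Rightarrow> 'u::ab_group_add \<Rightarrow> (('n \<Rightarrow> int) \<Rightarrow>\<^sub>0 'u))
    \<Rightarrow> (('n \<Rightarrow> int) \<Rightarrow>\<^sub>0 'u) \<Rightarrow> (('n \<Rightarrow> int) \<Rightarrow>\<^sub>0 'u)" where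
  "tens_ext op w = (\<Sum>m\<in>Poly_Mapping.keys w. op m (Poly_Mapping.lookup w m))"

definition tens_car :: "'u::ab_group_add set \<Rightarrow> (('n \<Rightarrow> int) \<Rightarrow>\<^sub>0 'u) set" where
  "tens_car C = {w. \<forall>m. Poly_Mapping.lookup w m \<in> C}"

text \<open>The sum over all \<beta> in a set B of (s^\<beta>/\<beta>!) x_\<beta>; it is taken over the
  nonzero terms (the theorem asserts there are finitely many of them).\<close>
definition wsum :: "(complex \<Rightarrow> 'u::ab_group_add \<Rightarrow> 'u) \<Rightarrow> ('n::finite \<Rightarrow> nat) set
    \<Rightarrow> ('n \<Rightarrow> int) \<Rightarrow> (('n \<Rightarrow> nat) \<Rightarrow> 'u) \<Rightarrow> 'u" where
  "wsum sc B s x = (\<Sum>\<beta>\<in>{\<beta>\<in>B. sc (mpow s \<beta> / mfact \<beta>) (x \<beta>) \<noteq> 0}. sc (mpow s \<beta> / mfact \<beta>) (x \<beta>))"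

definition PhiB :: "('n::finite \<Rightarrow> complex) \<Rightarrow> ('n, 'g, 'u::ab_group_add) Pmod
    \<Rightarrow> ('n, 'g, ('n \<Rightarrow> int) \<Rightarrow>\<^sub>0 'u) Jmod" where
  "PhiB lam U = \<lparr> jcar = tens_car (ucar U),
     jsc = (\<lambda>c. tens_ext (\<lambda>m v. Poly_Mapping.single m (usc U c v))),
     jE = (\<lambda>k. tens_ext (\<lambda>m v. Poly_Mapping.single (m + k) v)),
     jD = (\<lambda>j s. tens_ext (\<lambda>m v. Poly_Mapping.single (m + s)
             (usc U (of_int (m j) + lam j) v + wsum (usc U) {\<beta>. \<beta> \<noteq> 0} s (\<lambda>\<beta>. uR U \<beta> j v)))),
     jG = (\<lambda>s g. tens_ext (\<lambda>m v. Poly_Mapping.single (m + s)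
             (wsum (usc U) UNIV s (\<lambda>\<beta>. uP U \<beta> g v)))) \<rparr>"

definition PhiC :: "('n::finite \<Rightarrow> complex) \<Rightarrow> ('n, 'g, 'v::ab_group_add) GLmod
    \<Rightarrow> ('n, 'g, ('n \<Rightarrow> int) \<Rightarrow>\<^sub>0 'v) Jmod" where
  "PhiC lam V = \<lparr> jcar = tens_car (vcar V),
     jsc = (\<lambda>c. tens_ext (\<lambda>m v. Poly_Mapping.single m (vsc V c v))),
     jE = (\<lambda>k. tens_ext (\<lambda>m v. Poly_Mapping.single (m + k) v)),
     jD = (\<lambda>j s. tens_ext (\<lambda>m v. Poly_Mapping.single (m + s)
             (vsc V (of_int (m j) + lam j) v + (\<Sum>p\<in>UNIV. vsc V (of_int (s p)) (vA V p j v))))),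
     jG = (\<lambda>s g. tens_ext (\<lambda>m v. Poly_Mapping.single (m + s) (vB V g v))) \<rparr>"

definition congZ :: "('n \<Rightarrow> complex) \<Rightarrow> ('n \<Rightarrow> complex) \<Rightarrow> bool" where
  "congZ lam lam' \<longleftrightarrow> (\<forall>i. \<exists>z::int. lam i - lam' i = of_int z)"

end

(*
A weight argument writes every module J of the category as F(T^n) (x) C, where C is spanned by
weight vectors whose weights represent distinct classes modulo Z^n. On C act the operators
D_j(s) = e_{-s} d_j(s) and G(s,a) = e_{-s} (e_s (x) a). Up to a central term D_j(s) represents the
vector field (z^s - 1) z_j d/dz_j, which vanishes at z = 1, so the Euler fields (z_i - 1) d/dz_i act
on End(C). These have finitely many eigenvalues there, since C is finite-dimensional; hence fields
vanishing to high order at 1 act by zero, and D_j(s), G(s,a) are polynomial in s. Their Taylor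
coefficients in s are the operators of a g^+-module, and the commutation relations of the D_j(s),
G(s,a) are equivalent to those of g^+ by comparison of coefficients. For irreducible C, the degree
grading of g^+ bounds the length of nonzero products of elements of positive degree, so these
elements have a common kernel; it is a submodule, hence everything, and only gl_n + g survives.
*)
theory Submission
  imports Defs "HOL-Library.FuncSet" "HOL-Computational_Algebra.Polynomial"
begin

section \<open>Subspaces, linear maps and finite bases inside a carrier\<close>

section \<open>Linear algebra on a carrier set\<close>

text \<open>The difference operators are best read in logarithmic coordinates z_i = exp(t_i): z_j
  d/dz_j becomes d/dt_j, and z^s - 1 becomes the sum of s^\<beta> t^\<beta>/\<beta>! over \<beta>
  \<noteq> 0. The Taylor coefficients in s are therefore the fields t^\<beta> d/dt_j, and the
  variables of g^+ are these t_i. The t_i are not Laurent polynomials, so the eigenvalue argument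
  runs with z_i - 1 instead, and log z_i appears only in truncated form, modulo an ideal. The
  obstacle is that eigenvalues kill only special fields, such as (z_i - 1)^p d/dz_i for large p,
  whereas polynomiality needs all Laurent multiples of some power of z_i - 1, on which the Euler
  field is not diagonal. A Lie identity closes the gap: if f \<delta> and f h \<delta> act by zero,
  where \<delta> = z_k d/dz_k, \<delta> h = h and f(1) = 0, then so does f g h \<delta> for every g
  with g(1) = 0. Once everything is polynomial in s, values and coefficients are finite linear
  combinations of each other. This transfers relations, submodules and morphisms between the two
  sides.\<close>

locale vsp =
  fixes sc :: "complex \<Rightarrow> 'a::ab_group_add \<Rightarrow> 'a" and C :: "'a set"
  assumes vs: "vs_on sc C"
begin

lemma zero_in [simp]: "0 \<in> C"
  and add_in [simp]: "x \<in> C \<Longrightarrow> y \<in> C \<Longrightarrow> x + y \<in> C"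
  and sc_in [simp]: "x \<in> C \<Longrightarrow> sc c x \<in> C"
  and sc_add: "x \<in> C \<Longrightarrow> y \<in> C \<Longrightarrow> sc a (x + y) = sc a x + sc a y"
  and sc_left: "x \<in> C \<Longrightarrow> sc (a + b) x = sc a x + sc b x"
  and sc_sc [simp]: "x \<in> C \<Longrightarrow> sc a (sc b x) = sc (a * b) x"
  and sc_one [simp]: "x \<in> C \<Longrightarrow> sc 1 x = x"
  using vs unfolding vs_on_def by auto

lemma sc_zero_left [simp]: "x \<in> C \<Longrightarrow> sc 0 x = 0"
  using sc_left[of x 0 0] by simp

lemma sc_zero_right [simp]: "sc c 0 = 0"
  using sc_add[of 0 0 c] by simp

lemma sc_minus1: "x \<in> C \<Longrightarrow> sc (-1) x = - x"
  using sc_left[of x 1 "-1"] by (simp add: eq_neg_iff_add_eq_0 add.commute)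

lemma minus_in [simp]: "x \<in> C \<Longrightarrow> - x \<in> C"
  using sc_in[of x "-1"] by (simp add: sc_minus1)

lemma diff_in [simp]: "x \<in> C \<Longrightarrow> y \<in> C \<Longrightarrow> x - y \<in> C"
  using add_in[of x "-y"] by simp

lemma sc_minus_left: "x \<in> C \<Longrightarrow> sc (- a) x = - sc a x"
  using sc_left[of x a "-a"] by (simp add: eq_neg_iff_add_eq_0 add.commute)

lemma sc_minus_right: "x \<in> C \<Longrightarrow> sc a (- x) = - sc a x"
  using sc_add[of x "-x" a] by (simp add: eq_neg_iff_add_eq_0 add.commute)

lemma sc_diff: "x \<in> C \<Longrightarrow> y \<in> C \<Longrightarrow> sc a (x - y) = sc a x - sc a y"
  using sc_add[of x "-y" a] by (simp add: sc_minus_right)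

lemma sc_diff_left: "x \<in> C \<Longrightarrow> sc (a - b) x = sc a x - sc b x"
  using sc_left[of x a "-b"] by (simp add: sc_minus_left)

lemmas sc_distribs = sc_add sc_left sc_minus_left sc_minus_right sc_diff sc_diff_left

lemma sum_in [simp]: "(\<And>i. i \<in> I \<Longrightarrow> f i \<in> C) \<Longrightarrow> sum f I \<in> C"
  by (induction I rule: infinite_finite_induct) auto

lemma sc_sum: "(\<And>i. i \<in> I \<Longrightarrow> f i \<in> C) \<Longrightarrow> sc c (sum f I) = (\<Sum>i\<in>I. sc c (f i))"
  by (induction I rule: infinite_finite_induct) (auto simp: sc_add)

lemma sc_sum_left: "x \<in> C \<Longrightarrow> sc (sum f I) x = (\<Sum>i\<in>I. sc (f i) x)"
  by (induction I rule: infinite_finite_induct) (auto simp: sc_left)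

lemma sc_cancel: "x \<in> C \<Longrightarrow> sc c x = 0 \<Longrightarrow> c \<noteq> 0 \<Longrightarrow> x = 0"
  using sc_sc[of x "inverse c" c] by simp

end

lemma subsp_vsp: "vsp sc M \<Longrightarrow> subsp sc M N \<Longrightarrow> vsp sc N"
  unfolding vsp_def vs_on_def subsp_def by (auto simp: subset_iff)

lemma subsp_zero: "vsp sc M \<Longrightarrow> subsp sc M {0}"
  using vsp.sc_zero_right[of sc M] by (auto simp: subsp_def vsp_def vs_on_def)

locale lin = vsp +
  fixes T
  assumes lin: "lin_on sc C T"
begin

lemma app_in [simp]: "x \<in> C \<Longrightarrow> T x \<in> C"
  and app_add: "x \<in> C \<Longrightarrow> y \<in> C \<Longrightarrow> T (x + y) = T x + T y"
  and app_sc: "x \<in> C \<Longrightarrow> T (sc c x) = sc c (T x)"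
  using lin by (auto simp: lin_on_def)

lemma app_0 [simp]: "T 0 = 0"
  using app_add[of 0 0] by simp

lemma app_minus: "x \<in> C \<Longrightarrow> T (- x) = - T x"
  using app_sc[of x "-1"] by (simp add: sc_minus1)

lemma app_diff: "x \<in> C \<Longrightarrow> y \<in> C \<Longrightarrow> T (x - y) = T x - T y"
  using app_add[of x "-y"] by (simp add: app_minus)

lemma app_sum: "(\<And>i. i \<in> I \<Longrightarrow> f i \<in> C) \<Longrightarrow> T (sum f I) = (\<Sum>i\<in>I. T (f i))"
  by (induction I rule: infinite_finite_induct) (auto simp: app_add vsp.sum_in[OF vsp_axioms])

lemmas app_simps = app_add app_minus app_diff app_sc app_sum

end

context vsp
begin

lemma linI: "lin_on sc C T \<Longrightarrow> lin sc C T"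
  by (simp add: lin_def vsp_axioms lin_axioms_def)

lemma lin_sum: "(\<And>i. i \<in> I \<Longrightarrow> lin_on sc C (T i)) \<Longrightarrow> lin_on sc C (\<lambda>v. \<Sum>i\<in>I. T i v)"
  unfolding lin_on_def by (auto simp: sum.distrib sc_sum)

lemma lin_sc: "lin_on sc C T \<Longrightarrow> lin_on sc C (\<lambda>v. sc c (T v))"
  unfolding lin_on_def by (auto simp: sc_add mult.commute)

lemma lin_zero: "lin_on sc C (\<lambda>v. 0)"
  unfolding lin_on_def by auto

lemma lin_id: "lin_on sc C (\<lambda>v. v)"
  unfolding lin_on_def by auto

lemma lin_comp: "lin_on sc C T \<Longrightarrow> lin_on sc C S \<Longrightarrow> lin_on sc C (\<lambda>v. T (S v))"
  unfolding lin_on_def by auto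

lemma span_famI: "finite A \<Longrightarrow> A \<subseteq> I \<Longrightarrow> (\<Sum>i\<in>A. sc (c i) (f i)) \<in> span_fam sc f I"
  unfolding span_fam_def by blast

lemma span_famE:
  assumes "x \<in> span_fam sc f I"
  obtains A c where "finite A" "A \<subseteq> I" "x = (\<Sum>i\<in>A. sc (c i) (f i))"
  using assms unfolding span_fam_def by blast

lemma sum_extend:
  assumes "finite I" "A \<subseteq> I" "\<And>i. i \<in> I \<Longrightarrow> f i \<in> C"
  shows "(\<Sum>i\<in>A. sc (c i) (f i)) = (\<Sum>i\<in>I. sc (if i \<in> A then c i else 0) (f i))"
  by (rule sum.mono_neutral_cong_left) (use assms in \<open>auto intro: finite_subset\<close>)

lemma span_fam_finite:
  assumes "finite I" "\<And>i. i \<in> I \<Longrightarrow> f i \<in> C"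
  shows "x \<in> span_fam sc f I \<longleftrightarrow> (\<exists>c. x = (\<Sum>i\<in>I. sc (c i) (f i)))"
proof
  assume "x \<in> span_fam sc f I"
  then obtain A c where "A \<subseteq> I" "x = (\<Sum>i\<in>A. sc (c i) (f i))"
    by (rule span_famE)
  then show "\<exists>c. x = (\<Sum>i\<in>I. sc (c i) (f i))"
    using sum_extend[OF assms(1) _ assms(2), where A=A and c=c] by auto
qed (use assms in \<open>auto intro!: span_famI\<close>)

lemma span_fam_subsp:
  assumes "\<And>i. i \<in> I \<Longrightarrow> f i \<in> C"
  shows "subsp sc C (span_fam sc f I)"
  unfolding subsp_def
proof (intro conjI ballI allI)
  show "span_fam sc f I \<subseteq> C"
    using assms by (auto elim!: span_famE simp: subset_iff intro!: sum_in sc_in)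
  show "0 \<in> span_fam sc f I"
    using span_famI[of "{}" I] by simp
next
  fix x y assume "x \<in> span_fam sc f I" "y \<in> span_fam sc f I"
  then obtain A c B d where A: "finite A" "A \<subseteq> I" "x = (\<Sum>i\<in>A. sc (c i) (f i))"
      and B: "finite B" "B \<subseteq> I" "y = (\<Sum>i\<in>B. sc (d i) (f i))"
    by (elim span_famE)
  have f: "f i \<in> C" if "i \<in> A \<union> B" for i using that assms A B by auto
  have "x = (\<Sum>i\<in>A\<union>B. sc (if i \<in> A then c i else 0) (f i))"
    unfolding A by (rule sum_extend) (use A B f in auto)
  moreover have "y = (\<Sum>i\<in>A\<union>B. sc (if i \<in> B then d i else 0) (f i))"
    unfolding B by (rule sum_extend) (use A B f in auto)
  ultimately have "x + y = (\<Sum>i\<in>A\<union>B. sc ((if i \<in> A then c i else 0) + (if i \<in> B then d i else 0)) (f i))"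
    using f by (simp add: sc_left sum.distrib)
  then show "x + y \<in> span_fam sc f I"
    using A B by (auto intro!: span_famI)
next
  fix a x assume "x \<in> span_fam sc f I"
  then obtain A c where A: "finite A" "A \<subseteq> I" "x = (\<Sum>i\<in>A. sc (c i) (f i))"
    by (elim span_famE)
  then have "sc a x = (\<Sum>i\<in>A. sc (a * c i) (f i))"
    using assms by (auto simp: sc_sum subset_iff)
  then show "sc a x \<in> span_fam sc f I"
    using A by (auto intro!: span_famI)
qed

lemma span_fam_base: "i \<in> I \<Longrightarrow> f i \<in> C \<Longrightarrow> f i \<in> span_fam sc f I"
  using span_famI[of "{i}" I "\<lambda>_. 1" f] by simp

lemma span_fam_min:
  assumes "subsp sc C N" "\<And>i. i \<in> I \<Longrightarrow> f i \<in> N"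
  shows "span_fam sc f I \<subseteq> N"
proof -
  interpret N: vsp sc N using subsp_vsp[OF vsp_axioms assms(1)] .
  show ?thesis using assms(2) by (auto elim!: span_famE intro!: N.sum_in N.sc_in)
qed

text \<open>Greedy selection: a vector is added exactly when it lies outside the span of those
  already chosen.\<close>

lemma basis_extract:
  assumes "finite S" "S \<subseteq> C"
  shows "\<exists>B. B \<subseteq> S \<and> indep_fam sc id B \<and> S \<subseteq> span_fam sc id B"
  using assms
proof (induction S)
  case empty
  then show ?case by (auto simp: indep_fam_def)
next
  case (insert x S)
  then obtain B where B: "B \<subseteq> S" "indep_fam sc id B" "S \<subseteq> span_fam sc id B" by blast
  have BC: "B \<subseteq> C" "finite B" using B insert by (auto intro: finite_subset)
  show ?case
  proof (cases "x \<in> span_fam sc id B")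
    case True
    then have "insert x S \<subseteq> span_fam sc id B" using B(3) by blast
    then show ?thesis using B(1,2) by blast
  next
    case False
    have xB: "x \<notin> B" using False span_fam_base[of x B id] insert.prems by auto
    have "indep_fam sc id (insert x B)"
      unfolding indep_fam_def
    proof (intro allI impI)
      fix A c
      assume A: "finite A \<and> A \<subseteq> insert x B \<and> (\<Sum>i\<in>A. sc (c i) (id i)) = 0"
      define A' where "A' = A - {x}"
      have A': "finite A'" "A' \<subseteq> B" using A by (auto simp: A'_def)
      have "c x = 0" if "x \<in> A"
      proof (rule ccontr)
        assume cx: "c x \<noteq> 0"
        have "sc (c x) x + (\<Sum>i\<in>A'. sc (c i) i) = 0"
          using A that sum.remove[of A x "\<lambda>i. sc (c i) i"] unfolding A'_def by simp
        then have "sc (inverse (c x)) (sc (c x) x + (\<Sum>i\<in>A'. sc (c i) i)) = 0" by simp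
        then have "x + (\<Sum>i\<in>A'. sc (inverse (c x) * c i) i) = 0"
          using cx A' BC insert.prems by (subst (asm) sc_add) (auto simp: sc_sum subset_iff)
        then have "x = (\<Sum>i\<in>A'. sc (- (inverse (c x) * c i)) i)"
          using A' BC by (auto simp: sc_minus_left subset_iff sum_negf eq_neg_iff_add_eq_0)
        then have "x \<in> span_fam sc id B"
          using span_famI[OF A', of "\<lambda>i. - (inverse (c x) * c i)" id] by simp
        then show False using False by blast
      qed
      moreover from this have "(\<Sum>i\<in>A'. sc (c i) (id i)) = 0"
        using A insert.prems sum.remove[of A x "\<lambda>i. sc (c i) i"] unfolding A'_def by (cases "x \<in> A") auto
      then have "\<forall>i\<in>A'. c i = 0" using B(2) A' unfolding indep_fam_def by blast
      ultimately show "\<forall>i\<in>A. c i = 0" by (auto simp: A'_def)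
    qed
    moreover have "insert x S \<subseteq> span_fam sc id (insert x B)"
    proof -
      have "span_fam sc id B \<subseteq> span_fam sc id (insert x B)"
        unfolding span_fam_def by blast
      then show ?thesis using B(3) insert.prems span_fam_base[of x "insert x B" id] by auto
    qed
    moreover have "insert x B \<subseteq> insert x S" using B(1) by blast
    ultimately show ?thesis by blast
  qed
qed

text \<open>Indexing by an initial segment of the naturals matches the index range of
  \<open>free_basis\<close>; a basis found as a set only has to be enumerated.\<close>

lemma fin_dim_basis:
  assumes "fin_dim sc C"
  obtains d and b :: "nat \<Rightarrow> 'a" where "\<And>i. i < d \<Longrightarrow> b i \<in> C" "indep_fam sc b {..<d}"
    "C \<subseteq> span_fam sc b {..<d}"
proof -
  obtain S where S: "finite S" "S \<subseteq> C" "C \<subseteq> span_fam sc id S"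
    using assms unfolding fin_dim_def by blast
  obtain B where B: "B \<subseteq> S" "indep_fam sc id B" "S \<subseteq> span_fam sc id B"
    using basis_extract[OF S(1,2)] by blast
  have finB: "finite B" using B S finite_subset by blast
  have BC: "B \<subseteq> C" using B S by auto
  obtain b where b: "bij_betw b {..<card B} B"
    using finB ex_bij_betw_nat_finite[OF finB] by (auto simp: atLeast0LessThan)
  have inj: "inj_on b {..<card B}" and img: "b ` {..<card B} = B" using b by (auto simp: bij_betw_def)
  show ?thesis
  proof
    show bC: "\<And>i. i < card B \<Longrightarrow> b i \<in> C" using img BC by auto
    show "indep_fam sc b {..<card B}"
      unfolding indep_fam_def
    proof (intro allI impI ballI)
      fix A c i assume A: "finite A \<and> A \<subseteq> {..<card B} \<and> (\<Sum>i\<in>A. sc (c i) (b i)) = 0" and i: "i \<in> A"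
      have injA: "inj_on b A" using A inj by (auto intro: inj_on_subset)
      have "(\<Sum>x\<in>b ` A. sc (c (the_inv_into A b x)) (id x)) = 0"
        using A injA by (simp add: sum.reindex the_inv_into_f_f)
      moreover have "b ` A \<subseteq> B" using A img by auto
      ultimately have "\<forall>x\<in>b ` A. c (the_inv_into A b x) = 0"
        using B(2)[unfolded indep_fam_def, rule_format, of "b ` A" "\<lambda>x. c (the_inv_into A b x)"] A by simp
      then have "c (the_inv_into A b (b i)) = 0" using i by simp
      then show "c i = 0" using injA i by (simp add: the_inv_into_f_f)
    qed
    have sB: "subsp sc C (span_fam sc id B)" by (rule span_fam_subsp) (use BC in auto)
    have sb: "subsp sc C (span_fam sc b {..<card B})" by (rule span_fam_subsp) (use bC in auto)
    have 1: "span_fam sc id S \<subseteq> span_fam sc id B"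
    proof (rule span_fam_min[OF sB])
      fix x assume "x \<in> S"
      then show "id x \<in> span_fam sc id B" using B(3) unfolding id_apply by blast
    qed
    have im: "id x \<in> span_fam sc b {..<card B}" if "x \<in> B" for x
    proof -
      from that have "x \<in> b ` {..<card B}" by (simp only: img)
      then obtain k where "k \<in> {..<card B}" "x = b k" by blast
      then show ?thesis using span_fam_base[of k "{..<card B}" b] bC by simp
    qed
    have 2: "span_fam sc id B \<subseteq> span_fam sc b {..<card B}"
      by (rule span_fam_min[OF sb]) (rule im)
    show "C \<subseteq> span_fam sc b {..<card B}" using S(3) 1 2 by blast
  qed
qed

end

section \<open>Joint eigenvectors and the eigenvalues of ad E\<close>

lemma underdetermined_system:
  fixes Y :: "'i \<Rightarrow> 'e \<Rightarrow> 'f::field"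
  assumes "finite I" "finite A" "card I < card A"
  shows "\<exists>a. (\<exists>e\<in>A. a e \<noteq> 0) \<and> (\<forall>i\<in>I. (\<Sum>e\<in>A. a e * Y i e) = 0)"
  using assms
proof (induction I arbitrary: A Y)
  case empty
  then have "A \<noteq> {}" by auto
  then show ?case by (intro exI[of _ "\<lambda>_. 1"]) auto
next
  case (insert i I)
  show ?case
  proof (cases "\<forall>e\<in>A. Y i e = 0")
    case True
    obtain a where "\<exists>e\<in>A. a e \<noteq> 0" "\<forall>i\<in>I. (\<Sum>e\<in>A. a e * Y i e) = 0"
      using insert.IH[of A Y] insert.prems insert.hyps by auto
    with True show ?thesis by (intro exI[of _ a]) auto
  next
    case False
    then obtain e0 where e0: "e0 \<in> A" "Y i e0 \<noteq> 0" by auto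
    \<comment> \<open>Gaussian elimination: unknown e0 is solved from equation i, and substituting
      it into the others gives a system with one equation and one unknown fewer.\<close>
    define A' where "A' = A - {e0}"
    have A': "finite A'" "card I < card A'" "e0 \<notin> A'" "A = insert e0 A'"
      using insert.prems insert.hyps e0 by (auto simp: A'_def)
    obtain a where a: "\<exists>e\<in>A'. a e \<noteq> 0"
        "\<forall>l\<in>I. (\<Sum>e\<in>A'. a e * (Y l e - Y l e0 * Y i e / Y i e0)) = 0"
      using insert.IH[of A' "\<lambda>l e. Y l e - Y l e0 * Y i e / Y i e0"] A' by auto
    define a' where "a' = (\<lambda>e. if e = e0 then - (\<Sum>e\<in>A'. a e * Y i e) / Y i e0 else a e)"
    have a'A: "(\<Sum>e\<in>A'. a' e * Y l e) = (\<Sum>e\<in>A'. a e * Y l e)" for l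
      using A' by (intro sum.cong) (auto simp: a'_def)
    have "(\<Sum>e\<in>A. a' e * Y l e) = 0" if "l \<in> insert i I" for l
    proof -
      have "(\<Sum>e\<in>A. a' e * Y l e) = a' e0 * Y l e0 + (\<Sum>e\<in>A'. a e * Y l e)"
        using A' a'A by simp
      also have "\<dots> = (\<Sum>e\<in>A'. a e * (Y l e - Y l e0 * Y i e / Y i e0))"
        by (simp add: a'_def algebra_simps sum_subtractf sum_distrib_left sum_distrib_right
            sum_divide_distrib)
      also have "\<dots> = 0" using that a(2) e0 by auto
      finally show ?thesis .
    qed
    moreover have "\<exists>e\<in>A. a' e \<noteq> 0" using a(1) A' by (auto simp: a'_def)
    ultimately show ?thesis by blast
  qed
qed

context vsp
begin

text \<open>The operator T_j - \<nu>_j preserves N, kills the \<nu>-component and scales the others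
  by \<mu>_j - \<nu>_j, so induction on the number of weights separates them. An invariant subspace
  N in place of a zero sum serves two purposes: N = {0} gives independence of weight vectors, a
  submodule N gives its weight grading.\<close>

lemma weight_components:
  assumes lin: "\<And>j. lin_on sc C (T j)" and N: "subsp sc C N" and TN: "\<And>j x. x \<in> N \<Longrightarrow> T j x \<in> N"
    and fin: "finite A" and x: "\<And>\<mu>. \<mu> \<in> A \<Longrightarrow> x \<mu> \<in> C"
    and wt: "\<And>\<mu> j. \<mu> \<in> A \<Longrightarrow> T j (x \<mu>) = sc (\<mu> j) (x \<mu>)"
    and sum: "(\<Sum>\<mu>\<in>A. x \<mu>) \<in> N" and \<nu>: "\<nu> \<in> A"
  shows "x \<nu> \<in> N"
proof -
  interpret N: vsp sc N using subsp_vsp[OF vsp_axioms N] .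
  have NC: "N \<subseteq> C" using N by (simp add: subsp_def)
  have "\<forall>x. (\<forall>\<mu>\<in>A. x \<mu> \<in> C \<and> (\<forall>j. T j (x \<mu>) = sc (\<mu> j) (x \<mu>))) \<and> (\<Sum>\<mu>\<in>A. x \<mu>) \<in> N
      \<longrightarrow> (\<forall>\<mu>\<in>A. x \<mu> \<in> N)"
    using fin
  proof (induction A)
    case (insert \<nu> A)
    show ?case
    proof (intro allI impI)
      fix x assume x: "(\<forall>\<mu>\<in>insert \<nu> A. x \<mu> \<in> C \<and> (\<forall>j. T j (x \<mu>) = sc (\<mu> j) (x \<mu>)))
        \<and> (\<Sum>\<mu>\<in>insert \<nu> A. x \<mu>) \<in> N"
      define S where "S = (\<Sum>\<mu>\<in>A. x \<mu>)"
      have SN: "x \<nu> + S \<in> N" using x insert by (simp add: S_def)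
      have SC: "S \<in> C" using x by (auto simp: S_def)
      have mem: "x \<mu> \<in> N" if \<mu>: "\<mu> \<in> A" for \<mu>
      proof -
        have "\<mu> \<noteq> \<nu>" using \<mu> insert.hyps by auto
        \<comment> \<open>The index j may depend on \<mu>: different weights need only differ in one
          coordinate, and each \<mu> is treated by its own operator.\<close>
        then obtain j where j: "\<mu> j \<noteq> \<nu> j" unfolding fun_eq_iff by blast
        interpret T: lin sc C "T j" using linI[OF lin] .
        have "T j (x \<nu> + S) - sc (\<nu> j) (x \<nu> + S) = T j S - sc (\<nu> j) S"
          using x SC by (simp add: T.app_add sc_add)
        also have "\<dots> = (\<Sum>\<mu>\<in>A. sc (\<mu> j - \<nu> j) (x \<mu>))"
          using x by (simp add: S_def T.app_sum sc_sum sc_diff_left sum_subtractf)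
        finally have eq: "T j (x \<nu> + S) - sc (\<nu> j) (x \<nu> + S) = (\<Sum>\<mu>\<in>A. sc (\<mu> j - \<nu> j) (x \<mu>))" .
        have "(\<Sum>\<mu>\<in>A. sc (\<mu> j - \<nu> j) (x \<mu>)) \<in> N"
          unfolding eq[symmetric] by (intro N.diff_in N.sc_in TN SN)
        then have "\<forall>\<mu>\<in>A. sc (\<mu> j - \<nu> j) (x \<mu>) \<in> N"
          using insert.IH[THEN spec, of "\<lambda>\<mu>. sc (\<mu> j - \<nu> j) (x \<mu>)"] x
          by (simp add: lin.app_sc[OF linI[OF lin]] mult.commute)
        then have "sc (\<mu> j - \<nu> j) (x \<mu>) \<in> N" using \<mu> by blast
        then have "sc (inverse (\<mu> j - \<nu> j)) (sc (\<mu> j - \<nu> j) (x \<mu>)) \<in> N" by (rule N.sc_in)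
        then show ?thesis using j x \<mu> by simp
      qed
      then have "S \<in> N" by (auto simp: S_def)
      then have "x \<nu> \<in> N" using N.diff_in[OF SN, of S] by simp
      then show "\<forall>\<mu>\<in>insert \<nu> A. x \<mu> \<in> N" using mem by auto
    qed
  qed auto
  then have "(\<forall>\<mu>\<in>A. x \<mu> \<in> C \<and> (\<forall>j. T j (x \<mu>) = sc (\<mu> j) (x \<mu>))) \<and> (\<Sum>\<mu>\<in>A. x \<mu>) \<in> N
      \<longrightarrow> (\<forall>\<mu>\<in>A. x \<mu> \<in> N)" by (rule spec)
  moreover have "\<forall>\<mu>\<in>A. x \<mu> \<in> C \<and> (\<forall>j. T j (x \<mu>) = sc (\<mu> j) (x \<mu>))"
    using x wt by blast
  ultimately have "\<forall>\<mu>\<in>A. x \<mu> \<in> N" using sum by blast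
  then show ?thesis using \<nu> by blast
qed

lemma weight_independent:
  assumes lin: "\<And>j. lin_on sc C (T j)"
    and fin: "finite A" and x: "\<And>\<mu>. \<mu> \<in> A \<Longrightarrow> x \<mu> \<in> C"
    and wt: "\<And>\<mu> j. \<mu> \<in> A \<Longrightarrow> T j (x \<mu>) = sc (\<mu> j) (x \<mu>)"
    and sum: "(\<Sum>\<mu>\<in>A. x \<mu>) = 0" and \<nu>: "\<nu> \<in> A"
  shows "x \<nu> = 0"
proof -
  have "T j y \<in> {0}" if "y \<in> {0}" for j y
    using that lin.app_0[OF linI[OF lin]] by simp
  then have "x \<nu> \<in> {0}"
    by (intro weight_components[where T=T and A=A and x=x, OF lin subsp_zero[OF vsp_axioms] _ fin x wt _ \<nu>])
      (simp_all add: sum)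
  then show ?thesis by simp
qed

text \<open>Eigenvectors of \<open>ad E\<close> for distinct eigenvalues are independent, and \<open>End C\<close> is
  finite-dimensional.\<close>
lemma finite_ad_eigenvalues:
  assumes fd: "fin_dim sc C" and E: "lin_on sc C E"
    and X: "\<And>x. x \<in> S \<Longrightarrow> lin_on sc C (X x)"
    and eig: "\<And>x v. x \<in> S \<Longrightarrow> v \<in> C \<Longrightarrow> E (X x v) - X x (E v) = sc (ev x) (X x v)"
  shows "finite (ev ` {x\<in>S. \<exists>v\<in>C. X x v \<noteq> 0})"
proof (rule ccontr)
  assume inf: "infinite (ev ` {x\<in>S. \<exists>v\<in>C. X x v \<noteq> 0})"
  interpret E: lin sc C E using linI[OF E] .
  obtain B where B: "finite B" "B \<subseteq> C" "C \<subseteq> span_fam sc id B"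
    using fd unfolding fin_dim_def by blast
  \<comment> \<open>One eigenvalue more than an operator has coefficients with respect to the
    generating set B, so that the operators \<open>X (p e)\<close> with e in A satisfy a nontrivial
    linear relation.\<close>
  obtain A where A: "A \<subseteq> ev ` {x\<in>S. \<exists>v\<in>C. X x v \<noteq> 0}" "finite A" "card A = Suc (card (B \<times> B))"
    using infinite_arbitrarily_large[OF inf] by blast
  define p where "p e = (SOME x. x \<in> S \<and> (\<exists>v\<in>C. X x v \<noteq> 0) \<and> ev x = e)" for e
  have p: "p e \<in> S \<and> (\<exists>v\<in>C. X (p e) v \<noteq> 0) \<and> ev (p e) = e" if "e \<in> A" for e
  proof -
    have "\<exists>x. x \<in> S \<and> (\<exists>v\<in>C. X x v \<noteq> 0) \<and> ev x = e" using A(1) that by blast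
    then show ?thesis unfolding p_def by (rule someI_ex)
  qed
  have "\<exists>c. X (p e) b = (\<Sum>l\<in>B. sc (c l) (id l))" if "e \<in> A" "b \<in> B" for e b
    using that p[OF that(1)] X B
    by (subst span_fam_finite[symmetric]) (auto simp: lin_on_def subset_iff)
  then obtain Y where Y: "\<And>e b. e \<in> A \<Longrightarrow> b \<in> B \<Longrightarrow> X (p e) b = (\<Sum>l\<in>B. sc (Y e b l) l)"
    unfolding id_def by metis
  obtain a where a: "\<exists>e\<in>A. a e \<noteq> 0" "\<forall>(b,l)\<in>B\<times>B. (\<Sum>e\<in>A. a e * Y e b l) = 0"
    using underdetermined_system[of "B \<times> B" A "\<lambda>(b,l) e. Y e b l"] A B by auto
  have zero: "(\<Sum>e\<in>A. sc (a e) (X (p e) v)) = 0" if v: "v \<in> C" for v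
  proof -
    have z: "(\<Sum>e\<in>A. sc (a e) (X (p e) b)) = 0" if b: "b \<in> B" for b
    proof -
      have "(\<Sum>e\<in>A. sc (a e) (X (p e) b)) = (\<Sum>e\<in>A. \<Sum>l\<in>B. sc (a e * Y e b l) l)"
        using b B by (intro sum.cong refl) (auto simp: Y sc_sum subset_iff)
      also have "\<dots> = (\<Sum>l\<in>B. \<Sum>e\<in>A. sc (a e * Y e b l) l)" by (rule sum.swap)
      also have "\<dots> = (\<Sum>l\<in>B. sc (\<Sum>e\<in>A. a e * Y e b l) l)"
        using B by (intro sum.cong refl) (auto simp: sc_sum_left subset_iff)
      also have "\<dots> = (\<Sum>l\<in>B. sc 0 l)"
        using a(2) b by (intro sum.cong refl) auto
      also have "\<dots> = 0" using B by (auto simp: subset_iff intro!: sum.neutral)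
      finally show ?thesis .
    qed
    obtain c where c: "v = (\<Sum>b\<in>B. sc (c b) b)"
      using span_fam_finite[of B id v] B v by (auto simp: subset_iff)
    have L: "lin_on sc C (\<lambda>v. \<Sum>e\<in>A. sc (a e) (X (p e) v))"
      using p X by (intro lin_sum lin_sc) auto
    interpret L: lin sc C "\<lambda>v. \<Sum>e\<in>A. sc (a e) (X (p e) v)" using linI[OF L] .
    have "(\<Sum>e\<in>A. sc (a e) (X (p e) v)) = (\<Sum>b\<in>B. sc (c b) (\<Sum>e\<in>A. sc (a e) (X (p e) b)))"
      unfolding c using B by (subst L.app_sum) (auto simp: subset_iff intro!: sum.cong L.app_sc)
    also have "\<dots> = 0" using z by simp
    finally show ?thesis .
  qed
  have indep: "\<forall>a. (\<forall>v\<in>C. (\<Sum>e\<in>A'. sc (a e) (X (p e) v)) = 0) \<longrightarrow> (\<forall>e\<in>A'. a e = 0)"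
    if "finite A'" "A' \<subseteq> A" for A'
    using that
  proof (induction A')
    case (insert f A')
    have pA: "p e \<in> S" "ev (p e) = e" if "e \<in> insert f A'" for e
      using p insert.prems that by auto
    show ?case
    proof (intro allI impI)
      fix a assume a: "\<forall>v\<in>C. (\<Sum>e\<in>insert f A'. sc (a e) (X (p e) v)) = 0"
      have XC: "X (p e) v \<in> C" if "e \<in> insert f A'" "v \<in> C" for e v
        using X[OF pA(1)[OF that(1)]] that by (auto simp: lin_on_def)
      have "\<forall>v\<in>C. (\<Sum>e\<in>A'. sc (a e * (e - f)) (X (p e) v)) = 0"
      proof
        fix v assume v: "v \<in> C"
        let ?F = "insert f A'"
        have 1: "(\<Sum>e\<in>?F. sc (a e) (X (p e) v)) = 0" "(\<Sum>e\<in>?F. sc (a e) (X (p e) (E v))) = 0"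
          using a v by auto
        \<comment> \<open>Applying ad E to the relation multiplies each term by its eigenvalue;
          subtracting f times the relation removes the term at f and leaves the nonzero factors e -
          f on A'.\<close>
        have "(\<Sum>e\<in>?F. sc (a e * e) (X (p e) v)) = (\<Sum>e\<in>?F. sc (a e) (E (X (p e) v) - X (p e) (E v)))"
          using v XC pA by (intro sum.cong refl) (simp add: eig)
        also have "\<dots> = E (\<Sum>e\<in>?F. sc (a e) (X (p e) v)) - (\<Sum>e\<in>?F. sc (a e) (X (p e) (E v)))"
          using v XC by (subst E.app_sum) (auto simp: sc_diff sum_subtractf E.app_sc)
        also have "\<dots> = 0" using 1 by simp
        finally have 2: "(\<Sum>e\<in>?F. sc (a e * e) (X (p e) v)) = 0" .
        have "(\<Sum>e\<in>?F. sc (a e * (e - f)) (X (p e) v))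
            = (\<Sum>e\<in>?F. sc (a e * e) (X (p e) v)) - sc f (\<Sum>e\<in>?F. sc (a e) (X (p e) v))"
          using v XC by (subst sc_sum)
            (auto simp: right_diff_distrib sc_diff_left sum_subtractf mult.commute)
        then have "(\<Sum>e\<in>?F. sc (a e * (e - f)) (X (p e) v)) = 0" using 1 2 by simp
        then show "(\<Sum>e\<in>A'. sc (a e * (e - f)) (X (p e) v)) = 0"
          using insert.hyps v XC by simp
      qed
      then have "\<forall>e\<in>A'. a e * (e - f) = 0"
        using insert.IH[rule_format, of "\<lambda>e. a e * (e - f)"] insert.prems by auto
      then have A'0: "\<forall>e\<in>A'. a e = 0" using insert.hyps by auto
      have "a f = 0"
      proof (rule ccontr)
        assume af: "a f \<noteq> 0"
        obtain v where v: "v \<in> C" "X (p f) v \<noteq> 0" using p insert.prems by blast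
        have "(\<Sum>e\<in>A'. sc (a e) (X (p e) v)) = 0"
          using A'0 XC v by (intro sum.neutral) auto
        then have "sc (a f) (X (p f) v) = 0"
          using a v insert.hyps by auto
        then show False using af v sc_cancel XC by blast
      qed
      then show "\<forall>e\<in>insert f A'. a e = 0" using A'0 by auto
    qed
  qed auto
  show False using indep[OF A(2) order_refl] zero a(1) by blast
qed

end

section \<open>Divided powers, exponential generating functions and comparison of
  coefficients\<close>

section \<open>Multi-indices and generating functions\<close>

text \<open>A componentwise bound instead of a bound on the total degree, since sums over such a box
  factor into one-variable sums.\<close>

definition box :: "nat \<Rightarrow> ('n::finite \<Rightarrow> nat) set" where
  "box Q = {\<beta>. \<forall>i. \<beta> i \<le> Q}"

lemma box_iff: "\<beta> \<in> box Q \<longleftrightarrow> (\<forall>i. \<beta> i \<le> Q)"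
  by (simp add: box_def)

lemma box_PiE: "box Q = PiE UNIV (\<lambda>_. {..Q})"
  by (auto simp: box_def PiE_UNIV_domain)

lemma finite_box [simp]: "finite (box Q)"
  unfolding box_PiE by (intro finite_PiE) auto

lemma zero_in_box [simp]: "0 \<in> box Q"
  by (simp add: box_iff)

lemma box_mono: "Q \<le> R \<Longrightarrow> box Q \<subseteq> box R"
  unfolding box_def using le_trans by blast

lemma prod_sum_box:
  fixes g :: "'n::finite \<Rightarrow> nat \<Rightarrow> 'a::comm_semiring_1"
  shows "(\<Prod>i\<in>UNIV. \<Sum>q\<le>Q. g i q) = (\<Sum>\<beta>\<in>box Q. \<Prod>i\<in>UNIV. g i (\<beta> i))"
  unfolding box_PiE by (rule prod_sum_PiE) auto

text \<open>The coefficient of t^\<beta> in exp(s \<cdot> t). The laws used below are exp((s + m)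
  \<cdot> t) = exp(s \<cdot> t) exp(m \<cdot> t) and that d/dt_j multiplies exp(m \<cdot> t) by
  m_j.\<close>

definition dp :: "('n::finite \<Rightarrow> int) \<Rightarrow> ('n \<Rightarrow> nat) \<Rightarrow> complex" where
  "dp s \<beta> = mpow s \<beta> / mfact \<beta>"

lemma mfact_nonzero [simp]: "mfact \<beta> \<noteq> 0"
  by (simp add: mfact_def)

lemma mpow_zero_right [simp]: "mpow s 0 = 1"
  by (simp add: mpow_def)

lemma mfact_zero [simp]: "mfact 0 = 1"
  by (simp add: mfact_def)

lemma dp_zero_right [simp]: "dp s 0 = 1"
  by (simp add: dp_def)

lemma mpow_zero_left: "\<beta> \<noteq> 0 \<Longrightarrow> mpow 0 \<beta> = 0"
proof -
  assume "\<beta> \<noteq> 0"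
  then obtain i where "\<beta> i \<noteq> 0" by (auto simp: fun_eq_iff)
  then show ?thesis unfolding mpow_def by (intro prod_zero) auto
qed

lemma dp_zero_left: "dp 0 \<beta> = (if \<beta> = 0 then 1 else 0)"
  by (simp add: dp_def mpow_zero_left)

lemma dp_prod: "dp s \<beta> = (\<Prod>i\<in>UNIV. of_int (s i) ^ \<beta> i / fact (\<beta> i))"
  by (simp add: dp_def mpow_def mfact_def prod_dividef)

text \<open>The binomial theorem in every coordinate, multiplied out. The summands are set to zero
  beyond \<beta>_i so that all coordinates share the range that \<open>prod_sum_box\<close>
  requires.\<close>

lemma dp_add_single:
  "dp (s + m) \<beta> = (\<Sum>\<alpha>\<in>box Q. if \<alpha> \<le> \<beta> then dp s \<alpha> * dp m (\<beta> - \<alpha>) else 0)"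
  if "\<beta> \<in> box Q"
proof -
  define g where "g i a = (if a \<le> \<beta> i then (of_int (s i) ^ a / fact a) *
    (of_int (m i) ^ (\<beta> i - a) / fact (\<beta> i - a)) else 0 :: complex)" for i a
  have "(of_int (s i) + of_int (m i)) ^ \<beta> i / fact (\<beta> i) = (\<Sum>a\<le>Q. g i a)" for i
  proof -
    have "(of_int (s i) + of_int (m i)) ^ \<beta> i / (fact (\<beta> i) :: complex) = (\<Sum>a\<le>\<beta> i. g i a)"
      unfolding binomial_ring sum_divide_distrib
      by (intro sum.cong refl) (auto simp: g_def binomial_fact)
    also have "\<dots> = (\<Sum>a\<le>Q. g i a)"
      using that by (intro sum.mono_neutral_left) (auto simp: box_iff g_def)
    finally show ?thesis .
  qed
  then have "dp (s + m) \<beta> = (\<Prod>i\<in>UNIV. \<Sum>a\<le>Q. g i a)"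
    by (simp add: dp_prod)
  also have "\<dots> = (\<Sum>\<alpha>\<in>box Q. \<Prod>i\<in>UNIV. g i (\<alpha> i))"
    by (rule prod_sum_box)
  also have "\<dots> = (\<Sum>\<alpha>\<in>box Q. if \<alpha> \<le> \<beta> then dp s \<alpha> * dp m (\<beta> - \<alpha>) else 0)"
  proof (intro sum.cong refl)
    fix \<alpha> :: "'a \<Rightarrow> nat"
    show "(\<Prod>i\<in>UNIV. g i (\<alpha> i)) = (if \<alpha> \<le> \<beta> then dp s \<alpha> * dp m (\<beta> - \<alpha>) else 0)"
    proof (cases "\<alpha> \<le> \<beta>")
      case True
      then have "(\<Prod>i\<in>UNIV. g i (\<alpha> i)) = (\<Prod>i\<in>UNIV. (of_int (s i) ^ \<alpha> i / fact (\<alpha> i)) *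
          (of_int (m i) ^ (\<beta> i - \<alpha> i) / fact (\<beta> i - \<alpha> i)))"
        by (intro prod.cong) (auto simp: g_def le_fun_def)
      then show ?thesis using True by (simp only: prod.distrib dp_prod fun_diff_def if_True)
    next
      case False
      then obtain i where "\<not> \<alpha> i \<le> \<beta> i" by (auto simp: le_fun_def)
      then have "(\<Prod>i\<in>UNIV. g i (\<alpha> i)) = 0" by (intro prod_zero) (auto simp: g_def)
      then show ?thesis using False by simp
    qed
  qed
  finally show ?thesis .
qed

lemma dp_shift: "of_int (m j) * dp m \<gamma> = of_nat (Suc (\<gamma> j)) * dp m (\<gamma> + eps j)"
proof -
  let ?f = "\<lambda>\<beta> i. of_int (m i) ^ \<beta> i / (fact (\<beta> i) :: complex)"
  have rest: "(\<Prod>i\<in>UNIV-{j}. ?f (\<gamma> + eps j) i) = (\<Prod>i\<in>UNIV-{j}. ?f \<gamma> i)"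
    by (intro prod.cong) (auto simp: eps_def)
  let ?P = "\<Prod>i\<in>UNIV-{j}. ?f \<gamma> i"
  have 1: "dp m (\<gamma> + eps j) = ?f (\<gamma> + eps j) j * ?P"
    unfolding dp_prod rest[symmetric] by (rule prod.remove) auto
  have 2: "dp m \<gamma> = ?f \<gamma> j * ?P"
    unfolding dp_prod by (rule prod.remove) auto
  have 3: "of_nat (Suc (\<gamma> j)) * ?f (\<gamma> + eps j) j = of_int (m j) * ?f \<gamma> j"
    by (simp add: eps_def divide_simps del: of_nat_Suc)
  have "of_int (m j) * dp m \<gamma> = (of_int (m j) * ?f \<gamma> j) * ?P"
    unfolding 2 by (rule mult.assoc[symmetric])
  also have "\<dots> = of_nat (Suc (\<gamma> j)) * dp m (\<gamma> + eps j)"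
    unfolding 1 3[symmetric] by (rule mult.assoc)
  finally show ?thesis .
qed

context vsp
begin

lemma box_extend:
  assumes "\<And>\<beta>. \<beta> \<notin> box Q \<Longrightarrow> x \<beta> = 0" "Q \<le> R"
  shows "(\<Sum>\<beta>\<in>box R. sc (c \<beta>) (x \<beta>)) = (\<Sum>\<beta>\<in>box Q. sc (c \<beta>) (x \<beta>))"
  by (rule sum.mono_neutral_right) (use assms box_mono[OF assms(2)] in auto)

text \<open>A finitely supported family x is read as an exponential generating function; evaluation
  at s + m has the coefficient x (\<alpha> + \<gamma>) at s^\<alpha> m^\<gamma>/(\<alpha>!
  \<gamma>!). Vanishing of x outside the box makes the truncation exact.\<close>

lemma gen_add:
  assumes x: "\<And>\<beta>. x \<beta> \<in> C" and sup: "\<And>\<beta>. \<beta> \<notin> box R \<Longrightarrow> x \<beta> = 0"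
  shows "(\<Sum>\<beta>\<in>box R. sc (dp (s + m) \<beta>) (x \<beta>))
    = (\<Sum>\<alpha>\<in>box R. \<Sum>\<gamma>\<in>box R. sc (dp s \<alpha> * dp m \<gamma>) (x (\<alpha> + \<gamma>)))"
proof -
  have "(\<Sum>\<beta>\<in>box R. sc (dp (s + m) \<beta>) (x \<beta>))
      = (\<Sum>\<beta>\<in>box R. \<Sum>\<alpha>\<in>box R. if \<alpha> \<le> \<beta> then sc (dp s \<alpha> * dp m (\<beta> - \<alpha>)) (x \<beta>) else 0)"
    by (intro sum.cong refl) (auto simp: dp_add_single[where Q=R] sc_sum_left x intro!: sum.cong)
  also have "\<dots> = (\<Sum>\<alpha>\<in>box R. \<Sum>\<beta>\<in>box R. if \<alpha> \<le> \<beta> then sc (dp s \<alpha> * dp m (\<beta> - \<alpha>)) (x \<beta>) else 0)"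
    by (rule sum.swap)
  also have "\<dots> = (\<Sum>\<alpha>\<in>box R. \<Sum>\<gamma>\<in>box R. sc (dp s \<alpha> * dp m \<gamma>) (x (\<alpha> + \<gamma>)))"
  proof (rule sum.cong[OF refl])
    fix \<alpha> :: "'b \<Rightarrow> nat"
    have eq: "\<alpha> + (\<beta> - \<alpha>) = \<beta>" if "\<forall>i. \<alpha> i \<le> \<beta> i" for \<beta>
      using that by (auto simp: fun_eq_iff le_fun_def)
    have "(\<Sum>\<beta>\<in>box R. if \<alpha> \<le> \<beta> then sc (dp s \<alpha> * dp m (\<beta> - \<alpha>)) (x \<beta>) else 0)
        = (\<Sum>\<beta>\<in>{\<beta>\<in>box R. \<alpha> \<le> \<beta>}. sc (dp s \<alpha> * dp m (\<beta> - \<alpha>)) (x \<beta>))"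
      by (rule sum.inter_filter[symmetric]) simp
    also have "\<dots> = (\<Sum>\<gamma>\<in>{\<gamma>\<in>box R. \<alpha> + \<gamma> \<in> box R}. sc (dp s \<alpha> * dp m \<gamma>) (x (\<alpha> + \<gamma>)))"
      by (rule sum.reindex_bij_witness[of _ "\<lambda>\<gamma>. \<alpha> + \<gamma>" "\<lambda>\<beta>. \<beta> - \<alpha>"])
        (auto simp: eq le_fun_def box_iff intro: diff_le_self[THEN order_trans])
    also have "\<dots> = (\<Sum>\<gamma>\<in>box R. sc (dp s \<alpha> * dp m \<gamma>) (x (\<alpha> + \<gamma>)))"
      by (rule sum.mono_neutral_left) (auto simp: sup)
    finally show "(\<Sum>\<beta>\<in>box R. if \<alpha> \<le> \<beta> then sc (dp s \<alpha> * dp m (\<beta> - \<alpha>)) (x \<beta>) else 0)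
      = (\<Sum>\<gamma>\<in>box R. sc (dp s \<alpha> * dp m \<gamma>) (x (\<alpha> + \<gamma>)))" .
  qed
  finally show ?thesis .
qed

text \<open>Multiplication by m_j shifts the indices by \<open>eps j\<close>, which may leave the
  box of size Q by one; hence Q < R. The truncated difference \<gamma> - \<open>eps j\<close> is
  harmless, because the factor \<gamma>_j vanishes exactly when the truncation is effective.\<close>

lemma gen_deriv:
  assumes x: "\<And>\<beta>. x \<beta> \<in> C" and sup: "\<And>\<beta>. \<beta> \<notin> box Q \<Longrightarrow> x \<beta> = 0" and QR: "Q < R"
  shows "(\<Sum>\<gamma>\<in>box R. sc (of_int (m j) * dp m \<gamma>) (x \<gamma>))
    = (\<Sum>\<gamma>\<in>box R. sc (of_nat (\<gamma> j) * dp m \<gamma>) (x (\<gamma> - eps j)))"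
proof -
  have "(\<Sum>\<gamma>\<in>box R. sc (of_int (m j) * dp m \<gamma>) (x \<gamma>))
      = (\<Sum>\<gamma>\<in>box Q. sc (of_int (m j) * dp m \<gamma>) (x \<gamma>))"
    using QR by (intro box_extend sup) auto
  also have "\<dots> = (\<Sum>\<gamma>\<in>box Q. sc (of_nat (Suc (\<gamma> j)) * dp m (\<gamma> + eps j)) (x \<gamma>))"
    by (simp only: dp_shift)
  also have "\<dots> = (\<Sum>\<gamma>\<in>{\<gamma>. \<gamma> j \<noteq> 0 \<and> \<gamma> - eps j \<in> box Q}. sc (of_nat (\<gamma> j) * dp m \<gamma>) (x (\<gamma> - eps j)))"
    by (rule sum.reindex_bij_witness[of _ "\<lambda>\<gamma>. \<gamma> - eps j" "\<lambda>\<gamma>. \<gamma> + eps j"])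
      (auto simp: fun_eq_iff eps_def box_iff)
  also have "\<dots> = (\<Sum>\<gamma>\<in>box R. sc (of_nat (\<gamma> j) * dp m \<gamma>) (x (\<gamma> - eps j)))"
  proof (rule sum.mono_neutral_left)
    show "{\<gamma>. \<gamma> j \<noteq> 0 \<and> \<gamma> - eps j \<in> box Q} \<subseteq> box R"
    proof
      fix \<gamma> assume *: "\<gamma> \<in> {\<gamma>. \<gamma> j \<noteq> 0 \<and> \<gamma> - eps j \<in> box Q}"
      have "\<gamma> i \<le> R" for i
      proof -
        have "\<gamma> i - eps j i \<le> Q" using * by (auto simp: box_iff)
        then show ?thesis using QR by (auto simp: eps_def split: if_splits)
      qed
      then show "\<gamma> \<in> box R" by (simp add: box_iff)
    qed
    show "\<forall>\<gamma>\<in>box R - {\<gamma>. \<gamma> j \<noteq> 0 \<and> \<gamma> - eps j \<in> box Q}. sc (of_nat (\<gamma> j) * dp m \<gamma>) (x (\<gamma> - eps j)) = 0"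
    proof
      fix \<gamma> assume "\<gamma> \<in> box R - {\<gamma>. \<gamma> j \<noteq> 0 \<and> \<gamma> - eps j \<in> box Q}"
      then consider "\<gamma> j = 0" | "\<gamma> - eps j \<notin> box Q" by blast
      then show "sc (of_nat (\<gamma> j) * dp m \<gamma>) (x (\<gamma> - eps j)) = 0"
        by cases (simp_all add: x sup)
    qed
  qed simp
  finally show ?thesis .
qed

text \<open>The coefficient that appears, \<gamma>_j times x at \<alpha> + \<gamma> -
  \<open>eps j\<close>, is that of the bracket [z^\<alpha> d/dz_j, z^\<gamma> a] in g^+; this is the
  bridge between the two sets of relations.\<close>

lemma gen_add_deriv:
  assumes x: "\<And>\<beta>. x \<beta> \<in> C" and sup: "\<And>\<beta>. \<beta> \<notin> box Q \<Longrightarrow> x \<beta> = 0" and QR: "Q < R"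
  shows "sc (of_int (m j)) (\<Sum>\<beta>\<in>box R. sc (dp (s + m) \<beta>) (x \<beta>))
    = (\<Sum>\<alpha>\<in>box R. \<Sum>\<gamma>\<in>box R. sc (dp s \<alpha> * dp m \<gamma>) (sc (of_nat (\<gamma> j)) (x (\<alpha> + \<gamma> - eps j))))"
proof -
  have supR: "\<beta> \<notin> box R \<Longrightarrow> x \<beta> = 0" for \<beta>
    using sup box_mono[of Q R] QR by auto
  have "sc (of_int (m j)) (\<Sum>\<beta>\<in>box R. sc (dp (s + m) \<beta>) (x \<beta>))
      = (\<Sum>\<alpha>\<in>box R. sc (dp s \<alpha>) (\<Sum>\<gamma>\<in>box R. sc (of_int (m j) * dp m \<gamma>) (x (\<alpha> + \<gamma>))))"
  proof -
    have "(\<Sum>\<beta>\<in>box R. sc (dp (s + m) \<beta>) (x \<beta>))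
        = (\<Sum>\<alpha>\<in>box R. \<Sum>\<gamma>\<in>box R. sc (dp s \<alpha> * dp m \<gamma>) (x (\<alpha> + \<gamma>)))"
      by (rule gen_add[OF x supR])
    then show ?thesis by (simp only:) (simp add: sc_sum x mult_ac)
  qed
  also have "\<dots> = (\<Sum>\<alpha>\<in>box R. sc (dp s \<alpha>) (\<Sum>\<gamma>\<in>box R. sc (of_nat (\<gamma> j) * dp m \<gamma>) (x (\<alpha> + (\<gamma> - eps j)))))"
  proof (rule sum.cong[OF refl])
    fix \<alpha> :: "'b \<Rightarrow> nat"
    have "x (\<alpha> + \<beta>) = 0" if \<beta>: "\<beta> \<notin> box Q" for \<beta>
    proof (rule sup)
      obtain i where "\<not> \<beta> i \<le> Q" using \<beta> unfolding box_iff by blast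
      then have "\<not> (\<alpha> + \<beta>) i \<le> Q" by simp
      then show "\<alpha> + \<beta> \<notin> box Q" unfolding box_iff by blast
    qed
    then show "sc (dp s \<alpha>) (\<Sum>\<gamma>\<in>box R. sc (of_int (m j) * dp m \<gamma>) (x (\<alpha> + \<gamma>)))
      = sc (dp s \<alpha>) (\<Sum>\<gamma>\<in>box R. sc (of_nat (\<gamma> j) * dp m \<gamma>) (x (\<alpha> + (\<gamma> - eps j))))"
      using gen_deriv[of "\<lambda>\<gamma>. x (\<alpha> + \<gamma>)" Q R m j] x QR by simp
  qed
  also have "\<dots> = (\<Sum>\<alpha>\<in>box R. \<Sum>\<gamma>\<in>box R. sc (dp s \<alpha> * dp m \<gamma>) (sc (of_nat (\<gamma> j)) (x (\<alpha> + \<gamma> - eps j))))"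
  proof -
    have "sc (dp s \<alpha>) (sc (of_nat (\<gamma> j) * dp m \<gamma>) (x (\<alpha> + (\<gamma> - eps j))))
      = sc (dp s \<alpha> * dp m \<gamma>) (sc (of_nat (\<gamma> j)) (x (\<alpha> + \<gamma> - eps j)))" for \<alpha> \<gamma> :: "'b \<Rightarrow> nat"
    proof (cases "\<gamma> j = 0")
      case False
      then have "\<alpha> + (\<gamma> - eps j) = \<alpha> + \<gamma> - eps j" by (auto simp: fun_eq_iff eps_def)
      then show ?thesis by (simp add: x mult_ac)
    qed (simp add: x)
    then show ?thesis by (simp add: sc_sum x)
  qed
  finally show ?thesis .
qed

end

text \<open>On polynomials of degree at most Q, reading off the coefficient of degree e is a
  combination of the values at 0, ..., Q: the weights are the coefficients of degree e of the
  Lagrange polynomials for these nodes.\<close>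

lemma dual_moments:
  assumes "e \<le> Q"
  shows "\<exists>q. \<forall>\<beta>\<le>Q. (\<Sum>t\<le>Q. q t * of_nat t ^ \<beta>) = (if \<beta> = e then 1 else 0 :: complex)"
proof -
  define L where "L t = (\<Prod>t'\<in>{..Q}-{t}. smult (1 / (of_nat t - of_nat t')) [:- of_nat t', 1:] :: complex poly)" for t
  have L: "poly (L t) (of_nat u) = (if u = t then 1 else 0)" if "t \<le> Q" "u \<le> Q" for t u
  proof (cases "u = t")
    case True
    then show ?thesis by (auto simp: L_def poly_prod intro!: prod.neutral simp flip: diff_divide_distrib)
  next
    case False
    then show ?thesis using that by (auto simp: L_def poly_prod intro!: prod_zero bexI[of _ u])
  qed
  have degL: "degree (L t) \<le> Q" if "t \<le> Q" for t
  proof -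
    have "degree (L t) \<le> (\<Sum>t'\<in>{..Q}-{t}. degree (smult (1 / (of_nat t - of_nat t')) [:- of_nat t', 1:] :: complex poly))"
      unfolding L_def by (rule order_trans[OF degree_prod_sum_le]) (simp_all add: o_def)
    also have "\<dots> \<le> (\<Sum>t'\<in>{..Q}-{t}. 1)" by (intro sum_mono) auto
    also have "\<dots> = Q" using that by simp
    finally show ?thesis .
  qed
  \<comment> \<open>Both sides have degree at most Q and agree at the Q + 1 nodes.\<close>
  have interp: "(\<Sum>t\<le>Q. smult (of_nat t ^ \<beta>) (L t)) = monom 1 \<beta>" if "\<beta> \<le> Q" for \<beta>
  proof (rule poly_eqI_degree[where A = "of_nat ` {..Q}"])
    fix x :: complex assume "x \<in> of_nat ` {..Q}"
    then obtain u where u: "u \<le> Q" "x = of_nat u" by auto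
    have "poly (\<Sum>t\<le>Q. smult (of_nat t ^ \<beta>) (L t)) x = (\<Sum>t\<le>Q. if t = u then of_nat t ^ \<beta> else 0)"
      unfolding poly_sum u using u by (intro sum.cong refl) (auto simp: L)
    also have "\<dots> = poly (monom 1 \<beta>) x" using u by (simp add: poly_monom)
    finally show "poly (\<Sum>t\<le>Q. smult (of_nat t ^ \<beta>) (L t)) x = poly (monom 1 \<beta>) x" .
  next
    have card: "card (of_nat ` {..Q} :: complex set) = Suc Q"
      by (subst card_image) (auto simp: inj_on_def)
    have "degree (\<Sum>t\<le>Q. smult (of_nat t ^ \<beta>) (L t)) \<le> Q"
      by (intro degree_sum_le) (auto intro: order_trans[OF degree_smult_le] degL)
    then show "degree (\<Sum>t\<le>Q. smult (of_nat t ^ \<beta>) (L t)) < card (of_nat ` {..Q} :: complex set)"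
      using card by simp
    show "degree (monom (1::complex) \<beta>) < card (of_nat ` {..Q} :: complex set)"
      using card that by (simp add: degree_monom_eq)
  qed
  show ?thesis
  proof (intro exI allI impI)
    fix \<beta> assume "\<beta> \<le> Q"
    have "(\<Sum>t\<le>Q. coeff (L t) e * of_nat t ^ \<beta>) = coeff (\<Sum>t\<le>Q. smult (of_nat t ^ \<beta>) (L t)) e"
      by (simp add: coeff_sum mult.commute)
    then show "(\<Sum>t\<le>Q. coeff (L t) e * of_nat t ^ \<beta>) = (if \<beta> = e then 1 else 0)"
      using interp[OF \<open>\<beta> \<le> Q\<close>] by simp
  qed
qed

text \<open>Tensor product of the one-variable weights. The nodes are natural numbers, so values at
  points of Z^n recover the coefficients.\<close>

lemma dual_moments_box:
  assumes "\<beta>\<^sub>0 \<in> box Q"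
  shows "\<exists>q. \<forall>\<beta>\<in>box Q. (\<Sum>t\<in>box Q. q t * mpow (\<lambda>i. int (t i)) \<beta>) = (if \<beta> = \<beta>\<^sub>0 then 1 else 0)"
proof -
  have "\<forall>e. \<exists>q. e \<le> Q \<longrightarrow> (\<forall>\<beta>\<le>Q. (\<Sum>t\<le>Q. q t * of_nat t ^ \<beta>) = (if \<beta> = e then 1 else 0 :: complex))"
    using dual_moments by blast
  from choice[OF this] obtain q where q: "\<And>e \<beta>. e \<le> Q \<Longrightarrow> \<beta> \<le> Q \<Longrightarrow>
      (\<Sum>t\<le>Q. q e t * of_nat t ^ \<beta>) = (if \<beta> = e then 1 else 0 :: complex)"
    by blast
  show ?thesis
  proof (intro exI ballI)
    fix \<beta> :: "'a \<Rightarrow> nat" assume \<beta>: "\<beta> \<in> box Q"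
    have "(\<Sum>t\<in>box Q. (\<Prod>i\<in>UNIV. q (\<beta>\<^sub>0 i) (t i)) * mpow (\<lambda>i. int (t i)) \<beta>)
        = (\<Prod>i\<in>UNIV. \<Sum>t\<le>Q. q (\<beta>\<^sub>0 i) t * of_nat t ^ \<beta> i)"
      unfolding prod_sum_box by (simp add: mpow_def prod.distrib)
    also have "\<dots> = (\<Prod>i\<in>UNIV. if \<beta> i = \<beta>\<^sub>0 i then 1 else 0)"
      using assms \<beta> by (intro prod.cong refl q) (auto simp: box_iff)
    also have "\<dots> = (if \<beta> = \<beta>\<^sub>0 then 1 else 0)"
      by (auto simp: fun_eq_iff intro: prod_zero)
    finally show "(\<Sum>t\<in>box Q. (\<Prod>i\<in>UNIV. q (\<beta>\<^sub>0 i) (t i)) * mpow (\<lambda>i. int (t i)) \<beta>)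
      = (if \<beta> = \<beta>\<^sub>0 then 1 else 0)" .
  qed
qed

context vsp
begin

text \<open>A coefficient is a finite linear combination of values at lattice points, hence lies in
  every subspace that contains the values. With N = {0} this is comparison of coefficients; with a
  submodule N it carries invariance from the operators at all s to their Taylor
  coefficients.\<close>

lemma gen_coeff_mem:
  assumes N: "subsp sc C N" and x: "\<And>\<beta>. \<beta> \<in> box Q \<Longrightarrow> x \<beta> \<in> C"
    and sum: "\<And>s. (\<Sum>\<beta>\<in>box Q. sc (dp s \<beta>) (x \<beta>)) \<in> N" and \<beta>: "\<beta> \<in> box Q"
  shows "x \<beta> \<in> N"
proof -
  interpret N: vsp sc N using subsp_vsp[OF vsp_axioms N] .
  obtain q where q: "\<And>\<gamma>. \<gamma> \<in> box Q \<Longrightarrow> (\<Sum>t\<in>box Q. q t * mpow (\<lambda>i. int (t i)) \<gamma>) = (if \<gamma> = \<beta> then 1 else 0)"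
    using dual_moments_box[OF \<beta>] by blast
  have "(\<Sum>t\<in>box Q. sc (q t) (\<Sum>\<gamma>\<in>box Q. sc (dp (\<lambda>i. int (t i)) \<gamma>) (x \<gamma>))) \<in> N"
    by (rule N.sum_in, rule N.sc_in, rule sum)
  also have "(\<Sum>t\<in>box Q. sc (q t) (\<Sum>\<gamma>\<in>box Q. sc (dp (\<lambda>i. int (t i)) \<gamma>) (x \<gamma>)))
      = (\<Sum>t\<in>box Q. \<Sum>\<gamma>\<in>box Q. sc (q t * dp (\<lambda>i. int (t i)) \<gamma>) (x \<gamma>))"
    using x by (simp add: sc_sum)
  also have "\<dots> = (\<Sum>\<gamma>\<in>box Q. \<Sum>t\<in>box Q. sc (q t * dp (\<lambda>i. int (t i)) \<gamma>) (x \<gamma>))"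
    by (rule sum.swap)
  also have "\<dots> = (\<Sum>\<gamma>\<in>box Q. sc (if \<gamma> = \<beta> then 1 / mfact \<beta> else 0) (x \<gamma>))"
  proof (rule sum.cong[OF refl])
    fix \<gamma> :: "'b \<Rightarrow> nat" assume \<gamma>: "\<gamma> \<in> box Q"
    have "(\<Sum>t\<in>box Q. q t * dp (\<lambda>i. int (t i)) \<gamma>) = (\<Sum>t\<in>box Q. q t * mpow (\<lambda>i. int (t i)) \<gamma>) / mfact \<gamma>"
      by (simp add: dp_def sum_divide_distrib)
    then show "(\<Sum>t\<in>box Q. sc (q t * dp (\<lambda>i. int (t i)) \<gamma>) (x \<gamma>)) = sc (if \<gamma> = \<beta> then 1 / mfact \<beta> else 0) (x \<gamma>)"
      using q[OF \<gamma>] x[OF \<gamma>] by (simp flip: sc_sum_left)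
  qed
  also have "\<dots> = (\<Sum>\<gamma>\<in>box Q. if \<gamma> = \<beta> then sc (1 / mfact \<beta>) (x \<gamma>) else 0)"
    using x by (intro sum.cong) auto
  also have "\<dots> = sc (1 / mfact \<beta>) (x \<beta>)"
    using \<beta> by simp
  finally have "sc (mfact \<beta>) (sc (1 / mfact \<beta>) (x \<beta>)) \<in> N" by (rule N.sc_in)
  then show ?thesis using x \<beta> by simp
qed

lemma gen_coeff_zero:
  assumes x: "\<And>\<beta>. \<beta> \<in> box Q \<Longrightarrow> x \<beta> \<in> C"
    and sum: "\<And>s. (\<Sum>\<beta>\<in>box Q. sc (dp s \<beta>) (x \<beta>)) = 0" and \<beta>: "\<beta> \<in> box Q"
  shows "x \<beta> = 0"
proof -
  have "x \<beta> \<in> {0}"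
    by (rule gen_coeff_mem[OF subsp_zero[OF vsp_axioms] x _ \<beta>]) (simp_all add: sum)
  then show ?thesis by simp
qed

text \<open>Comparison in s first, with the inner sum over \<gamma> as vector-valued coefficient,
  then in m.\<close>

lemma gen_coeff_zero2:
  assumes y: "\<And>\<alpha> \<gamma>. \<alpha> \<in> box R \<Longrightarrow> \<gamma> \<in> box R \<Longrightarrow> y \<alpha> \<gamma> \<in> C"
    and sum: "\<And>s m. (\<Sum>\<alpha>\<in>box R. \<Sum>\<gamma>\<in>box R. sc (dp s \<alpha> * dp m \<gamma>) (y \<alpha> \<gamma>)) = 0"
    and \<alpha>\<gamma>: "\<alpha> \<in> box R" "\<gamma> \<in> box R"
  shows "y \<alpha> \<gamma> = 0"
proof -
  have "(\<Sum>\<gamma>\<in>box R. sc (dp m \<gamma>) (y \<alpha> \<gamma>)) = 0" if "\<alpha> \<in> box R" for m \<alpha>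
  proof (rule gen_coeff_zero[where x = "\<lambda>\<alpha>. \<Sum>\<gamma>\<in>box R. sc (dp m \<gamma>) (y \<alpha> \<gamma>)", OF _ _ that])
    show "(\<Sum>\<alpha>\<in>box R. sc (dp s \<alpha>) (\<Sum>\<gamma>\<in>box R. sc (dp m \<gamma>) (y \<alpha> \<gamma>))) = 0" for s
      using sum[of s m] y by (simp add: sc_sum)
  qed (use y in auto)
  note inner = this[OF \<alpha>\<gamma>(1)]
  show ?thesis
  proof (rule gen_coeff_zero[where x = "y \<alpha>", OF _ _ \<alpha>\<gamma>(2)])
    show "y \<alpha> \<beta> \<in> C" if "\<beta> \<in> box R" for \<beta> using y \<alpha>\<gamma>(1) that by blast
    show "(\<Sum>\<beta>\<in>box R. sc (dp s \<beta>) (y \<alpha> \<beta>)) = 0" for s by (rule inner)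
  qed
qed

end

section \<open>Laurent polynomials near the point z = 1\<close>

section \<open>Laurent polynomials\<close>

type_synonym 'n laurent = "('n \<Rightarrow> int) \<Rightarrow>\<^sub>0 complex"

definition zmon :: "('n \<Rightarrow> int) \<Rightarrow> 'n laurent" where
  "zmon s = Poly_Mapping.single s 1"

definition cst :: "complex \<Rightarrow> 'n laurent" where
  "cst c = Poly_Mapping.single 0 c"

lemma zmon_add: "zmon (s + t) = zmon s * zmon t"
  by (simp add: zmon_def mult_single)

lemma zmon_0 [simp]: "zmon 0 = 1"
  by (simp add: zmon_def)

lemma zmon_minus: "zmon (- s) * zmon s = 1"
  by (simp flip: zmon_add)

lemma cst_simps [simp]: "cst 0 = 0" "cst 1 = 1" "cst (a + b) = cst a + cst b" "cst (a * b) = cst a * cst b"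
  "cst (- a) = - cst a" "cst (a - b) = cst a - cst b"
  by (simp_all add: cst_def single_add mult_single single_uminus single_diff)

lemma cst_sum: "cst (sum f A) = (\<Sum>i\<in>A. cst (f i))"
  by (induction A rule: infinite_finite_induct) auto

lemma cst_prod: "cst (prod f A) = (\<Prod>i\<in>A. cst (f i))"
  by (induction A rule: infinite_finite_induct) auto

lemma cst_of_nat: "cst (of_nat n) = of_nat n"
  by (induction n) auto

lemma poly_mapping_sum_single:
  "(f :: 'a \<Rightarrow>\<^sub>0 'b::comm_monoid_add) = (\<Sum>s\<in>Poly_Mapping.keys f. Poly_Mapping.single s (Poly_Mapping.lookup f s))"
proof (rule poly_mapping_eqI)
  fix k
  have "Poly_Mapping.lookup (\<Sum>s\<in>Poly_Mapping.keys f. Poly_Mapping.single s (Poly_Mapping.lookup f s)) k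
      = (\<Sum>s\<in>Poly_Mapping.keys f. if s = k then Poly_Mapping.lookup f s else 0)"
    unfolding lookup_sum by (intro sum.cong refl) (simp add: lookup_single when_def)
  also have "\<dots> = Poly_Mapping.lookup f k"
    by (simp add: in_keys_iff)
  finally show "Poly_Mapping.lookup f k
    = Poly_Mapping.lookup (\<Sum>s\<in>Poly_Mapping.keys f. Poly_Mapping.single s (Poly_Mapping.lookup f s)) k" ..
qed

lemma poly_mapping_induct_single:
  fixes f :: "'a \<Rightarrow>\<^sub>0 'b::comm_monoid_add"
  assumes "P 0" "\<And>s c. P (Poly_Mapping.single s c)" "\<And>f g. P f \<Longrightarrow> P g \<Longrightarrow> P (f + g)"
  shows "P f"
proof -
  have "P (\<Sum>s\<in>A. Poly_Mapping.single s (Poly_Mapping.lookup f s))" if "finite A" for A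
    using that by induction (auto intro: assms)
  then show ?thesis by (subst poly_mapping_sum_single) simp
qed

text \<open>The degree derivation z_j d/dz_j.\<close>

definition lderiv :: "'n \<Rightarrow> 'n laurent \<Rightarrow> 'n laurent" where
  "lderiv j f = Abs_poly_mapping (\<lambda>s. of_int (s j) * Poly_Mapping.lookup f s)"

lemma lookup_lderiv: "Poly_Mapping.lookup (lderiv j f) s = of_int (s j) * Poly_Mapping.lookup f s"
proof -
  have "finite {s. of_int (s j) * Poly_Mapping.lookup f s \<noteq> 0}"
    by (rule finite_subset[of _ "Poly_Mapping.keys f"]) (auto simp: in_keys_iff)
  then show ?thesis by (simp add: lderiv_def)
qed

lemma lderiv_simps [simp]: "lderiv j 0 = 0" "lderiv j (f + g) = lderiv j f + lderiv j g"
  "lderiv j (f - g) = lderiv j f - lderiv j g"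
  by (auto intro!: poly_mapping_eqI simp: lookup_lderiv lookup_add lookup_minus algebra_simps)

lemma lderiv_single: "lderiv j (Poly_Mapping.single s c) = Poly_Mapping.single s (of_int (s j) * c)"
  by (rule poly_mapping_eqI) (auto simp: lookup_lderiv lookup_single when_def)

lemma lderiv_zmon: "lderiv j (zmon s) = cst (of_int (s j)) * zmon s"
  unfolding zmon_def lderiv_single by (simp add: cst_def mult_single del: single_of_int)

lemma lderiv_1 [simp]: "lderiv j 1 = 0"
  using lderiv_zmon[of j 0] by simp

lemma lderiv_mult: "lderiv j (f * g) = lderiv j f * g + f * lderiv j g"
proof (induction f rule: poly_mapping_induct_single)
  case (2 s c)
  show ?case
    by (induction g rule: poly_mapping_induct_single)
      (simp_all add: mult_single lderiv_single distrib_left distrib_right single_add[symmetric] algebra_simps)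
qed (simp_all add: algebra_simps)

text \<open>Evaluation at z = (1, ..., 1); the elements of value zero form the maximal ideal of that
  point.\<close>

definition aug :: "'n laurent \<Rightarrow> complex" where
  "aug f = (\<Sum>s\<in>Poly_Mapping.keys f. Poly_Mapping.lookup f s)"

lemma aug_superset: "finite A \<Longrightarrow> Poly_Mapping.keys f \<subseteq> A \<Longrightarrow> aug f = (\<Sum>s\<in>A. Poly_Mapping.lookup f s)"
  unfolding aug_def by (rule sum.mono_neutral_left) (auto simp: in_keys_iff)

lemma aug_0 [simp]: "aug 0 = 0"
  by (simp add: aug_def)

lemma aug_single [simp]: "aug (Poly_Mapping.single s c) = c"
  by (simp add: aug_def)

lemma aug_zmon [simp]: "aug (zmon s) = 1"
  by (simp add: zmon_def)

lemma aug_add [simp]: "aug (f + g) = aug f + aug g"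
proof -
  let ?A = "Poly_Mapping.keys f \<union> Poly_Mapping.keys g"
  have "aug (f + g) = (\<Sum>s\<in>?A. Poly_Mapping.lookup (f + g) s)"
    by (rule aug_superset) (auto simp: Poly_Mapping.keys_add)
  also have "\<dots> = (\<Sum>s\<in>?A. Poly_Mapping.lookup f s) + (\<Sum>s\<in>?A. Poly_Mapping.lookup g s)"
    by (simp add: lookup_add sum.distrib)
  also have "\<dots> = aug f + aug g"
    by (subst (1 2) aug_superset[of ?A]) auto
  finally show ?thesis .
qed

lemma aug_mult: "aug (f * g) = aug f * aug g"
proof (induction f rule: poly_mapping_induct_single)
  case (2 s c)
  show ?case
    by (induction g rule: poly_mapping_induct_single) (simp_all add: mult_single algebra_simps)
qed (simp_all add: algebra_simps)

lemma aug_1 [simp]: "aug 1 = 1"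
  using aug_zmon[of 0] by simp

lemma aug_diff [simp]: "aug (f - g) = aug f - aug g"
  using aug_add[of "f - g" g] by simp

definition ymon :: "'n \<Rightarrow> 'n laurent" where
  "ymon i = zmon (eps i) - 1"

lemma aug_ymon [simp]: "aug (ymon i) = 0"
  by (simp add: ymon_def)

definition is_ideal :: "'n laurent set \<Rightarrow> bool" where
  "is_ideal K \<longleftrightarrow> 0 \<in> K \<and> (\<forall>f\<in>K. \<forall>g\<in>K. f + g \<in> K) \<and> (\<forall>f\<in>K. \<forall>g. f * g \<in> K)"

lemma is_ideal_diff:
  assumes "is_ideal K" "f \<in> K" "g \<in> K" shows "f - g \<in> K"
proof -
  have "g * (-1) \<in> K" using assms unfolding is_ideal_def by blast
  then have "f + g * (-1) \<in> K" using assms unfolding is_ideal_def by blast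
  then show ?thesis by simp
qed

lemma is_ideal_prod_cong:
  assumes K: "is_ideal K" and xy: "\<And>i. i \<in> A \<Longrightarrow> x i - y i \<in> K"
  shows "(\<Prod>i\<in>A. x i) - (\<Prod>i\<in>A. y i) \<in> K"
  using xy
proof (induction A rule: infinite_finite_induct)
  case (insert a A)
  have "(x a - y a) * prod x A + (prod x A - prod y A) * y a \<in> K"
    using K insert by (simp add: is_ideal_def)
  then show ?case using insert by (simp add: algebra_simps)
qed (use K in \<open>simp_all add: is_ideal_def\<close>)

text \<open>With y = z_i - 1, the truncated binomial series is (1 + y)^a modulo y^(M+1). Pascal's
  rule gives it the recursion in a that z_i^a satisfies, up to a multiple of y^(M+1), so induction
  from a = 0 in both directions covers negative exponents as well.\<close>

lemma zmon_power_mod_ideal: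
  fixes i :: 'n and a :: int
  assumes K: "is_ideal K" and y: "ymon i ^ Suc M \<in> K"
  shows "zmon (\<lambda>k. if k = i then a else 0) - (\<Sum>r\<le>M. cst (of_int a gchoose r) * ymon i ^ r) \<in> K"
proof -
  define P where "P a = (\<Sum>r\<le>M. cst (of_int a gchoose r) * ymon i ^ r)" for a :: int
  define Z where "Z a = zmon (\<lambda>k. if k = i then a else 0)" for a :: int
  have Z_add: "Z (a + b) = Z a * Z b" for a b
    unfolding Z_def zmon_add[symmetric] by (rule arg_cong[of _ _ zmon]) (auto simp: fun_eq_iff)
  have Z0: "Z 0 = 1" unfolding Z_def using zmon_0 by (simp add: zero_fun_def)
  have Z1: "Z 1 = ymon i + 1" unfolding Z_def ymon_def eps_def by simp
  have P0: "P 0 = 1"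
  proof -
    have "P 0 = (\<Sum>r\<le>M. if r = 0 then 1 else 0)"
      unfolding P_def by (intro sum.cong refl) (auto simp: gbinomial_0_left gr0_conv_Suc)
    then show ?thesis by simp
  qed
  have step: "P (a + 1) - Z 1 * P a \<in> K" for a
  proof -
    let ?g = "\<lambda>a r. cst (of_int a gchoose r :: complex)"
    have P_Suc: "P b = 1 + (\<Sum>r<M. ?g b (Suc r) * ymon i ^ Suc r)" for b
      unfolding P_def lessThan_Suc_atMost[symmetric] by (subst sum.lessThan_Suc_shift) simp
    have yP: "ymon i * P a = (\<Sum>r<M. ?g a r * ymon i ^ Suc r) + ?g a M * ymon i ^ Suc M"
      unfolding P_def lessThan_Suc_atMost[symmetric] by (simp add: sum_distrib_left algebra_simps)
    have "P (a + 1) = 1 + (\<Sum>r<M. ?g a (Suc r) * ymon i ^ Suc r) + (\<Sum>r<M. ?g a r * ymon i ^ Suc r)"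
    proof -
      have eq: "?g (a + 1) (Suc r) = ?g a r + ?g a (Suc r)" for r
        using gbinomial_Suc_Suc[of "of_int a :: complex" r] by simp
      show ?thesis unfolding P_Suc eq by (simp only: distrib_right sum.distrib add_ac)
    qed
    \<comment> \<open>Pascal's rule leaves an error consisting of the single top term of degree M +
      1, which lies in K.\<close>
    also have "\<dots> = P a + ymon i * P a - ?g a M * ymon i ^ Suc M"
      unfolding yP by (simp add: P_Suc[of a] add_ac)
    finally have "P (a + 1) - Z 1 * P a = ymon i ^ Suc M * (- ?g a M)"
      by (simp add: Z1 algebra_simps)
    also have "\<dots> \<in> K" using K y unfolding is_ideal_def by blast
    finally show ?thesis .
  qed
  have "Z a - P a \<in> K"
  proof (induction a rule: int_induct[where k = 0])
    case base
    show ?case using K by (simp add: Z0 P0 is_ideal_def)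
  next
    case (step1 a)
    have "(Z a - P a) * Z 1 - (P (a + 1) - Z 1 * P a) \<in> K"
    proof (rule is_ideal_diff[OF K])
      show "(Z a - P a) * Z 1 \<in> K" using K step1 unfolding is_ideal_def by blast
    qed (rule step)
    then show ?case by (simp add: Z_add algebra_simps)
  next
    case (step2 a)
    \<comment> \<open>The downward step divides by z_i, which is possible since monomials are
      units.\<close>
    have 1: "(Z a - P a) * Z (-1) + (P a - Z 1 * P (a - 1)) * Z (-1) \<in> K"
      using K step2 step[of "a - 1"] by (simp add: is_ideal_def)
    have "Z a * Z (-1) = Z (a - 1)" "Z 1 * Z (-1) = 1"
      by (simp_all add: Z0 flip: Z_add)
    moreover have "(Z a - P a) * Z (-1) + (P a - Z 1 * P (a - 1)) * Z (-1)
        = Z a * Z (-1) - (Z 1 * Z (-1)) * P (a - 1)"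
      by (simp add: algebra_simps)
    ultimately have "(Z a - P a) * Z (-1) + (P a - Z 1 * P (a - 1)) * Z (-1) = Z (a - 1) - P (a - 1)"
      by simp
    then show ?case using 1 by simp
  qed
  then show ?thesis unfolding Z_def P_def .
qed

lemma gbinomial_as_polynomial:
  "\<exists>c. \<forall>a. (a gchoose r :: complex) = (\<Sum>q\<le>r. c q * a ^ q)"
proof -
  define p where "p = smult (1 / fact r) (\<Prod>l\<in>{0..<r}. [:- of_nat l, 1:] :: complex poly)"
  have deg: "degree p \<le> r"
  proof -
    have "degree (\<Prod>l\<in>{0..<r}. [:- of_nat l, 1:] :: complex poly) \<le> (\<Sum>l\<in>{0..<r}. 1)"
      by (rule order_trans[OF degree_prod_sum_le]) (auto simp: o_def)
    then show ?thesis unfolding p_def by (auto intro: order_trans[OF degree_smult_le])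
  qed
  have "(a gchoose r) = (\<Sum>q\<le>r. coeff p q * a ^ q)" for a
  proof -
    have "(a gchoose r) = poly p a"
      by (simp add: p_def gbinomial_prod_rev poly_prod)
    also have "\<dots> = (\<Sum>q\<le>degree p. coeff p q * a ^ q)"
      by (rule poly_altdef)
    also have "\<dots> = (\<Sum>q\<le>r. coeff p q * a ^ q)"
      by (rule sum.mono_neutral_left) (use deg in \<open>auto simp: coeff_eq_0\<close>)
    finally show ?thesis .
  qed
  then show ?thesis by blast
qed

text \<open>Morally \<open>z\<^sub>i\<^sup>a = exp (a log z\<^sub>i)\<close>, where \<open>log z\<^sub>i\<close> is nilpotent modulo the ideal.\<close>
lemma zmon_polynomial_mod_ideal:
  obtains \<Lambda> :: "('n::finite \<Rightarrow> nat) \<Rightarrow> 'n laurent" where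
    "\<And>K s. is_ideal K \<Longrightarrow> (\<And>i. ymon i ^ Suc M \<in> K) \<Longrightarrow>
      zmon s - (\<Sum>\<beta>\<in>box M. cst (mpow s \<beta>) * \<Lambda> \<beta>) \<in> K"
proof -
  have "\<forall>r. \<exists>c. \<forall>a. (a gchoose r :: complex) = (\<Sum>q\<le>r. c q * a ^ q)"
    using gbinomial_as_polynomial by blast
  from choice[OF this] obtain c where c: "\<And>r a. (a gchoose r :: complex) = (\<Sum>q\<le>r. c r q * a ^ q)"
    by blast
  \<comment> \<open>Padding with zeros gives every r the same range of q, which allows the two sums
    to be exchanged.\<close>
  define c' where "c' r q = (if q \<le> r then c r q else 0)" for r q
  have c': "(a gchoose r :: complex) = (\<Sum>q\<le>M. c' r q * a ^ q)" if "r \<le> M" for a r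
    unfolding c by (rule sum.mono_neutral_cong_left) (use that in \<open>auto simp: c'_def\<close>)
  \<comment> \<open>The coefficient of a^q in the truncated series for z_i^a, morally (log
    z_i)^q/q!. It depends on M but on neither K nor s: one \<Lambda> has to serve the kernel ideals
    of all vectors at once, because it will define linear operators.\<close>
  define l where "l i q = (\<Sum>r\<le>M. cst (c' r q) * ymon i ^ r)" for i :: 'n and q
  show ?thesis
  proof
    fix K :: "'n laurent set" and s :: "'n \<Rightarrow> int"
    assume K: "is_ideal K" and y: "\<And>i. ymon i ^ Suc M \<in> K"
    have one: "(\<Sum>r\<le>M. cst (of_int a gchoose r) * ymon i ^ r) = (\<Sum>q\<le>M. cst (of_int a ^ q) * l i q)" for i a
    proof -
      have "(\<Sum>r\<le>M. cst (of_int a gchoose r) * ymon i ^ r)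
          = (\<Sum>r\<le>M. \<Sum>q\<le>M. cst (c' r q * of_int a ^ q) * ymon i ^ r)"
        by (intro sum.cong refl) (simp add: c' cst_sum sum_distrib_right del: cst_simps)
      also have "\<dots> = (\<Sum>q\<le>M. \<Sum>r\<le>M. cst (c' r q * of_int a ^ q) * ymon i ^ r)"
        by (rule sum.swap)
      also have "\<dots> = (\<Sum>q\<le>M. cst (of_int a ^ q) * l i q)"
        unfolding l_def by (simp add: sum_distrib_left mult_ac)
      finally show ?thesis .
    qed
    have fold: "(\<Sum>i\<in>A. (\<lambda>k. if k = i then s i else 0)) = (\<lambda>k. if k \<in> A then s k else 0)" if "finite A" for A
      using that by induction (auto simp: fun_eq_iff)
    have prod: "zmon (\<Sum>i\<in>A. t i) = (\<Prod>i\<in>A. zmon (t i))" if "finite A" for A :: "'n set" and t :: "'n \<Rightarrow> 'n \<Rightarrow> int"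
      using that by induction (simp_all only: sum.insert prod.insert sum.empty prod.empty zmon_0 zmon_add simp_thms)
    have "zmon s = (\<Prod>i\<in>UNIV. zmon (\<lambda>k. if k = i then s i else 0))"
      unfolding prod[OF finite_UNIV, symmetric] fold[OF finite_UNIV] by simp
    moreover have "(\<Prod>i\<in>UNIV. \<Sum>q\<le>M. cst (of_int (s i) ^ q) * l i q)
        = (\<Sum>\<beta>\<in>box M. cst (mpow s \<beta>) * (\<Prod>i\<in>UNIV. l i (\<beta> i)))"
      unfolding prod_sum_box by (simp add: prod.distrib mpow_def cst_prod)
    moreover have "zmon (\<lambda>k. if k = i then s i else 0) - (\<Sum>q\<le>M. cst (of_int (s i) ^ q) * l i q) \<in> K" for i
      unfolding one[symmetric] by (rule zmon_power_mod_ideal[OF K y])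
    ultimately show "zmon s - (\<Sum>\<beta>\<in>box M. cst (mpow s \<beta>) * (\<Prod>i\<in>UNIV. l i (\<beta> i))) \<in> K"
      using is_ideal_prod_cong[OF K, of UNIV "\<lambda>i. zmon (\<lambda>k. if k = i then s i else 0)"
          "\<lambda>i. \<Sum>q\<le>M. cst (of_int (s i) ^ q) * l i q"] by simp
  qed
qed

definition (in vsp) ext :: "(('n \<Rightarrow> int) \<Rightarrow> 'a) \<Rightarrow> 'n laurent \<Rightarrow> 'a" where
  "ext F f = (\<Sum>s\<in>Poly_Mapping.keys f. sc (Poly_Mapping.lookup f s) (F s))"

context vsp
begin

lemma ext_superset: "finite A \<Longrightarrow> Poly_Mapping.keys f \<subseteq> A \<Longrightarrow> (\<And>s. F s \<in> C) \<Longrightarrow>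
    ext F f = (\<Sum>s\<in>A. sc (Poly_Mapping.lookup f s) (F s))"
  unfolding ext_def by (rule sum.mono_neutral_left) (auto simp: in_keys_iff)

lemma ext_in [simp]: "(\<And>s. F s \<in> C) \<Longrightarrow> ext F f \<in> C"
  by (simp add: ext_def)

lemma ext_0 [simp]: "ext F 0 = 0"
  by (simp add: ext_def)

lemma ext_single: "(\<And>s. F s \<in> C) \<Longrightarrow> ext F (Poly_Mapping.single s c) = sc c (F s)"
  by (simp add: ext_def)

lemma ext_zmon: "(\<And>s. F s \<in> C) \<Longrightarrow> ext F (zmon s) = F s"
  by (simp add: zmon_def ext_single)

lemma ext_add: assumes "\<And>s. F s \<in> C" shows "ext F (f + g) = ext F f + ext F g"
proof -
  let ?A = "Poly_Mapping.keys f \<union> Poly_Mapping.keys g"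
  have "ext F (f + g) = (\<Sum>s\<in>?A. sc (Poly_Mapping.lookup (f + g) s) (F s))"
    by (rule ext_superset) (auto simp: Poly_Mapping.keys_add assms)
  also have "\<dots> = (\<Sum>s\<in>?A. sc (Poly_Mapping.lookup f s) (F s)) + (\<Sum>s\<in>?A. sc (Poly_Mapping.lookup g s) (F s))"
    by (simp add: lookup_add sum.distrib sc_left assms)
  also have "\<dots> = ext F f + ext F g"
    by (subst (1 2) ext_superset[of ?A]) (auto simp: assms)
  finally show ?thesis .
qed

lemma ext_cst: assumes "\<And>s. F s \<in> C" shows "ext F (cst c * f) = sc c (ext F f)"
  by (induction f rule: poly_mapping_induct_single)
    (simp_all add: cst_def mult_single ext_single assms distrib_left ext_add sc_add)

lemma ext_diff: assumes "\<And>s. F s \<in> C" shows "ext F (f - g) = ext F f - ext F g"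
  using ext_add[where F = F and f = "f - g" and g = g, OF assms] by simp

lemma ext_sum: assumes "\<And>s. F s \<in> C" shows "ext F (sum f I) = (\<Sum>i\<in>I. ext F (f i))"
  by (induction I rule: infinite_finite_induct) (auto simp: ext_add assms)

text \<open>The kernel of \<open>ext F\<close> is only a subspace; asking that all multiples be
  killed gives the largest ideal inside it, and g = 1 recovers the kernel condition.\<close>

lemma ext_kernel_ideal:
  assumes "\<And>s. F s \<in> C"
  shows "is_ideal {f. \<forall>g. ext F (f * g) = 0}"
  unfolding is_ideal_def by (auto simp: distrib_right ext_add assms mult.assoc)

end

section \<open>Vector fields vanishing at z = 1, and polynomiality of their action\<close>

section \<open>Families of difference operators\<close>

text \<open>\<open>D j s\<close> and \<open>G s a\<close> stand for \<open>e\<^bsub>-s\<^esub> d\<^sub>j(s)\<close> and \<open>e\<^bsub>-s\<^esub> (e\<^sub>s \<otimes> a)\<close>; up to a central term,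
  \<open>D j s\<close> behaves like the vector field \<open>(z\<^sup>s - 1) z\<^sub>j \<partial>/\<partial>z\<^sub>j\<close>.\<close>
locale diff_system = vsp sc C
  for sg :: "complex \<Rightarrow> 'g::ab_group_add \<Rightarrow> 'g" and lb :: "'g \<Rightarrow> 'g \<Rightarrow> 'g"
    and sc :: "complex \<Rightarrow> 'a::ab_group_add \<Rightarrow> 'a" and C :: "'a set" +
  fixes D :: "'n::finite \<Rightarrow> ('n \<Rightarrow> int) \<Rightarrow> 'a \<Rightarrow> 'a" and G :: "('n \<Rightarrow> int) \<Rightarrow> 'g \<Rightarrow> 'a \<Rightarrow> 'a"
  assumes fd: "fin_dim sc C"
    and D_lin: "lin_on sc C (D j s)" and G_lin: "lin_on sc C (G s a)"
    and G_add: "v \<in> C \<Longrightarrow> G s (a + b) v = G s a v + G s b v"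
    and G_sg: "v \<in> C \<Longrightarrow> G s (sg c a) v = sc c (G s a v)"
    and DD: "v \<in> C \<Longrightarrow> D j s (D k m v) - D k m (D j s v)
      = sc (of_int (m j)) (D k (s + m) v - D k m v) - sc (of_int (s k)) (D j (s + m) v - D j s v)"
    and DG: "v \<in> C \<Longrightarrow> D j s (G m a v) - G m a (D j s v) = sc (of_int (m j)) (G (s + m) a v - G m a v)"
    and GG: "v \<in> C \<Longrightarrow> G s a (G m b v) - G m b (G s a v) = G (s + m) (lb a b) v"
begin

sublocale D: lin sc C "D j s" for j s by (rule linI[OF D_lin])
sublocale G: lin sc C "G s a" for s a by (rule linI[OF G_lin])

text \<open>Up to a multiple of the central operator \<open>D j 0\<close>, this is the action of the
  field (f - f(1)) z_j d/dz_j: every monomial z^s enters as z^s - 1.\<close>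

definition T :: "'n \<Rightarrow> 'n laurent \<Rightarrow> 'a \<Rightarrow> 'a" where
  "T j f v = ext (\<lambda>s. D j s v) f"

definition TG :: "'n laurent \<Rightarrow> 'g \<Rightarrow> 'a \<Rightarrow> 'a" where
  "TG f a v = ext (\<lambda>s. G s a v) f"

lemma T_lin: "lin_on sc C (T j f)"
  unfolding T_def[abs_def] ext_def by (intro lin_sum lin_sc D_lin)

lemma TG_lin: "lin_on sc C (TG f a)"
  unfolding TG_def[abs_def] ext_def by (intro lin_sum lin_sc G_lin)

sublocale T: lin sc C "T j f" for j f by (rule linI[OF T_lin])
sublocale TG: lin sc C "TG f a" for f a by (rule linI[OF TG_lin])

lemma T_simps: assumes "v \<in> C"
  shows "T j 0 v = 0" "T j (f + g) v = T j f v + T j g v" "T j (f - g) v = T j f v - T j g v"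
    "T j (cst c * f) v = sc c (T j f v)" "T j (zmon s) v = D j s v"
    "T j (Poly_Mapping.single s c) v = sc c (D j s v)"
  using assms by (simp_all add: T_def ext_add ext_diff ext_cst ext_zmon ext_single)

lemma TG_simps: assumes "v \<in> C"
  shows "TG 0 a v = 0" "TG (f + g) a v = TG f a v + TG g a v" "TG (f - g) a v = TG f a v - TG g a v"
    "TG (cst c * f) a v = sc c (TG f a v)" "TG (zmon s) a v = G s a v"
    "TG (Poly_Mapping.single s c) a v = sc c (G s a v)"
  using assms by (simp_all add: TG_def ext_add ext_diff ext_cst ext_zmon ext_single)

text \<open>Both sides are bilinear in f and g, so the claim reduces to monomials, where it is
  \<open>DD\<close>. The terms with \<open>aug\<close> account for the subtracted constants f(1) and
  g(1) and disappear when f and g vanish at 1.\<close>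

lemma T_bracket:
  assumes v: "v \<in> C"
  shows "T j f (T k g v) - T k g (T j f v)
    = T k (f * lderiv j g) v - sc (aug f) (T k (lderiv j g) v)
      - T j (g * lderiv k f) v + sc (aug g) (T j (lderiv k f) v)"
proof (induction f rule: poly_mapping_induct_single)
  case 1
  show ?case using v by (simp add: T_simps)
next
  case (2 s c)
  show ?case
  proof (induction g rule: poly_mapping_induct_single)
    case 1
    show ?case using v by (simp add: T_simps)
  next
    case (2 m d)
    have "T j (Poly_Mapping.single s c) (T k (Poly_Mapping.single m d) v)
        - T k (Poly_Mapping.single m d) (T j (Poly_Mapping.single s c) v)
        = sc (c * d) (D j s (D k m v) - D k m (D j s v))"
      using v by (simp add: T_simps D.app_sc sc_diff mult.commute)
    then show ?case unfolding DD[OF v]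
      using v by (simp add: T_simps lderiv_single mult_single sc_diff mult_ac add.commute)
  next
    case (3 g h)
    from arg_cong2[OF this, of "(+)"] show ?case
      using v by (simp add: T_simps sc_distribs T.app_add distrib_left distrib_right algebra_simps)
  qed
next
  case (3 f h)
  from arg_cong2[OF this, of "(+)"] show ?case
    using v by (simp add: T_simps sc_distribs T.app_add distrib_left distrib_right algebra_simps)
qed

lemma TG_bracket:
  assumes v: "v \<in> C"
  shows "T j f (TG g a v) - TG g a (T j f v) = TG (f * lderiv j g) a v - sc (aug f) (TG (lderiv j g) a v)"
proof (induction f rule: poly_mapping_induct_single)
  case 1
  show ?case using v by (simp add: T_simps TG_simps)
next
  case (2 s c)
  show ?case
  proof (induction g rule: poly_mapping_induct_single)
    case 1
    show ?case using v by (simp add: T_simps TG_simps)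
  next
    case (2 m d)
    have "T j (Poly_Mapping.single s c) (TG (Poly_Mapping.single m d) a v)
        - TG (Poly_Mapping.single m d) a (T j (Poly_Mapping.single s c) v)
        = sc (c * d) (D j s (G m a v) - G m a (D j s v))"
      using v by (simp add: T_simps TG_simps D.app_sc G.app_sc sc_diff mult.commute)
    then show ?case unfolding DG[OF v]
      using v by (simp add: TG_simps lderiv_single mult_single sc_diff mult_ac add.commute)
  next
    case (3 g h)
    from arg_cong2[OF this, of "(+)"] show ?case
      using v by (simp add: T_simps TG_simps sc_distribs T.app_add TG.app_add distrib_left distrib_right algebra_simps)
  qed
next
  case (3 f h)
  from arg_cong2[OF this, of "(+)"] show ?case
    using v by (simp add: T_simps TG_simps sc_distribs T.app_add TG.app_add distrib_left distrib_right algebra_simps)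
qed

text \<open>\<open>T i (1 - z\<^sub>i\<inverse>)\<close> is the Euler field \<open>(z\<^sub>i - 1) \<partial>/\<partial>z\<^sub>i\<close>.\<close>
lemma euler_power: "(1 - zmon (- eps i)) * lderiv i (ymon i ^ p) = of_nat p * ymon i ^ p"
proof (induction p)
  case (Suc p)
  have d: "lderiv i (ymon i) = zmon (eps i)"
    by (simp add: ymon_def lderiv_zmon eps_def)
  have z: "(1 - zmon (- eps i)) * zmon (eps i) = ymon i"
    by (simp add: ymon_def left_diff_distrib zmon_minus)
  have "(1 - zmon (- eps i)) * lderiv i (ymon i ^ Suc p)
      = ((1 - zmon (- eps i)) * zmon (eps i)) * ymon i ^ p
        + ymon i * ((1 - zmon (- eps i)) * lderiv i (ymon i ^ p))"
    by (simp add: lderiv_mult d algebra_simps)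
  also have "\<dots> = of_nat (Suc p) * ymon i ^ Suc p"
    unfolding z Suc by (simp add: algebra_simps)
  finally show ?case .
qed simp

lemma lderiv_zmon_eps: "lderiv k (zmon (- eps i)) = (if k = i then - zmon (- eps i) else 0)"
  by (auto simp: lderiv_zmon eps_def)

text \<open>For k \<noteq> i neither z_k d/dz_k nor h involves z_i, so the Euler field in z_i sees
  only (z_i - 1)^p. The factor h is kept free because both h = 1 and h = z_k occur later.\<close>

lemma euler_bracket_neq:
  assumes v: "v \<in> C" and ki: "k \<noteq> i" and h: "lderiv i h = 0"
  shows "T i (1 - zmon (- eps i)) (T k (ymon i ^ p * h) v) - T k (ymon i ^ p * h) (T i (1 - zmon (- eps i)) v)
    = sc (of_nat p) (T k (ymon i ^ p * h) v)"
proof -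
  have "(1 - zmon (- eps i)) * lderiv i (ymon i ^ p * h) = cst (of_nat p) * (ymon i ^ p * h)"
    using euler_power[of i p] h by (simp add: lderiv_mult cst_of_nat mult.assoc[symmetric])
  then show ?thesis
    using v ki by (subst T_bracket) (simp_all add: lderiv_zmon_eps T_simps)
qed

text \<open>The factor z_i^-1 turns z_i d/dz_i into d/dz_i, so the field is (z_i - 1)^(p+1) d/dz_i,
  of degree p for the Euler field.\<close>

lemma euler_bracket_eq:
  assumes v: "v \<in> C"
  shows "T i (1 - zmon (- eps i)) (T i (ymon i ^ Suc p * zmon (- eps i)) v)
      - T i (ymon i ^ Suc p * zmon (- eps i)) (T i (1 - zmon (- eps i)) v)
    = sc (of_nat p) (T i (ymon i ^ Suc p * zmon (- eps i)) v)"
proof -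
  let ?Z = "zmon (- eps i)" and ?g = "ymon i ^ Suc p * zmon (- eps i)"
  have dZ: "lderiv i ?Z = - ?Z" by (simp add: lderiv_zmon eps_def)
  have "(1 - ?Z) * lderiv i ?g - ?g * ?Z = ((1 - ?Z) * lderiv i (ymon i ^ Suc p)) * ?Z - ?g"
    unfolding lderiv_mult[of i _ ?Z] dZ by (simp add: algebra_simps)
  also have "\<dots> = cst (of_nat p) * ?g"
    unfolding euler_power cst_of_nat by (simp add: algebra_simps)
  finally have eq: "(1 - ?Z) * lderiv i ?g - ?g * ?Z = cst (of_nat p) * ?g" .
  have "T i (1 - ?Z) (T i ?g v) - T i ?g (T i (1 - ?Z) v)
      = T i ((1 - ?Z) * lderiv i ?g) v - T i (?g * ?Z) v"
    using v by (subst T_bracket) (simp_all add: lderiv_zmon_eps aug_mult)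
  also have "\<dots> = T i (cst (of_nat p) * ?g) v"
    unfolding eq[symmetric] using v by (simp only: T_simps)
  finally show ?thesis using v by (simp only: T_simps)
qed

text \<open>The operators \<open>T k (g p)\<close> have pairwise different eigenvalues p, and only
  finitely many eigenvalues occur on End(C).\<close>

lemma eventually_killed:
  assumes "\<And>p v. v \<in> C \<Longrightarrow> T i e (T k (g p) v) - T k (g p) (T i e v) = sc (of_nat p) (T k (g p) v)"
  shows "\<exists>P. \<forall>p\<ge>P. \<forall>v\<in>C. T k (g p) v = 0"
proof -
  have "finite ((of_nat :: nat \<Rightarrow> complex) ` {p\<in>UNIV. \<exists>v\<in>C. T k (g p) v \<noteq> 0})"
    by (rule finite_ad_eigenvalues[OF fd T_lin[of i e]]) (use T_lin assms in auto)
  then have "finite {p. \<exists>v\<in>C. T k (g p) v \<noteq> 0}"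
    by (simp add: finite_image_iff)
  then obtain P where "\<forall>p\<in>{p. \<exists>v\<in>C. T k (g p) v \<noteq> 0}. p < P"
    using finite_nat_set_iff_bounded by blast
  then show ?thesis by (intro exI[of _ P]) (auto simp: not_less[symmetric])
qed

text \<open>With \<open>\<delta> = z\<^sub>k \<partial>/\<partial>z\<^sub>k\<close> and \<open>\<delta> h = h\<close> one has \<open>[f \<delta>, h g \<delta>] - [f h \<delta>, g \<delta>] = 2 f g h \<delta>\<close>;
  this passes from powers of \<open>z\<^sub>i - 1\<close> to the ideal they generate.\<close>
lemma killed_product:
  assumes f: "aug f = 0" "\<And>v. v \<in> C \<Longrightarrow> T k f v = 0" "\<And>v. v \<in> C \<Longrightarrow> T k (f * h) v = 0"
    and h: "lderiv k h = h" and g: "aug g = 0" and v: "v \<in> C"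
  shows "T k (f * g * h) v = 0"
proof -
  \<comment> \<open>Each commutator contains an operator that acts by zero on C, so both brackets
    vanish; f(1) = g(1) = 0 removes the correction terms of \<open>T_bracket\<close>.\<close>
  have "T k f (T k (h * g) v) - T k (h * g) (T k f v) = 0" "T k (f * h) (T k g v) - T k g (T k (f * h) v) = 0"
    using f v by simp_all
  then have "T k (f * lderiv k (h * g) - h * g * lderiv k f) v - T k ((f * h) * lderiv k g - g * lderiv k (f * h)) v = 0"
    unfolding T_bracket[OF v] using v f g by (simp add: aug_mult T_simps(3))
  then have "T k ((f * lderiv k (h * g) - h * g * lderiv k f) - ((f * h) * lderiv k g - g * lderiv k (f * h))) v = 0"
    using v by (simp only: T_simps)
  also have "(f * lderiv k (h * g) - h * g * lderiv k f) - ((f * h) * lderiv k g - g * lderiv k (f * h))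
      = cst 2 * (f * g * h)"
    by (simp add: lderiv_mult h cst_def algebra_simps)
  finally have "sc 2 (T k (f * g * h) v) = 0" using v by (simp only: T_simps)
  then show ?thesis using v sc_cancel by auto
qed

text \<open>To apply \<open>killed_product\<close> with h = z_k, an f is needed that divides a power
  of z_i - 1 and for which f and f z_k are both killed. The extra factor z_i - 1 coming from the
  exponent \<open>Suc P\<close> supplies a cofactor that vanishes at 1, whatever the multiple
  is.\<close>

lemma T_kills_power: "\<exists>P. \<forall>v\<in>C. \<forall>f. T k (ymon i ^ P * f) v = 0"
proof -
  have zz: "zmon (- eps i) * zmon (eps i) = 1" by (rule zmon_minus)
  obtain f P where fP: "aug f = 0" "\<And>v. v \<in> C \<Longrightarrow> T k f v = 0"
      "\<And>v. v \<in> C \<Longrightarrow> T k (f * zmon (eps k)) v = 0" "f dvd ymon i ^ P"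
  proof (cases "k = i")
    case False
    obtain P1 where P1: "\<forall>p\<ge>P1. \<forall>v\<in>C. T k (ymon i ^ p * 1) v = 0"
      using eventually_killed[OF euler_bracket_neq[OF _ False lderiv_1]] by blast
    have "lderiv i (zmon (eps k)) = 0" using False by (simp add: lderiv_zmon eps_def)
    from eventually_killed[OF euler_bracket_neq[OF _ False this]]
    obtain P2 where P2: "\<forall>p\<ge>P2. \<forall>v\<in>C. T k (ymon i ^ p * zmon (eps k)) v = 0" by blast
    \<comment> \<open>At least one factor z_i - 1 is needed for f(1) = 0.\<close>
    let ?P = "Suc (max P1 P2)"
    show thesis
    proof (rule that[of "ymon i ^ ?P" ?P])
      show "T k (ymon i ^ ?P) v = 0" if "v \<in> C" for v
        using P1[rule_format, of ?P v] that by simp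
      show "T k (ymon i ^ ?P * zmon (eps k)) v = 0" if "v \<in> C" for v
        using P2[rule_format, of ?P v] that by simp
    qed (simp_all add: aug_mult)
  next
    case True
    obtain P where P: "\<forall>p\<ge>P. \<forall>v\<in>C. T i (ymon i ^ Suc p * zmon (- eps i)) v = 0"
      using eventually_killed[OF euler_bracket_eq] by blast
    show thesis
    proof (rule that[of "ymon i ^ Suc P * zmon (- eps i)" "Suc P"])
      show "aug (ymon i ^ Suc P * zmon (- eps i)) = 0" by (simp add: aug_mult)
      show "T k (ymon i ^ Suc P * zmon (- eps i)) v = 0" if "v \<in> C" for v
        using P that True by blast
      \<comment> \<open>Writing z_i = (z_i - 1) + 1 expresses f z_i by two consecutive members of
        the killed family.\<close>
      have eq: "ymon i ^ Suc P * zmon (- eps i) * zmon (eps k)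
        = ymon i ^ Suc (Suc P) * zmon (- eps i) + ymon i ^ Suc P * zmon (- eps i)"
        unfolding True using zz by (simp add: ymon_def algebra_simps)
      show "T k (ymon i ^ Suc P * zmon (- eps i) * zmon (eps k)) v = 0" if "v \<in> C" for v
        unfolding eq using P[rule_format, of P v] P[rule_format, of "Suc P" v] that True
        by (simp only: T_simps) simp
      have "ymon i ^ Suc P = ymon i ^ Suc P * zmon (- eps i) * zmon (eps i)"
        using zz by (simp only: mult.assoc mult_1_right)
      then show "ymon i ^ Suc P * zmon (- eps i) dvd ymon i ^ Suc P" by (rule dvdI)
    qed
  qed
  obtain u where u: "ymon i ^ P = f * u" using fP(4) by (elim dvdE)
  show ?thesis
  proof (intro exI[of _ "Suc P"] ballI allI)
    fix v and g assume v: "v \<in> C"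
    have "ymon i ^ Suc P * g = f * (ymon i * u * g * zmon (- eps k)) * zmon (eps k)"
    proof -
      have "f * (ymon i * u * g * zmon (- eps k)) * zmon (eps k) = (f * u) * (ymon i * g) * (zmon (- eps k) * zmon (eps k))"
        by (simp only: mult_ac)
      also have "\<dots> = ymon i ^ Suc P * g"
        unfolding zmon_minus by (simp add: u[symmetric] mult_ac)
      finally show ?thesis ..
    qed
    also have "T k \<dots> v = 0"
      by (rule killed_product[OF fP(1-3) _ _ v]) (simp_all add: lderiv_zmon eps_def aug_mult)
    finally show "T k (ymon i ^ Suc P * g) v = 0" .
  qed
qed

text \<open>There are finitely many pairs (i, k), the sum of their exponents bounds each of them,
  and a multiple of a higher power is a multiple of a lower one.\<close>

lemma common_power: "\<exists>M. \<forall>i k f. \<forall>v\<in>C. T k (ymon i ^ Suc M * f) v = 0"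
proof -
  have "\<forall>x. \<exists>P. \<forall>v\<in>C. \<forall>f. T (snd x) (ymon (fst x) ^ P * f) v = 0"
    using T_kills_power by blast
  from choice[OF this] obtain P where P: "\<And>x v f. v \<in> C \<Longrightarrow> T (snd x) (ymon (fst x) ^ P x * f) v = 0"
    by blast
  define M where "M = (\<Sum>x\<in>UNIV. P x)"
  have "T k (ymon i ^ Suc M * f) v = 0" if "v \<in> C" for i k f v
  proof -
    have "P (i, k) \<le> M" unfolding M_def by (rule member_le_sum) auto
    then have "ymon i ^ Suc M = ymon i ^ P (i, k) * ymon i ^ (Suc M - P (i, k))"
      by (simp flip: power_add)
    then have "ymon i ^ Suc M * f = ymon i ^ P (i, k) * (ymon i ^ (Suc M - P (i, k)) * f)"
      by (simp only: mult.assoc)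
    then show ?thesis using P[OF that, of "(i, k)"] by simp
  qed
  then show ?thesis by blast
qed

text \<open>Since z_i d/dz_i fixes z_i, the bracket of the killed field f z_i^-1 z_i d/dz_i with z_i
  \<otimes> a is f \<otimes> a; vanishing thus passes from the fields to the second family.\<close>

lemma TG_killed:
  assumes M: "\<And>k f v. v \<in> C \<Longrightarrow> T k (ymon i ^ Suc M * f) v = 0" and v: "v \<in> C"
  shows "TG (ymon i ^ Suc M * f) a v = 0"
proof -
  let ?f = "ymon i ^ Suc M * (f * zmon (- eps i))"
  have d: "lderiv i (zmon (eps i)) = zmon (eps i)" by (simp add: lderiv_zmon eps_def)
  have "TG (?f * zmon (eps i)) a v = T i ?f (TG (zmon (eps i)) a v) - TG (zmon (eps i)) a (T i ?f v)"
    unfolding TG_bracket[OF v] d using v by (simp add: aug_mult)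
  also have "\<dots> = 0" using M v by simp
  also have "?f * zmon (eps i) = ymon i ^ Suc M * f"
  proof -
    have "?f * zmon (eps i) = (ymon i ^ Suc M * f) * (zmon (- eps i) * zmon (eps i))"
      by (simp only: mult_ac)
    then show ?thesis unfolding zmon_minus by simp
  qed
  finally show ?thesis .
qed

text \<open>For each v the map sending z^s to D_j(s) v extends to Laurent polynomials, and its
  kernel ideal contains all (z_i - 1)^(M+1). Hence z^s may be replaced by a polynomial in s with
  fixed Laurent coefficients \<Lambda>.\<close>

lemma polynomial:
  obtains Q and R :: "('n \<Rightarrow> nat) \<Rightarrow> 'n \<Rightarrow> 'a \<Rightarrow> 'a" and P :: "('n \<Rightarrow> nat) \<Rightarrow> 'g \<Rightarrow> 'a \<Rightarrow> 'a"
  where "\<And>\<beta> j. lin_on sc C (R \<beta> j)" "\<And>\<beta> a. lin_on sc C (P \<beta> a)"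
    "\<And>\<beta> j v. \<beta> \<notin> box Q \<Longrightarrow> R \<beta> j v = 0" "\<And>\<beta> a v. \<beta> \<notin> box Q \<Longrightarrow> P \<beta> a v = 0"
    "\<And>j s v. v \<in> C \<Longrightarrow> D j s v = (\<Sum>\<beta>\<in>box Q. sc (dp s \<beta>) (R \<beta> j v))"
    "\<And>s a v. v \<in> C \<Longrightarrow> G s a v = (\<Sum>\<beta>\<in>box Q. sc (dp s \<beta>) (P \<beta> a v))"
    "\<And>\<beta> a b v. v \<in> C \<Longrightarrow> P \<beta> (a + b) v = P \<beta> a v + P \<beta> b v"
    "\<And>\<beta> c a v. v \<in> C \<Longrightarrow> P \<beta> (sg c a) v = sc c (P \<beta> a v)"
proof -
  obtain M where M: "\<And>i k f v. v \<in> C \<Longrightarrow> T k (ymon i ^ Suc M * f) v = 0"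
    using common_power by blast
  obtain \<Lambda> :: "('n \<Rightarrow> nat) \<Rightarrow> 'n laurent" where \<Lambda>: "\<And>K s. is_ideal K \<Longrightarrow> (\<And>i. ymon i ^ Suc M \<in> K) \<Longrightarrow>
      zmon s - (\<Sum>\<beta>\<in>box M. cst (mpow s \<beta>) * \<Lambda> \<beta>) \<in> K"
    using zmon_polynomial_mod_ideal[of M] by blast
  have expand: "F s = (\<Sum>\<beta>\<in>box M. sc (dp s \<beta>) (sc (mfact \<beta>) (ext F (\<Lambda> \<beta>))))"
    if F: "\<And>s. F s \<in> C" and kill: "\<And>i f. ext F (ymon i ^ Suc M * f) = 0" for F s
  proof -
    have "zmon s - (\<Sum>\<beta>\<in>box M. cst (mpow s \<beta>) * \<Lambda> \<beta>) \<in> {f. \<forall>g. ext F (f * g) = 0}"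
      by (rule \<Lambda>[OF ext_kernel_ideal[OF F]]) (use kill in simp)
    then have "ext F ((zmon s - (\<Sum>\<beta>\<in>box M. cst (mpow s \<beta>) * \<Lambda> \<beta>)) * 1) = 0" by blast
    then show ?thesis using F by (simp add: ext_diff ext_sum ext_cst ext_zmon dp_def)
  qed
  \<comment> \<open>The factor \<beta>! normalises the coefficients to divided powers; the value
    zero outside the box makes the support explicit for later index shifts.\<close>
  define R where "R \<beta> j v = (if \<beta> \<in> box M then sc (mfact \<beta>) (T j (\<Lambda> \<beta>) v) else 0)" for \<beta> j v
  define P where "P \<beta> a v = (if \<beta> \<in> box M then sc (mfact \<beta>) (TG (\<Lambda> \<beta>) a v) else 0)" for \<beta> a v
  show thesis
  proof (rule that[of R P M])
    show "lin_on sc C (R \<beta> j)" for \<beta> j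
      by (cases "\<beta> \<in> box M") (auto simp: R_def[abs_def] intro: lin_sc T_lin lin_zero)
    show "lin_on sc C (P \<beta> a)" for \<beta> a
      by (cases "\<beta> \<in> box M") (auto simp: P_def[abs_def] intro: lin_sc TG_lin lin_zero)
    show "D j s v = (\<Sum>\<beta>\<in>box M. sc (dp s \<beta>) (R \<beta> j v))" if v: "v \<in> C" for j s v
      using expand[of "\<lambda>s. D j s v" s] M[OF v] v by (simp add: R_def T_def del: sc_sc)
    show "G s a v = (\<Sum>\<beta>\<in>box M. sc (dp s \<beta>) (P \<beta> a v))" if v: "v \<in> C" for s a v
      using expand[of "\<lambda>s. G s a v" s] TG_killed[OF M v] v by (simp add: P_def TG_def del: sc_sc)
    show "P \<beta> (a + b) v = P \<beta> a v + P \<beta> b v" if "v \<in> C" for \<beta> a b v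
      using that by (simp add: P_def TG_def ext_def G_add sc_add sum.distrib)
    show "P \<beta> (sg c a) v = sc c (P \<beta> a v)" if "v \<in> C" for \<beta> c a v
      using that by (simp add: P_def TG_def ext_def G_sg sc_sum mult_ac)
  qed (auto simp: R_def P_def)
qed

end

section \<open>The dictionary between g^+ and families polynomial in s\<close>

section \<open>Modules over \<open>\<g>\<^sup>+\<close> and families of difference operators\<close>

context vsp
begin

text \<open>Subtracting the series at m alone removes exactly the terms with \<alpha> = 0 from the
  right-hand side of \<open>DD\<close>, and symmetrically for \<gamma> = 0. This makes the
  coefficient with index 0 central, and the remaining coefficients are the structure constants of
  W_n^+.\<close>

lemma gen_DD:
  assumes x: "\<And>\<beta>. x \<beta> \<in> C" "\<And>\<beta>. \<beta> \<notin> box Q \<Longrightarrow> x \<beta> = 0"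
    and y: "\<And>\<beta>. y \<beta> \<in> C" "\<And>\<beta>. \<beta> \<notin> box Q \<Longrightarrow> y \<beta> = 0" and QR: "Q < R"
  shows "sc (of_int (m j)) ((\<Sum>\<beta>\<in>box R. sc (dp (s + m) \<beta>) (x \<beta>)) - (\<Sum>\<beta>\<in>box R. sc (dp m \<beta>) (x \<beta>)))
      - sc (of_int (s k)) ((\<Sum>\<beta>\<in>box R. sc (dp (s + m) \<beta>) (y \<beta>)) - (\<Sum>\<beta>\<in>box R. sc (dp s \<beta>) (y \<beta>)))
    = (\<Sum>\<alpha>\<in>box R. \<Sum>\<gamma>\<in>box R. sc (dp s \<alpha> * dp m \<gamma>)
        ((if \<alpha> = 0 then 0 else sc (of_nat (\<gamma> j)) (x (\<alpha> + \<gamma> - eps j)))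
          - (if \<gamma> = 0 then 0 else sc (of_nat (\<alpha> k)) (y (\<alpha> + \<gamma> - eps k)))))"
proof -
  have half: "sc (of_int (q l)) ((\<Sum>\<beta>\<in>box R. sc (dp (p + q) \<beta>) (x \<beta>)) - (\<Sum>\<beta>\<in>box R. sc (dp q \<beta>) (x \<beta>)))
      = (\<Sum>\<alpha>\<in>box R. \<Sum>\<gamma>\<in>box R. sc (dp p \<alpha> * dp q \<gamma>)
          (if \<alpha> = 0 then 0 else sc (of_nat (\<gamma> l)) (x (\<alpha> + \<gamma> - eps l))))"
    if x: "\<And>\<beta>. x \<beta> \<in> C" "\<And>\<beta>. \<beta> \<notin> box Q \<Longrightarrow> x \<beta> = 0" for x p q and l :: 'b
  proof -
    define F where "F \<alpha> = (\<Sum>\<gamma>\<in>box R. sc (dp p \<alpha> * dp q \<gamma>) (sc (of_nat (\<gamma> l)) (x (\<alpha> + \<gamma> - eps l))))" for \<alpha>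
    have "sc (of_int (q l)) (\<Sum>\<beta>\<in>box R. sc (dp q \<beta>) (x \<beta>))
        = (\<Sum>\<gamma>\<in>box R. sc (of_int (q l) * dp q \<gamma>) (x \<gamma>))"
      using x by (simp add: sc_sum)
    \<comment> \<open>The series at m alone is the \<alpha> = 0 slice of the double series, because
      \<open>dp p 0\<close> is 1.\<close>
    also have "\<dots> = F 0"
    proof -
      have "(\<Sum>\<gamma>\<in>box R. sc (of_int (q l) * dp q \<gamma>) (x \<gamma>))
          = (\<Sum>\<gamma>\<in>box R. sc (of_nat (\<gamma> l) * dp q \<gamma>) (x (\<gamma> - eps l)))"
        by (rule gen_deriv[OF x QR])
      also have "\<dots> = F 0"
        unfolding F_def using x by (intro sum.cong refl) (simp add: mult.commute)
      finally show ?thesis .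
    qed
    finally have 0: "sc (of_int (q l)) (\<Sum>\<beta>\<in>box R. sc (dp q \<beta>) (x \<beta>)) = F 0" .
    have "sc (of_int (q l)) ((\<Sum>\<beta>\<in>box R. sc (dp (p + q) \<beta>) (x \<beta>)) - (\<Sum>\<beta>\<in>box R. sc (dp q \<beta>) (x \<beta>)))
        = (\<Sum>\<alpha>\<in>box R. F \<alpha>) - F 0"
    proof -
      have "sc (of_int (q l)) (\<Sum>\<beta>\<in>box R. sc (dp (p + q) \<beta>) (x \<beta>)) = (\<Sum>\<alpha>\<in>box R. F \<alpha>)"
        unfolding F_def by (rule gen_add_deriv[OF x QR])
      then show ?thesis using x 0 by (simp add: sc_diff)
    qed
    also have "\<dots> = (\<Sum>\<alpha>\<in>box R - {0}. F \<alpha>)"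
      by (simp add: sum.remove[of "box R" 0])
    also have "\<dots> = (\<Sum>\<alpha>\<in>box R. if \<alpha> = 0 then 0 else F \<alpha>)"
      by (rule sum.mono_neutral_cong_left) auto
    finally show ?thesis
      unfolding F_def by (simp only: if_distrib[of "\<lambda>y. sc _ y"] if_distrib[of "\<lambda>z. sum z _"])
        (auto intro!: sum.cong)
  qed
  \<comment> \<open>The second half is the first with s and m, and with \<alpha> and \<gamma>,
    exchanged.\<close>
  have "sc (of_int (s k)) ((\<Sum>\<beta>\<in>box R. sc (dp (s + m) \<beta>) (y \<beta>)) - (\<Sum>\<beta>\<in>box R. sc (dp s \<beta>) (y \<beta>)))
      = (\<Sum>\<gamma>\<in>box R. \<Sum>\<alpha>\<in>box R. sc (dp m \<gamma> * dp s \<alpha>)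
          (if \<gamma> = 0 then 0 else sc (of_nat (\<alpha> k)) (y (\<gamma> + \<alpha> - eps k))))"
  proof -
    have "sc (of_int (s k)) ((\<Sum>\<beta>\<in>box R. sc (dp (m + s) \<beta>) (y \<beta>)) - (\<Sum>\<beta>\<in>box R. sc (dp s \<beta>) (y \<beta>)))
      = (\<Sum>\<gamma>\<in>box R. \<Sum>\<alpha>\<in>box R. sc (dp m \<gamma> * dp s \<alpha>)
          (if \<gamma> = 0 then 0 else sc (of_nat (\<alpha> k)) (y (\<gamma> + \<alpha> - eps k))))"
      by (rule half[OF y])
    then show ?thesis by (simp only: add.commute)
  qed
  also have "\<dots> = (\<Sum>\<alpha>\<in>box R. \<Sum>\<gamma>\<in>box R. sc (dp s \<alpha> * dp m \<gamma>)
          (if \<gamma> = 0 then 0 else sc (of_nat (\<alpha> k)) (y (\<alpha> + \<gamma> - eps k))))"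
    by (subst sum.swap) (simp only: mult.commute add.commute)
  finally have 2: "sc (of_int (s k)) ((\<Sum>\<beta>\<in>box R. sc (dp (s + m) \<beta>) (y \<beta>)) - (\<Sum>\<beta>\<in>box R. sc (dp s \<beta>) (y \<beta>))) = \<dots>" .
  have 1: "sc (of_int (m j)) ((\<Sum>\<beta>\<in>box R. sc (dp (s + m) \<beta>) (x \<beta>)) - (\<Sum>\<beta>\<in>box R. sc (dp m \<beta>) (x \<beta>)))
      = (\<Sum>\<alpha>\<in>box R. \<Sum>\<gamma>\<in>box R. sc (dp s \<alpha> * dp m \<gamma>)
          (if \<alpha> = 0 then 0 else sc (of_nat (\<gamma> j)) (x (\<alpha> + \<gamma> - eps j))))"
    by (rule half[OF x])
  have if_in: "(if b then 0 else z) \<in> C" if "z \<in> C" for b z using that by simp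
  show ?thesis
    unfolding 1 2 unfolding sum_subtractf[symmetric]
    by (intro sum.cong refl sc_diff[symmetric] if_in sc_in x y)
qed

lemma gen_DG:
  assumes x: "\<And>\<beta>. x \<beta> \<in> C" "\<And>\<beta>. \<beta> \<notin> box Q \<Longrightarrow> x \<beta> = 0" and QR: "Q < R"
  shows "sc (of_int (m j)) ((\<Sum>\<beta>\<in>box R. sc (dp (s + m) \<beta>) (x \<beta>)) - (\<Sum>\<beta>\<in>box R. sc (dp m \<beta>) (x \<beta>)))
    = (\<Sum>\<alpha>\<in>box R. \<Sum>\<gamma>\<in>box R. sc (dp s \<alpha> * dp m \<gamma>)
        (if \<alpha> = 0 then 0 else sc (of_nat (\<gamma> j)) (x (\<alpha> + \<gamma> - eps j))))"
  using gen_DD[where x = x and y = "\<lambda>_. 0" and k = j and j = j and m = m and s = s, OF x _ _ QR]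
  by (simp only: sc_zero_right if_cancel diff_zero zero_in sum.neutral_const) simp

lemma gen_comm:
  assumes A: "\<And>\<alpha>. \<alpha> \<in> I \<Longrightarrow> lin_on sc C (A \<alpha>)" and B: "\<And>\<gamma>. \<gamma> \<in> J \<Longrightarrow> lin_on sc C (B \<gamma>)" and v: "v \<in> C"
  shows "(\<Sum>\<alpha>\<in>I. sc (a \<alpha>) (A \<alpha> (\<Sum>\<gamma>\<in>J. sc (b \<gamma>) (B \<gamma> v)))) - (\<Sum>\<gamma>\<in>J. sc (b \<gamma>) (B \<gamma> (\<Sum>\<alpha>\<in>I. sc (a \<alpha>) (A \<alpha> v))))
    = (\<Sum>\<alpha>\<in>I. \<Sum>\<gamma>\<in>J. sc (a \<alpha> * b \<gamma>) (A \<alpha> (B \<gamma> v) - B \<gamma> (A \<alpha> v)))"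
proof -
  have AC: "A \<alpha> w \<in> C" if "\<alpha> \<in> I" "w \<in> C" for \<alpha> w using A[OF that(1)] that by (simp add: lin_on_def)
  have BC: "B \<gamma> w \<in> C" if "\<gamma> \<in> J" "w \<in> C" for \<gamma> w using B[OF that(1)] that by (simp add: lin_on_def)
  have 1: "(\<Sum>\<alpha>\<in>I. sc (a \<alpha>) (A \<alpha> (\<Sum>\<gamma>\<in>J. sc (b \<gamma>) (B \<gamma> v)))) = (\<Sum>\<alpha>\<in>I. \<Sum>\<gamma>\<in>J. sc (a \<alpha> * b \<gamma>) (A \<alpha> (B \<gamma> v)))"
  proof (rule sum.cong[OF refl])
    fix \<alpha> assume \<alpha>: "\<alpha> \<in> I"
    interpret A: lin sc C "A \<alpha>" using linI[OF A[OF \<alpha>]] .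
    show "sc (a \<alpha>) (A \<alpha> (\<Sum>\<gamma>\<in>J. sc (b \<gamma>) (B \<gamma> v))) = (\<Sum>\<gamma>\<in>J. sc (a \<alpha> * b \<gamma>) (A \<alpha> (B \<gamma> v)))"
      using v BC by (simp add: A.app_sum A.app_sc sc_sum)
  qed
  have "(\<Sum>\<gamma>\<in>J. sc (b \<gamma>) (B \<gamma> (\<Sum>\<alpha>\<in>I. sc (a \<alpha>) (A \<alpha> v)))) = (\<Sum>\<gamma>\<in>J. \<Sum>\<alpha>\<in>I. sc (a \<alpha> * b \<gamma>) (B \<gamma> (A \<alpha> v)))"
  proof (rule sum.cong[OF refl])
    fix \<gamma> assume \<gamma>: "\<gamma> \<in> J"
    interpret B: lin sc C "B \<gamma>" using linI[OF B[OF \<gamma>]] .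
    show "sc (b \<gamma>) (B \<gamma> (\<Sum>\<alpha>\<in>I. sc (a \<alpha>) (A \<alpha> v))) = (\<Sum>\<alpha>\<in>I. sc (a \<alpha> * b \<gamma>) (B \<gamma> (A \<alpha> v)))"
      using v AC by (simp add: B.app_sum B.app_sc sc_sum mult.commute)
  qed
  also have "\<dots> = (\<Sum>\<alpha>\<in>I. \<Sum>\<gamma>\<in>J. sc (a \<alpha> * b \<gamma>) (B \<gamma> (A \<alpha> v)))"
    by (rule sum.swap)
  finally have 2: "(\<Sum>\<gamma>\<in>J. sc (b \<gamma>) (B \<gamma> (\<Sum>\<alpha>\<in>I. sc (a \<alpha>) (A \<alpha> v)))) = \<dots>" .
  show ?thesis unfolding 1 2 sum_subtractf[symmetric] using v AC BC by (simp add: sc_diff)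
qed

text \<open>The index set of \<open>wsum\<close> depends on s and on the vectors; a fixed box makes
  sums at different s and v comparable.\<close>

lemma wsum_box:
  assumes "\<And>\<beta>. \<beta> \<in> B \<Longrightarrow> x \<beta> \<in> C" "\<And>\<beta>. \<beta> \<in> B \<Longrightarrow> \<beta> \<notin> box Q \<Longrightarrow> x \<beta> = 0"
  shows "wsum sc B s x = (\<Sum>\<beta>\<in>box Q. if \<beta> \<in> B then sc (dp s \<beta>) (x \<beta>) else 0)"
  unfolding wsum_def dp_def[symmetric]
proof (rule sum.mono_neutral_cong_left)
  show "{\<beta> \<in> B. sc (dp s \<beta>) (x \<beta>) \<noteq> 0} \<subseteq> box Q"
  proof
    fix \<beta> assume "\<beta> \<in> {\<beta> \<in> B. sc (dp s \<beta>) (x \<beta>) \<noteq> 0}"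
    then show "\<beta> \<in> box Q" by (cases "\<beta> \<in> box Q") (auto simp: assms(2))
  qed
qed auto

end

text \<open>The operator e_{-s} d_j(s) on the fibre of \<open>PhiB lam U\<close>, that is, its
  formula at m = 0.\<close>

definition DU :: "('n::finite \<Rightarrow> complex) \<Rightarrow> ('n, 'g, 'u::ab_group_add) Pmod \<Rightarrow> 'n \<Rightarrow> ('n \<Rightarrow> int) \<Rightarrow> 'u \<Rightarrow> 'u" where
  "DU lam U j s v = usc U (lam j) v + wsum (usc U) {\<beta>. \<beta> \<noteq> 0} s (\<lambda>\<beta>. uR U \<beta> j v)"

definition GU :: "('n::finite, 'g, 'u::ab_group_add) Pmod \<Rightarrow> ('n \<Rightarrow> int) \<Rightarrow> 'g \<Rightarrow> 'u \<Rightarrow> 'u" where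
  "GU U s g v = wsum (usc U) UNIV s (\<lambda>\<beta>. uP U \<beta> g v)"

lemma eps_neq_0 [simp]: "(eps i :: 'n \<Rightarrow> nat) \<noteq> 0"
  by (auto simp: eps_def fun_eq_iff)

lemma eps_apply: "eps j i = (if i = j then 1 else 0)"
  by (simp add: eps_def)

locale gplus_module =
  fixes sg :: "complex \<Rightarrow> 'g::ab_group_add \<Rightarrow> 'g" and lb :: "'g \<Rightarrow> 'g \<Rightarrow> 'g"
    and U :: "('n::finite, 'g, 'u::ab_group_add) Pmod"
  assumes gm: "gplus_fdmod sg lb U"
begin

abbreviation "sc \<equiv> usc U"
abbreviation "C \<equiv> ucar U"

sublocale vsp sc C using gm by (auto simp: gplus_fdmod_def vsp_def)

lemma fd: "fin_dim sc C"
  and R_lin: "\<alpha> \<noteq> 0 \<Longrightarrow> lin_on sc C (uR U \<alpha> j)"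
  and P_lin: "lin_on sc C (uP U \<beta> a)"
  and P_add: "v \<in> C \<Longrightarrow> uP U \<beta> (a + b) v = uP U \<beta> a v + uP U \<beta> b v"
  and P_sg: "v \<in> C \<Longrightarrow> uP U \<beta> (sg c a) v = sc c (uP U \<beta> a v)"
  and RR: "\<alpha> \<noteq> 0 \<Longrightarrow> \<gamma> \<noteq> 0 \<Longrightarrow> v \<in> C \<Longrightarrow> uR U \<alpha> j (uR U \<gamma> k v) - uR U \<gamma> k (uR U \<alpha> j v)
      = sc (of_nat (\<gamma> j)) (uR U (\<alpha> + \<gamma> - eps j) k v) - sc (of_nat (\<alpha> k)) (uR U (\<alpha> + \<gamma> - eps k) j v)"
  and RP: "\<alpha> \<noteq> 0 \<Longrightarrow> v \<in> C \<Longrightarrow> uR U \<alpha> j (uP U \<beta> a v) - uP U \<beta> a (uR U \<alpha> j v)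
      = sc (of_nat (\<beta> j)) (uP U (\<alpha> + \<beta> - eps j) a v)"
  and PP: "v \<in> C \<Longrightarrow> uP U \<alpha> a (uP U \<beta> b v) - uP U \<beta> b (uP U \<alpha> a v) = uP U (\<alpha> + \<beta>) (lb a b) v"
  using gm unfolding gplus_fdmod_def by simp_all

lemma R_in [simp]: "\<alpha> \<noteq> 0 \<Longrightarrow> v \<in> C \<Longrightarrow> uR U \<alpha> j v \<in> C"
  using R_lin by (auto simp: lin_on_def)

lemma P_in [simp]: "v \<in> C \<Longrightarrow> uP U \<alpha> a v \<in> C"
  using P_lin by (auto simp: lin_on_def)

text \<open>The Euler fields \<open>z\<^sub>i \<partial>/\<partial>z\<^sub>i\<close> have finitely many eigenvalues on \<open>End U\<close>.\<close>
lemma finite_support: "\<exists>Q. (\<forall>\<beta> j. \<forall>v\<in>C. \<beta> \<noteq> 0 \<longrightarrow> \<beta> \<notin> box Q \<longrightarrow> uR U \<beta> j v = 0)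
    \<and> (\<forall>\<beta> a. \<forall>v\<in>C. \<beta> \<notin> box Q \<longrightarrow> uP U \<beta> a v = 0)"
proof -
  have eps_cancel: "eps i + \<beta> - eps i = (\<beta> :: 'n \<Rightarrow> nat)" for i \<beta> by (auto simp: fun_eq_iff)
  have nz: "eps i + \<beta> - eps j \<noteq> (0 :: 'n \<Rightarrow> nat)" if "j \<noteq> i" for i j :: 'n and \<beta>
  proof
    assume "eps i + \<beta> - eps j = 0"
    from fun_cong[OF this, of i] that show False by (simp add: eps_apply)
  qed
  have "\<exists>q. \<forall>\<beta> j. \<forall>v\<in>C. \<beta> \<noteq> 0 \<longrightarrow> \<beta> i > q \<longrightarrow> uR U \<beta> j v = 0" for i
  proof -
    \<comment> \<open>The eigenvalue of z^\<alpha> d/dz_j under ad (z_i d/dz_i) is \<alpha>_i,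
      lowered by one when j = i, so a bound on it bounds \<alpha>_i.\<close>
    define e where "e x = int (fst x i) - (if snd x = i then 1 else 0)" for x :: "('n \<Rightarrow> nat) \<times> 'n"
    define S where "S = {x :: ('n \<Rightarrow> nat) \<times> 'n. fst x \<noteq> 0}"
    let ?S = "{x\<in>S. \<exists>v\<in>C. uR U (fst x) (snd x) v \<noteq> 0}"
    have "finite ((\<lambda>x. of_int (e x) :: complex) ` ?S)"
    proof (rule finite_ad_eigenvalues[OF fd R_lin])
      show "eps i \<noteq> (0 :: 'n \<Rightarrow> nat)" by simp
      show "lin_on sc C (uR U (fst x) (snd x))" if "x \<in> S" for x using that R_lin by (simp add: S_def)
      fix x v assume x: "x \<in> S" "v \<in> C"
      then show "uR U (eps i) i (uR U (fst x) (snd x) v) - uR U (fst x) (snd x) (uR U (eps i) i v)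
          = sc (of_int (e x)) (uR U (fst x) (snd x) v)"
        by (subst RR) (auto simp: S_def e_def eps_cancel eps_apply sc_diff_left nz)
    qed
    then have "finite (e ` ?S)"
      using finite_imageD[of "of_int :: int \<Rightarrow> complex" "e ` ?S"] by (simp add: image_image inj_on_def)
    then obtain b where b: "\<forall>y\<in>e ` ?S. y \<le> b" using finite_has_maximal2 bdd_above_finite
      by (meson bdd_above.E)
    have "uR U \<beta> j v = 0" if "v \<in> C" "\<beta> \<noteq> 0" "\<beta> i > nat (b + 1)" for \<beta> j v
    proof (rule ccontr)
      assume "uR U \<beta> j v \<noteq> 0"
      then have "(\<beta>, j) \<in> ?S" using that by (auto simp: S_def)
      then have "e (\<beta>, j) \<le> b" using b by blast
      then show False using that(3) by (auto simp: e_def split: if_splits)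
    qed
    then show ?thesis by blast
  qed
  then obtain q1 where q1: "\<And>i \<beta> j v. v \<in> C \<Longrightarrow> \<beta> \<noteq> 0 \<Longrightarrow> \<beta> i > q1 i \<Longrightarrow> uR U \<beta> j v = 0"
    using choice[of "\<lambda>i q. \<forall>\<beta> j. \<forall>v\<in>C. \<beta> \<noteq> 0 \<longrightarrow> \<beta> i > q \<longrightarrow> uR U \<beta> j v = 0"] by blast
  have "\<exists>q. \<forall>\<beta> a. \<forall>v\<in>C. \<beta> i > q \<longrightarrow> uP U \<beta> a v = 0" for i
  proof -
    let ?S = "{x\<in>UNIV. \<exists>v\<in>C. uP U (fst x) (snd x) v \<noteq> 0}"
    have "finite ((\<lambda>x. of_nat (fst x i) :: complex) ` ?S)"
    proof (rule finite_ad_eigenvalues[OF fd R_lin])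
      show "eps i \<noteq> (0 :: 'n \<Rightarrow> nat)" by simp
      show "lin_on sc C (uP U (fst x) (snd x))" for x by (rule P_lin)
      fix x :: "('n \<Rightarrow> nat) \<times> 'g" and v assume x: "v \<in> C"
      then show "uR U (eps i) i (uP U (fst x) (snd x) v) - uP U (fst x) (snd x) (uR U (eps i) i v)
          = sc (of_nat (fst x i)) (uP U (fst x) (snd x) v)"
        by (subst RP) (auto simp: eps_cancel)
    qed
    then have "finite ((\<lambda>x. fst x i) ` ?S)"
      using finite_imageD[of "of_nat :: nat \<Rightarrow> complex" "(\<lambda>x. fst x i) ` ?S"] by (simp add: image_image inj_on_def)
    then obtain b where b: "\<forall>y\<in>(\<lambda>x. fst x i) ` ?S. y \<le> b"
      using finite_nat_set_iff_bounded_le by blast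
    have "uP U \<beta> a v = 0" if "v \<in> C" "\<beta> i > b" for \<beta> a v
    proof (rule ccontr)
      assume "uP U \<beta> a v \<noteq> 0"
      then have "(\<beta>, a) \<in> ?S" using that by auto
      then have "\<beta> i \<le> b" using b by fastforce
      then show False using that(2) by simp
    qed
    then show ?thesis by blast
  qed
  then obtain q2 where q2: "\<And>i \<beta> a v. v \<in> C \<Longrightarrow> \<beta> i > q2 i \<Longrightarrow> uP U \<beta> a v = 0"
    using choice[of "\<lambda>i q. \<forall>\<beta> a. \<forall>v\<in>C. \<beta> i > q \<longrightarrow> uP U \<beta> a v = 0"] by blast
  \<comment> \<open>One coordinate above its own bound is enough for vanishing, so a common bound
    for all coordinates works.\<close>
  define Q where "Q = (\<Sum>i\<in>UNIV. q1 i + q2 i)"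
  have Q: "\<exists>i. \<beta> i > q1 i \<and> \<beta> i > q2 i" if \<beta>: "\<beta> \<notin> box Q" for \<beta>
  proof -
    obtain i where i: "\<not> \<beta> i \<le> Q" using \<beta> unfolding box_iff by blast
    have "q1 i + q2 i \<le> Q" unfolding Q_def by (rule member_le_sum) auto
    with i have "\<beta> i > q1 i \<and> \<beta> i > q2 i" by auto
    then show ?thesis ..
  qed
  show ?thesis
  proof (intro exI[of _ Q] conjI allI ballI impI)
    fix \<beta> :: "'n \<Rightarrow> nat" and j v assume "v \<in> C" "\<beta> \<noteq> 0" "\<beta> \<notin> box Q"
    then show "uR U \<beta> j v = 0" using Q q1 by blast
  next
    fix \<beta> :: "'n \<Rightarrow> nat" and a v assume "v \<in> C" "\<beta> \<notin> box Q"
    then show "uP U \<beta> a v = 0" using Q q2 by blast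
  qed
qed

definition "supp = (SOME Q. (\<forall>\<beta> j. \<forall>v\<in>C. \<beta> \<noteq> 0 \<longrightarrow> \<beta> \<notin> box Q \<longrightarrow> uR U \<beta> j v = 0)
    \<and> (\<forall>\<beta> a. \<forall>v\<in>C. \<beta> \<notin> box Q \<longrightarrow> uP U \<beta> a v = 0))"

lemma supp: "v \<in> C \<Longrightarrow> \<beta> \<noteq> 0 \<Longrightarrow> \<beta> \<notin> box supp \<Longrightarrow> uR U \<beta> j v = 0"
  "v \<in> C \<Longrightarrow> \<beta> \<notin> box supp \<Longrightarrow> uP U \<beta> a v = 0"
  using someI_ex[OF finite_support] unfolding supp_def[symmetric] by blast+

text \<open>Absorbs the summand \<open>lam j\<close> of \<open>DU\<close> into the series as its
  coefficient at \<beta> = 0. The field d/dz_j is not in W_n^+, so \<open>uR\<close> at index 0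
  carries no meaning and is replaced.\<close>

definition Rext :: "('n \<Rightarrow> complex) \<Rightarrow> ('n \<Rightarrow> nat) \<Rightarrow> 'n \<Rightarrow> 'u \<Rightarrow> 'u" where
  "Rext lam \<beta> j v = (if \<beta> = 0 then sc (lam j) v else uR U \<beta> j v)"

lemma Rext_lin: "lin_on sc C (Rext lam \<beta> j)"
  by (cases "\<beta> = 0") (auto simp: Rext_def[abs_def] lin_sc lin_id R_lin)

lemma Rext_in [simp]: "v \<in> C \<Longrightarrow> Rext lam \<beta> j v \<in> C"
  by (simp add: Rext_def)

lemma Rext_supp: "v \<in> C \<Longrightarrow> \<beta> \<notin> box supp \<Longrightarrow> Rext lam \<beta> j v = 0"
  by (auto simp: Rext_def supp)

lemma DU_box:
  assumes v: "v \<in> C" and Q: "supp \<le> Q"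
  shows "DU lam U j s v = (\<Sum>\<beta>\<in>box Q. sc (dp s \<beta>) (Rext lam \<beta> j v))"
proof -
  have out: "\<beta> \<notin> box supp" if "\<beta> \<notin> box Q" for \<beta> :: "'n \<Rightarrow> nat"
    using that box_mono[OF Q] by auto
  have "wsum sc {\<beta>. \<beta> \<noteq> 0} s (\<lambda>\<beta>. uR U \<beta> j v)
      = (\<Sum>\<beta>\<in>box Q. if \<beta> \<in> {\<beta>. \<beta> \<noteq> 0} then sc (dp s \<beta>) (uR U \<beta> j v) else 0)"
    by (rule wsum_box) (use v out supp in auto)
  also have "\<dots> = (\<Sum>\<beta>\<in>box Q - {0}. sc (dp s \<beta>) (Rext lam \<beta> j v))"
    by (rule sum.mono_neutral_cong_right) (auto simp: Rext_def)
  finally show ?thesis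
    unfolding DU_def using v by (simp add: sum.remove[of "box Q" 0] Rext_def)
qed

lemma GU_box:
  assumes v: "v \<in> C" and Q: "supp \<le> Q"
  shows "GU U s a v = (\<Sum>\<beta>\<in>box Q. sc (dp s \<beta>) (uP U \<beta> a v))"
proof -
  have out: "\<beta> \<notin> box supp" if "\<beta> \<notin> box Q" for \<beta> :: "'n \<Rightarrow> nat"
    using that box_mono[OF Q] by auto
  show ?thesis unfolding GU_def
    by (subst wsum_box[where Q = Q]) (use v out supp in auto)
qed

lemma DU_lin: "lin_on sc C (DU lam U j s)"
proof -
  have "lin_on sc C (\<lambda>v. \<Sum>\<beta>\<in>box supp. sc (dp s \<beta>) (Rext lam \<beta> j v))"
    by (intro lin_sum lin_sc Rext_lin)
  then show ?thesis using DU_box[OF _ order_refl] unfolding lin_on_def by simp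
qed

lemma GU_lin: "lin_on sc C (GU U s a)"
proof -
  have "lin_on sc C (\<lambda>v. \<Sum>\<beta>\<in>box supp. sc (dp s \<beta>) (uP U \<beta> a v))"
    by (intro lin_sum lin_sc P_lin)
  then show ?thesis using GU_box[OF _ order_refl] unfolding lin_on_def by simp
qed

lemma DU_0: "v \<in> C \<Longrightarrow> DU lam U j 0 v = sc (lam j) v"
  by (simp add: DU_def wsum_def mpow_zero_left cong: conj_cong)

lemma DU_shift: "v \<in> C \<Longrightarrow> DU lam U j s v = sc (lam j) v + DU (\<lambda>_. 0) U j s v"
  by (simp add: DU_def)

text \<open>If \<alpha> and \<gamma> are both nonzero, their sum has total degree at least 2, so
  \<alpha> + \<gamma> - \<open>eps i\<close> never drops to 0 and the relation stays within W_n^+.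
  If one of them is 0, a scalar commutes with everything.\<close>

lemma Rext_Rext:
  assumes v: "v \<in> C"
  shows "Rext lam \<alpha> j (Rext lam \<gamma> k v) - Rext lam \<gamma> k (Rext lam \<alpha> j v)
    = (if \<alpha> = 0 then 0 else sc (of_nat (\<gamma> j)) (Rext lam (\<alpha> + \<gamma> - eps j) k v))
      - (if \<gamma> = 0 then 0 else sc (of_nat (\<alpha> k)) (Rext lam (\<alpha> + \<gamma> - eps k) j v))"
proof (cases "\<alpha> = 0 \<or> \<gamma> = 0")
  case True
  then show ?thesis
    using v lin.app_sc[OF linI[OF R_lin]] by (auto simp: Rext_def mult.commute)
next
  case False
  have "\<alpha> + \<gamma> - eps i \<noteq> 0" for i
  proof
    assume *: "\<alpha> + \<gamma> - eps i = 0"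
    have **: "\<alpha> l + \<gamma> l \<le> (if l = i then 1 else 0)" for l
      using fun_cong[OF *, of l] by (simp add: eps_def)
    from False obtain a b where "\<alpha> a \<noteq> 0" "\<gamma> b \<noteq> 0" by (auto simp: fun_eq_iff)
    then show False using **[of a] **[of b] by (auto split: if_splits)
  qed
  then show ?thesis using False RR v by (simp add: Rext_def)
qed

lemma Rext_P:
  assumes v: "v \<in> C"
  shows "Rext lam \<alpha> j (uP U \<gamma> a v) - uP U \<gamma> a (Rext lam \<alpha> j v)
    = (if \<alpha> = 0 then 0 else sc (of_nat (\<gamma> j)) (uP U (\<alpha> + \<gamma> - eps j) a v))"
  using v RP lin.app_sc[OF linI[OF P_lin]] by (auto simp: Rext_def)

lemma diff_system: "diff_system sg lb sc C (DU lam U) (GU U)"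
proof
  \<comment> \<open>One more than the support, since \<open>gen_DD\<close> needs room for a shift by
    \<open>eps\<close>.\<close>
  let ?R = "Suc supp"
  have le: "supp \<le> ?R" "supp < ?R" by auto
  have P_supp: "uP U \<beta> a v = 0" if "v \<in> C" "\<beta> \<notin> box ?R" for \<beta> a v
    using that box_mono[OF le(1)] supp(2) by blast
  fix v assume v: "v \<in> C"
  have DUv: "DU lam U j s v \<in> C" for j s using DU_lin v by (simp add: lin_on_def)
  have GUv: "GU U s a v \<in> C" for s a using GU_lin v by (simp add: lin_on_def)
  show "GU U s (a + b) v = GU U s a v + GU U s b v" for s a b
    using v by (simp add: GU_box[OF v order_refl] P_add sc_add sum.distrib)
  show "GU U s (sg c a) v = sc c (GU U s a v)" for s c a
    using v by (simp add: GU_box[OF v order_refl] P_sg sc_sum mult.commute)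
  show "DU lam U j s (DU lam U k m v) - DU lam U k m (DU lam U j s v)
      = sc (of_int (m j)) (DU lam U k (s + m) v - DU lam U k m v)
        - sc (of_int (s k)) (DU lam U j (s + m) v - DU lam U j s v)" for j s k m
  proof -
    have "DU lam U j s (DU lam U k m v) - DU lam U k m (DU lam U j s v)
        = (\<Sum>\<alpha>\<in>box ?R. \<Sum>\<gamma>\<in>box ?R. sc (dp s \<alpha> * dp m \<gamma>)
            (Rext lam \<alpha> j (Rext lam \<gamma> k v) - Rext lam \<gamma> k (Rext lam \<alpha> j v)))"
      unfolding DU_box[OF DUv le(1)] unfolding DU_box[OF v le(1)] by (rule gen_comm[OF Rext_lin Rext_lin v])
    also have "\<dots> = sc (of_int (m j)) (DU lam U k (s + m) v - DU lam U k m v)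
        - sc (of_int (s k)) (DU lam U j (s + m) v - DU lam U j s v)"
      unfolding DU_box[OF v le(1)] Rext_Rext[OF v]
      by (rule gen_DD[where Q = supp, symmetric]) (use v Rext_supp le in auto)
    finally show ?thesis .
  qed
  show "DU lam U j s (GU U m a v) - GU U m a (DU lam U j s v)
      = sc (of_int (m j)) (GU U (s + m) a v - GU U m a v)" for j s m a
  proof -
    have "DU lam U j s (GU U m a v) - GU U m a (DU lam U j s v)
        = (\<Sum>\<alpha>\<in>box ?R. \<Sum>\<gamma>\<in>box ?R. sc (dp s \<alpha> * dp m \<gamma>)
            (Rext lam \<alpha> j (uP U \<gamma> a v) - uP U \<gamma> a (Rext lam \<alpha> j v)))"
      unfolding DU_box[OF GUv le(1)] GU_box[OF DUv le(1)]
      unfolding DU_box[OF v le(1)] GU_box[OF v le(1)] by (rule gen_comm[OF Rext_lin P_lin v])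
    also have "\<dots> = sc (of_int (m j)) (GU U (s + m) a v - GU U m a v)"
      unfolding GU_box[OF v le(1)] Rext_P[OF v]
      by (rule gen_DG[where Q = supp, symmetric]) (use v supp le in auto)
    finally show ?thesis .
  qed
  show "GU U s a (GU U m b v) - GU U m b (GU U s a v) = GU U (s + m) (lb a b) v" for s a m b
  proof -
    have "GU U s a (GU U m b v) - GU U m b (GU U s a v)
        = (\<Sum>\<alpha>\<in>box ?R. \<Sum>\<gamma>\<in>box ?R. sc (dp s \<alpha> * dp m \<gamma>)
            (uP U \<alpha> a (uP U \<gamma> b v) - uP U \<gamma> b (uP U \<alpha> a v)))"
      unfolding GU_box[OF GUv le(1)] unfolding GU_box[OF v le(1)] by (rule gen_comm[OF P_lin P_lin v])
    also have "\<dots> = GU U (s + m) (lb a b) v"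
      unfolding GU_box[OF v le(1)] PP[OF v]
      by (rule gen_add[symmetric]) (use v P_supp in auto)
    finally show ?thesis .
  qed
qed (use fd DU_lin GU_lin in auto)

text \<open>Operators and their Taylor coefficients are finite linear combinations of one another,
  so they leave the same subspaces invariant. The weight enters only through scalars, hence
  \<open>lam\<close> is arbitrary.\<close>

lemma Psub_iff:
  "Psub U N \<longleftrightarrow> subsp sc C N \<and> (\<forall>j s. \<forall>v\<in>N. DU lam U j s v \<in> N) \<and> (\<forall>s a. \<forall>v\<in>N. GU U s a v \<in> N)"
proof
  assume N: "Psub U N"
  then have sub: "subsp sc C N" by (simp add: Psub_def)
  interpret N: vsp sc N using subsp_vsp[OF vsp_axioms sub] .
  have NC: "v \<in> N \<Longrightarrow> v \<in> C" for v using sub by (auto simp: subsp_def)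
  have R: "Rext lam \<beta> j v \<in> N" if "v \<in> N" for \<beta> j v
    using N that by (auto simp: Rext_def Psub_def)
  have P: "uP U \<beta> a v \<in> N" if "v \<in> N" for \<beta> a v
    using N that by (auto simp: Psub_def)
  show "subsp sc C N \<and> (\<forall>j s. \<forall>v\<in>N. DU lam U j s v \<in> N) \<and> (\<forall>s a. \<forall>v\<in>N. GU U s a v \<in> N)"
    using sub R P by (auto simp: DU_box[OF NC order_refl] GU_box[OF NC order_refl] intro!: N.sum_in N.sc_in)
next
  assume N: "subsp sc C N \<and> (\<forall>j s. \<forall>v\<in>N. DU lam U j s v \<in> N) \<and> (\<forall>s a. \<forall>v\<in>N. GU U s a v \<in> N)"
  then have sub: "subsp sc C N" by simp
  interpret N: vsp sc N using subsp_vsp[OF vsp_axioms sub] .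
  have NC: "v \<in> N \<Longrightarrow> v \<in> C" for v using sub by (auto simp: subsp_def)
  have R: "Rext lam \<beta> j v \<in> N" if v: "v \<in> N" for \<beta> j v
  proof (cases "\<beta> \<in> box supp")
    case True
    show ?thesis
    proof (rule gen_coeff_mem[OF sub _ _ True, where x = "\<lambda>\<beta>. Rext lam \<beta> j v"])
      show "(\<Sum>\<beta>\<in>box supp. sc (dp s \<beta>) (Rext lam \<beta> j v)) \<in> N" for s
        unfolding DU_box[OF NC[OF v] order_refl, symmetric] using N v by blast
    qed (use NC v in auto)
  qed (use Rext_supp NC v in auto)
  have P: "uP U \<beta> a v \<in> N" if v: "v \<in> N" for \<beta> a v
  proof (cases "\<beta> \<in> box supp")
    case True
    show ?thesis
    proof (rule gen_coeff_mem[OF sub _ _ True, where x = "\<lambda>\<beta>. uP U \<beta> a v"])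
      show "(\<Sum>\<beta>\<in>box supp. sc (dp s \<beta>) (uP U \<beta> a v)) \<in> N" for s
        unfolding GU_box[OF NC[OF v] order_refl, symmetric] using N v by blast
    qed (use NC v in auto)
  qed (use supp NC v in auto)
  show "Psub U N" unfolding Psub_def
  proof (intro conjI allI impI ballI)
    fix \<alpha> :: "'n \<Rightarrow> nat" and j v assume "\<alpha> \<noteq> 0" "v \<in> N"
    then show "uR U \<alpha> j v \<in> N" using R[of v \<alpha> j] by (simp add: Rext_def)
  qed (use sub P in auto)
qed

end

text \<open>The same comparison of coefficients, applied to the difference of the two composites.
  Both supports are enclosed in one box so that the series can be subtracted.\<close>

lemma morphism_iff:
  fixes U :: "('n::finite, 'g::ab_group_add, 'u::ab_group_add) Pmod" and U' :: "('n, 'g, 'w::ab_group_add) Pmod"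
  assumes U: "gplus_fdmod sg lb U" and U': "gplus_fdmod sg lb U'"
    and \<phi>: "\<And>x. x \<in> ucar U \<Longrightarrow> \<phi> x \<in> ucar U'"
      "\<And>x y. x \<in> ucar U \<Longrightarrow> y \<in> ucar U \<Longrightarrow> \<phi> (x + y) = \<phi> x + \<phi> y"
      "\<And>c x. x \<in> ucar U \<Longrightarrow> \<phi> (usc U c x) = usc U' c (\<phi> x)"
  shows "(\<forall>\<alpha> j. \<alpha> \<noteq> 0 \<longrightarrow> (\<forall>x\<in>ucar U. \<phi> (uR U \<alpha> j x) = uR U' \<alpha> j (\<phi> x)))
      \<and> (\<forall>\<beta> a. \<forall>x\<in>ucar U. \<phi> (uP U \<beta> a x) = uP U' \<beta> a (\<phi> x))
    \<longleftrightarrow> (\<forall>j s. \<forall>x\<in>ucar U. \<phi> (DU lam U j s x) = DU lam U' j s (\<phi> x))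
      \<and> (\<forall>s a. \<forall>x\<in>ucar U. \<phi> (GU U s a x) = GU U' s a (\<phi> x))" (is "?L \<longleftrightarrow> ?R")
proof -
  interpret U: gplus_module sg lb U by unfold_locales (rule U)
  interpret U': gplus_module sg lb U' by unfold_locales (rule U')
  have \<phi>0: "\<phi> 0 = 0" using \<phi>(2)[of 0 0] by simp
  have \<phi>_sum: "\<phi> (sum f I) = (\<Sum>i\<in>I. \<phi> (f i))" if "\<And>i. i \<in> I \<Longrightarrow> f i \<in> ucar U" for f and I :: "('n \<Rightarrow> nat) set"
    using that by (induction I rule: infinite_finite_induct) (auto simp: \<phi>0 \<phi>(2))
  define Q where "Q = max U.supp U'.supp"
  have Q: "U.supp \<le> Q" "U'.supp \<le> Q" by (auto simp: Q_def)
  note boxes = U.DU_box[OF _ Q(1)] U'.DU_box[OF _ Q(2)] U.GU_box[OF _ Q(1)] U'.GU_box[OF _ Q(2)]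
  have D: "\<phi> (DU lam U j s x) = (\<Sum>\<beta>\<in>box Q. usc U' (dp s \<beta>) (\<phi> (U.Rext lam \<beta> j x)))" if "x \<in> ucar U" for j s x
    using that by (simp add: boxes \<phi>_sum \<phi>)
  have G: "\<phi> (GU U s a x) = (\<Sum>\<beta>\<in>box Q. usc U' (dp s \<beta>) (\<phi> (uP U \<beta> a x)))" if "x \<in> ucar U" for s a x
    using that by (simp add: boxes \<phi>_sum \<phi>)
  show ?thesis
  proof
    assume L: ?L
    have "\<phi> (U.Rext lam \<beta> j x) = U'.Rext lam \<beta> j (\<phi> x)" if "x \<in> ucar U" for \<beta> j x
      using L that by (auto simp: U.Rext_def U'.Rext_def \<phi>)
    note 1 = this
    have 2: "\<phi> (uP U \<beta> a x) = uP U' \<beta> a (\<phi> x)" if "x \<in> ucar U" for \<beta> a x using L that by blast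
    show ?R
    proof (intro conjI allI ballI)
      fix j s x assume x: "x \<in> ucar U"
      show "\<phi> (DU lam U j s x) = DU lam U' j s (\<phi> x)"
        unfolding D[OF x] U'.DU_box[OF \<phi>(1)[OF x] Q(2)] 1[OF x] ..
    next
      fix a s x assume x: "x \<in> ucar U"
      show "\<phi> (GU U s a x) = GU U' s a (\<phi> x)"
        unfolding G[OF x] U'.GU_box[OF \<phi>(1)[OF x] Q(2)] 2[OF x] ..
    qed
  next
    assume R: ?R
    have out: "\<beta> \<notin> box U.supp \<and> \<beta> \<notin> box U'.supp" if "\<beta> \<notin> box Q" for \<beta> :: "'n \<Rightarrow> nat"
      using that box_mono[OF Q(1)] box_mono[OF Q(2)] by auto
    have 1: "\<phi> (U.Rext lam \<beta> j x) = U'.Rext lam \<beta> j (\<phi> x)" if x: "x \<in> ucar U" for \<beta> j x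
    proof (cases "\<beta> \<in> box Q")
      case True
      have "\<phi> (U.Rext lam \<beta> j x) - U'.Rext lam \<beta> j (\<phi> x) = 0"
      proof (rule U'.gen_coeff_zero[OF _ _ True, where x = "\<lambda>\<beta>. \<phi> (U.Rext lam \<beta> j x) - U'.Rext lam \<beta> j (\<phi> x)"])
        have "(\<Sum>\<beta>\<in>box Q. usc U' (dp s \<beta>) (\<phi> (U.Rext lam \<beta> j x)))
            = (\<Sum>\<beta>\<in>box Q. usc U' (dp s \<beta>) (U'.Rext lam \<beta> j (\<phi> x)))" for s
          using R x D[OF x, of j s] U'.DU_box[OF \<phi>(1)[OF x] Q(2), of lam j s] by simp
        then show "(\<Sum>\<beta>\<in>box Q. usc U' (dp s \<beta>) (\<phi> (U.Rext lam \<beta> j x) - U'.Rext lam \<beta> j (\<phi> x))) = 0" for s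
          using x by (simp add: U'.sc_diff \<phi> sum_subtractf)
      qed (use x in \<open>auto simp: \<phi>\<close>)
      then show ?thesis by simp
    qed (use x out U.Rext_supp U'.Rext_supp \<phi> \<phi>0 in auto)
    have 2: "\<phi> (uP U \<beta> a x) = uP U' \<beta> a (\<phi> x)" if x: "x \<in> ucar U" for \<beta> a x
    proof (cases "\<beta> \<in> box Q")
      case True
      have "\<phi> (uP U \<beta> a x) - uP U' \<beta> a (\<phi> x) = 0"
      proof (rule U'.gen_coeff_zero[OF _ _ True, where x = "\<lambda>\<beta>. \<phi> (uP U \<beta> a x) - uP U' \<beta> a (\<phi> x)"])
        have "(\<Sum>\<beta>\<in>box Q. usc U' (dp s \<beta>) (\<phi> (uP U \<beta> a x)))
            = (\<Sum>\<beta>\<in>box Q. usc U' (dp s \<beta>) (uP U' \<beta> a (\<phi> x)))" for s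
          using R x G[OF x, of s a] U'.GU_box[OF \<phi>(1)[OF x] Q(2), of s a] by simp
        then show "(\<Sum>\<beta>\<in>box Q. usc U' (dp s \<beta>) (\<phi> (uP U \<beta> a x) - uP U' \<beta> a (\<phi> x))) = 0" for s
          using x by (simp add: U'.sc_diff \<phi> sum_subtractf)
      qed (use x in \<open>auto simp: \<phi>\<close>)
      then show ?thesis by simp
    qed (use x out U.supp U'.supp \<phi> \<phi>0 in auto)
    show ?L
    proof (intro conjI allI impI ballI 2)
      fix \<alpha> :: "'n \<Rightarrow> nat" and j x assume "\<alpha> \<noteq> 0" "x \<in> ucar U"
      then show "\<phi> (uR U \<alpha> j x) = uR U' \<alpha> j (\<phi> x)" using 1[of x \<alpha> j] by (simp add: U.Rext_def U'.Rext_def)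
    qed
  qed
qed

text \<open>Expanding the relations of the difference operators in s and m and comparing the
  coefficients of s^\<alpha> m^\<gamma> gives the relations of g^+, one pair (\<alpha>, \<gamma>) at
  a time.\<close>

lemma (in diff_system) gplus_module_of_diff_system:
  assumes lam: "\<And>j v. v \<in> C \<Longrightarrow> D j 0 v = sc (lam j) v"
  shows "\<exists>U. gplus_fdmod sg lb U \<and> ucar U = C \<and> usc U = sc
    \<and> (\<forall>j s. \<forall>v\<in>C. DU lam U j s v = D j s v) \<and> (\<forall>s a. \<forall>v\<in>C. GU U s a v = G s a v)"
proof -
  obtain R :: "('n \<Rightarrow> nat) \<Rightarrow> 'n \<Rightarrow> 'a \<Rightarrow> 'a" and P :: "('n \<Rightarrow> nat) \<Rightarrow> 'g \<Rightarrow> 'a \<Rightarrow> 'a" and Q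
    where R_lin: "\<And>\<beta> j. lin_on sc C (R \<beta> j)" and P_lin: "\<And>\<beta> a. lin_on sc C (P \<beta> a)"
    and R_out: "\<And>\<beta> j v. \<beta> \<notin> box Q \<Longrightarrow> R \<beta> j v = 0" and P_out: "\<And>\<beta> a v. \<beta> \<notin> box Q \<Longrightarrow> P \<beta> a v = 0"
    and DR: "\<And>j s v. v \<in> C \<Longrightarrow> D j s v = (\<Sum>\<beta>\<in>box Q. sc (dp s \<beta>) (R \<beta> j v))"
    and GP: "\<And>s a v. v \<in> C \<Longrightarrow> G s a v = (\<Sum>\<beta>\<in>box Q. sc (dp s \<beta>) (P \<beta> a v))"
    and P_add: "\<And>\<beta> a b v. v \<in> C \<Longrightarrow> P \<beta> (a + b) v = P \<beta> a v + P \<beta> b v"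
    and P_sg: "\<And>\<beta> c a v. v \<in> C \<Longrightarrow> P \<beta> (sg c a) v = sc c (P \<beta> a v)"
    by (rule polynomial, rule that) simp_all
  have R_in [simp]: "v \<in> C \<Longrightarrow> R \<beta> j v \<in> C" for \<beta> j v using R_lin by (simp add: lin_on_def)
  have P_in [simp]: "v \<in> C \<Longrightarrow> P \<beta> a v \<in> C" for \<beta> a v using P_lin by (simp add: lin_on_def)
  let ?R = "Suc Q"
  have DR': "D j s v = (\<Sum>\<beta>\<in>box ?R. sc (dp s \<beta>) (R \<beta> j v))" if "v \<in> C" for j s v
    unfolding DR[OF that] by (rule box_extend[symmetric]) (use R_out in auto)
  have GP': "G s a v = (\<Sum>\<beta>\<in>box ?R. sc (dp s \<beta>) (P \<beta> a v))" if "v \<in> C" for s a v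
    unfolding GP[OF that] by (rule box_extend[symmetric]) (use P_out in auto)
  \<comment> \<open>At s = 0 only the term with \<beta> = 0 survives.\<close>
  have R0: "R 0 j v = sc (lam j) v" if v: "v \<in> C" for j v
  proof -
    have "D j 0 v = (\<Sum>\<beta>\<in>box Q. if \<beta> = 0 then R \<beta> j v else 0)"
      unfolding DR[OF v] by (intro sum.cong refl) (use v in \<open>auto simp: dp_zero_left\<close>)
    then show ?thesis using lam[OF v] by simp
  qed
  \<comment> \<open>Beyond the box of size Q + 1 the relations hold because all terms vanish:
    subtracting \<open>eps i\<close> lowers a coordinate by at most one, so an index beyond Q
    remains.\<close>
  have out: "R (\<alpha> + \<gamma> - eps i) k v = 0" "P (\<alpha> + \<gamma> - eps i) a v = 0" if ag: "\<alpha> \<notin> box ?R \<or> \<gamma> \<notin> box ?R"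
    for \<alpha> \<gamma> i k v a
  proof -
    obtain l where "\<not> \<alpha> l \<le> ?R \<or> \<not> \<gamma> l \<le> ?R" using ag unfolding box_iff by blast
    then have "\<not> (\<alpha> + \<gamma> - eps i) l \<le> Q" by (auto simp: eps_def)
    then have "\<alpha> + \<gamma> - eps i \<notin> box Q" unfolding box_iff by blast
    then show "R (\<alpha> + \<gamma> - eps i) k v = 0" "P (\<alpha> + \<gamma> - eps i) a v = 0" using R_out P_out by auto
  qed
  have outR: "R \<alpha> j v = 0" "P \<alpha> a v = 0" if "\<alpha> \<notin> box ?R" for \<alpha> j v a
  proof -
    have "\<alpha> \<notin> box Q" using that box_mono[of Q ?R] by auto
    then show "R \<alpha> j v = 0" "P \<alpha> a v = 0" using R_out P_out by auto
  qed
  have R00: "R \<alpha> j 0 = 0" "P \<alpha> a 0 = 0" for \<alpha> j a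
    using lin.app_0[OF linI[OF R_lin]] lin.app_0[OF linI[OF P_lin]] by auto
  have RRv: "R \<alpha> j (R \<gamma> k v) - R \<gamma> k (R \<alpha> j v)
    = (if \<alpha> = 0 then 0 else sc (of_nat (\<gamma> j)) (R (\<alpha> + \<gamma> - eps j) k v))
      - (if \<gamma> = 0 then 0 else sc (of_nat (\<alpha> k)) (R (\<alpha> + \<gamma> - eps k) j v))" (is "?l \<alpha> \<gamma> = ?r \<alpha> \<gamma>")
    if v: "v \<in> C" for \<alpha> \<gamma> j k v
  proof (cases "\<alpha> \<in> box ?R \<and> \<gamma> \<in> box ?R")
    case True
    have lr: "?l \<alpha> \<gamma> \<in> C" "?r \<alpha> \<gamma> \<in> C" for \<alpha> \<gamma> using v by auto
    have "?l \<alpha> \<gamma> - ?r \<alpha> \<gamma> = 0"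
    proof (rule gen_coeff_zero2[where y = "\<lambda>\<alpha> \<gamma>. ?l \<alpha> \<gamma> - ?r \<alpha> \<gamma>" and R = ?R])
      fix s m
      have "(\<Sum>\<alpha>\<in>box ?R. \<Sum>\<gamma>\<in>box ?R. sc (dp s \<alpha> * dp m \<gamma>) (?l \<alpha> \<gamma>)) = D j s (D k m v) - D k m (D j s v)"
        unfolding DR'[OF D.app_in[OF v]] unfolding DR'[OF v]
        by (rule gen_comm[OF R_lin R_lin v, symmetric])
      also have "\<dots> = (\<Sum>\<alpha>\<in>box ?R. \<Sum>\<gamma>\<in>box ?R. sc (dp s \<alpha> * dp m \<gamma>) (?r \<alpha> \<gamma>))"
        unfolding DD[OF v] unfolding DR'[OF v] by (rule gen_DD[where Q = Q]) (use v R_out in auto)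
      finally have eq: "(\<Sum>\<alpha>\<in>box ?R. \<Sum>\<gamma>\<in>box ?R. sc (dp s \<alpha> * dp m \<gamma>) (?l \<alpha> \<gamma>)) = \<dots>" .
      show "(\<Sum>\<alpha>\<in>box ?R. \<Sum>\<gamma>\<in>box ?R. sc (dp s \<alpha> * dp m \<gamma>) (?l \<alpha> \<gamma> - ?r \<alpha> \<gamma>)) = 0"
        unfolding sc_diff[OF lr] sum_subtractf eq by (rule diff_self)
    qed (use True v lr in auto)
    then show ?thesis by (simp only: right_minus_eq)
  qed (use v out outR R00 in auto)
  have RPv: "R \<alpha> j (P \<gamma> a v) - P \<gamma> a (R \<alpha> j v)
    = (if \<alpha> = 0 then 0 else sc (of_nat (\<gamma> j)) (P (\<alpha> + \<gamma> - eps j) a v))" (is "?l \<alpha> \<gamma> = ?r \<alpha> \<gamma>")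
    if v: "v \<in> C" for \<alpha> \<gamma> j a v
  proof (cases "\<alpha> \<in> box ?R \<and> \<gamma> \<in> box ?R")
    case True
    have lr: "?l \<alpha> \<gamma> \<in> C" "?r \<alpha> \<gamma> \<in> C" for \<alpha> \<gamma> using v by auto
    have "?l \<alpha> \<gamma> - ?r \<alpha> \<gamma> = 0"
    proof (rule gen_coeff_zero2[where y = "\<lambda>\<alpha> \<gamma>. ?l \<alpha> \<gamma> - ?r \<alpha> \<gamma>" and R = ?R])
      fix s m
      have "(\<Sum>\<alpha>\<in>box ?R. \<Sum>\<gamma>\<in>box ?R. sc (dp s \<alpha> * dp m \<gamma>) (?l \<alpha> \<gamma>)) = D j s (G m a v) - G m a (D j s v)"
        unfolding DR'[OF G.app_in[OF v]] GP'[OF D.app_in[OF v]] unfolding DR'[OF v] GP'[OF v]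
        by (rule gen_comm[OF R_lin P_lin v, symmetric])
      also have "\<dots> = (\<Sum>\<alpha>\<in>box ?R. \<Sum>\<gamma>\<in>box ?R. sc (dp s \<alpha> * dp m \<gamma>) (?r \<alpha> \<gamma>))"
        unfolding DG[OF v] unfolding GP'[OF v] by (rule gen_DG[where Q = Q]) (use v P_out in auto)
      finally have eq: "(\<Sum>\<alpha>\<in>box ?R. \<Sum>\<gamma>\<in>box ?R. sc (dp s \<alpha> * dp m \<gamma>) (?l \<alpha> \<gamma>)) = \<dots>" .
      show "(\<Sum>\<alpha>\<in>box ?R. \<Sum>\<gamma>\<in>box ?R. sc (dp s \<alpha> * dp m \<gamma>) (?l \<alpha> \<gamma> - ?r \<alpha> \<gamma>)) = 0"
        unfolding sc_diff[OF lr] sum_subtractf eq by (rule diff_self)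
    qed (use True v lr in auto)
    then show ?thesis by (simp only: right_minus_eq)
  qed (use v out outR R00 in auto)
  have PPv: "P \<alpha> a (P \<gamma> b v) - P \<gamma> b (P \<alpha> a v) = P (\<alpha> + \<gamma>) (lb a b) v" (is "?l \<alpha> \<gamma> = ?r \<alpha> \<gamma>")
    if v: "v \<in> C" for \<alpha> \<gamma> a b v
  proof (cases "\<alpha> \<in> box ?R \<and> \<gamma> \<in> box ?R")
    case True
    have lr: "?l \<alpha> \<gamma> \<in> C" "?r \<alpha> \<gamma> \<in> C" for \<alpha> \<gamma> using v by auto
    have "?l \<alpha> \<gamma> - ?r \<alpha> \<gamma> = 0"
    proof (rule gen_coeff_zero2[where y = "\<lambda>\<alpha> \<gamma>. ?l \<alpha> \<gamma> - ?r \<alpha> \<gamma>" and R = ?R])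
      fix s m
      have "(\<Sum>\<alpha>\<in>box ?R. \<Sum>\<gamma>\<in>box ?R. sc (dp s \<alpha> * dp m \<gamma>) (?l \<alpha> \<gamma>)) = G s a (G m b v) - G m b (G s a v)"
        unfolding GP'[OF G.app_in[OF v]] unfolding GP'[OF v]
        by (rule gen_comm[OF P_lin P_lin v, symmetric])
      also have "\<dots> = (\<Sum>\<alpha>\<in>box ?R. \<Sum>\<gamma>\<in>box ?R. sc (dp s \<alpha> * dp m \<gamma>) (?r \<alpha> \<gamma>))"
        unfolding GG[OF v] unfolding GP'[OF v] by (rule gen_add) (use v outR in auto)
      finally have eq: "(\<Sum>\<alpha>\<in>box ?R. \<Sum>\<gamma>\<in>box ?R. sc (dp s \<alpha> * dp m \<gamma>) (?l \<alpha> \<gamma>)) = \<dots>" .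
      show "(\<Sum>\<alpha>\<in>box ?R. \<Sum>\<gamma>\<in>box ?R. sc (dp s \<alpha> * dp m \<gamma>) (?l \<alpha> \<gamma> - ?r \<alpha> \<gamma>)) = 0"
        unfolding sc_diff[OF lr] sum_subtractf eq by (rule diff_self)
    qed (use True v lr in auto)
    then show ?thesis by (simp only: right_minus_eq)
  next
    case False
    then obtain l where "\<not> \<alpha> l \<le> ?R \<or> \<not> \<gamma> l \<le> ?R" unfolding box_iff by blast
    then have "\<not> (\<alpha> + \<gamma>) l \<le> Q" by auto
    then have "\<alpha> + \<gamma> \<notin> box Q" unfolding box_iff by blast
    then show ?thesis using False outR P_out R00 by auto
  qed
  \<comment> \<open>The value of \<open>uR\<close> at index 0 is the scalar \<open>lam j\<close>;
    that index lies outside W_n^+, and \<open>DU\<close> adds this scalar separately.\<close>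
  define U where "U = \<lparr>ucar = C, usc = sc, uR = R, uP = P\<rparr>"
  have "gplus_fdmod sg lb U"
    unfolding gplus_fdmod_def U_def
    using vs fd R_lin P_lin P_add P_sg RRv RPv PPv by simp
  moreover have "DU lam U j s v = D j s v" if v: "v \<in> C" for j s v
  proof -
    have "wsum sc {\<beta>. \<beta> \<noteq> 0} s (\<lambda>\<beta>. R \<beta> j v) = (\<Sum>\<beta>\<in>box Q. if \<beta> \<in> {\<beta>. \<beta> \<noteq> 0} then sc (dp s \<beta>) (R \<beta> j v) else 0)"
      by (rule wsum_box) (use v R_out in auto)
    also have "\<dots> = (\<Sum>\<beta>\<in>box Q - {0}. sc (dp s \<beta>) (R \<beta> j v))"
      by (rule sum.mono_neutral_cong_right) auto
    finally show ?thesis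
      unfolding DU_def DR[OF v] using v by (simp add: U_def sum.remove[of "box Q" 0] R0)
  qed
  moreover have "GU U s a v = G s a v" if v: "v \<in> C" for s a v
    unfolding GU_def GP[OF v] U_def using v P_out by (simp add: wsum_box[where Q = Q])
  ultimately show ?thesis by (intro exI[of _ U]) (auto simp: U_def)
qed

section \<open>Modules F \<otimes> C determined by operators on C\<close>

section \<open>Modules on \<open>\<F>(\<T>\<^sup>n) \<otimes> U\<close>\<close>

abbreviation "lkp \<equiv> Poly_Mapping.lookup"
abbreviation "sgl \<equiv> Poly_Mapping.single"

text \<open>The sum runs over the keys of w only, so positions with zero coefficient rely on f m 0 =
  0.\<close>

lemma lookup_tens_ext:
  fixes w :: "('n \<Rightarrow> int) \<Rightarrow>\<^sub>0 'u::ab_group_add" and f :: "('n \<Rightarrow> int) \<Rightarrow> 'u \<Rightarrow> 'v::ab_group_add"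
  assumes "\<And>m. f m 0 = 0"
  shows "lkp (\<Sum>m\<in>Poly_Mapping.keys w. sgl (m + s) (f m (lkp w m))) k = f (k - s) (lkp w (k - s))"
proof -
  have "lkp (\<Sum>m\<in>Poly_Mapping.keys w. sgl (m + s) (f m (lkp w m))) k
      = (\<Sum>m\<in>Poly_Mapping.keys w. if m = k - s then f m (lkp w m) else 0)"
    unfolding lookup_sum by (intro sum.cong refl) (auto simp: lookup_single when_def)
  also have "\<dots> = f (k - s) (lkp w (k - s))"
    by (auto simp: in_keys_iff assms)
  finally show ?thesis .
qed

lemma tens_carI: "(\<And>m. lkp w m \<in> C) \<Longrightarrow> w \<in> tens_car C"
  by (simp add: tens_car_def)

lemma tens_carD: "w \<in> tens_car C \<Longrightarrow> lkp w m \<in> C"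
  by (simp add: tens_car_def)

lemma tens_car_mono_iff: "0 \<in> C1 \<Longrightarrow> tens_car C1 \<subseteq> tens_car C2 \<longleftrightarrow> C1 \<subseteq> C2"
proof
  assume 0: "0 \<in> C1" and *: "tens_car C1 \<subseteq> (tens_car C2 :: (('n \<Rightarrow> int) \<Rightarrow>\<^sub>0 'a) set)"
  show "C1 \<subseteq> C2"
  proof
    fix v assume "v \<in> C1"
    then have "(sgl 0 v :: ('n \<Rightarrow> int) \<Rightarrow>\<^sub>0 'a) \<in> tens_car C1"
      using 0 by (auto intro!: tens_carI simp: lookup_single when_def)
    then have "lkp (sgl 0 v :: ('n \<Rightarrow> int) \<Rightarrow>\<^sub>0 'a) 0 \<in> C2" using * tens_carD by blast
    then show "v \<in> C2" by simp
  qed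
qed (auto simp: tens_car_def)

lemma tens_car_eq_iff: "0 \<in> C1 \<Longrightarrow> 0 \<in> C2 \<Longrightarrow> tens_car C1 = tens_car C2 \<longleftrightarrow> C1 = C2"
  using tens_car_mono_iff[of C1 C2] tens_car_mono_iff[of C2 C1] by (auto simp: set_eq_subset)

lemma tens_car_zero: "tens_car {0} = {0}"
  by (auto simp: tens_car_def intro: poly_mapping_eqI)

text \<open>A description by coefficients shared by \<open>PhiB\<close> and \<open>PhiC\<close>: the
  coefficient at e_k comes from e_m with m = k - s, which explains the factor k_j - s_j. The weight
  is part of \<open>D j s\<close>.\<close>

definition tensor_shape :: "('n, 'g, ('n \<Rightarrow> int) \<Rightarrow>\<^sub>0 'u::ab_group_add) Jmod \<Rightarrow> 'u set \<Rightarrow> (complex \<Rightarrow> 'u \<Rightarrow> 'u)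
    \<Rightarrow> ('n \<Rightarrow> ('n \<Rightarrow> int) \<Rightarrow> 'u \<Rightarrow> 'u) \<Rightarrow> (('n \<Rightarrow> int) \<Rightarrow> 'g \<Rightarrow> 'u \<Rightarrow> 'u) \<Rightarrow> bool" where
  "tensor_shape M C sc D G \<longleftrightarrow> jcar M = tens_car C \<and> (\<forall>w\<in>tens_car C.
      (\<forall>c k. lkp (jsc M c w) k = sc c (lkp w k))
    \<and> (\<forall>m k. lkp (jE M m w) k = lkp w (k - m))
    \<and> (\<forall>j s k. lkp (jD M j s w) k = sc (of_int (k j - s j)) (lkp w (k - s)) + D j s (lkp w (k - s)))
    \<and> (\<forall>s a k. lkp (jG M s a w) k = G s a (lkp w (k - s))))"

locale tensor_module = diff_system sg lb sc C D G
  for sg :: "complex \<Rightarrow> 'g::ab_group_add \<Rightarrow> 'g" and lb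
    and sc :: "complex \<Rightarrow> 'u::ab_group_add \<Rightarrow> 'u" and C
    and D :: "'n::finite \<Rightarrow> ('n \<Rightarrow> int) \<Rightarrow> 'u \<Rightarrow> 'u" and G +
  fixes M :: "('n, 'g, ('n \<Rightarrow> int) \<Rightarrow>\<^sub>0 'u) Jmod" and lam :: "'n \<Rightarrow> complex"
  assumes tm: "tensor_shape M C sc D G" and D_0: "\<And>j v. v \<in> C \<Longrightarrow> D j 0 v = sc (lam j) v"
begin

lemma car: "jcar M = tens_car C"
  using tm by (simp add: tensor_shape_def)

lemma mem_iff: "w \<in> jcar M \<longleftrightarrow> (\<forall>m. lkp w m \<in> C)"
  by (simp add: car tens_car_def)

lemma memD [simp]: "w \<in> jcar M \<Longrightarrow> lkp w m \<in> C"
  by (simp add: mem_iff)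

lemma lkp_simps:
  assumes "w \<in> jcar M"
  shows "lkp (jsc M c w) k = sc c (lkp w k)" "lkp (jE M m w) k = lkp w (k - m)"
    "lkp (jD M j s w) k = sc (of_int (k j - s j)) (lkp w (k - s)) + D j s (lkp w (k - s))"
    "lkp (jG M s a w) k = G s a (lkp w (k - s))"
  using tm assms unfolding tensor_shape_def by auto

lemma closed [simp]:
  assumes "w \<in> jcar M"
  shows "jsc M c w \<in> jcar M" "jE M m w \<in> jcar M" "jD M j s w \<in> jcar M" "jG M s a w \<in> jcar M"
  using assms by (simp_all add: mem_iff[of "_ M _ w"] mem_iff[of "_ M _ _ w"] lkp_simps[OF assms])

lemma sgl_in [simp]: "v \<in> C \<Longrightarrow> sgl m v \<in> jcar M"
  by (simp add: mem_iff lookup_single when_def)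

lemma vs_M: "vs_on (jsc M) (jcar M)"
proof -
  have plus: "x + y \<in> jcar M" if "x \<in> jcar M" "y \<in> jcar M" for x y
    using that by (simp add: mem_iff lookup_add)
  have zero: "0 \<in> jcar M" by (simp add: mem_iff)
  show ?thesis unfolding vs_on_def
    using plus zero by (auto intro!: poly_mapping_eqI simp: lkp_simps lookup_add sc_add sc_left)
qed

sublocale M: vsp "jsc M" "jcar M"
  by (simp add: vsp_def vs_M)

lemma action_sgl:
  assumes "v \<in> C"
  shows "jsc M c (sgl m v) = sgl m (sc c v)" "jE M k (sgl m v) = sgl (m + k) v"
    "jD M j s (sgl m v) = sgl (m + s) (sc (of_int (m j)) v + D j s v)"
    "jG M s a (sgl m v) = sgl (m + s) (G s a v)"
  using assms by (auto intro!: poly_mapping_eqI simp: lkp_simps lookup_single when_def algebra_simps)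

lemma jD_lin: "lin_on (jsc M) (jcar M) (jD M j s)"
  unfolding lin_on_def
  by (auto intro!: poly_mapping_eqI simp: lkp_simps lookup_add D.app_add D.app_sc sc_add mult.commute algebra_simps)

lemma span_sgl:
  assumes N: "subsp (jsc M) (jcar M) N" and w: "\<And>m. sgl m (lkp w m) \<in> N"
  shows "w \<in> N"
proof -
  interpret N: vsp "jsc M" N using subsp_vsp[OF M.vsp_axioms N] .
  have "(\<Sum>m\<in>Poly_Mapping.keys w. sgl m (lkp w m)) \<in> N" by (rule N.sum_in) (rule w)
  then show ?thesis using poly_mapping_sum_single[of w] by simp
qed

lemma diag: "diagonalizable (jsc M) (jcar M) (jD M j 0)"
  unfolding diagonalizable_def
proof
  fix w assume w: "w \<in> jcar M"
  let ?E = "{v \<in> jcar M. \<exists>c. jD M j 0 v = jsc M c v}"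
  have sub: "subsp (jsc M) (jcar M) (span_fam (jsc M) id ?E)"
    by (rule M.span_fam_subsp) auto
  show "w \<in> span_fam (jsc M) id ?E"
  proof (rule span_sgl[OF sub])
    fix m
    have "sgl m (lkp w m) \<in> ?E"
      using w D_0 by (auto simp: action_sgl sc_left[symmetric] intro!: exI[of _ "of_int (m j) + lam j"])
    then show "sgl m (lkp w m) \<in> span_fam (jsc M) id ?E"
      using M.span_fam_base[of "sgl m (lkp w m)" ?E id] by simp
  qed
qed

lemma free: "\<exists>k v. free_basis M k v"
proof -
  obtain d and b :: "nat \<Rightarrow> 'u" where b: "\<And>i. i < d \<Longrightarrow> b i \<in> C" "indep_fam sc b {..<d}" "C \<subseteq> span_fam sc b {..<d}"
    by (rule fin_dim_basis[OF fd], rule that) simp_all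
  let ?v = "\<lambda>r. sgl 0 (b r) :: ('n \<Rightarrow> int) \<Rightarrow>\<^sub>0 'u"
  let ?f = "\<lambda>(m, r). jE M m (?v r)"
  have f: "?f (m, r) = sgl m (b r)" if "r < d" for m r
    using b(1)[OF that] by (simp add: action_sgl)
  have sub: "subsp (jsc M) (jcar M) (span_fam (jsc M) ?f (UNIV \<times> {..<d}))"
    by (rule M.span_fam_subsp) (use b in auto)
  interpret S: vsp "jsc M" "span_fam (jsc M) ?f (UNIV \<times> {..<d})"
    using subsp_vsp[OF M.vsp_axioms sub] .
  have "free_basis M d ?v"
    unfolding free_basis_def
  proof (intro conjI)
    show "\<forall>r<d. ?v r \<in> jcar M" using b by simp
    show "indep_fam (jsc M) ?f (UNIV \<times> {..<d})"
      unfolding indep_fam_def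
    proof (intro allI impI ballI)
      fix A c and p :: "('n \<Rightarrow> int) \<times> nat"
      assume A: "finite A \<and> A \<subseteq> UNIV \<times> {..<d} \<and> (\<Sum>p\<in>A. jsc M (c p) (?f p)) = 0" and p: "p \<in> A"
      obtain m0 r0 where p_eq: "p = (m0, r0)" by force
      \<comment> \<open>Independence is tested in the coefficient at e_m0, which involves only the
        pairs with first component m0.\<close>
      define B where "B = snd ` {q\<in>A. fst q = m0}"
      have "0 = lkp (\<Sum>p\<in>A. jsc M (c p) (?f p)) m0" using A by simp
      also have "\<dots> = (\<Sum>p\<in>A. if fst p = m0 then sc (c p) (b (snd p)) else 0)"
        unfolding lookup_sum using A b
        by (intro sum.cong refl) (force simp: f action_sgl lookup_single when_def)
      also have "\<dots> = (\<Sum>p\<in>{q\<in>A. fst q = m0}. sc (c p) (b (snd p)))"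
        using A by (intro sum.inter_filter[symmetric]) simp
      also have "\<dots> = (\<Sum>r\<in>B. sc (c (m0, r)) (b r))"
        unfolding B_def by (subst sum.reindex) (auto simp: inj_on_def prod_eq_iff intro!: sum.cong)
      finally have "(\<Sum>r\<in>B. sc (c (m0, r)) (b r)) = 0" ..
      moreover have "finite B" "B \<subseteq> {..<d}" "r0 \<in> B" using A p p_eq by (force simp: B_def)+
      ultimately have "c (m0, r0) = 0"
        using b(2)[unfolded indep_fam_def, THEN spec, THEN spec, of B "\<lambda>r. c (m0, r)"] by blast
      then show "c p = 0" by (simp add: p_eq)
    qed
    show "jcar M \<subseteq> span_fam (jsc M) ?f (UNIV \<times> {..<d})"
    proof
      fix w assume w: "w \<in> jcar M"
      show "w \<in> span_fam (jsc M) ?f (UNIV \<times> {..<d})"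
      proof (rule span_sgl[OF sub])
        fix m
        obtain c where c: "lkp w m = (\<Sum>r<d. sc (c r) (b r))"
          using span_fam_finite[of "{..<d}" b "lkp w m"] b memD[OF w, of m] by auto
        have "sgl m (lkp w m) = (\<Sum>r<d. sgl m (sc (c r) (b r)))"
          unfolding c by (rule poly_mapping_eqI) (simp add: lookup_sum lookup_single when_def)
        also have "\<dots> = (\<Sum>r<d. jsc M (c r) (?f (m, r)))"
          using b by (intro sum.cong refl) (simp add: action_sgl)
        also have "\<dots> \<in> span_fam (jsc M) ?f (UNIV \<times> {..<d})"
          using M.span_fam_base[of _ "UNIV \<times> {..<d}" ?f] b by (intro S.sum_in S.sc_in) (auto simp: f)
        finally show "sgl m (lkp w m) \<in> span_fam (jsc M) ?f (UNIV \<times> {..<d})" .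
      qed
    qed
  qed
  then show ?thesis by blast
qed

lemma bracket_M:
  assumes w: "w \<in> jcar M"
  shows "jD M j s (jD M k m w) - jD M k m (jD M j s w)
    = jsc M (of_int (m j)) (jD M k (s + m) w) - jsc M (of_int (s k)) (jD M j (s + m) w)"
proof (rule poly_mapping_eqI)
  fix l
  define u where "u = lkp w (l - (s + m))"
  have u: "u \<in> C" using w by (simp add: u_def)
  have idx: "l - s - m = l - (s + m)" "l - m - s = l - (s + m)" by (simp_all add: algebra_simps)
  let ?A = "D j s" and ?B = "D k m" and ?c = "\<lambda>z::int. complex_of_int z"
  have "lkp (jD M j s (jD M k m w) - jD M k m (jD M j s w)) l
      = (sc (?c (l j - s j)) (sc (?c (l k - s k - m k)) u + ?B u) + ?A (sc (?c (l k - s k - m k)) u + ?B u))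
        - (sc (?c (l k - m k)) (sc (?c (l j - m j - s j)) u + ?A u) + ?B (sc (?c (l j - m j - s j)) u + ?A u))"
    using w by (simp add: lookup_minus lkp_simps idx u_def[symmetric])
  also have "\<dots> = sc (?c (l j - s j) * ?c (l k - s k - m k) - ?c (l k - m k) * ?c (l j - m j - s j)) u
      + sc (?c (m j)) (?B u) - sc (?c (s k)) (?A u) + (?A (?B u) - ?B (?A u))"
    using u by (simp add: D.app_simps sc_distribs algebra_simps)
  \<comment> \<open>The terms \<open>D k m\<close> and \<open>D j s\<close> subtracted in
    \<open>DD\<close> cancel against the mixed terms of weight factors and operators.\<close>
  also have "\<dots> = sc (?c (m j) * ?c (l k - s k - m k) - ?c (s k) * ?c (l j - s j - m j)) u
      + sc (?c (m j)) (D k (s + m) u) - sc (?c (s k)) (D j (s + m) u)"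
    unfolding DD[OF u] using u by (simp add: sc_distribs algebra_simps)
  also have "\<dots> = sc (?c (m j)) (sc (?c (l k - (s k + m k))) u + D k (s + m) u)
      - sc (?c (s k)) (sc (?c (l j - (s j + m j))) u + D j (s + m) u)"
    using u by (simp add: sc_distribs algebra_simps)
  also have "\<dots> = lkp (jsc M (of_int (m j)) (jD M k (s + m) w) - jsc M (of_int (s k)) (jD M j (s + m) w)) l"
    using w u by (simp add: lookup_minus lkp_simps u_def[symmetric] del: of_int_diff)
  finally show "lkp (jD M j s (jD M k m w) - jD M k m (jD M j s w)) l
    = lkp (jsc M (of_int (m j)) (jD M k (s + m) w) - jsc M (of_int (s k)) (jD M j (s + m) w)) l" .
qed

lemma bracket_MG:
  assumes w: "w \<in> jcar M"
  shows "jD M j s (jG M m a w) - jG M m a (jD M j s w) = jsc M (of_int (m j)) (jG M (s + m) a w)"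
proof (rule poly_mapping_eqI)
  fix l
  define u where "u = lkp w (l - (s + m))"
  have u: "u \<in> C" using w by (simp add: u_def)
  have idx: "l - s - m = l - (s + m)" "l - m - s = l - (s + m)" by (simp_all add: algebra_simps)
  let ?c = "\<lambda>z::int. complex_of_int z"
  have "lkp (jD M j s (jG M m a w) - jG M m a (jD M j s w)) l
      = (sc (?c (l j - s j)) (G m a u) + D j s (G m a u)) - G m a (sc (?c (l j - m j - s j)) u + D j s u)"
    using w by (simp add: lookup_minus lkp_simps idx u_def[symmetric])
  also have "\<dots> = sc (?c (m j)) (G m a u) + (D j s (G m a u) - G m a (D j s u))"
    using u by (simp add: G.app_simps sc_distribs algebra_simps)
  also have "\<dots> = sc (?c (m j)) (G (s + m) a u)"
    unfolding DG[OF u] using u by (simp add: sc_distribs algebra_simps)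
  also have "\<dots> = lkp (jsc M (of_int (m j)) (jG M (s + m) a w)) l"
    using w by (simp add: lkp_simps u_def[symmetric])
  finally show "lkp (jD M j s (jG M m a w) - jG M m a (jD M j s w)) l
    = lkp (jsc M (of_int (m j)) (jG M (s + m) a w)) l" .
qed

lemma catJ: "catJ sg lb M"
  unfolding catJ_def
proof (intro conjI allI ballI)
  show "lin_on (jsc M) (jcar M) (jE M m)" for m
    unfolding lin_on_def by (auto intro!: poly_mapping_eqI simp: lkp_simps lookup_add)
  show "lin_on (jsc M) (jcar M) (jG M s a)" for s a
    unfolding lin_on_def by (auto intro!: poly_mapping_eqI simp: lkp_simps lookup_add G.app_add G.app_sc)
  fix w assume w: "w \<in> jcar M"
  show "jE M 0 w = w" using w by (auto intro!: poly_mapping_eqI simp: lkp_simps)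
  show "jE M m (jE M k w) = jE M (m + k) w" for m k
    using w by (auto intro!: poly_mapping_eqI simp: lkp_simps diff_diff_eq)
  show "jG M s (a + b) w = jG M s a w + jG M s b w" for s a b
    using w by (auto intro!: poly_mapping_eqI simp: lkp_simps lookup_add G_add)
  show "jG M s (sg c a) w = jsc M c (jG M s a w)" for s c a
    using w by (auto intro!: poly_mapping_eqI simp: lkp_simps G_sg)
  show "jG M s a (jG M m b w) - jG M m b (jG M s a w) = jG M (s + m) (lb a b) w" for s m a b
  proof -
    have idx: "l - s - m = l - (s + m)" "l - m - s = l - (s + m)" for l by (simp_all add: algebra_simps)
    show ?thesis using w by (auto intro!: poly_mapping_eqI simp: lkp_simps lookup_minus idx GG)
  qed
  show "jD M j s (jE M m w) = jsc M (of_int (m j)) (jE M (m + s) w) + jE M m (jD M j s w)" for j s m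
  proof (rule poly_mapping_eqI)
    fix l
    have idx: "l - s - m = l - (m + s)" "l - m - s = l - (m + s)" by (simp_all add: algebra_simps)
    show "lkp (jD M j s (jE M m w)) l = lkp (jsc M (of_int (m j)) (jE M (m + s) w) + jE M m (jD M j s w)) l"
      using w by (simp add: lkp_simps lookup_add idx sc_left sc_diff_left algebra_simps)
  qed
  show "jG M s a (jE M m w) = jE M m (jG M s a w)" for s a m
  proof -
    have idx: "l - s - m = l - m - s" for l by (simp add: algebra_simps)
    show ?thesis using w by (auto intro!: poly_mapping_eqI simp: lkp_simps idx)
  qed
qed (simp_all add: vs_M jD_lin bracket_M bracket_MG diag free)

definition inv_sub :: "'u set \<Rightarrow> bool" where
  "inv_sub N \<longleftrightarrow> subsp sc C N \<and> (\<forall>j s. \<forall>v\<in>N. D j s v \<in> N) \<and> (\<forall>s a. \<forall>v\<in>N. G s a v \<in> N)"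

lemma inv_sub_0: "inv_sub N \<Longrightarrow> 0 \<in> N"
  by (simp add: inv_sub_def subsp_def)

lemma Jsub_tens: assumes N: "inv_sub N" shows "Jsub M (tens_car N)"
proof -
  have sub: "subsp sc C N" using N by (simp add: inv_sub_def)
  interpret N: vsp sc N using subsp_vsp[OF vsp_axioms sub] .
  have NC: "N \<subseteq> C" using sub by (simp add: subsp_def)
  have car': "w \<in> jcar M" if "w \<in> tens_car N" for w using that NC by (auto simp: mem_iff tens_car_def)
  have DN: "v \<in> N \<Longrightarrow> D j s v \<in> N" "v \<in> N \<Longrightarrow> G s a v \<in> N" for j s a v
    using N by (auto simp: inv_sub_def)
  show ?thesis
    unfolding Jsub_def subsp_def
    using car' DN by (auto intro!: tens_carI simp: lookup_add lkp_simps tens_carD subset_iff)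
qed

text \<open>The operators d_j(0) have weight m + lam on e_m \<otimes> C, and these weights differ
  for different m, so a submodule contains the homogeneous components of its elements.\<close>

lemma Jsub_components:
  assumes N: "Jsub M N" and w: "w \<in> N"
  shows "sgl m (lkp w m) \<in> N"
proof (cases "m \<in> Poly_Mapping.keys w")
  case True
  have sub: "subsp (jsc M) (jcar M) N" using N by (simp add: Jsub_def)
  have wM: "w \<in> jcar M" using sub w by (auto simp: subsp_def)
  \<comment> \<open>\<open>weight_components\<close> is indexed by weights; this injection
    translates degrees into weights.\<close>
  define g where "g m = (\<lambda>j. of_int (m j) + lam j)" for m :: "'n \<Rightarrow> int"
  have inj: "inj_on g A" for A by (auto simp: g_def inj_on_def fun_eq_iff)
  define x where "x \<mu> = (let m = the_inv_into UNIV g \<mu> in sgl m (lkp w m))" for \<mu>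
  have x: "x (g m) = sgl m (lkp w m)" for m
    by (simp add: x_def the_inv_into_f_f[OF inj])
  have "x (g m) \<in> N"
  proof (rule M.weight_components[where T = "\<lambda>j. jD M j 0" and A = "g ` Poly_Mapping.keys w", OF jD_lin sub])
    show "jD M j 0 y \<in> N" if "y \<in> N" for j y using N that by (auto simp: Jsub_def)
    show "x \<mu> \<in> jcar M" if "\<mu> \<in> g ` Poly_Mapping.keys w" for \<mu> using that wM by (auto simp: x)
    show "jD M j 0 (x \<mu>) = jsc M (\<mu> j) (x \<mu>)" if "\<mu> \<in> g ` Poly_Mapping.keys w" for \<mu> j
    proof -
      obtain m' where m': "\<mu> = g m'" using \<open>\<mu> \<in> g ` Poly_Mapping.keys w\<close> by blast
      have "g m' j = of_int (m' j) + lam j" by (simp add: g_def)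
      then show ?thesis using wM unfolding m' by (simp add: x action_sgl D_0 sc_left)
    qed
    show "sum x (g ` Poly_Mapping.keys w) \<in> N"
      using w poly_mapping_sum_single[of w] by (simp add: sum.reindex[OF inj] x o_def)
  qed (use True in auto)
  then show ?thesis by (simp add: x)
next
  case False
  then show ?thesis using N by (simp add: in_keys_iff Jsub_def subsp_def)
qed

text \<open>Multiplication by e_m identifies all homogeneous slices of a submodule, so the slice in
  degree 0 determines it.\<close>

lemma Jsub_ex:
  assumes N: "Jsub M N"
  obtains N0 where "inv_sub N0" "N = tens_car N0"
proof
  define N0 where "N0 = {v\<in>C. sgl 0 v \<in> N}"
  have sub: "subsp (jsc M) (jcar M) N" using N by (simp add: Jsub_def)
  interpret N: vsp "jsc M" N using subsp_vsp[OF M.vsp_axioms sub] .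
  have E: "jE M m w \<in> N" and DN: "jD M j s w \<in> N" and GN: "jG M s a w \<in> N" if "w \<in> N" for m j s a w
    using N that by (auto simp: Jsub_def)
  have shift: "sgl m v \<in> N \<longleftrightarrow> v \<in> N0" if v: "v \<in> C" for m v
  proof
    assume "sgl m v \<in> N"
    from E[OF this, of "-m"] show "v \<in> N0" using v by (simp add: action_sgl N0_def)
  next
    assume "v \<in> N0"
    then have "sgl 0 v \<in> N" by (simp add: N0_def)
    from E[OF this, of m] show "sgl m v \<in> N" using v by (simp add: action_sgl)
  qed
  show "inv_sub N0"
    unfolding inv_sub_def subsp_def
  proof (intro conjI allI ballI)
    show "N0 \<subseteq> C" by (auto simp: N0_def)
    show "0 \<in> N0" by (simp add: N0_def)
    show "x + y \<in> N0" if "x \<in> N0" "y \<in> N0" for x y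
      using that N.add_in by (simp add: N0_def single_add)
    show "sc c x \<in> N0" if "x \<in> N0" for c x
      using that N.sc_in[of "sgl 0 x" c] by (simp add: N0_def action_sgl)
    fix v s assume v: "v \<in> N0"
    then have vC: "v \<in> C" and vN: "sgl 0 v \<in> N" by (auto simp: N0_def)
    show "D j s v \<in> N0" for j
      using DN[OF vN, of j s] vC shift[of "D j s v" s] by (simp add: action_sgl)
    show "G s a v \<in> N0" for a
      using GN[OF vN, of s a] vC shift[of "G s a v" s] by (simp add: action_sgl)
  qed
  show "N = tens_car N0"
  proof
    show "N \<subseteq> tens_car N0"
    proof
      fix w assume w: "w \<in> N"
      then have "w \<in> jcar M" using sub by (auto simp: subsp_def)
      then show "w \<in> tens_car N0" using Jsub_components[OF N w] shift by (intro tens_carI) simp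
    qed
    show "tens_car N0 \<subseteq> N"
    proof
      fix w :: "('n \<Rightarrow> int) \<Rightarrow>\<^sub>0 'u" assume w: "w \<in> tens_car N0"
      show "w \<in> N"
      proof (rule span_sgl[OF sub])
        fix m
        have "lkp w m \<in> N0" using w by (rule tens_carD)
        moreover from this have "lkp w m \<in> C" by (simp add: N0_def)
        ultimately show "sgl m (lkp w m) \<in> N" using shift by blast
      qed
    qed
  qed
qed

lemma Jirred_iff: "Jirred M \<longleftrightarrow> C \<noteq> {0} \<and> (\<forall>N. inv_sub N \<longrightarrow> N = {0} \<or> N = C)"
proof -
  have nz: "jcar M \<noteq> {0} \<longleftrightarrow> C \<noteq> {0}"
    unfolding car tens_car_zero[symmetric] by (subst tens_car_eq_iff) auto
  have eq: "tens_car N = ({0} :: (('n \<Rightarrow> int) \<Rightarrow>\<^sub>0 'u) set) \<longleftrightarrow> N = {0}" "tens_car N = jcar M \<longleftrightarrow> N = C" if "inv_sub N" for N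
  proof -
    show "tens_car N = ({0} :: (('n \<Rightarrow> int) \<Rightarrow>\<^sub>0 'u) set) \<longleftrightarrow> N = {0}"
      unfolding tens_car_zero[symmetric] by (rule tens_car_eq_iff) (simp_all add: inv_sub_0[OF that])
    show "tens_car N = jcar M \<longleftrightarrow> N = C"
      unfolding car by (rule tens_car_eq_iff) (simp_all add: inv_sub_0[OF that])
  qed
  show ?thesis
  proof
    assume J: "Jirred M"
    show "C \<noteq> {0} \<and> (\<forall>N. inv_sub N \<longrightarrow> N = {0} \<or> N = C)"
    proof (intro conjI allI impI)
      show "C \<noteq> {0}" using J nz by (simp add: Jirred_def)
      fix N assume N: "inv_sub N"
      have "tens_car N = ({0} :: (('n \<Rightarrow> int) \<Rightarrow>\<^sub>0 'u) set) \<or> tens_car N = jcar M"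
        using J Jsub_tens[OF N] by (simp add: Jirred_def)
      then show "N = {0} \<or> N = C" by (simp only: eq[OF N])
    qed
  next
    assume R: "C \<noteq> {0} \<and> (\<forall>N. inv_sub N \<longrightarrow> N = {0} \<or> N = C)"
    show "Jirred M" unfolding Jirred_def
    proof (intro conjI allI impI)
      fix N assume "Jsub M N"
      then obtain N0 where N0: "inv_sub N0" "N = tens_car N0" by (rule Jsub_ex)
      have "N0 = {0} \<or> N0 = C" using R N0(1) by simp
      then show "N = {0} \<or> N = jcar M" unfolding N0(2) by (simp only: eq[OF N0(1)])
    next
      show "jcar M \<noteq> {0}" using R nz by simp
    qed
  qed
qed

lemma tens_decomp:
  assumes "inv_sub N1" "inv_sub N2"
  shows "(\<forall>w\<in>jcar M. \<exists>x\<in>tens_car N1. \<exists>y\<in>tens_car N2. w = x + y) \<longleftrightarrow> (\<forall>v\<in>C. \<exists>x\<in>N1. \<exists>y\<in>N2. v = x + y)"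
proof (intro iffI ballI)
  fix v assume L: "\<forall>w\<in>jcar M. \<exists>x\<in>tens_car N1. \<exists>y\<in>tens_car N2. w = x + y" and v: "v \<in> C"
  then obtain x y :: "('n \<Rightarrow> int) \<Rightarrow>\<^sub>0 'u" where xy: "x \<in> tens_car N1" "y \<in> tens_car N2" "sgl 0 v = x + y"
    using sgl_in[OF v, of 0] by blast
  have "v = lkp x 0 + lkp y 0"
    using arg_cong[OF xy(3), of "\<lambda>f. lkp f 0"] by (simp add: lookup_add)
  then show "\<exists>x\<in>N1. \<exists>y\<in>N2. v = x + y" using xy tens_carD by blast
next
  fix w assume R: "\<forall>v\<in>C. \<exists>x\<in>N1. \<exists>y\<in>N2. v = x + y" and w: "w \<in> jcar M"
  have "\<forall>m. \<exists>p. fst p \<in> N1 \<and> snd p \<in> N2 \<and> lkp w m = fst p + snd p"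
  proof (intro allI)
    fix m
    obtain x y where "x \<in> N1" "y \<in> N2" "lkp w m = x + y" using R memD[OF w] by blast
    then show "\<exists>p. fst p \<in> N1 \<and> snd p \<in> N2 \<and> lkp w m = fst p + snd p"
      by (intro exI[of _ "(x, y)"]) simp
  qed
  from choice[OF this] obtain p where p: "\<And>m. fst (p m) \<in> N1" "\<And>m. snd (p m) \<in> N2"
      "\<And>m. lkp w m = fst (p m) + snd (p m)" by blast
  \<comment> \<open>Restricting to the keys of w keeps both parts finitely supported; the choice p
    may be nonzero elsewhere.\<close>
  let ?x = "\<Sum>m\<in>Poly_Mapping.keys w. sgl m (fst (p m))"
  let ?y = "\<Sum>m\<in>Poly_Mapping.keys w. sgl m (snd (p m))"
  have "w = (\<Sum>m\<in>Poly_Mapping.keys w. sgl m (lkp w m))" by (rule poly_mapping_sum_single)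
  also have "\<dots> = ?x + ?y" by (simp add: p(3) single_add sum.distrib)
  finally have eq: "w = ?x + ?y" .
  have mem: "(\<Sum>m\<in>A. sgl m (q m)) \<in> tens_car N" if N: "inv_sub N" and q: "\<And>m. q m \<in> N" for q N and A :: "('n \<Rightarrow> int) set"
  proof (rule tens_carI)
    fix k
    interpret N: vsp sc N using N subsp_vsp[OF vsp_axioms] by (simp add: inv_sub_def)
    show "lkp (\<Sum>m\<in>A. sgl m (q m)) k \<in> N"
      unfolding lookup_sum by (rule N.sum_in) (auto simp: lookup_single when_def q)
  qed
  show "\<exists>x\<in>tens_car N1. \<exists>y\<in>tens_car N2. w = x + y"
    using eq mem[OF assms(1), of "\<lambda>m. fst (p m)"] mem[OF assms(2), of "\<lambda>m. snd (p m)"] p(1,2) by blast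
qed

text \<open>The bijection N to F \<otimes> N onto the submodules respects zero, intersections and
  sums, so direct decompositions correspond.\<close>

lemma Jindec_iff: "Jindec M \<longleftrightarrow> C \<noteq> {0} \<and> \<not> (\<exists>N1 N2. inv_sub N1 \<and> inv_sub N2 \<and> N1 \<noteq> {0} \<and> N2 \<noteq> {0}
      \<and> N1 \<inter> N2 = {0} \<and> (\<forall>w\<in>C. \<exists>x\<in>N1. \<exists>y\<in>N2. w = x + y))"
proof -
  have nz: "jcar M \<noteq> {0} \<longleftrightarrow> C \<noteq> {0}"
    unfolding car tens_car_zero[symmetric] by (subst tens_car_eq_iff) auto
  have eq: "(tens_car N :: (('n \<Rightarrow> int) \<Rightarrow>\<^sub>0 'u) set) = {0} \<longleftrightarrow> N = {0}" if "0 \<in> N" for N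
    unfolding tens_car_zero[symmetric] by (rule tens_car_eq_iff) (simp_all add: that)
  have int: "tens_car N1 \<inter> tens_car N2 = (tens_car (N1 \<inter> N2) :: (('n \<Rightarrow> int) \<Rightarrow>\<^sub>0 'u) set)" for N1 N2
    by (auto simp: tens_car_def)
  let ?t = "tens_car :: 'u set \<Rightarrow> (('n \<Rightarrow> int) \<Rightarrow>\<^sub>0 'u) set"
  have conv: "(?t N1 \<noteq> {0} \<and> ?t N2 \<noteq> {0} \<and> ?t N1 \<inter> ?t N2 = {0}
      \<and> (\<forall>w\<in>jcar M. \<exists>x\<in>?t N1. \<exists>y\<in>?t N2. w = x + y))
    \<longleftrightarrow> (N1 \<noteq> {0} \<and> N2 \<noteq> {0} \<and> N1 \<inter> N2 = {0} \<and> (\<forall>w\<in>C. \<exists>x\<in>N1. \<exists>y\<in>N2. w = x + y))"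
    if N: "inv_sub N1" "inv_sub N2" for N1 N2
    unfolding tens_decomp[OF N] int using inv_sub_0[OF N(1)] inv_sub_0[OF N(2)] by (simp add: eq)
  have "(\<exists>N1 N2. Jsub M N1 \<and> Jsub M N2 \<and> N1 \<noteq> {0} \<and> N2 \<noteq> {0} \<and> N1 \<inter> N2 = {0}
        \<and> (\<forall>w\<in>jcar M. \<exists>x\<in>N1. \<exists>y\<in>N2. w = x + y))
    \<longleftrightarrow> (\<exists>N1 N2. inv_sub N1 \<and> inv_sub N2 \<and> N1 \<noteq> {0} \<and> N2 \<noteq> {0} \<and> N1 \<inter> N2 = {0}
        \<and> (\<forall>w\<in>C. \<exists>x\<in>N1. \<exists>y\<in>N2. w = x + y))" (is "?L \<longleftrightarrow> ?R")
  proof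
    assume ?L
    then obtain N1 N2 where N: "Jsub M N1" "Jsub M N2" and rest: "N1 \<noteq> {0} \<and> N2 \<noteq> {0} \<and> N1 \<inter> N2 = {0}
        \<and> (\<forall>w\<in>jcar M. \<exists>x\<in>N1. \<exists>y\<in>N2. w = x + y)" by blast
    obtain K1 where K1: "inv_sub K1" "N1 = tens_car K1" using N(1) by (rule Jsub_ex)
    obtain K2 where K2: "inv_sub K2" "N2 = tens_car K2" using N(2) by (rule Jsub_ex)
    show ?R using rest[unfolded K1(2) K2(2) conv[OF K1(1) K2(1)]] K1(1) K2(1) by blast
  next
    assume ?R
    then obtain N1 N2 where N: "inv_sub N1" "inv_sub N2" and rest: "N1 \<noteq> {0} \<and> N2 \<noteq> {0} \<and> N1 \<inter> N2 = {0}
        \<and> (\<forall>w\<in>C. \<exists>x\<in>N1. \<exists>y\<in>N2. w = x + y)" by blast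
    show ?L using rest[folded conv[OF N]] Jsub_tens[OF N(1)] Jsub_tens[OF N(2)] by blast
  qed
  then show ?thesis unfolding Jindec_def nz by simp
qed

end

lemma (in gplus_module) tensor_shape_PhiB: "tensor_shape (PhiB lam U) C sc (DU lam U) (GU U)"
proof -
  \<comment> \<open>\<open>lookup_tens_ext\<close> asks for maps that fix 0, which for these series
    follows from the linearity of \<open>DU\<close> and \<open>GU\<close>.\<close>
  have D0: "sc (of_int (m j) + lam j) 0 + wsum sc {\<beta>. \<beta> \<noteq> 0} s (\<lambda>\<beta>. uR U \<beta> j 0) = 0" for m j and s :: "'n \<Rightarrow> int"
    using lin.app_0[OF linI[OF DU_lin], of lam j s] by (simp add: DU_def)
  have G0: "wsum sc UNIV s (\<lambda>\<beta>. uP U \<beta> g 0) = 0" for g and s :: "'n \<Rightarrow> int"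
    using lin.app_0[OF linI[OF GU_lin], of s g] by (simp add: GU_def)
  show ?thesis
    unfolding tensor_shape_def
  proof (intro conjI ballI allI)
    fix w :: "('n \<Rightarrow> int) \<Rightarrow>\<^sub>0 'u" assume w: "w \<in> tens_car C"
    fix k
    show "lkp (jsc (PhiB lam U) c w) k = sc c (lkp w k)" for c
      using lookup_tens_ext[where f = "\<lambda>m v. sc c v" and w = w and s = 0 and k = k] by (simp add: PhiB_def tens_ext_def)
    show "lkp (jE (PhiB lam U) m w) k = lkp w (k - m)" for m
      using lookup_tens_ext[where f = "\<lambda>m v. v" and w = w and s = m and k = k] by (simp add: PhiB_def tens_ext_def)
    show "lkp (jD (PhiB lam U) j s w) k = sc (of_int (k j - s j)) (lkp w (k - s)) + DU lam U j s (lkp w (k - s))" for j s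
      using lookup_tens_ext[where f = "\<lambda>m v. sc (of_int (m j) + lam j) v + wsum sc {\<beta>. \<beta> \<noteq> 0} s (\<lambda>\<beta>. uR U \<beta> j v)" and w = w and s = s and k = k]
        D0 tens_carD[OF w] by (simp add: PhiB_def tens_ext_def DU_def sc_left add.assoc)
    show "lkp (jG (PhiB lam U) s a w) k = GU U s a (lkp w (k - s))" for s a
      using lookup_tens_ext[where f = "\<lambda>m v. wsum sc UNIV s (\<lambda>\<beta>. uP U \<beta> a v)" and w = w and s = s and k = k] G0
      by (simp add: PhiB_def tens_ext_def GU_def)
  qed (simp add: PhiB_def)
qed

lemma (in gplus_module) tensor_moduleI: "tensor_shape M C sc (DU lam U) (GU U) \<Longrightarrow> tensor_module sg lb sc C (DU lam U) (GU U) M lam"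
  by (simp add: tensor_module_def diff_system tensor_module_axioms_def DU_0)

lemma (in gplus_module) finite_nonzero_terms:
  assumes v: "v \<in> C"
  shows "finite {\<beta>. \<beta> \<noteq> 0 \<and> sc (mpow s \<beta> / mfact \<beta>) (uR U \<beta> j v) \<noteq> 0}"
    "finite {\<beta>. sc (mpow s \<beta> / mfact \<beta>) (uP U \<beta> g v) \<noteq> 0}"
proof -
  show "finite {\<beta>. \<beta> \<noteq> 0 \<and> sc (mpow s \<beta> / mfact \<beta>) (uR U \<beta> j v) \<noteq> 0}"
    by (rule finite_subset[OF _ finite_box[of supp]]) (use supp(1)[OF v] in force)
  show "finite {\<beta>. sc (mpow s \<beta> / mfact \<beta>) (uP U \<beta> g v) \<noteq> 0}"
    by (rule finite_subset[OF _ finite_box[of supp]]) (use supp(2)[OF v] in force)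
qed

lemma (in gplus_module) Jindec_iff_Pindec:
  assumes "tensor_shape M C sc (DU lam U) (GU U)" shows "Jindec M \<longleftrightarrow> Pindec U"
proof -
  interpret M: tensor_module sg lb sc C "DU lam U" "GU U" M lam using tensor_moduleI[OF assms] .
  have "M.inv_sub N \<longleftrightarrow> Psub U N" for N unfolding M.inv_sub_def Psub_iff[of N lam] ..
  then show ?thesis unfolding M.Jindec_iff Pindec_def by simp
qed

lemma (in gplus_module) Jirred_iff_Psub:
  assumes "tensor_shape M C sc (DU lam U) (GU U)"
  shows "Jirred M \<longleftrightarrow> C \<noteq> {0} \<and> (\<forall>N. Psub U N \<longrightarrow> N = {0} \<or> N = C)"
proof -
  interpret M: tensor_module sg lb sc C "DU lam U" "GU U" M lam using tensor_moduleI[OF assms] .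
  have "M.inv_sub N \<longleftrightarrow> Psub U N" for N unfolding M.inv_sub_def Psub_iff[of N lam] ..
  then show ?thesis unfolding M.Jirred_iff by simp
qed

section \<open>Recovering the weight class and the fibre from the module\<close>

section \<open>Isomorphisms\<close>

text \<open>The inverse map is controlled only on images of carrier elements, so closure of the
  source carrier under all operations enters through \<open>catJ\<close>.\<close>

lemma Jiso_sym: assumes "Jiso M1 M2" "catJ sg lb M1" shows "Jiso M2 M1"
proof -
  obtain \<phi> where bij: "bij_betw \<phi> (jcar M1) (jcar M2)"
    and \<phi>: "\<And>x y. x \<in> jcar M1 \<Longrightarrow> y \<in> jcar M1 \<Longrightarrow> \<phi> (x + y) = \<phi> x + \<phi> y"
      "\<And>c x. x \<in> jcar M1 \<Longrightarrow> \<phi> (jsc M1 c x) = jsc M2 c (\<phi> x)"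
      "\<And>m x. x \<in> jcar M1 \<Longrightarrow> \<phi> (jE M1 m x) = jE M2 m (\<phi> x)"
      "\<And>j s x. x \<in> jcar M1 \<Longrightarrow> \<phi> (jD M1 j s x) = jD M2 j s (\<phi> x)"
      "\<And>s a x. x \<in> jcar M1 \<Longrightarrow> \<phi> (jG M1 s a x) = jG M2 s a (\<phi> x)"
    using assms(1) unfolding Jiso_def by auto
  let ?\<psi> = "inv_into (jcar M1) \<phi>"
  have closed: "x + y \<in> jcar M1" "jsc M1 c x \<in> jcar M1" "jE M1 m x \<in> jcar M1" "jD M1 j s x \<in> jcar M1" "jG M1 s a x \<in> jcar M1"
    if "x \<in> jcar M1" "y \<in> jcar M1" for x y c m j s a
    using assms(2) that by (simp_all add: catJ_def vs_on_def lin_on_def)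
  have inv: "?\<psi> (\<phi> x) = x" if "x \<in> jcar M1" for x using bij that by (simp add: bij_betw_inv_into_left)
  have ex: "\<exists>x\<in>jcar M1. y = \<phi> x" if "y \<in> jcar M2" for y using bij that by (auto simp: bij_betw_def)
  show ?thesis unfolding Jiso_def
  proof (intro exI[of _ ?\<psi>] conjI ballI allI)
    show "bij_betw ?\<psi> (jcar M2) (jcar M1)" by (rule bij_betw_inv_into[OF bij])
    fix y assume "y \<in> jcar M2"
    then obtain x where x: "x \<in> jcar M1" "y = \<phi> x" using ex by blast
    show "?\<psi> (jsc M2 c y) = jsc M1 c (?\<psi> y)" for c using x closed by (simp add: \<phi>(2)[symmetric] inv)
    show "?\<psi> (jE M2 c y) = jE M1 c (?\<psi> y)" for c using x closed by (simp add: \<phi>(3)[symmetric] inv)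
    show "?\<psi> (jD M2 j s y) = jD M1 j s (?\<psi> y)" for j s using x closed by (simp add: \<phi>(4)[symmetric] inv)
    show "?\<psi> (jG M2 s a y) = jG M1 s a (?\<psi> y)" for s a using x closed by (simp add: \<phi>(5)[symmetric] inv)
    fix z assume "z \<in> jcar M2"
    then obtain x' where x': "x' \<in> jcar M1" "z = \<phi> x'" using ex by blast
    show "?\<psi> (y + z) = ?\<psi> y + ?\<psi> z" using x x' closed by (simp add: \<phi>(1)[symmetric] inv)
  qed
qed

lemma Jiso_trans: assumes "Jiso M1 M2" "Jiso M2 M3" shows "Jiso M1 M3"
proof -
  obtain \<phi> where \<phi>: "bij_betw \<phi> (jcar M1) (jcar M2)"
      "\<forall>x\<in>jcar M1. \<forall>y\<in>jcar M1. \<phi> (x + y) = \<phi> x + \<phi> y"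
      "\<forall>c. \<forall>x\<in>jcar M1. \<phi> (jsc M1 c x) = jsc M2 c (\<phi> x)"
      "\<forall>m. \<forall>x\<in>jcar M1. \<phi> (jE M1 m x) = jE M2 m (\<phi> x)"
      "\<forall>j s. \<forall>x\<in>jcar M1. \<phi> (jD M1 j s x) = jD M2 j s (\<phi> x)"
      "\<forall>s a. \<forall>x\<in>jcar M1. \<phi> (jG M1 s a x) = jG M2 s a (\<phi> x)"
    using assms(1) unfolding Jiso_def by blast
  obtain \<psi> where \<psi>: "bij_betw \<psi> (jcar M2) (jcar M3)"
      "\<forall>x\<in>jcar M2. \<forall>y\<in>jcar M2. \<psi> (x + y) = \<psi> x + \<psi> y"
      "\<forall>c. \<forall>x\<in>jcar M2. \<psi> (jsc M2 c x) = jsc M3 c (\<psi> x)"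
      "\<forall>m. \<forall>x\<in>jcar M2. \<psi> (jE M2 m x) = jE M3 m (\<psi> x)"
      "\<forall>j s. \<forall>x\<in>jcar M2. \<psi> (jD M2 j s x) = jD M3 j s (\<psi> x)"
      "\<forall>s a. \<forall>x\<in>jcar M2. \<psi> (jG M2 s a x) = jG M3 s a (\<psi> x)"
    using assms(2) unfolding Jiso_def by blast
  have mem: "\<phi> x \<in> jcar M2" if "x \<in> jcar M1" for x using \<phi>(1) that by (auto simp: bij_betw_def)
  show ?thesis unfolding Jiso_def
  proof (intro exI[of _ "\<lambda>x. \<psi> (\<phi> x)"] conjI)
    show "bij_betw (\<lambda>x. \<psi> (\<phi> x)) (jcar M1) (jcar M3)"
      using bij_betw_trans[OF \<phi>(1) \<psi>(1)] by (simp add: o_def)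
  qed (use \<phi>(2-) \<psi>(2-) mem in simp_all)
qed

locale tensor_module_pair = M1: tensor_module sg lb sc1 C1 D1 G1 M1 lam1 + M2: tensor_module sg lb sc2 C2 D2 G2 M2 lam2
  for sg :: "complex \<Rightarrow> 'g::ab_group_add \<Rightarrow> 'g" and lb
    and sc1 :: "complex \<Rightarrow> 'u::ab_group_add \<Rightarrow> 'u" and C1
    and D1 :: "'n::finite \<Rightarrow> ('n \<Rightarrow> int) \<Rightarrow> 'u \<Rightarrow> 'u" and G1 M1 lam1
    and sc2 :: "complex \<Rightarrow> 'w::ab_group_add \<Rightarrow> 'w" and C2
    and D2 :: "'n::finite \<Rightarrow> ('n \<Rightarrow> int) \<Rightarrow> 'w \<Rightarrow> 'w" and G2 M2 lam2
begin

text \<open>The central weights are subtracted from the operators because \<open>lam1\<close> and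
  \<open>lam2\<close> may differ by an integer vector; what remains is the part coming from
  g^+.\<close>

definition fibre_iso :: "('u \<Rightarrow> 'w) \<Rightarrow> bool" where
  "fibre_iso \<psi> \<longleftrightarrow> bij_betw \<psi> C1 C2 \<and> (\<forall>x\<in>C1. \<forall>y\<in>C1. \<psi> (x + y) = \<psi> x + \<psi> y)
    \<and> (\<forall>c. \<forall>x\<in>C1. \<psi> (sc1 c x) = sc2 c (\<psi> x))
    \<and> (\<forall>j s. \<forall>x\<in>C1. \<psi> (D1 j s x - sc1 (lam1 j) x) = D2 j s (\<psi> x) - sc2 (lam2 j) (\<psi> x))
    \<and> (\<forall>s a. \<forall>x\<in>C1. \<psi> (G1 s a x) = G2 s a (\<psi> x))"

lemma Jiso_if:
  assumes cong: "congZ lam1 lam2" and \<psi>: "fibre_iso \<psi>"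
  shows "Jiso M1 M2"
proof -
  have "\<forall>i. \<exists>z::int. lam1 i - lam2 i = of_int z" using cong by (simp add: congZ_def)
  from choice[OF this] obtain z where z: "\<And>i. lam1 i - lam2 i = of_int (z i)" by blast
  have bij: "bij_betw \<psi> C1 C2" and add: "\<And>x y. x \<in> C1 \<Longrightarrow> y \<in> C1 \<Longrightarrow> \<psi> (x + y) = \<psi> x + \<psi> y"
    and sca: "\<And>c x. x \<in> C1 \<Longrightarrow> \<psi> (sc1 c x) = sc2 c (\<psi> x)"
    and D: "\<And>j s x. x \<in> C1 \<Longrightarrow> \<psi> (D1 j s x - sc1 (lam1 j) x) = D2 j s (\<psi> x) - sc2 (lam2 j) (\<psi> x)"
    and G: "\<And>s a x. x \<in> C1 \<Longrightarrow> \<psi> (G1 s a x) = G2 s a (\<psi> x)"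
    using \<psi> by (auto simp: fibre_iso_def)
  have \<psi>C: "\<psi> x \<in> C2" if "x \<in> C1" for x using bij that by (auto simp: bij_betw_def)
  have \<psi>0: "\<psi> 0 = 0" using add[of 0 0] by simp
  let ?\<chi> = "inv_into C1 \<psi>"
  have \<chi>: "?\<chi> (\<psi> x) = x" if "x \<in> C1" for x using bij that by (simp add: bij_betw_inv_into_left)
  have \<chi>': "\<psi> (?\<chi> y) = y" "?\<chi> y \<in> C1" if "y \<in> C2" for y
    using bij that by (auto simp: bij_betw_inv_into_right bij_betw_def inv_into_into)
  have \<chi>0: "?\<chi> 0 = 0" using \<chi>[of 0] by (simp add: \<psi>0)
  \<comment> \<open>The integer difference z of the weights is compensated by a shift of degrees:
    e_m \<otimes> v goes to e_(m+z) \<otimes> \<psi>(v).\<close>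
  define \<phi> where "\<phi> w = (\<Sum>m\<in>Poly_Mapping.keys w. sgl (m + z) (\<psi> (lkp w m)))" for w
  define \<phi>' where "\<phi>' w = (\<Sum>m\<in>Poly_Mapping.keys w. sgl (m + (- z)) (?\<chi> (lkp w m)))" for w
  have l: "lkp (\<phi> w) k = \<psi> (lkp w (k - z))" for w k
    unfolding \<phi>_def using lookup_tens_ext[where f = "\<lambda>m v. \<psi> v" and w = w and s = z and k = k] by (simp add: \<psi>0)
  have l': "lkp (\<phi>' w) k = ?\<chi> (lkp w (k + z))" for w k
    unfolding \<phi>'_def using lookup_tens_ext[where f = "\<lambda>m v. ?\<chi> v" and w = w and s = "- z" and k = k] by (simp add: \<chi>0)
  have \<phi>M: "\<phi> w \<in> jcar M2" if "w \<in> jcar M1" for w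
    using that by (simp add: M2.mem_iff l \<psi>C)
  have \<phi>'M: "\<phi>' w \<in> jcar M1" if "w \<in> jcar M2" for w
    using that by (simp add: M1.mem_iff l' \<chi>')
  have idx: "k - s - z = k - z - s" for k s by (simp add: algebra_simps)
  have D': "\<psi> (D1 j s x) = D2 j s (\<psi> x) - sc2 (lam2 j) (\<psi> x) + sc2 (lam1 j) (\<psi> x)" if x: "x \<in> C1" for j s x
  proof -
    have "\<psi> (D1 j s x) = \<psi> ((D1 j s x - sc1 (lam1 j) x) + sc1 (lam1 j) x)" by simp
    also have "\<dots> = \<psi> (D1 j s x - sc1 (lam1 j) x) + \<psi> (sc1 (lam1 j) x)"
      by (rule add) (use x in auto)
    finally show ?thesis by (simp add: D sca x)
  qed
  show ?thesis unfolding Jiso_def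
  proof (intro exI[of _ \<phi>] conjI ballI allI)
    show "bij_betw \<phi> (jcar M1) (jcar M2)"
      by (rule bij_betwI[where g = \<phi>'])
        (auto intro!: poly_mapping_eqI \<phi>M \<phi>'M simp: l l' \<chi> \<chi>')
    fix x assume x: "x \<in> jcar M1"
    show "\<phi> (jsc M1 c x) = jsc M2 c (\<phi> x)" for c
      using x by (auto intro!: poly_mapping_eqI simp: l M1.lkp_simps M2.lkp_simps \<phi>M sca)
    show "\<phi> (jE M1 c x) = jE M2 c (\<phi> x)" for c
      using x by (auto intro!: poly_mapping_eqI simp: l M1.lkp_simps M2.lkp_simps \<phi>M idx)
    show "\<phi> (jG M1 s a x) = jG M2 s a (\<phi> x)" for s a
      using x by (auto intro!: poly_mapping_eqI simp: l M1.lkp_simps M2.lkp_simps \<phi>M idx G)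
    show "\<phi> (jD M1 j s x) = jD M2 j s (\<phi> x)" for j s
    proof (rule poly_mapping_eqI)
      fix k
      define y where "y = lkp x (k - z - s)"
      have y: "y \<in> C1" using x by (simp add: y_def)
      have "lkp (\<phi> (jD M1 j s x)) k = \<psi> (sc1 (of_int (k j - z j - s j)) y + D1 j s y)"
        using x by (simp add: l M1.lkp_simps y_def)
      also have "\<dots> = sc2 (of_int (k j - z j - s j)) (\<psi> y) + (D2 j s (\<psi> y) - sc2 (lam2 j) (\<psi> y) + sc2 (lam1 j) (\<psi> y))"
        using y by (simp add: add sca D')
      also have "\<dots> = sc2 (of_int (k j - s j)) (\<psi> y) + D2 j s (\<psi> y)"
      proof -
        have lam: "lam1 j = lam2 j + of_int (z j)" using z[of j] by (simp add: algebra_simps)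
        show ?thesis using y \<psi>C[OF y] unfolding lam by (simp add: M2.sc_distribs algebra_simps)
      qed
      also have "\<dots> = lkp (jD M2 j s (\<phi> x)) k"
        using x by (simp add: M2.lkp_simps \<phi>M l y_def idx)
      finally show "lkp (\<phi> (jD M1 j s x)) k = lkp (jD M2 j s (\<phi> x)) k" .
    qed
    fix y assume y: "y \<in> jcar M1"
    show "\<phi> (x + y) = \<phi> x + \<phi> y"
      using x y by (auto intro!: poly_mapping_eqI simp: l lookup_add add)
  qed
qed

text \<open>An isomorphism preserves weights: e_0 \<otimes> v has weight lam1, and in the target
  this weight occurs in the single degree z with lam1 = z + lam2. Hence the image is e_z \<otimes>
  \<psi>(v). A nonzero vector is needed to find z.\<close>

lemma Jiso_only_if:
  assumes iso: "Jiso M1 M2" and nz: "C1 \<noteq> {0}"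
  shows "congZ lam1 lam2 \<and> (\<exists>\<psi>. fibre_iso \<psi>)"
proof -
  obtain \<phi> where bij: "bij_betw \<phi> (jcar M1) (jcar M2)"
    and \<phi>: "\<And>x y. x \<in> jcar M1 \<Longrightarrow> y \<in> jcar M1 \<Longrightarrow> \<phi> (x + y) = \<phi> x + \<phi> y"
      "\<And>c x. x \<in> jcar M1 \<Longrightarrow> \<phi> (jsc M1 c x) = jsc M2 c (\<phi> x)"
      "\<And>m x. x \<in> jcar M1 \<Longrightarrow> \<phi> (jE M1 m x) = jE M2 m (\<phi> x)"
      "\<And>j s x. x \<in> jcar M1 \<Longrightarrow> \<phi> (jD M1 j s x) = jD M2 j s (\<phi> x)"
      "\<And>s a x. x \<in> jcar M1 \<Longrightarrow> \<phi> (jG M1 s a x) = jG M2 s a (\<phi> x)"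
    using iso unfolding Jiso_def by auto
  have \<phi>M: "\<phi> x \<in> jcar M2" if "x \<in> jcar M1" for x using bij that by (auto simp: bij_betw_def)
  have \<phi>0: "\<phi> 0 = 0" using \<phi>(1)[of 0 0] by simp
  have inj: "x = y" if "\<phi> x = \<phi> y" "x \<in> jcar M1" "y \<in> jcar M1" for x y
    using bij that by (auto simp: bij_betw_def inj_on_def)
  have wt: "of_int (k j) + lam2 j = lam1 j"
    if v: "v \<in> C1" and k: "lkp (\<phi> (sgl 0 v)) k \<noteq> 0" for v k j
  proof -
    have "jD M2 j 0 (\<phi> (sgl 0 v)) = \<phi> (jD M1 j 0 (sgl 0 v))" using v by (simp add: \<phi>)
    also have "\<dots> = jsc M2 (lam1 j) (\<phi> (sgl 0 v))"
      using v by (simp add: M1.action_sgl M1.D_0 \<phi>(2)[symmetric])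
    finally have "lkp (jD M2 j 0 (\<phi> (sgl 0 v))) k = lkp (jsc M2 (lam1 j) (\<phi> (sgl 0 v))) k" by simp
    then have "sc2 (of_int (k j) + lam2 j - lam1 j) (lkp (\<phi> (sgl 0 v)) k) = 0"
      using v \<phi>M by (simp add: M2.lkp_simps M2.D_0 M2.sc_distribs)
    then have "of_int (k j) + lam2 j - lam1 j = 0"
      using M2.sc_cancel[of "lkp (\<phi> (sgl 0 v)) k" "of_int (k j) + lam2 j - lam1 j"] k v \<phi>M by auto
    then show ?thesis by simp
  qed
  obtain v0 where v0: "v0 \<in> C1" "v0 \<noteq> 0" using nz M1.zero_in by blast
  have "\<phi> (sgl 0 v0) \<noteq> 0"
  proof
    assume "\<phi> (sgl 0 v0) = 0"
    then have "sgl (0::'n \<Rightarrow> int) v0 = 0" using inj[of "sgl 0 v0" 0] v0 \<phi>0 by simp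
    from arg_cong[OF this, of "\<lambda>f. lkp f 0"] show False using v0 by simp
  qed
  then obtain z where z0: "lkp (\<phi> (sgl 0 v0)) z \<noteq> 0" by (auto simp: poly_mapping_eq_iff fun_eq_iff)
  have z: "lam1 j = of_int (z j) + lam2 j" for j using wt[OF v0(1) z0] by simp
  have zk: "k = z" if "v \<in> C1" "lkp (\<phi> (sgl 0 v)) k \<noteq> 0" for v k
  proof
    fix j
    have "of_int (k j) = (of_int (z j) :: complex)" using wt[OF that, of j] z[of j] by simp
    then show "k j = z j" by simp
  qed
  define \<psi> where "\<psi> v = lkp (\<phi> (sgl 0 v)) z" for v
  have \<phi>\<psi>: "\<phi> (sgl 0 v) = sgl z (\<psi> v)" if v: "v \<in> C1" for v
  proof (rule poly_mapping_eqI)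
    fix k show "lkp (\<phi> (sgl 0 v)) k = lkp (sgl z (\<psi> v)) k"
      using zk[OF v, of k] by (auto simp: \<psi>_def lookup_single when_def)
  qed
  have \<psi>C: "\<psi> v \<in> C2" if "v \<in> C1" for v using that \<phi>M by (simp add: \<psi>_def)
  have shift: "\<phi> (sgl m v) = sgl (z + m) (\<psi> v)" if v: "v \<in> C1" for m v
  proof -
    have "\<phi> (sgl m v) = \<phi> (jE M1 m (sgl 0 v))" using v by (simp add: M1.action_sgl)
    also have "\<dots> = jE M2 m (sgl z (\<psi> v))" using v by (simp add: \<phi> \<phi>\<psi>)
    finally show ?thesis using v \<psi>C by (simp add: M2.action_sgl)
  qed
  have sgl_inj: "x = y" if "sgl k x = sgl k y" for k x y
    using arg_cong[OF that, of "\<lambda>f. lkp f k"] by simp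
  have add: "\<psi> (x + y) = \<psi> x + \<psi> y" if "x \<in> C1" "y \<in> C1" for x y
    using that \<phi>(1)[of "sgl 0 x" "sgl 0 y"] by (simp add: single_add[symmetric] \<psi>_def lookup_add)
  have sca: "\<psi> (sc1 c x) = sc2 c (\<psi> x)" if "x \<in> C1" for c x
    using that \<phi>(2)[of "sgl 0 x" c] \<phi>M by (simp add: M1.action_sgl \<psi>_def M2.lkp_simps)
  have D: "\<psi> (D1 j s x) = sc2 (of_int (z j)) (\<psi> x) + D2 j s (\<psi> x)" if x: "x \<in> C1" for j s x
  proof -
    have "\<phi> (jD M1 j s (sgl 0 x)) = jD M2 j s (sgl z (\<psi> x))" using x by (simp add: \<phi> \<phi>\<psi>)
    then have "sgl (z + s) (\<psi> (D1 j s x)) = sgl (z + s) (sc2 (of_int (z j)) (\<psi> x) + D2 j s (\<psi> x))"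
      using x \<psi>C by (simp add: M1.action_sgl M2.action_sgl shift)
    then show ?thesis by (rule sgl_inj)
  qed
  have G: "\<psi> (G1 s a x) = G2 s a (\<psi> x)" if x: "x \<in> C1" for s a x
  proof -
    have "\<phi> (jG M1 s a (sgl 0 x)) = jG M2 s a (sgl z (\<psi> x))" using x by (simp add: \<phi> \<phi>\<psi>)
    then have "sgl (z + s) (\<psi> (G1 s a x)) = sgl (z + s) (G2 s a (\<psi> x))"
      using x \<psi>C by (simp add: M1.action_sgl M2.action_sgl shift)
    then show ?thesis by (rule sgl_inj)
  qed
  have \<psi>bij: "bij_betw \<psi> C1 C2"
    unfolding bij_betw_def
  proof
    show "inj_on \<psi> C1"
    proof (rule inj_onI)
      fix x y assume xy: "x \<in> C1" "y \<in> C1" "\<psi> x = \<psi> y"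
      then have "\<phi> (sgl 0 x) = \<phi> (sgl 0 y)" by (simp add: \<phi>\<psi>)
      then have "sgl (0::'n \<Rightarrow> int) x = sgl 0 y" using xy by (intro inj) auto
      then show "x = y" by (rule sgl_inj)
    qed
    show "\<psi> ` C1 = C2"
    proof
      show "\<psi> ` C1 \<subseteq> C2" using \<psi>C by auto
      show "C2 \<subseteq> \<psi> ` C1"
      proof
        fix y assume y: "y \<in> C2"
        then have "sgl z y \<in> \<phi> ` jcar M1"
          using bij M2.sgl_in[OF y, of z] by (simp add: bij_betw_def)
        then obtain w where w: "w \<in> jcar M1" "\<phi> w = sgl z y" by force
        \<comment> \<open>The preimage of e_z \<otimes> y inherits weight lam1, which forces it into
          degree 0.\<close>
        have "jD M1 j 0 w = jsc M1 (lam1 j) w" for j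
        proof (rule inj)
          show "\<phi> (jD M1 j 0 w) = \<phi> (jsc M1 (lam1 j) w)"
            using w y by (simp add: \<phi> M2.action_sgl M2.D_0 z M2.sc_left)
        qed (use w in auto)
        then have "lkp (jD M1 j 0 w) k = lkp (jsc M1 (lam1 j) w) k" for j k by simp
        then have k0: "sc1 (of_int (k j)) (lkp w k) = 0" for j k
          using w by (simp add: M1.lkp_simps M1.D_0)
        have "w = sgl 0 (lkp w 0)"
        proof (rule poly_mapping_eqI)
          fix k
          show "lkp w k = lkp (sgl 0 (lkp w 0)) k"
          proof (cases "k = 0")
            case False
            then obtain j where "k j \<noteq> 0" by (auto simp: fun_eq_iff)
            then have "lkp w k = 0" using M1.sc_cancel[OF _ k0[of k j]] w by simp
            then show ?thesis using False by (simp add: lookup_single when_def)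
          qed simp
        qed
        then have "\<psi> (lkp w 0) = y" using w by (simp add: \<psi>_def)
        then show "y \<in> \<psi> ` C1" using w M1.memD by blast
      qed
    qed
  qed
  have "\<psi> (D1 j s x - sc1 (lam1 j) x) = D2 j s (\<psi> x) - sc2 (lam2 j) (\<psi> x)" if x: "x \<in> C1" for j s x
  proof -
    have "\<psi> (D1 j s x) = \<psi> ((D1 j s x - sc1 (lam1 j) x) + sc1 (lam1 j) x)" by simp
    also have "\<dots> = \<psi> (D1 j s x - sc1 (lam1 j) x) + \<psi> (sc1 (lam1 j) x)"
      by (rule add) (use x in auto)
    finally show ?thesis using x \<psi>C by (simp add: D sca z M2.sc_left algebra_simps)
  qed
  then have "fibre_iso \<psi>" using \<psi>bij add sca G by (simp add: fibre_iso_def)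
  moreover have "congZ lam1 lam2" unfolding congZ_def
  proof
    fix i show "\<exists>y::int. lam1 i - lam2 i = of_int y" using z[of i] by (intro exI[of _ "z i"]) simp
  qed
  ultimately show ?thesis by blast
qed

end

text \<open>The two directions are separate because the weight class can be recovered only from a
  nonzero module: for U = 0 every weight gives the zero module.\<close>

lemma Jiso_iff_Piso:
  fixes U :: "('n::finite, 'g::ab_group_add, 'u::ab_group_add) Pmod" and U' :: "('n, 'g, 'w::ab_group_add) Pmod"
  assumes U: "gplus_fdmod sg lb U" and U': "gplus_fdmod sg lb U'"
    and M: "tensor_shape M (ucar U) (usc U) (DU lam U) (GU U)"
    and M': "tensor_shape M' (ucar U') (usc U') (DU lam' U') (GU U')"
  shows "congZ lam lam' \<and> Piso U U' \<Longrightarrow> Jiso M M'"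
    and "Jiso M M' \<Longrightarrow> ucar U \<noteq> {0} \<Longrightarrow> congZ lam lam' \<and> Piso U U'"
proof -
  interpret U: gplus_module sg lb U by unfold_locales (rule U)
  interpret U': gplus_module sg lb U' by unfold_locales (rule U')
  interpret P: tensor_module_pair sg lb "usc U" "ucar U" "DU lam U" "GU U" M lam "usc U'" "ucar U'" "DU lam' U'" "GU U'" M' lam'
    unfolding tensor_module_pair_def using U.tensor_moduleI[OF M] U'.tensor_moduleI[OF M'] ..
  have fi: "P.fibre_iso \<psi> \<longleftrightarrow> bij_betw \<psi> (ucar U) (ucar U')
     \<and> (\<forall>x\<in>ucar U. \<forall>y\<in>ucar U. \<psi> (x + y) = \<psi> x + \<psi> y)
     \<and> (\<forall>c. \<forall>x\<in>ucar U. \<psi> (usc U c x) = usc U' c (\<psi> x))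
     \<and> (\<forall>\<alpha> j. \<alpha> \<noteq> 0 \<longrightarrow> (\<forall>x\<in>ucar U. \<psi> (uR U \<alpha> j x) = uR U' \<alpha> j (\<psi> x)))
     \<and> (\<forall>\<beta> a. \<forall>x\<in>ucar U. \<psi> (uP U \<beta> a x) = uP U' \<beta> a (\<psi> x))" (is "_ \<longleftrightarrow> ?R \<psi>") for \<psi>
  proof (cases "bij_betw \<psi> (ucar U) (ucar U') \<and> (\<forall>x\<in>ucar U. \<forall>y\<in>ucar U. \<psi> (x + y) = \<psi> x + \<psi> y)
     \<and> (\<forall>c. \<forall>x\<in>ucar U. \<psi> (usc U c x) = usc U' c (\<psi> x))")
    case True
    have C: "\<psi> x \<in> ucar U'" if "x \<in> ucar U" for x using True that by (auto simp: bij_betw_def)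
    \<comment> \<open>Removing the weight from \<open>DU\<close> leaves \<open>DU\<close> with
      weight 0, so \<open>morphism_iff\<close> applies at a common weight although the two modules
      carry different ones.\<close>
    have "(DU lam U j s x - usc U (lam j) x) = DU (\<lambda>_. 0) U j s x" if "x \<in> ucar U" for j s x
      using U.DU_shift[OF that, of lam] by simp
    moreover have "(DU lam' U' j s x - usc U' (lam' j) x) = DU (\<lambda>_. 0) U' j s x" if "x \<in> ucar U'" for j s x
      using U'.DU_shift[OF that, of lam'] by simp
    ultimately show ?thesis
      using True C morphism_iff[OF U U', of \<psi> "\<lambda>_. 0"] unfolding P.fibre_iso_def by simp
  next
    case False
    then show ?thesis unfolding P.fibre_iso_def by blast
  qed
  have Pi: "Piso U U' \<longleftrightarrow> (\<exists>\<psi>. P.fibre_iso \<psi>)" unfolding Piso_def fi ..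
  show "congZ lam lam' \<and> Piso U U' \<Longrightarrow> Jiso M M'" unfolding Pi using P.Jiso_if by blast
  show "Jiso M M' \<Longrightarrow> ucar U \<noteq> {0} \<Longrightarrow> congZ lam lam' \<and> Piso U U'" unfolding Pi by (rule P.Jiso_only_if)
qed

section \<open>gl_n plus the finite-dimensional algebra as a quotient of g^+\<close>

section \<open>Modules over \<open>gl\<^sub>n \<oplus> \<g>\<close>\<close>

text \<open>The degree-zero part of g^+ is its quotient by the part of positive degree, with z_p
  d/dz_j corresponding to E^p_j; this is the inflation of V along that quotient. The p with \<alpha>
  = \<open>eps p\<close> is unique, so the choice is determined.\<close>

definition UV :: "('n::finite, 'g, 'v::ab_group_add) GLmod \<Rightarrow> ('n, 'g, 'v) Pmod" where
  "UV V = \<lparr>ucar = vcar V, usc = vsc V,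
    uR = (\<lambda>\<alpha> j v. if \<exists>p. \<alpha> = eps p then vA V (SOME p. \<alpha> = eps p) j v else 0),
    uP = (\<lambda>\<beta> a v. if \<beta> = 0 then vB V a v else 0)\<rparr>"

lemma eps_inj [simp]: "(eps p :: 'n \<Rightarrow> nat) = eps q \<longleftrightarrow> p = q"
proof
  assume "(eps p :: 'n \<Rightarrow> nat) = eps q"
  from fun_cong[OF this, of p] show "p = q" by (simp add: eps_apply split: if_splits)
qed simp

lemma UV_simps [simp]: "ucar (UV V) = vcar V" "usc (UV V) = vsc V" "uR (UV V) (eps p) j v = vA V p j v"
  "uP (UV V) 0 a v = vB V a v" "\<beta> \<noteq> 0 \<Longrightarrow> uP (UV V) \<beta> a v = 0"
  "(\<And>p. \<alpha> \<noteq> eps p) \<Longrightarrow> uR (UV V) \<alpha> j v = 0"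
  by (auto simp: UV_def)

definition deg :: "('n::finite \<Rightarrow> nat) \<Rightarrow> nat" where
  "deg \<alpha> = (\<Sum>i\<in>UNIV. \<alpha> i)"

lemma deg_add: "deg (\<alpha> + \<beta>) = deg \<alpha> + deg \<beta>"
  by (simp add: deg_def sum.distrib)

lemma deg_eps [simp]: "deg (eps p) = 1"
  by (simp add: deg_def eps_def)

lemma deg_0_iff: "deg \<alpha> = 0 \<longleftrightarrow> \<alpha> = 0"
  by (auto simp: deg_def fun_eq_iff)

lemma deg_1_iff: "deg \<alpha> = 1 \<longleftrightarrow> (\<exists>p. \<alpha> = eps p)"
proof
  assume d: "deg \<alpha> = 1"
  then obtain p where p: "\<alpha> p \<noteq> 0" using deg_0_iff[of \<alpha>] by (auto simp: fun_eq_iff)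
  have "\<alpha> = (\<alpha> - eps p) + eps p" using p by (auto simp: fun_eq_iff eps_apply)
  then have "deg (\<alpha> - eps p) = 0" using d by (metis deg_add deg_eps add_cancel_left_left)
  then show "\<exists>p. \<alpha> = eps p" using \<open>\<alpha> = (\<alpha> - eps p) + eps p\<close> by (auto simp: deg_0_iff)
qed auto

text \<open>The condition on \<gamma>_j makes the truncated subtraction of \<open>eps j\<close> a
  true one.\<close>

lemma deg_shift: "\<gamma> j \<noteq> 0 \<Longrightarrow> Suc (deg (\<alpha> + \<gamma> - eps j)) = deg \<alpha> + deg \<gamma>"
proof -
  assume "\<gamma> j \<noteq> 0"
  then have "\<alpha> + \<gamma> = (\<alpha> + \<gamma> - eps j) + eps j" by (auto simp: fun_eq_iff eps_apply)
  then have "deg (\<alpha> + \<gamma>) = deg (\<alpha> + \<gamma> - eps j) + deg (eps j)" using deg_add[of "\<alpha> + \<gamma> - eps j" "eps j"] by simp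
  then show ?thesis by (simp add: deg_add)
qed


locale gl_module =
  fixes sg :: "complex \<Rightarrow> 'g::ab_group_add \<Rightarrow> 'g" and lb :: "'g \<Rightarrow> 'g \<Rightarrow> 'g"
    and V :: "('n::finite, 'g, 'v::ab_group_add) GLmod"
  assumes gl: "gl_fdmod sg lb V"
begin

abbreviation "sc \<equiv> vsc V"
abbreviation "C \<equiv> vcar V"

sublocale vsp sc C using gl by (auto simp: gl_fdmod_def vsp_def)

lemma fd: "fin_dim sc C"
  and A_lin: "lin_on sc C (vA V p q)"
  and B_lin: "lin_on sc C (vB V a)"
  and B_add: "v \<in> C \<Longrightarrow> vB V (a + b) v = vB V a v + vB V b v"
  and B_sg: "v \<in> C \<Longrightarrow> vB V (sg c a) v = sc c (vB V a v)"
  and AA: "v \<in> C \<Longrightarrow> vA V p q (vA V r t v) - vA V r t (vA V p q v)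
      = (if q = r then vA V p t v else 0) - (if t = p then vA V r q v else 0)"
  and AB: "v \<in> C \<Longrightarrow> vA V p q (vB V a v) - vB V a (vA V p q v) = 0"
  and BB: "v \<in> C \<Longrightarrow> vB V a (vB V b v) - vB V b (vB V a v) = vB V (lb a b) v"
  using gl unfolding gl_fdmod_def by simp_all

lemma A_in [simp]: "v \<in> C \<Longrightarrow> vA V p q v \<in> C"
  using A_lin by (auto simp: lin_on_def)

lemma B_in [simp]: "v \<in> C \<Longrightarrow> vB V a v \<in> C"
  using B_lin by (auto simp: lin_on_def)

lemma A_0 [simp]: "vA V p q 0 = 0"
  using lin.app_0[OF linI[OF A_lin]] .

lemma B_0 [simp]: "vB V a 0 = 0"
  using lin.app_0[OF linI[OF B_lin]] .

lemma UV_not_eps: "deg \<alpha> \<noteq> 1 \<Longrightarrow> uR (UV V) \<alpha> j v = 0"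
  by (rule UV_simps(6)) (auto simp: deg_1_iff)

lemma UV_lin: "lin_on sc C (uR (UV V) \<alpha> j)"
proof (cases "\<exists>p. \<alpha> = eps p")
  case True
  then obtain p where "\<alpha> = eps p" by blast
  then show ?thesis using A_lin[of p j] by (simp add: lin_on_def)
next
  case False
  then show ?thesis by (simp add: lin_on_def)
qed

lemma UV_lin_P: "lin_on sc C (uP (UV V) \<beta> a)"
  using B_lin[of a] by (cases "\<beta> = 0") (simp_all add: lin_on_def)

lemma UV_in [simp]: "v \<in> C \<Longrightarrow> uR (UV V) \<alpha> j v \<in> C" "v \<in> C \<Longrightarrow> uP (UV V) \<beta> a v \<in> C"
  using UV_lin UV_lin_P by (auto simp: lin_on_def)

lemma UV_0: "uR (UV V) \<alpha> j 0 = 0" "uP (UV V) \<beta> a 0 = 0"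
  using lin.app_0[OF linI[OF UV_lin]] lin.app_0[OF linI[OF UV_lin_P]] by auto

text \<open>For two indices of degree 1 this is the commutator of matrix units. Otherwise the
  degrees add up to more than 2, so at least one factor, and every bracket term with nonzero
  coefficient, has an index of degree above 1 and acts by zero.\<close>

lemma UV_RR:
  assumes "\<alpha> \<noteq> 0" "\<gamma> \<noteq> 0" and v: "v \<in> C"
  shows "uR (UV V) \<alpha> j (uR (UV V) \<gamma> k v) - uR (UV V) \<gamma> k (uR (UV V) \<alpha> j v)
      = sc (of_nat (\<gamma> j)) (uR (UV V) (\<alpha> + \<gamma> - eps j) k v) - sc (of_nat (\<alpha> k)) (uR (UV V) (\<alpha> + \<gamma> - eps k) j v)"
proof (cases "deg \<alpha> = 1 \<and> deg \<gamma> = 1")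
  case True
  then obtain p r where pr: "\<alpha> = eps p" "\<gamma> = eps r" unfolding deg_1_iff by blast
  have canc: "eps p + eps r - eps r = (eps p :: 'n \<Rightarrow> nat)" "eps p + eps r - eps p = (eps r :: 'n \<Rightarrow> nat)"
    by (auto simp: fun_eq_iff)
  have "sc (of_nat (\<gamma> j)) (uR (UV V) (\<alpha> + \<gamma> - eps j) k v) = (if j = r then vA V p k v else 0)"
    using v canc by (auto simp: pr eps_apply)
  moreover have "sc (of_nat (\<alpha> k)) (uR (UV V) (\<alpha> + \<gamma> - eps k) j v) = (if k = p then vA V r j v else 0)"
    using v canc by (auto simp: pr eps_apply)
  ultimately show ?thesis using AA[OF v] by (simp add: pr)
next
  case False
  have d: "deg \<alpha> + deg \<gamma> > 2" using False assms(1,2) deg_0_iff[of \<alpha>] deg_0_iff[of \<gamma>] by linarith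
  have "sc (of_nat (\<gamma> j)) (uR (UV V) (\<alpha> + \<gamma> - eps j) k v) = 0"
  proof (cases "\<gamma> j = 0")
    case False
    from deg_shift[of \<gamma> j \<alpha>, OF this] d have "deg (\<alpha> + \<gamma> - eps j) \<noteq> 1" by linarith
    then show ?thesis by (simp add: UV_not_eps)
  qed (use v in simp)
  moreover have "sc (of_nat (\<alpha> k)) (uR (UV V) (\<alpha> + \<gamma> - eps k) j v) = 0"
  proof (cases "\<alpha> k = 0")
    case False
    have "deg (\<alpha> + \<gamma> - eps k) \<noteq> 1"
      using deg_shift[of \<alpha> k \<gamma>, OF False] d by (simp add: add.commute)
    then show ?thesis by (simp add: UV_not_eps)
  qed (use v in simp)
  moreover have "uR (UV V) \<alpha> j (uR (UV V) \<gamma> k v) = 0 \<and> uR (UV V) \<gamma> k (uR (UV V) \<alpha> j v) = 0"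
    using False UV_not_eps UV_0 by auto
  ultimately show ?thesis by simp
qed

lemma UV_RP:
  assumes "\<alpha> \<noteq> 0" and v: "v \<in> C"
  shows "uR (UV V) \<alpha> j (uP (UV V) \<beta> a v) - uP (UV V) \<beta> a (uR (UV V) \<alpha> j v)
      = sc (of_nat (\<beta> j)) (uP (UV V) (\<alpha> + \<beta> - eps j) a v)"
proof (cases "\<beta> = 0")
  case True
  then show ?thesis
  proof (cases "\<exists>p. \<alpha> = eps p")
    case True
    then obtain p where "\<alpha> = eps p" by blast
    then show ?thesis using \<open>\<beta> = 0\<close> v AB by simp
  next
    case False
    then show ?thesis using \<open>\<beta> = 0\<close> v by simp
  qed
next
  case False
  have "sc (of_nat (\<beta> j)) (uP (UV V) (\<alpha> + \<beta> - eps j) a v) = 0"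
  proof (cases "\<beta> j = 0")
    case False
    then have "\<beta> \<noteq> 0" by auto
    then have "deg (\<alpha> + \<beta> - eps j) \<noteq> 0"
      using deg_shift[of \<beta> j \<alpha>, OF False] assms(1) deg_0_iff[of \<alpha>] deg_0_iff[of \<beta>] by linarith
    then show ?thesis by (simp add: deg_0_iff)
  qed (use v in simp)
  then show ?thesis using False by (simp add: UV_0)
qed

lemma UV_PP:
  assumes v: "v \<in> C"
  shows "uP (UV V) \<alpha> a (uP (UV V) \<beta> b v) - uP (UV V) \<beta> b (uP (UV V) \<alpha> a v) = uP (UV V) (\<alpha> + \<beta>) (lb a b) v"
proof (cases "\<alpha> = 0 \<and> \<beta> = 0")
  case True
  then show ?thesis using BB[OF v] by simp
next
  case False
  have "\<alpha> + \<beta> \<noteq> 0" using False deg_add[of \<alpha> \<beta>] deg_0_iff[of \<alpha>] deg_0_iff[of \<beta>] deg_0_iff[of "\<alpha> + \<beta>"] by linarith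
  then show ?thesis using False by (auto simp: UV_0)
qed

lemma gplus_UV: "gplus_fdmod sg lb (UV V)"
  unfolding gplus_fdmod_def
proof (intro conjI allI impI ballI)
  show "uP (UV V) \<beta> (a + b) v = uP (UV V) \<beta> a v + uP (UV V) \<beta> b v" if "v \<in> ucar (UV V)" for \<beta> a b v
    using that by (cases "\<beta> = 0") (simp_all add: B_add)
  show "uP (UV V) \<beta> (sg c a) v = usc (UV V) c (uP (UV V) \<beta> a v)" if "v \<in> ucar (UV V)" for \<beta> c a v
    using that by (cases "\<beta> = 0") (simp_all add: B_sg)
qed (simp_all add: vs fd UV_lin UV_lin_P UV_RR UV_RP UV_PP)

sublocale UV: gplus_module sg lb "UV V"
  by unfold_locales (rule gplus_UV)

lemma Psub_UV: "Psub (UV V) N \<longleftrightarrow> GLsub V N"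
proof
  assume N: "Psub (UV V) N"
  show "GLsub V N" unfolding GLsub_def
  proof (intro conjI allI ballI)
    show "subsp sc C N" using N by (simp add: Psub_def)
    fix v assume v: "v \<in> N"
    show "vA V p q v \<in> N" for p q
      using N v unfolding Psub_def by (metis UV_simps(3) eps_neq_0)
    show "vB V a v \<in> N" for a
      using N v unfolding Psub_def by (metis UV_simps(4))
  qed
next
  assume N: "GLsub V N"
  then have sub: "subsp sc C N" and 0: "0 \<in> N" by (simp_all add: GLsub_def subsp_def)
  show "Psub (UV V) N" unfolding Psub_def
  proof (intro conjI allI ballI impI)
    show "subsp (usc (UV V)) (ucar (UV V)) N" using sub by simp
    fix \<alpha> :: "'n \<Rightarrow> nat" and v assume v: "v \<in> N"
    show "uR (UV V) \<alpha> j v \<in> N" for j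
    proof (cases "\<exists>p. \<alpha> = eps p")
      case True
      then obtain p where "\<alpha> = eps p" by blast
      then show ?thesis using N v by (simp add: GLsub_def)
    qed (use 0 in simp)
    show "uP (UV V) \<alpha> a v \<in> N" for a
      using N v 0 by (cases "\<alpha> = 0") (simp_all add: GLsub_def)
  qed
qed

text \<open>Only \<beta> = \<open>eps p\<close> contributes, with s^\<beta>/\<beta>! = s_p, so the
  series collapses to the formula of \<open>PhiC\<close>.\<close>

lemma DU_UV:
  assumes v: "v \<in> C"
  shows "DU lam (UV V) j s v = sc (lam j) v + (\<Sum>p\<in>UNIV. sc (of_int (s p)) (vA V p j v))"
proof -
  have "wsum sc {\<beta>. \<beta> \<noteq> 0} s (\<lambda>\<beta>. uR (UV V) \<beta> j v) = (\<Sum>\<beta>\<in>range eps. sc (dp s \<beta>) (uR (UV V) \<beta> j v))"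
    unfolding wsum_def dp_def[symmetric]
  proof (rule sum.mono_neutral_left)
    show "{\<beta> \<in> {\<beta>. \<beta> \<noteq> 0}. sc (dp s \<beta>) (uR (UV V) \<beta> j v) \<noteq> 0} \<subseteq> range eps"
    proof
      fix \<beta> assume b: "\<beta> \<in> {\<beta> \<in> {\<beta>. \<beta> \<noteq> 0}. sc (dp s \<beta>) (uR (UV V) \<beta> j v) \<noteq> 0}"
      show "\<beta> \<in> range eps"
      proof (rule ccontr)
        assume "\<beta> \<notin> range eps"
        then have "uR (UV V) \<beta> j v = 0" by (intro UV_simps(6)) auto
        then show False using b by simp
      qed
    qed
  qed auto
  also have "\<dots> = (\<Sum>p\<in>UNIV. sc (dp s (eps p)) (vA V p j v))"
    by (subst sum.reindex) (auto simp: inj_on_def)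
  also have "\<dots> = (\<Sum>p\<in>UNIV. sc (of_int (s p)) (vA V p j v))"
  proof (intro sum.cong refl)
    fix p
    have "dp s (eps p) = (\<Prod>i\<in>UNIV. if i = p then of_int (s i) else 1)"
      unfolding dp_prod by (intro prod.cong refl) (auto simp: eps_apply)
    then show "sc (dp s (eps p)) (vA V p j v) = sc (of_int (s p)) (vA V p j v)" by simp
  qed
  finally show ?thesis by (simp add: DU_def)
qed

lemma GU_UV:
  assumes v: "v \<in> C"
  shows "GU (UV V) s a v = vB V a v"
proof -
  have "wsum sc UNIV s (\<lambda>\<beta>. uP (UV V) \<beta> a v) = (\<Sum>\<beta>\<in>{0}. sc (dp s \<beta>) (uP (UV V) \<beta> a v))"
    unfolding wsum_def dp_def[symmetric]
  proof (rule sum.mono_neutral_left)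
    show "{\<beta> \<in> UNIV. sc (dp s \<beta>) (uP (UV V) \<beta> a v) \<noteq> 0} \<subseteq> {0}"
    proof
      fix \<beta> assume b: "\<beta> \<in> {\<beta> \<in> UNIV. sc (dp s \<beta>) (uP (UV V) \<beta> a v) \<noteq> 0}"
      show "\<beta> \<in> {0}"
      proof (rule ccontr)
        assume "\<beta> \<notin> {0}"
        then have "uP (UV V) \<beta> a v = 0" by (intro UV_simps(5)) auto
        then show False using b by simp
      qed
    qed
  qed auto
  then show ?thesis using v by (simp add: GU_def)
qed

text \<open>\<open>PhiC lam V\<close> has the shape of \<open>PhiB lam (UV V)\<close>, so the
  results on tensor modules over g^+ apply to it through inflation.\<close>

lemma tensor_shape_PhiC: "tensor_shape (PhiC lam V) C sc (DU lam (UV V)) (GU (UV V))"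
  unfolding tensor_shape_def
proof (intro conjI ballI allI)
  fix w :: "('n \<Rightarrow> int) \<Rightarrow>\<^sub>0 'v" assume w: "w \<in> tens_car C"
  fix k
  show "lkp (jsc (PhiC lam V) c w) k = sc c (lkp w k)" for c
    using lookup_tens_ext[where f = "\<lambda>m v. sc c v" and w = w and s = 0 and k = k]
    by (simp add: PhiC_def tens_ext_def)
  show "lkp (jE (PhiC lam V) m w) k = lkp w (k - m)" for m
    using lookup_tens_ext[where f = "\<lambda>m v. v" and w = w and s = m and k = k]
    by (simp add: PhiC_def tens_ext_def)
  show "lkp (jD (PhiC lam V) j s w) k = sc (of_int (k j - s j)) (lkp w (k - s)) + DU lam (UV V) j s (lkp w (k - s))" for j s
    using lookup_tens_ext[where f = "\<lambda>m v. sc (of_int (m j) + lam j) v + (\<Sum>p\<in>UNIV. sc (of_int (s p)) (vA V p j v))" and w = w and s = s and k = k]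
      tens_carD[OF w] by (simp add: PhiC_def tens_ext_def DU_UV sc_left add.assoc)
  show "lkp (jG (PhiC lam V) s a w) k = GU (UV V) s a (lkp w (k - s))" for s a
    using lookup_tens_ext[where f = "\<lambda>m v. vB V a v" and w = w and s = s and k = k] tens_carD[OF w]
    by (simp add: PhiC_def tens_ext_def GU_UV)
qed (simp add: PhiC_def)

lemma tensor_shape_PhiC': "tensor_shape (PhiC lam V) (ucar (UV V)) (usc (UV V)) (DU lam (UV V)) (GU (UV V))"
  using tensor_shape_PhiC by simp

lemma catJ_PhiC: "catJ sg lb (PhiC lam V)"
  using tensor_module.catJ[OF UV.tensor_moduleI[OF tensor_shape_PhiC']] .

lemma Jirred_PhiC: "Jirred (PhiC lam V) \<longleftrightarrow> GLirred V"
  unfolding UV.Jirred_iff_Psub[OF tensor_shape_PhiC'] GLirred_def Psub_UV by simp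

end

lemma Piso_UV:
  fixes V :: "('n::finite, 'g::ab_group_add, 'v::ab_group_add) GLmod" and V' :: "('n, 'g, 'w::ab_group_add) GLmod"
  assumes V: "gl_fdmod sg lb V" and V': "gl_fdmod sg lb V'"
  shows "Piso (UV V) (UV V') \<longleftrightarrow> GLiso V V'"
proof -
  interpret V: gl_module sg lb V by unfold_locales (rule V)
  interpret V': gl_module sg lb V' by unfold_locales (rule V')
  have "((\<forall>\<alpha> j. \<alpha> \<noteq> 0 \<longrightarrow> (\<forall>x\<in>vcar V. \<phi> (uR (UV V) \<alpha> j x) = uR (UV V') \<alpha> j (\<phi> x)))
      \<and> (\<forall>\<beta> a. \<forall>x\<in>vcar V. \<phi> (uP (UV V) \<beta> a x) = uP (UV V') \<beta> a (\<phi> x)))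
    \<longleftrightarrow> ((\<forall>p q. \<forall>x\<in>vcar V. \<phi> (vA V p q x) = vA V' p q (\<phi> x)) \<and> (\<forall>a. \<forall>x\<in>vcar V. \<phi> (vB V a x) = vB V' a (\<phi> x)))"
    (is "?L \<longleftrightarrow> ?R") if add: "\<forall>x\<in>vcar V. \<forall>y\<in>vcar V. \<phi> (x + y) = \<phi> x + \<phi> y" for \<phi>
  proof
    have \<phi>0: "\<phi> 0 = 0" using add[rule_format, of 0 0] by simp
    {
      assume L: ?L
      show ?R
      proof (intro conjI allI ballI)
        fix x assume x: "x \<in> vcar V"
        show "\<phi> (vA V p q x) = vA V' p q (\<phi> x)" for p q
          using L[THEN conjunct1, rule_format, of "eps p" x q] x by simp
        show "\<phi> (vB V a x) = vB V' a (\<phi> x)" for a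
          using L[THEN conjunct2, rule_format, of x 0 a] x by simp
      qed
    next
      assume R: ?R
      show ?L
      proof (intro conjI allI ballI impI)
        fix \<alpha> :: "'n \<Rightarrow> nat" and x assume x: "x \<in> vcar V"
        show "\<phi> (uR (UV V) \<alpha> j x) = uR (UV V') \<alpha> j (\<phi> x)" for j
        proof (cases "\<exists>p. \<alpha> = eps p")
          case True
          then obtain p where "\<alpha> = eps p" by blast
          then show ?thesis using R x by simp
        qed (use \<phi>0 in simp)
        show "\<phi> (uP (UV V) \<alpha> a x) = uP (UV V') \<alpha> a (\<phi> x)" for a
          using R x \<phi>0 by (cases "\<alpha> = 0") simp_all
      qed
    }
  qed
  note * = this
  show ?thesis unfolding Piso_def GLiso_def UV_simps
    by (rule ex_cong1, rule conj_cong[OF refl], rule conj_cong[OF refl], rule conj_cong[OF refl], rule *)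
qed

section \<open>Weight decomposition and the fibre of a general module\<close>

section \<open>The structure of modules in category \<open>J\<close>\<close>

lemma congZ_refl: "congZ a a"
  by (auto simp: congZ_def intro!: exI[of _ 0])

lemma congZ_sym: "congZ a b \<Longrightarrow> congZ b a"
  unfolding congZ_def
proof
  fix i assume "\<forall>i. \<exists>z::int. a i - b i = of_int z"
  then obtain z :: int where "a i - b i = of_int z" by blast
  then have "b i - a i = of_int (- z)" by (simp add: algebra_simps)
  then show "\<exists>z::int. b i - a i = of_int z" ..
qed

lemma congZ_trans: "congZ a b \<Longrightarrow> congZ b c \<Longrightarrow> congZ a c"
  unfolding congZ_def
proof
  fix i assume "\<forall>i. \<exists>z::int. a i - b i = of_int z" "\<forall>i. \<exists>z::int. b i - c i = of_int z"
  then obtain y z :: int where "a i - b i = of_int y" "b i - c i = of_int z" by blast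
  then have "a i - c i = of_int (y + z)" by (simp add: algebra_simps)
  then show "\<exists>z::int. a i - c i = of_int z" ..
qed

text \<open>A canonical representative modulo Z^n: the choice depends only on the class, so
  congruent weights get equal representatives.\<close>

definition wrep :: "('n \<Rightarrow> complex) \<Rightarrow> ('n \<Rightarrow> complex)" where
  "wrep \<mu> = (SOME \<nu>. congZ \<mu> \<nu>)"

lemma wrep_cong: "congZ \<mu> (wrep \<mu>)"
  unfolding wrep_def by (rule someI[of _ \<mu>]) (rule congZ_refl)

lemma wrep_eq: assumes "congZ \<mu> \<nu>" shows "wrep \<mu> = wrep \<nu>"
proof -
  have "congZ \<mu> = congZ \<nu>"
    by (intro ext iffI) (use assms congZ_sym congZ_trans in blast)+
  then show ?thesis by (simp add: wrep_def)
qed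

lemma wrep_wrep: "wrep (wrep \<mu>) = wrep \<mu>"
  by (rule wrep_eq[OF wrep_cong, symmetric])

context vsp
begin

text \<open>Summands of equal weight are collected first, since \<open>weight_independent\<close>
  takes one vector per weight.\<close>

lemma grouped_independent:
  assumes T: "\<And>j. lin_on sc C (T j)" and A: "finite A" and f: "\<And>p. p \<in> A \<Longrightarrow> f p \<in> C"
    and wt: "\<And>p j. p \<in> A \<Longrightarrow> T j (f p) = sc (wt p j) (f p)"
    and sum: "(\<Sum>p\<in>A. f p) = 0"
  shows "(\<Sum>p\<in>{p\<in>A. wt p = \<mu>}. f p) = 0"
proof (cases "\<mu> \<in> wt ` A")
  case True
  show ?thesis
  proof (rule weight_independent[where T = T and A = "wt ` A" and x = "\<lambda>\<mu>. \<Sum>p\<in>{p\<in>A. wt p = \<mu>}. f p", OF T])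
    show "T j (\<Sum>p\<in>{p\<in>A. wt p = \<mu>}. f p) = sc (\<mu> j) (\<Sum>p\<in>{p\<in>A. wt p = \<mu>}. f p)" for j \<mu>
    proof -
      interpret Tj: lin sc C "T j" using linI[OF T] .
      have "T j (\<Sum>p\<in>{p\<in>A. wt p = \<mu>}. f p) = (\<Sum>p\<in>{p\<in>A. wt p = \<mu>}. T j (f p))"
        by (rule Tj.app_sum) (use f in auto)
      also have "\<dots> = (\<Sum>p\<in>{p\<in>A. wt p = \<mu>}. sc (\<mu> j) (f p))"
        by (rule sum.cong) (use wt in auto)
      also have "\<dots> = sc (\<mu> j) (\<Sum>p\<in>{p\<in>A. wt p = \<mu>}. f p)"
        by (rule sc_sum[symmetric]) (use f in auto)
      finally show ?thesis .
    qed
    show "(\<Sum>\<mu>\<in>wt ` A. \<Sum>p\<in>{p\<in>A. wt p = \<mu>}. f p) = 0"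
      using sum.group[of A "wt ` A" wt f] A sum by simp
    show "(\<Sum>p\<in>{p\<in>A. wt p = \<mu>}. f p) \<in> C" for \<mu> by (rule sum_in) (use f in auto)
  qed (use A True in auto)
next
  case False
  then show ?thesis by (intro sum.neutral) auto
qed

end

locale catJ_module =
  fixes sg :: "complex \<Rightarrow> 'g::ab_group_add \<Rightarrow> 'g" and lb :: "'g \<Rightarrow> 'g \<Rightarrow> 'g"
    and M :: "('n::finite, 'g, 'j::ab_group_add) Jmod"
  assumes cj: "catJ sg lb M"
begin

abbreviation "sc \<equiv> jsc M"
abbreviation "J \<equiv> jcar M"
abbreviation "E \<equiv> jE M"
abbreviation "d \<equiv> jD M"
abbreviation "gg \<equiv> jG M"

sublocale vsp sc J using cj by (auto simp: catJ_def vsp_def)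

lemma E_lin: "lin_on sc J (E m)"
  and E_0: "w \<in> J \<Longrightarrow> E 0 w = w"
  and E_E: "w \<in> J \<Longrightarrow> E m (E s w) = E (m + s) w"
  and d_lin: "lin_on sc J (d j s)"
  and g_lin: "lin_on sc J (gg s a)"
  and g_add: "w \<in> J \<Longrightarrow> gg s (a + b) w = gg s a w + gg s b w"
  and g_sg: "w \<in> J \<Longrightarrow> gg s (sg c a) w = sc c (gg s a w)"
  and dd: "w \<in> J \<Longrightarrow> d j s (d k m w) - d k m (d j s w)
            = sc (of_int (m j)) (d k (s + m) w) - sc (of_int (s k)) (d j (s + m) w)"
  and dg: "w \<in> J \<Longrightarrow> d j s (gg m a w) - gg m a (d j s w) = sc (of_int (m j)) (gg (s + m) a w)"
  and g_g: "w \<in> J \<Longrightarrow> gg s a (gg m b w) - gg m b (gg s a w) = gg (s + m) (lb a b) w"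
  and diag: "diagonalizable sc J (d j 0)"
  and free: "\<exists>k v. free_basis M k v"
  and dE: "w \<in> J \<Longrightarrow> d j s (E m w) = sc (of_int (m j)) (E (m + s) w) + E m (d j s w)"
  and gE: "w \<in> J \<Longrightarrow> gg s a (E m w) = E m (gg s a w)"
  using cj unfolding catJ_def by simp_all

sublocale E: lin sc J "E m" for m by (rule linI[OF E_lin])
sublocale d: lin sc J "d j s" for j s by (rule linI[OF d_lin])
sublocale g: lin sc J "gg s a" for s a by (rule linI[OF g_lin])

lemma E_inj: "w \<in> J \<Longrightarrow> E m w = 0 \<Longrightarrow> w = 0"
  using E_E[of w "-m" m] by (simp add: E_0)

definition wtv :: "('n \<Rightarrow> complex) \<Rightarrow> 'j \<Rightarrow> bool" where
  "wtv \<mu> w \<longleftrightarrow> w \<in> J \<and> (\<forall>j. d j 0 w = sc (\<mu> j) w)"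

lemma wtv_E: "wtv \<mu> w \<Longrightarrow> wtv (\<lambda>j. of_int (m j) + \<mu> j) (E m w)"
  by (simp add: wtv_def dE sc_left E.app_sc)

definition W :: "'n set \<Rightarrow> 'j set" where
  "W S = {w\<in>J. \<forall>j\<in>S. \<exists>c. d j 0 w = sc c w}"

lemma W_sub: "W S \<subseteq> J"
  by (auto simp: W_def)

lemma span_W_subsp: "subsp sc J (span_fam sc id (W S))"
  by (rule span_fam_subsp) (use W_sub in auto)

lemma d0_comm: "w \<in> J \<Longrightarrow> d i 0 (d j 0 w) = d j 0 (d i 0 w)"
  using dd[of w i 0 j 0] by simp

text \<open>Simultaneous diagonalization: d_i(0) commutes with the other d_j(0), so the
  d_i(0)-components of a joint eigenvector are eigenvectors of each d_j(0) with the same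
  eigenvalue.\<close>

lemma W_step: "W S \<subseteq> span_fam sc id (W (insert i S))"
proof
  fix w assume w: "w \<in> W S"
  then have wJ: "w \<in> J" by (simp add: W_def)
  let ?Eig = "{v \<in> J. \<exists>c. d i 0 v = sc c v}"
  have "w \<in> span_fam sc id ?Eig" using diag[of i] wJ unfolding diagonalizable_def by blast
  then obtain A c where A: "finite A" "A \<subseteq> ?Eig" "w = (\<Sum>x\<in>A. sc (c x) (id x))"
    by (rule span_famE)
  have "\<forall>x. \<exists>l. x \<in> A \<longrightarrow> d i 0 x = sc l x" using A(2) by blast
  from choice[OF this] obtain e where e: "\<And>x. x \<in> A \<Longrightarrow> d i 0 x = sc (e x) x" by blast
  have AJ: "x \<in> A \<Longrightarrow> x \<in> J" for x using A(2) by blast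
  define wl where "wl l = (\<Sum>x\<in>{x\<in>A. e x = l}. sc (c x) x)" for l
  have wlJ: "wl l \<in> J" for l unfolding wl_def by (rule sum_in) (auto intro: AJ sc_in)
  have w_sum: "w = (\<Sum>l\<in>e ` A. wl l)"
    unfolding wl_def using sum.group[of A "e ` A" e "\<lambda>x. sc (c x) x"] A by simp
  have ewl: "d i 0 (wl l) = sc l (wl l)" for l
  proof -
    have "d i 0 (wl l) = (\<Sum>x\<in>{x\<in>A. e x = l}. d i 0 (sc (c x) x))"
      unfolding wl_def by (rule d.app_sum) (auto intro: AJ sc_in)
    also have "\<dots> = (\<Sum>x\<in>{x\<in>A. e x = l}. sc l (sc (c x) x))"
      by (rule sum.cong[OF refl]) (auto simp: AJ e d.app_sc mult.commute)
    also have "\<dots> = sc l (wl l)"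
      unfolding wl_def by (rule sc_sum[symmetric]) (auto intro: AJ sc_in)
    finally show ?thesis .
  qed
  have "wl l \<in> W (insert i S)" if l: "l \<in> e ` A" for l
  proof -
    have "\<exists>c. d j 0 (wl l) = sc c (wl l)" if j: "j \<in> S" for j
    proof -
      obtain \<mu> where \<mu>: "d j 0 w = sc \<mu> w" using w j by (auto simp: W_def)
      define y where "y l = d j 0 (wl l) - sc \<mu> (wl l)" for l
      \<comment> \<open>The vectors y l sum to zero and have distinct eigenvalues l under d_i(0), so
        each vanishes. An eigenvalue is viewed as a weight indexed by \<open>unit\<close> to make
        \<open>weight_independent\<close> fit a single operator.\<close>
      let ?c = "\<lambda>l. (\<lambda>_::unit. l)"
      have "y ((?c l) ()) = 0"
      proof (rule weight_independent[where T = "\<lambda>_::unit. d i 0" and A = "?c ` (e ` A)" and x = "\<lambda>\<nu>. y (\<nu> ())"])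
        show "lin_on sc J (d i 0)" by (rule d_lin)
        show "y (\<nu> ()) \<in> J" for \<nu> using wlJ by (simp add: y_def)
        show "d i 0 (y (\<nu> ())) = sc (\<nu> u) (y (\<nu> ()))" for \<nu> and u :: unit
          using wlJ by (simp add: y_def d.app_simps d0_comm[of _ i j] ewl sc_diff mult.commute)
        have "(\<Sum>\<nu>\<in>?c ` (e ` A). y (\<nu> ())) = (\<Sum>l\<in>e ` A. y l)"
          by (subst sum.reindex) (auto simp: inj_on_def fun_eq_iff)
        also have "\<dots> = d j 0 w - sc \<mu> w"
          unfolding y_def w_sum using wlJ by (simp add: d.app_sum sc_sum sum_subtractf)
        also have "\<dots> = 0" using \<mu> by simp
        finally show "(\<Sum>\<nu>\<in>?c ` (e ` A). y (\<nu> ())) = 0" .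
      qed (use A l in auto)
      then show ?thesis by (auto simp: y_def)
    qed
    then show ?thesis using wlJ ewl by (auto simp: W_def)
  qed
  then have mem: "wl l \<in> span_fam sc id (W (insert i S))" if "l \<in> e ` A" for l
    using span_fam_base[of "wl l" "W (insert i S)" id] that wlJ by simp
  interpret N: vsp sc "span_fam sc id (W (insert i S))" using subsp_vsp[OF vsp_axioms span_W_subsp] .
  show "w \<in> span_fam sc id (W (insert i S))" unfolding w_sum by (rule N.sum_in) (rule mem)
qed

lemma J_span_W: "finite S \<Longrightarrow> J \<subseteq> span_fam sc id (W S)"
proof (induction S rule: finite_induct)
  case empty
  show ?case
  proof
    fix w assume "w \<in> J"
    then show "w \<in> span_fam sc id (W {})" using span_fam_base[of w "W {}" id] by (simp add: W_def)
  qed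
next
  case (insert i S)
  have "span_fam sc id (W S) \<subseteq> span_fam sc id (W (insert i S))"
    by (rule span_fam_min[OF span_W_subsp]) (use W_step in \<open>auto simp: id_def\<close>)
  then show ?case using insert by blast
qed

text \<open>The free generators are split into joint weight vectors, and each of these is multiplied
  by the e_m that moves its weight to the canonical representative. Weights of two generators are
  then either equal or incongruent.\<close>

lemma weight_generators:
  obtains S and wt :: "'j \<Rightarrow> 'n \<Rightarrow> complex" where "finite S" "\<And>x. x \<in> S \<Longrightarrow> wtv (wt x) x" "\<And>x. x \<in> S \<Longrightarrow> x \<noteq> 0"
    "\<And>x. x \<in> S \<Longrightarrow> wrep (wt x) = wt x"
    "J \<subseteq> span_fam sc (\<lambda>(m, x). E m x) (UNIV \<times> S)"
proof -
  obtain k v where kv: "free_basis M k v" using free by blast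
  have vJ: "r < k \<Longrightarrow> v r \<in> J" for r using kv by (simp add: free_basis_def)
  have "\<forall>r. \<exists>A c. r < k \<longrightarrow> finite A \<and> A \<subseteq> W UNIV \<and> v r = (\<Sum>x\<in>A. sc (c x) x)"
  proof
    fix r
    show "\<exists>A c. r < k \<longrightarrow> finite A \<and> A \<subseteq> W UNIV \<and> v r = (\<Sum>x\<in>A. sc (c x) x)"
    proof (cases "r < k")
      case True
      then have "v r \<in> span_fam sc id (W UNIV)" using J_span_W[of UNIV] vJ by auto
      then obtain A c where "finite A" "A \<subseteq> W UNIV" "v r = (\<Sum>x\<in>A. sc (c x) (id x))" by (rule span_famE)
      then show ?thesis by (intro exI[of _ A] exI[of _ c]) simp
    qed simp
  qed
  from choice[OF this] obtain A where "\<forall>r. \<exists>c. r < k \<longrightarrow> finite (A r) \<and> A r \<subseteq> W UNIV \<and> v r = (\<Sum>x\<in>A r. sc (c x) x)"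
    by blast
  from choice[OF this] obtain c where A: "\<And>r. r < k \<Longrightarrow> finite (A r) \<and> A r \<subseteq> W UNIV \<and> v r = (\<Sum>x\<in>A r. sc (c r x) x)"
    by blast
  \<comment> \<open>Zero satisfies every weight condition and is discarded, so that each remaining
    generator witnesses its weight class.\<close>
  define S0 where "S0 = (\<Union>r<k. A r) - {0}"
  have S0: "finite S0" "S0 \<subseteq> W UNIV" using A by (auto simp: S0_def)
  have "\<forall>x. \<exists>\<mu>. x \<in> S0 \<longrightarrow> wtv \<mu> x"
  proof
    fix x
    show "\<exists>\<mu>. x \<in> S0 \<longrightarrow> wtv \<mu> x"
    proof (cases "x \<in> S0")
      case True
      then have "x \<in> J" "\<forall>j. \<exists>c. d j 0 x = sc c x" using S0 by (auto simp: W_def)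
      from choice[OF this(2)] \<open>x \<in> J\<close> show ?thesis by (auto simp: wtv_def)
    qed simp
  qed
  from choice[OF this] obtain wt0 where wt0: "\<And>x. x \<in> S0 \<Longrightarrow> wtv (wt0 x) x" by blast
  have S0J: "x \<in> S0 \<Longrightarrow> x \<in> J" for x using wt0 by (simp add: wtv_def)
  have "\<forall>x. \<exists>m::'n \<Rightarrow> int. \<forall>j. of_int (m j) + wt0 x j = wrep (wt0 x) j"
  proof
    fix x
    have "\<forall>j. \<exists>z::int. wrep (wt0 x) j - wt0 x j = of_int z"
      using congZ_sym[OF wrep_cong[of "wt0 x"]] by (simp add: congZ_def)
    from choice[OF this] obtain m :: "'n \<Rightarrow> int" where m: "\<And>j. wrep (wt0 x) j - wt0 x j = of_int (m j)" by blast
    then have "of_int (m j) + wt0 x j = wrep (wt0 x) j" for j using m[of j] by (simp add: algebra_simps)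
    then show "\<exists>m::'n \<Rightarrow> int. \<forall>j. of_int (m j) + wt0 x j = wrep (wt0 x) j" by blast
  qed
  from choice[OF this] obtain m :: "'j \<Rightarrow> 'n \<Rightarrow> int" where m: "\<And>x j. of_int (m x j) + wt0 x j = wrep (wt0 x) j" by blast
  define S where "S = (\<lambda>x. E (m x) x) ` S0"
  have wtS: "\<exists>\<mu>. wtv \<mu> y \<and> wrep \<mu> = \<mu>" if "y \<in> S" for y
  proof -
    obtain x where x: "x \<in> S0" "y = E (m x) x" using \<open>y \<in> S\<close> by (auto simp: S_def)
    have "wtv (\<lambda>j. of_int (m x j) + wt0 x j) y" unfolding x(2) by (rule wtv_E[OF wt0[OF x(1)]])
    then show ?thesis by (intro exI[of _ "wrep (wt0 x)"]) (simp add: m wrep_wrep)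
  qed
  then have "\<forall>y. \<exists>\<mu>. y \<in> S \<longrightarrow> wtv \<mu> y \<and> wrep \<mu> = \<mu>" by blast
  from choice[OF this] obtain wt where wt: "\<And>y. y \<in> S \<Longrightarrow> wtv (wt y) y \<and> wrep (wt y) = wt y" by blast
  let ?f = "\<lambda>(m, x). E m x"
  let ?N = "span_fam sc ?f (UNIV \<times> S)"
  have SJ: "x \<in> S \<Longrightarrow> x \<in> J" for x using wt by (auto simp: wtv_def)
  have sub: "subsp sc J ?N" by (rule span_fam_subsp) (auto simp: SJ)
  interpret N: vsp sc ?N using subsp_vsp[OF vsp_axioms sub] .
  have ES: "E m' x \<in> ?N" if "x \<in> S" for m' x
    using span_fam_base[of "(m', x)" "UNIV \<times> S" ?f] that SJ by simp
  have ES0: "E m' x \<in> ?N" if x: "x \<in> S0" for m' x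
  proof -
    have "E m' x = E (m' - m x) (E (m x) x)" using S0J[OF x] by (simp add: E_E)
    then show ?thesis using ES[of "E (m x) x" "m' - m x"] x by (simp add: S_def)
  qed
  have EA: "E m' x \<in> ?N" if "r < k" "x \<in> A r" for m' r x
    using ES0[of x m'] that by (cases "x = 0") (auto simp: S0_def)
  have Ev: "E m' (v r) \<in> ?N" if r: "r < k" for m' r
  proof -
    have AJ: "x \<in> J" if "x \<in> A r" for x using A[OF r] that W_sub by blast
    have "E m' (v r) = (\<Sum>x\<in>A r. sc (c r x) (E m' x))"
      using A[OF r] AJ by (simp add: E.app_sum E.app_sc)
    also have "\<dots> \<in> ?N" by (intro N.sum_in N.sc_in EA[OF r])
    finally show ?thesis .
  qed
  have "J \<subseteq> span_fam sc (\<lambda>(m, r). E m (v r)) (UNIV \<times> {..<k})" using kv by (simp add: free_basis_def)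
  also have "\<dots> \<subseteq> ?N" by (rule span_fam_min[OF sub]) (auto intro: Ev)
  finally have span: "J \<subseteq> ?N" .
  show ?thesis
  proof (rule that[of S wt])
    show "finite S" using S0 by (simp add: S_def)
    show "x \<noteq> 0" if "x \<in> S" for x
      using that E_inj S0J by (force simp: S_def S0_def)
  qed (use wt span in auto)
qed

end

locale catJ_generators = catJ_module sg lb M for sg :: "complex \<Rightarrow> 'g::ab_group_add \<Rightarrow> 'g" and lb and M :: "('n::finite, 'g, 'j::ab_group_add) Jmod" +
  fixes S :: "'j set" and wt :: "'j \<Rightarrow> 'n \<Rightarrow> complex"
  assumes finS: "finite S" and wtS: "x \<in> S \<Longrightarrow> wtv (wt x) x" and nzS: "x \<in> S \<Longrightarrow> x \<noteq> 0"
    and repS: "x \<in> S \<Longrightarrow> wrep (wt x) = wt x"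
    and spanS: "J \<subseteq> span_fam sc (\<lambda>(m, x). E m x) (UNIV \<times> S)"
begin

lemma SJ [simp]: "x \<in> S \<Longrightarrow> x \<in> J"
  using wtS by (auto simp: wtv_def)

definition "wtp p = (\<lambda>j. of_int (fst p j) + wt (snd p) j)" for p :: "('n \<Rightarrow> int) \<times> 'j"

text \<open>Congruent canonical weights coincide, and then the degrees must agree as well.\<close>

lemma wtp_eq: assumes "x \<in> S" "y \<in> S" "wtp (m, x) = wtp (k, y)" shows "m = k \<and> wt x = wt y"
proof -
  have eq: "of_int (m j) + wt x j = of_int (k j) + wt y j" for j
    using fun_cong[OF assms(3), of j] by (simp add: wtp_def)
  have "congZ (wt x) (wt y)" unfolding congZ_def
  proof
    fix j
    have "wt x j - wt y j = of_int (k j - m j)" using eq[of j] by (simp add: algebra_simps)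
    then show "\<exists>z::int. wt x j - wt y j = of_int z" ..
  qed
  then have w: "wt x = wt y" using wrep_eq repS assms(1,2) by metis
  moreover have "m = k"
  proof
    fix j show "m j = k j" using eq[of j] w by simp
  qed
  ultimately show ?thesis by simp
qed

lemma wtv_f: "p \<in> UNIV \<times> S \<Longrightarrow> wtv (wtp p) (E (fst p) (snd p))"
  using wtv_E[OF wtS] by (auto simp: wtp_def)

lemma f_in: "p \<in> UNIV \<times> S \<Longrightarrow> E (fst p) (snd p) \<in> J"
  using wtv_f by (simp add: wtv_def)

lemma grouped:
  assumes A: "finite A" "A \<subseteq> UNIV \<times> S" and sum: "(\<Sum>p\<in>A. sc (c p) (E (fst p) (snd p))) = 0"
  shows "(\<Sum>p\<in>{p\<in>A. wtp p = \<mu>}. sc (c p) (E (fst p) (snd p))) = 0"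
  by (rule grouped_independent[where T = "\<lambda>j. d j 0" and wt = wtp, OF d_lin A(1) _ _ sum])
    (use A wtv_f f_in in \<open>auto simp: wtv_def d.app_sc mult.commute subset_iff\<close>)

lemma weight_extract:
  assumes A: "finite A" "A \<subseteq> UNIV \<times> S" and w: "wtv \<nu> w" "w = (\<Sum>p\<in>A. sc (c p) (E (fst p) (snd p)))"
  shows "w = (\<Sum>p\<in>{p\<in>A. wtp p = \<nu>}. sc (c p) (E (fst p) (snd p)))"
proof -
  \<comment> \<open>The index \<open>None\<close> carries -w, which turns the expansion of w into a
    vanishing sum and puts w into the group of its own weight.\<close>
  define f where "f q = (case q of None \<Rightarrow> - w | Some p \<Rightarrow> sc (c p) (E (fst p) (snd p)))" for q
  define wq where "wq q = (case q of None \<Rightarrow> \<nu> | Some p \<Rightarrow> wtp p)" for q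
  let ?A = "insert None (Some ` A)"
  have wJ: "w \<in> J" using w by (simp add: wtv_def)
  have "(\<Sum>q\<in>{q\<in>?A. wq q = \<nu>}. f q) = 0"
  proof (rule grouped_independent[where T = "\<lambda>j. d j 0", OF d_lin])
    show "finite ?A" using A by simp
    show "f q \<in> J" if "q \<in> ?A" for q using that A f_in wJ by (auto simp: f_def)
    show "d j 0 (f q) = sc (wq q j) (f q)" if "q \<in> ?A" for q j
      using that A wtv_f f_in w(1) wJ
      by (auto simp: f_def wq_def wtv_def d.app_sc d.app_minus sc_minus_right mult.commute subset_iff split: option.splits)
    show "(\<Sum>q\<in>?A. f q) = 0"
      using A w(2) by (simp add: f_def sum.reindex o_def)
  qed
  moreover have "{q\<in>?A. wq q = \<nu>} = insert None (Some ` {p\<in>A. wtp p = \<nu>})"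
    by (auto simp: wq_def)
  ultimately have "- w + (\<Sum>p\<in>{p\<in>A. wtp p = \<nu>}. sc (c p) (E (fst p) (snd p))) = 0"
    using A by (simp add: f_def sum.reindex o_def)
  then show ?thesis by (simp add: add_eq_0_iff)
qed

text \<open>Only generators in degree 0 contribute, because e_m with m \<noteq> 0 moves a weight off
  its canonical representative.\<close>

lemma weight_space:
  assumes w: "wtv (wt x) w" and x: "x \<in> S"
  shows "w \<in> span_fam sc id {y\<in>S. wt y = wt x}"
proof -
  have "w \<in> span_fam sc (\<lambda>(m, x). E m x) (UNIV \<times> S)" using spanS w by (auto simp: wtv_def)
  then obtain A c where A: "finite A" "A \<subseteq> UNIV \<times> S" "w = (\<Sum>p\<in>A. sc (c p) (case p of (m, x) \<Rightarrow> E m x))"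
    by (rule span_famE)
  have "w = (\<Sum>p\<in>A. sc (c p) (E (fst p) (snd p)))" unfolding A(3) by (simp add: case_prod_beta)
  from weight_extract[OF A(1,2) w this]
  have w_eq: "w = (\<Sum>p\<in>{p\<in>A. wtp p = wt x}. sc (c p) (E (fst p) (snd p)))" .
  let ?N = "span_fam sc id {y\<in>S. wt y = wt x}"
  have sub: "subsp sc J ?N" by (rule span_fam_subsp) auto
  interpret N: vsp sc ?N using subsp_vsp[OF vsp_axioms sub] .
  have "E (fst p) (snd p) \<in> ?N" if p: "p \<in> A" "wtp p = wt x" for p
  proof -
    have pS: "snd p \<in> S" using p A(2) by auto
    have "wtp (fst p, snd p) = wtp (0, x)" using p(2) by (simp add: wtp_def)
    from wtp_eq[OF pS x this] have "fst p = 0" "wt (snd p) = wt x" by auto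
    then show ?thesis using span_fam_base[of "snd p" "{y\<in>S. wt y = wt x}" id] pS by (simp add: E_0)
  qed
  then show ?thesis by (subst w_eq) (intro N.sum_in N.sc_in, auto)
qed

text \<open>J is the direct sum of the translates e_m C of this space C, as \<open>decompose\<close>
  and \<open>decompose_unique\<close> show.\<close>

definition "fibre = span_fam sc id S"

lemma fibre_sub: "subsp sc J fibre"
  unfolding fibre_def by (rule span_fam_subsp) auto

lemma fibre_J: "v \<in> fibre \<Longrightarrow> v \<in> J"
  using fibre_sub by (auto simp: subsp_def)

sublocale fibre: vsp sc fibre using subsp_vsp[OF vsp_axioms fibre_sub] .

lemma S_fibre: "x \<in> S \<Longrightarrow> x \<in> fibre"
  unfolding fibre_def using span_fam_base[of x S id] by simp

lemma fibre_eq: "v \<in> fibre \<longleftrightarrow> (\<exists>c. v = (\<Sum>x\<in>S. sc (c x) x))"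
  unfolding fibre_def using span_fam_finite[OF finS, of id v] by simp

lemma fibre_fd: "fin_dim sc fibre"
  unfolding fin_dim_def using finS S_fibre by (intro exI[of _ S]) (auto simp: fibre_def)

lemma weight_in_fibre: "wtv (wt x) w \<Longrightarrow> x \<in> S \<Longrightarrow> w \<in> fibre"
proof -
  assume "wtv (wt x) w" "x \<in> S"
  from weight_space[OF this] obtain A c where A: "finite A" "A \<subseteq> {y\<in>S. wt y = wt x}" "w = (\<Sum>p\<in>A. sc (c p) (id p))"
    by (rule span_famE)
  show "w \<in> fibre" unfolding A(3) using A(2) S_fibre by (intro fibre.sum_in fibre.sc_in) auto
qed

definition "fibre_D j s v = E (- s) (d j s v)"
definition "fibre_G s a v = E (- s) (gg s a v)"

lemma fibre_lin: "lin_on sc J (fibre_D j s)" "lin_on sc J (fibre_G s a)"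
  unfolding fibre_D_def[abs_def] fibre_G_def[abs_def]
  by (rule lin_comp[OF E_lin d_lin], rule lin_comp[OF E_lin g_lin])

text \<open>d_j(s) and e_s \<otimes> a raise weights by s, and e_{-s} lowers them again.\<close>

lemma fibre_weight: assumes w: "wtv \<mu> w" shows "wtv \<mu> (fibre_D j s w)" "wtv \<mu> (fibre_G s a w)"
proof -
  have wJ: "w \<in> J" and ww: "\<And>i. d i 0 w = sc (\<mu> i) w" using w by (auto simp: wtv_def)
  have "d i 0 (d j s w) = sc (\<mu> i) (d j s w) + sc (of_int (s i)) (d j s w)" for i
    using dd[OF wJ, of i 0 j s] wJ by (simp add: ww d.app_sc algebra_simps)
  then show "wtv \<mu> (fibre_D j s w)"
    unfolding wtv_def fibre_D_def using wJ by (simp add: dE E.app_simps sc_minus_left)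
  have "d i 0 (gg s a w) = sc (\<mu> i) (gg s a w) + sc (of_int (s i)) (gg s a w)" for i
    using dg[OF wJ, of i 0 s a] wJ by (simp add: ww g.app_sc algebra_simps)
  then show "wtv \<mu> (fibre_G s a w)"
    unfolding wtv_def fibre_G_def using wJ by (simp add: dE E.app_simps sc_minus_left)
qed

lemma fibre_closed: assumes v: "v \<in> fibre" shows "fibre_D j s v \<in> fibre" "fibre_G s a v \<in> fibre"
proof -
  obtain c where c: "v = (\<Sum>x\<in>S. sc (c x) x)" using v fibre_eq by blast
  interpret D: lin sc J "fibre_D j s" using linI[OF fibre_lin(1)] .
  interpret G: lin sc J "fibre_G s a" using linI[OF fibre_lin(2)] .
  have "fibre_D j s x \<in> fibre" "fibre_G s a x \<in> fibre" if "x \<in> S" for x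
    using weight_in_fibre[OF fibre_weight(1)[OF wtS[OF that]] that] weight_in_fibre[OF fibre_weight(2)[OF wtS[OF that]] that] by auto
  then show "fibre_D j s v \<in> fibre" "fibre_G s a v \<in> fibre"
    unfolding c by (simp_all add: D.app_sum D.app_sc G.app_sum G.app_sc)
qed

lemma diff_system_fibre: "diff_system sg lb sc fibre fibre_D fibre_G"
proof
  show "fin_dim sc fibre" by (rule fibre_fd)
  show "lin_on sc fibre (fibre_D j s)" for j s
    using fibre_lin(1)[of j s] fibre_closed fibre_J unfolding lin_on_def by blast
  show "lin_on sc fibre (fibre_G s a)" for s a
    using fibre_lin(2)[of s a] fibre_closed fibre_J unfolding lin_on_def by blast
  fix v assume "v \<in> fibre"
  then have v: "v \<in> J" by (rule fibre_J)
  show "fibre_G s (a + b) v = fibre_G s a v + fibre_G s b v" for s a b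
    using v by (simp add: fibre_G_def g_add E.app_add)
  show "fibre_G s (sg c a) v = sc c (fibre_G s a v)" for s c a
    using v by (simp add: fibre_G_def g_sg E.app_sc)
  show "fibre_D j s (fibre_D k m v) - fibre_D k m (fibre_D j s v)
      = sc (of_int (m j)) (fibre_D k (s + m) v - fibre_D k m v) - sc (of_int (s k)) (fibre_D j (s + m) v - fibre_D j s v)" for j s k m
  proof -
    \<comment> \<open>Moving e_{-m} to the left past d_j(s) costs a term -m_j e_{s-m} by (J3); these
      terms become the subtracted ones in \<open>DD\<close>.\<close>
    have 1: "fibre_D j s (fibre_D k m v) = - sc (of_int (m j)) (E (- m) (d k m v)) + E (- (s + m)) (d j s (d k m v))" for j s k m
      using v by (simp add: fibre_D_def dE E.app_simps E_E sc_minus_left sc_minus_right algebra_simps)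
    have "fibre_D j s (fibre_D k m v) - fibre_D k m (fibre_D j s v)
        = sc (of_int (s k)) (fibre_D j s v) - sc (of_int (m j)) (fibre_D k m v)
          + E (- (s + m)) (d j s (d k m v) - d k m (d j s v))"
      unfolding 1 using v by (simp add: fibre_D_def E.app_diff add.commute[of m s])
    then show ?thesis
      unfolding dd[OF v] using v by (simp add: fibre_D_def E.app_simps sc_distribs)
  qed
  show "fibre_D j s (fibre_G m a v) - fibre_G m a (fibre_D j s v) = sc (of_int (m j)) (fibre_G (s + m) a v - fibre_G m a v)" for j s m a
  proof -
    have 1: "fibre_D j s (fibre_G m a v) = - sc (of_int (m j)) (E (- m) (gg m a v)) + E (- (s + m)) (d j s (gg m a v))"
      using v by (simp add: fibre_D_def fibre_G_def dE E.app_simps E_E sc_minus_left sc_minus_right algebra_simps)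
    have 2: "fibre_G m a (fibre_D j s v) = E (- (s + m)) (gg m a (d j s v))"
      using v by (simp add: fibre_D_def fibre_G_def gE E_E algebra_simps)
    have "fibre_D j s (fibre_G m a v) - fibre_G m a (fibre_D j s v)
        = - sc (of_int (m j)) (fibre_G m a v) + E (- (s + m)) (d j s (gg m a v) - gg m a (d j s v))"
      unfolding 1 2 using v by (simp add: fibre_G_def E.app_diff)
    then show ?thesis
      unfolding dg[OF v] using v by (simp add: fibre_G_def E.app_simps sc_distribs)
  qed
  show "fibre_G s a (fibre_G m b v) - fibre_G m b (fibre_G s a v) = fibre_G (s + m) (lb a b) v" for s a m b
  proof -
    have "fibre_G s a (fibre_G m b v) - fibre_G m b (fibre_G s a v) = E (- (s + m)) (gg s a (gg m b v) - gg m b (gg s a v))"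
      using v by (simp add: fibre_G_def gE E_E E.app_diff add.commute[of "- m" "- s"] minus_diff_commute[of m s])
    then show ?thesis unfolding g_g[OF v] by (simp add: fibre_G_def)
  qed
qed

lemma decompose:
  assumes w: "w \<in> J"
  obtains A c where "finite A" "\<And>m. c m \<in> fibre" "w = (\<Sum>m\<in>A. E m (c m))"
proof -
  have "w \<in> span_fam sc (\<lambda>(m, x). E m x) (UNIV \<times> S)" using spanS w by auto
  then obtain A c where A: "finite A" "A \<subseteq> UNIV \<times> S" "w = (\<Sum>p\<in>A. sc (c p) (case p of (m, x) \<Rightarrow> E m x))"
    by (rule span_famE)
  define c' where "c' m = (\<Sum>p\<in>{p\<in>A. fst p = m}. sc (c p) (snd p))" for m
  show thesis
  proof (rule that[of "fst ` A" c'])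
    show "finite (fst ` A)" using A by simp
    show "c' m \<in> fibre" for m unfolding c'_def using A S_fibre by (intro fibre.sum_in fibre.sc_in) auto
    have "w = (\<Sum>m\<in>fst ` A. \<Sum>p\<in>{p\<in>A. fst p = m}. sc (c p) (case p of (m, x) \<Rightarrow> E m x))"
      unfolding A(3) using A(1) by (intro sum.group[symmetric]) auto
    also have "\<dots> = (\<Sum>m\<in>fst ` A. E m (c' m))"
    proof (rule sum.cong[OF refl])
      fix m
      have "E m (c' m) = (\<Sum>p\<in>{p\<in>A. fst p = m}. sc (c p) (E m (snd p)))"
        unfolding c'_def using A(2) by (subst E.app_sum) (auto simp: E.app_sc subset_iff intro!: sum.cong)
      also have "\<dots> = (\<Sum>p\<in>{p\<in>A. fst p = m}. sc (c p) (case p of (m, x) \<Rightarrow> E m x))"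
        by (intro sum.cong refl) (auto simp: case_prod_beta)
      finally show "(\<Sum>p\<in>{p\<in>A. fst p = m}. sc (c p) (case p of (m, x) \<Rightarrow> E m x)) = E m (c' m)" ..
    qed
    finally show "w = (\<Sum>m\<in>fst ` A. E m (c' m))" .
  qed
qed

text \<open>The weight of e_m x determines m and the weight of x, so a vanishing sum splits into
  vanishing pieces of fixed degree k and fixed weight \<nu>; adding the pieces over \<nu> returns
  e_k c_k. This works although S may be linearly dependent.\<close>

lemma decompose_unique:
  assumes A: "finite A" and c: "\<And>m. m \<in> A \<Longrightarrow> c m \<in> fibre" and sum: "(\<Sum>m\<in>A. E m (c m)) = 0" and k: "k \<in> A"
  shows "c k = 0"
proof -
  have "\<forall>m. \<exists>a. m \<in> A \<longrightarrow> c m = (\<Sum>x\<in>S. sc (a x) x)" using c fibre_eq by blast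
  from choice[OF this] obtain a where a: "\<And>m. m \<in> A \<Longrightarrow> c m = (\<Sum>x\<in>S. sc (a m x) x)" by blast
  let ?P = "A \<times> S" and ?g = "\<lambda>p. sc (a (fst p) (snd p)) (E (fst p) (snd p))"
  have Ec: "E m (c m) = (\<Sum>x\<in>S. sc (a m x) (E m x))" if "m \<in> A" for m
    using a[OF that] by (simp add: E.app_sum E.app_sc)
  have "(\<Sum>p\<in>?P. ?g p) = (\<Sum>m\<in>A. \<Sum>x\<in>S. sc (a m x) (E m x))"
    by (simp add: sum.cartesian_product case_prod_beta)
  also have "\<dots> = (\<Sum>m\<in>A. E m (c m))" using Ec by simp
  finally have zero: "(\<Sum>p\<in>?P. ?g p) = 0" using sum by simp
  have part: "(\<Sum>x\<in>{x\<in>S. wt x = \<nu>}. sc (a k x) (E k x)) = 0" if \<nu>: "\<nu> \<in> wt ` S" for \<nu>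
  proof -
    obtain y where y: "y \<in> S" "\<nu> = wt y" using \<nu> by blast
    have "(\<Sum>p\<in>{p\<in>?P. wtp p = wtp (k, y)}. ?g p) = 0"
      by (rule grouped[OF _ _ zero]) (use A finS in auto)
    also have "{p\<in>?P. wtp p = wtp (k, y)} = (\<lambda>x. (k, x)) ` {x\<in>S. wt x = \<nu>}"
    proof (intro set_eqI iffI)
      fix p assume "p \<in> {p\<in>?P. wtp p = wtp (k, y)}"
      then show "p \<in> (\<lambda>x. (k, x)) ` {x\<in>S. wt x = \<nu>}"
        using wtp_eq[of "snd p" y "fst p" k] y by (auto simp: image_iff)
    next
      fix p assume "p \<in> (\<lambda>x. (k, x)) ` {x\<in>S. wt x = \<nu>}"
      then show "p \<in> {p\<in>?P. wtp p = wtp (k, y)}" using k y by (auto simp: wtp_def)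
    qed
    finally show ?thesis by (subst (asm) sum.reindex) (auto simp: inj_on_def)
  qed
  have "E k (c k) = (\<Sum>\<nu>\<in>wt ` S. \<Sum>x\<in>{x\<in>S. wt x = \<nu>}. sc (a k x) (E k x))"
    unfolding Ec[OF k] using finS by (intro sum.group[symmetric]) auto
  also have "\<dots> = 0" using part by simp
  finally show ?thesis using E_inj c[OF k] fibre_J by blast
qed

end

lemma mpow_eps: "mpow m (eps j) = of_int (m j)"
proof -
  have "mpow m (eps j) = (\<Prod>i\<in>UNIV. if i = j then of_int (m i) else 1)"
    unfolding mpow_def by (intro prod.cong refl) (auto simp: eps_apply)
  then show ?thesis by simp
qed

text \<open>The shape of all structure constants: the derivation property contributes m_j, the fibre
  operators contribute powers of s.\<close>

lemma polyfun_affine: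
  fixes j :: "'n::finite"
  shows "polyfun (\<lambda>s m. a * of_int (m j) + (\<Sum>\<beta>\<in>box Q. mpow s \<beta> * c \<beta>))"
proof -
  let ?A = "insert (0, eps j) ((\<lambda>\<beta>. (\<beta>, 0)) ` box Q)"
  let ?c = "\<lambda>\<alpha> \<beta>. if \<beta> = 0 then c \<alpha> else a"
  have neq: "(eps j :: 'n \<Rightarrow> nat) \<noteq> 0" by simp
  then have notin: "(0, eps j) \<notin> (\<lambda>\<beta>. (\<beta>, 0 :: 'n \<Rightarrow> nat)) ` box Q" by blast
  have "a * of_int (m j) + (\<Sum>\<beta>\<in>box Q. mpow s \<beta> * c \<beta>)
      = (\<Sum>(\<alpha>, \<beta>)\<in>?A. ?c \<alpha> \<beta> * mpow s \<alpha> * mpow m \<beta>)" for s m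
  proof -
    have "(\<Sum>(\<alpha>, \<beta>)\<in>?A. ?c \<alpha> \<beta> * mpow s \<alpha> * mpow m \<beta>)
        = (case (0, eps j) of (\<alpha>, \<beta>) \<Rightarrow> ?c \<alpha> \<beta> * mpow s \<alpha> * mpow m \<beta>)
          + (\<Sum>(\<alpha>, \<beta>)\<in>(\<lambda>\<beta>. (\<beta>, 0)) ` box Q. ?c \<alpha> \<beta> * mpow s \<alpha> * mpow m \<beta>)"
      by (rule sum.insert) (simp, rule notin)
    also have "(\<Sum>(\<alpha>, \<beta>)\<in>(\<lambda>\<beta>. (\<beta>, 0)) ` box Q. ?c \<alpha> \<beta> * mpow s \<alpha> * mpow m \<beta>)
        = (\<Sum>\<beta>\<in>box Q. mpow s \<beta> * c \<beta>)"
      by (subst sum.reindex) (auto simp: inj_on_def mult.commute)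
    also have "(case (0, eps j) of (\<alpha>, \<beta>) \<Rightarrow> ?c \<alpha> \<beta> * mpow s \<alpha> * mpow m \<beta>) = a * of_int (m j)"
      unfolding prod.case if_not_P[OF neq] mpow_eps by simp
    finally show ?thesis ..
  qed
  then show ?thesis unfolding polyfun_def by (intro exI[of _ ?A] exI[of _ ?c]) auto
qed

lemma (in vsp) span_closed:
  assumes f: "\<And>i. i \<in> I \<Longrightarrow> f i \<in> C" and T: "lin_on sc C T"
    and cl: "\<And>i. i \<in> I \<Longrightarrow> T (f i) \<in> span_fam sc f I" and w: "w \<in> span_fam sc f I"
  shows "T w \<in> span_fam sc f I"
proof -
  interpret T: lin sc C T using linI[OF T] .
  have sub: "subsp sc C (span_fam sc f I)" by (rule span_fam_subsp) (rule f)
  interpret N: vsp sc "span_fam sc f I" using subsp_vsp[OF vsp_axioms sub] .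
  obtain A c where A: "finite A" "A \<subseteq> I" "w = (\<Sum>i\<in>A. sc (c i) (f i))" using w by (rule span_famE)
  have "T w = (\<Sum>i\<in>A. T (sc (c i) (f i)))" unfolding A(3) by (rule T.app_sum) (use A f in auto)
  also have "\<dots> = (\<Sum>i\<in>A. sc (c i) (T (f i)))" by (rule sum.cong[OF refl]) (use A f in \<open>auto simp: T.app_sc\<close>)
  also have "\<dots> \<in> span_fam sc f I" using A(2) cl by (intro N.sum_in N.sc_in) auto
  finally show ?thesis .
qed

section \<open>Polynomiality, splitting by weight classes, and the tensor model\<close>

context catJ_generators
begin

interpretation DS: diff_system sg lb sc fibre fibre_D fibre_G by (rule diff_system_fibre)

lemma d_E: "v \<in> J \<Longrightarrow> d j s (E m v) = sc (of_int (m j)) (E (m + s) v) + E (m + s) (fibre_D j s v)"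
  by (simp add: dE fibre_D_def E_E)

lemma g_E: "v \<in> J \<Longrightarrow> gg s a (E m v) = E (m + s) (fibre_G s a v)"
  by (simp add: gE fibre_G_def E_E)

text \<open>Terms of one degree lie in a single translate e_m C, so independence and generation
  reduce to the fibre.\<close>

lemma free_basis_fibre:
  assumes b: "\<And>i. i < n \<Longrightarrow> b i \<in> fibre" "indep_fam sc b {..<n}" "fibre \<subseteq> span_fam sc b {..<n}"
  shows "free_basis M n b"
  unfolding free_basis_def
proof (intro conjI)
  show bJ: "\<forall>r<n. b r \<in> J" using b fibre_J by auto
  let ?f = "\<lambda>(m, r). E m (b r)"
  show "indep_fam sc ?f (UNIV \<times> {..<n})"
    unfolding indep_fam_def
  proof (intro allI impI ballI)
    fix A c and p :: "('n \<Rightarrow> int) \<times> nat"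
    assume A: "finite A \<and> A \<subseteq> UNIV \<times> {..<n} \<and> (\<Sum>p\<in>A. sc (c p) (?f p)) = 0" and p: "p \<in> A"
    define c' where "c' m = (\<Sum>q\<in>{q\<in>A. fst q = m}. sc (c q) (b (snd q)))" for m
    have c'C: "c' m \<in> fibre" for m unfolding c'_def using A b by (intro fibre.sum_in fibre.sc_in) auto
    have "(\<Sum>m\<in>fst ` A. E m (c' m)) = (\<Sum>m\<in>fst ` A. \<Sum>q\<in>{q\<in>A. fst q = m}. sc (c q) (?f q))"
    proof (rule sum.cong[OF refl])
      fix m
      have "E m (c' m) = (\<Sum>q\<in>{q\<in>A. fst q = m}. E m (sc (c q) (b (snd q))))"
        unfolding c'_def by (rule E.app_sum) (use A bJ in auto)
      also have "\<dots> = (\<Sum>q\<in>{q\<in>A. fst q = m}. sc (c q) (?f q))"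
        by (rule sum.cong[OF refl]) (use A bJ in \<open>auto simp: E.app_sc\<close>)
      finally show "E m (c' m) = (\<Sum>q\<in>{q\<in>A. fst q = m}. sc (c q) (?f q))" .
    qed
    also have "\<dots> = (\<Sum>q\<in>A. sc (c q) (?f q))" using A by (intro sum.group) auto
    finally have sum0: "(\<Sum>m\<in>fst ` A. E m (c' m)) = 0" using A by simp
    have "c' (fst p) = 0"
      by (rule decompose_unique[OF _ _ sum0]) (use A p c'C in auto)
    moreover have "c' (fst p) = (\<Sum>r\<in>snd ` {q\<in>A. fst q = fst p}. sc (c (fst p, r)) (b r))"
      unfolding c'_def by (subst sum.reindex) (auto simp: inj_on_def prod_eq_iff intro!: sum.cong)
    ultimately have "(\<Sum>r\<in>snd ` {q\<in>A. fst q = fst p}. sc (c (fst p, r)) (b r)) = 0" by simp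
    moreover have "finite (snd ` {q\<in>A. fst q = fst p})" "snd ` {q\<in>A. fst q = fst p} \<subseteq> {..<n}"
        "snd p \<in> snd ` {q\<in>A. fst q = fst p}"
      using A p by auto
    ultimately have "c (fst p, snd p) = 0"
      using b(2)[unfolded indep_fam_def, THEN spec, THEN spec, of "snd ` {q\<in>A. fst q = fst p}" "\<lambda>r. c (fst p, r)"]
      by blast
    then show "c p = 0" by simp
  qed
  let ?N = "span_fam sc ?f (UNIV \<times> {..<n})"
  have sub: "subsp sc J ?N" by (rule span_fam_subsp) (use bJ in auto)
  interpret N: vsp sc ?N using subsp_vsp[OF vsp_axioms sub] .
  show "J \<subseteq> ?N"
  proof
    fix w assume "w \<in> J"
    then obtain A c where A: "finite A" "\<And>m. c m \<in> fibre" "w = (\<Sum>m\<in>A. E m (c m))" by (rule decompose) blast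
    have "E m (c m) \<in> ?N" for m
    proof -
      obtain a where a: "c m = (\<Sum>r<n. sc (a r) (b r))"
        using fibre.span_fam_finite[of "{..<n}" b "c m"] b A(2)[of m] by auto
      have "E m (c m) = (\<Sum>r<n. sc (a r) (?f (m, r)))"
        unfolding a using bJ by (subst E.app_sum) (auto simp: E.app_sc)
      also have "\<dots> \<in> ?N"
        using span_fam_base[of _ "UNIV \<times> {..<n}" ?f] bJ by (intro N.sum_in N.sc_in) auto
      finally show ?thesis .
    qed
    then show "w \<in> ?N" unfolding A(3) by (rule N.sum_in)
  qed
qed

text \<open>A basis of the fibre serves as F-basis: d_j(s) sends e_m v to m_j e_(m+s) v plus e_(m+s)
  times a fibre operator polynomial in s. Several weight classes may be present, so no weight is
  split off.\<close>

lemma poly_module: "poly_module M"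
proof -
  obtain n and b :: "nat \<Rightarrow> 'j" where b: "\<And>i. i < n \<Longrightarrow> b i \<in> fibre" "indep_fam sc b {..<n}" "fibre \<subseteq> span_fam sc b {..<n}"
    by (rule fibre.fin_dim_basis[OF fibre_fd], rule that) simp_all
  obtain R :: "('n \<Rightarrow> nat) \<Rightarrow> 'n \<Rightarrow> 'j \<Rightarrow> 'j" and P :: "('n \<Rightarrow> nat) \<Rightarrow> 'g \<Rightarrow> 'j \<Rightarrow> 'j" and Q
    where R_lin: "\<And>\<beta> j. lin_on sc fibre (R \<beta> j)" and P_lin: "\<And>\<beta> a. lin_on sc fibre (P \<beta> a)"
    and DR: "\<And>j s v. v \<in> fibre \<Longrightarrow> fibre_D j s v = (\<Sum>\<beta>\<in>box Q. sc (dp s \<beta>) (R \<beta> j v))"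
    and GP: "\<And>s a v. v \<in> fibre \<Longrightarrow> fibre_G s a v = (\<Sum>\<beta>\<in>box Q. sc (dp s \<beta>) (P \<beta> a v))"
    by (rule DS.polynomial, rule that) simp_all
  have coords: "\<exists>c. \<forall>r<n. x r = (\<Sum>l<n. sc (c r l) (b l))" if "\<And>r. r < n \<Longrightarrow> x r \<in> fibre" for x
  proof -
    have "\<forall>r. \<exists>c. r < n \<longrightarrow> x r = (\<Sum>l<n. sc (c l) (b l))"
      using fibre.span_fam_finite[of "{..<n}" b] b that by blast
    from choice[OF this] show ?thesis by blast
  qed
  have "\<forall>p. \<exists>c. \<forall>r<n. R (fst p) (snd p) (b r) = (\<Sum>l<n. sc (c r l) (b l))"
    using R_lin b(1) by (intro allI coords) (auto simp: lin_on_def)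
  from choice[OF this] obtain \<rho> where
    "\<forall>p. \<forall>r<n. R (fst p) (snd p) (b r) = (\<Sum>l<n. sc (\<rho> p r l) (b l))" by blast
  then have \<rho>: "\<And>\<beta> j r. r < n \<Longrightarrow> R \<beta> j (b r) = (\<Sum>l<n. sc (\<rho> (\<beta>, j) r l) (b l))" by simp
  have "\<forall>p. \<exists>c. \<forall>r<n. P (fst p) (snd p) (b r) = (\<Sum>l<n. sc (c r l) (b l))"
    using P_lin b(1) by (intro allI coords) (auto simp: lin_on_def)
  from choice[OF this] obtain \<pi> where
    "\<forall>p. \<forall>r<n. P (fst p) (snd p) (b r) = (\<Sum>l<n. sc (\<pi> p r l) (b l))" by blast
  then have \<pi>: "\<And>\<beta> a r. r < n \<Longrightarrow> P \<beta> a (b r) = (\<Sum>l<n. sc (\<pi> (\<beta>, a) r l) (b l))" by simp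
  have bJ: "b r \<in> J" if "r < n" for r using b(1)[OF that] fibre_J by blast
  have expand: "E k (\<Sum>\<beta>\<in>box Q. sc (dp s \<beta>) (x \<beta>)) = (\<Sum>l<n. sc (\<Sum>\<beta>\<in>box Q. mpow s \<beta> * (y \<beta> l / mfact \<beta>)) (E k (b l)))"
    if x: "\<And>\<beta>. x \<beta> = (\<Sum>l<n. sc (y \<beta> l) (b l))" for k s x and y :: "('n \<Rightarrow> nat) \<Rightarrow> nat \<Rightarrow> complex"
  proof -
    have xJ: "x \<beta> \<in> J" for \<beta> unfolding x using bJ by (intro sum_in sc_in) auto
    have Ex: "E k (x \<beta>) = (\<Sum>l<n. sc (y \<beta> l) (E k (b l)))" for \<beta>
      unfolding x using bJ by (subst E.app_sum) (auto simp: E.app_sc)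
    have "E k (\<Sum>\<beta>\<in>box Q. sc (dp s \<beta>) (x \<beta>)) = (\<Sum>\<beta>\<in>box Q. \<Sum>l<n. sc (dp s \<beta> * y \<beta> l) (E k (b l)))"
    proof -
      have "E k (\<Sum>\<beta>\<in>box Q. sc (dp s \<beta>) (x \<beta>)) = (\<Sum>\<beta>\<in>box Q. sc (dp s \<beta>) (E k (x \<beta>)))"
        using xJ by (simp add: E.app_sum E.app_sc)
      also have "\<dots> = (\<Sum>\<beta>\<in>box Q. \<Sum>l<n. sc (dp s \<beta> * y \<beta> l) (E k (b l)))"
        unfolding Ex by (intro sum.cong[OF refl], subst sc_sum) (auto simp: bJ)
      finally show ?thesis .
    qed
    also have "\<dots> = (\<Sum>l<n. \<Sum>\<beta>\<in>box Q. sc (dp s \<beta> * y \<beta> l) (E k (b l)))" by (rule sum.swap)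
    also have "\<dots> = (\<Sum>l<n. sc (\<Sum>\<beta>\<in>box Q. mpow s \<beta> * (y \<beta> l / mfact \<beta>)) (E k (b l)))"
      using bJ by (intro sum.cong refl) (simp add: sc_sum_left dp_def)
    finally show ?thesis .
  qed
  define f where "f j r l = (\<lambda>s m. (if r = l then 1 else 0) * of_int (m j)
      + (\<Sum>\<beta>\<in>box Q. mpow s \<beta> * (\<rho> (\<beta>, j) r l / mfact \<beta>)) :: complex)" for j r l
  \<comment> \<open>The vanishing term in m is there to fit \<open>polyfun_affine\<close>; its
    factor 0 makes the coordinate \<open>undefined\<close> immaterial.\<close>
  define h where "h a r l = (\<lambda>s (m :: 'n \<Rightarrow> int). 0 * of_int (m undefined)
      + (\<Sum>\<beta>\<in>box Q. mpow s \<beta> * (\<pi> (\<beta>, a) r l / mfact \<beta>)) :: complex)" for a r l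
  have "d j s (E m (b r)) = (\<Sum>l<n. sc (f j r l s m) (E (m + s) (b l)))" if r: "r < n" for j s m r
  proof -
    have "d j s (E m (b r)) = (\<Sum>l<n. sc (if r = l then of_int (m j) else 0) (E (m + s) (b l)))
        + (\<Sum>l<n. sc (\<Sum>\<beta>\<in>box Q. mpow s \<beta> * (\<rho> (\<beta>, j) r l / mfact \<beta>)) (E (m + s) (b l)))"
    proof -
      have "(\<Sum>l<n. sc (if r = l then of_int (m j) else 0) (E (m + s) (b l)))
          = (\<Sum>l<n. if r = l then sc (of_int (m j)) (E (m + s) (b l)) else 0)"
        using bJ by (intro sum.cong) auto
      also have "\<dots> = sc (of_int (m j)) (E (m + s) (b r))" using r by simp
      finally show ?thesis
        unfolding d_E[OF bJ[OF r]] DR[OF b(1)[OF r]] by (simp add: expand[OF \<rho>[OF r]])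
    qed
    also have "\<dots> = (\<Sum>l<n. sc (f j r l s m) (E (m + s) (b l)))"
      unfolding sum.distrib[symmetric] f_def using bJ by (intro sum.cong refl) (auto simp: sc_left)
    finally show ?thesis .
  qed
  moreover have "gg s a (E m (b r)) = (\<Sum>l<n. sc (h a r l s m) (E (m + s) (b l)))" if r: "r < n" for a s m r
    unfolding g_E[OF bJ[OF r]] GP[OF b(1)[OF r]] h_def by (simp add: expand[OF \<pi>[OF r]])
  moreover have "polyfun (f j r l)" for j r l unfolding f_def by (rule polyfun_affine)
  moreover have "polyfun (h a r l)" for a r l unfolding h_def by (rule polyfun_affine)
  ultimately show ?thesis
    unfolding poly_module_def using free_basis_fibre[OF b]
    by (intro exI[of _ n] exI[of _ b] exI[of _ f] exI[of _ h]) auto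
qed

text \<open>Fibre operators preserve weights and e_m shifts them by Z^n, so generators selected by
  their canonical weight span a submodule.\<close>

lemma Jsub_span:
  assumes S': "S' = {x\<in>S. Q (wt x)}"
  shows "Jsub M (span_fam sc (\<lambda>p. E (fst p) (snd p)) (UNIV \<times> S'))" (is "Jsub M ?N")
proof -
  let ?f = "\<lambda>p. E (fst p) (snd p)"
  have S'S: "x \<in> S" if "x \<in> S'" for x using that S' by simp
  have fJ: "?f p \<in> J" if "p \<in> UNIV \<times> S'" for p using that S'S by auto
  have sub: "subsp sc J ?N" by (rule span_fam_subsp[OF fJ])
  interpret N: vsp sc ?N using subsp_vsp[OF vsp_axioms sub] .
  have base: "E m x \<in> ?N" if "x \<in> S'" for m x using span_fam_base[of "(m, x)" "UNIV \<times> S'" ?f] fJ[of "(m, x)"] that by simp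
  have wsp: "E m w \<in> ?N" if x: "x \<in> S'" and w: "wtv (wt x) w" for m x w
  proof -
    have "w \<in> span_fam sc id {y\<in>S. wt y = wt x}" by (rule weight_space[OF w S'S[OF x]])
    then obtain A c where A: "finite A" "A \<subseteq> {y\<in>S. wt y = wt x}" "w = (\<Sum>y\<in>A. sc (c y) (id y))"
      by (rule span_famE)
    have AS': "y \<in> S'" if "y \<in> A" for y
    proof -
      have "y \<in> S" "wt y = wt x" using A(2) that by auto
      then show ?thesis using x S' by simp
    qed
    have "E m w = (\<Sum>y\<in>A. E m (sc (c y) y))" unfolding A(3) id_apply by (rule E.app_sum) (use AS' S'S in auto)
    also have "\<dots> = (\<Sum>y\<in>A. sc (c y) (E m y))" by (rule sum.cong[OF refl]) (use AS' S'S in \<open>auto simp: E.app_sc\<close>)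
    also have "\<dots> \<in> ?N" by (intro N.sum_in N.sc_in base AS')
    finally show ?thesis .
  qed
  have 1: "E m w \<in> ?N" if w: "w \<in> ?N" for m w
  proof (rule span_closed[OF fJ E_lin _ w])
    fix p assume "p \<in> (UNIV :: ('n \<Rightarrow> int) set) \<times> S'"
    then show "E m (?f p) \<in> ?N" using base[of "snd p" "m + fst p"] S'S by (auto simp: E_E)
  qed auto
  have 2: "d j s w \<in> ?N" if w: "w \<in> ?N" for j s w
  proof (rule span_closed[OF fJ d_lin _ w])
    fix p assume p: "p \<in> (UNIV :: ('n \<Rightarrow> int) set) \<times> S'"
    then have x: "snd p \<in> S'" by auto
    have "E (fst p + s) (fibre_D j s (snd p)) \<in> ?N"
      by (rule wsp[OF x fibre_weight(1)[OF wtS[OF S'S[OF x]]]])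
    then show "d j s (?f p) \<in> ?N"
      unfolding d_E[OF SJ[OF S'S[OF x]]] by (intro N.add_in N.sc_in base[OF x])
  qed auto
  have 3: "gg s a w \<in> ?N" if w: "w \<in> ?N" for s a w
  proof (rule span_closed[OF fJ g_lin _ w])
    fix p assume p: "p \<in> (UNIV :: ('n \<Rightarrow> int) set) \<times> S'"
    then have x: "snd p \<in> S'" by auto
    show "gg s a (?f p) \<in> ?N"
      unfolding g_E[OF SJ[OF S'S[OF x]]] by (rule wsp[OF x fibre_weight(2)[OF wtS[OF S'S[OF x]]]])
  qed auto
  show ?thesis unfolding Jsub_def using sub 1 2 3 by blast
qed

text \<open>Weights of two generators are equal or incongruent, so the generators with the weight of
  x0 and all the others span complementary submodules.\<close>

lemma single_weight:
  assumes ind: "Jindec M"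
  obtains lam where "\<And>x. x \<in> S \<Longrightarrow> wt x = lam"
proof -
  let ?f = "\<lambda>p. E (fst p) (snd p)"
  have span: "J \<subseteq> span_fam sc ?f (UNIV \<times> S)" using spanS by (simp add: case_prod_beta')
  have "S \<noteq> {}"
  proof
    assume "S = {}"
    then have "J \<subseteq> {0}" using span by (auto simp: span_fam_def)
    then have "J = {0}" using zero_in by blast
    then show False using ind by (simp add: Jindec_def)
  qed
  then obtain x0 where x0: "x0 \<in> S" by blast
  define S1 where "S1 = {x\<in>S. wt x = wt x0}"
  define S2 where "S2 = {x\<in>S. wt x \<noteq> wt x0}"
  let ?N1 = "span_fam sc ?f (UNIV \<times> S1)" and ?N2 = "span_fam sc ?f (UNIV \<times> S2)"
  have N1: "Jsub M ?N1" by (rule Jsub_span[where Q = "\<lambda>\<mu>. \<mu> = wt x0"]) (simp add: S1_def)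
  have N2: "Jsub M ?N2" by (rule Jsub_span[where Q = "\<lambda>\<mu>. \<mu> \<noteq> wt x0"]) (simp add: S2_def)
  have base: "x \<in> span_fam sc ?f (UNIV \<times> S')" if "x \<in> S'" "S' \<subseteq> S" for x S'
    using span_fam_base[of "(0, x)" "UNIV \<times> S'" ?f] that by (auto simp: E_0)
  have "?N1 \<inter> ?N2 = {0}"
  proof
    show "{0} \<subseteq> ?N1 \<inter> ?N2" using N1 N2 by (auto simp: Jsub_def subsp_def)
    show "?N1 \<inter> ?N2 \<subseteq> {0}"
    proof
      fix w assume "w \<in> ?N1 \<inter> ?N2"
      then have w: "w \<in> ?N1" "w \<in> ?N2" by auto
      obtain A1 c1 where A1: "finite A1" "A1 \<subseteq> UNIV \<times> S1" "w = (\<Sum>p\<in>A1. sc (c1 p) (?f p))"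
        using w(1) by (rule span_famE)
      obtain A2 c2 where A2: "finite A2" "A2 \<subseteq> UNIV \<times> S2" "w = (\<Sum>p\<in>A2. sc (c2 p) (?f p))"
        using w(2) by (rule span_famE)
      \<comment> \<open>An element of the intersection gives a relation on the disjoint union of
        both index sets. Each weight group lies on one side only, since equal total weights force
        equal weights of the generators.\<close>
      define c where "c p = (if p \<in> A1 then c1 p else - c2 p)" for p
      have disj: "A1 \<inter> A2 = {}" using A1(2) A2(2) by (auto simp: S1_def S2_def)
      have AS: "A1 \<union> A2 \<subseteq> UNIV \<times> S" using A1(2) A2(2) by (auto simp: S1_def S2_def)
      have fin: "finite (A1 \<union> A2)" using A1 A2 by simp
      have "(\<Sum>p\<in>A1 \<union> A2. sc (c p) (?f p)) = (\<Sum>p\<in>A1. sc (c p) (?f p)) + (\<Sum>p\<in>A2. sc (c p) (?f p))"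
        by (rule sum.union_disjoint[OF A1(1) A2(1) disj])
      also have "(\<Sum>p\<in>A1. sc (c p) (?f p)) = w" unfolding A1(3) by (rule sum.cong) (auto simp: c_def)
      also have "(\<Sum>p\<in>A2. sc (c p) (?f p)) = (\<Sum>p\<in>A2. - sc (c2 p) (?f p))"
      proof (rule sum.cong[OF refl])
        fix p assume p: "p \<in> A2"
        then have "p \<notin> A1" "?f p \<in> J" using disj AS f_in by auto
        then show "sc (c p) (?f p) = - sc (c2 p) (?f p)" by (simp add: c_def sc_minus_left)
      qed
      also have "\<dots> = - w" unfolding A2(3) by (simp add: sum_negf)
      finally have zero: "(\<Sum>p\<in>A1 \<union> A2. sc (c p) (?f p)) = 0" by simp
      have part: "(\<Sum>p\<in>{p\<in>A1. wtp p = \<mu>}. sc (c1 p) (?f p)) = 0" if \<mu>: "\<mu> \<in> wtp ` A1" for \<mu>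
      proof -
        obtain q where q: "q \<in> A1" "\<mu> = wtp q" using \<mu> by blast
        have "(\<Sum>p\<in>{p\<in>A1 \<union> A2. wtp p = \<mu>}. sc (c p) (?f p)) = 0"
          by (rule grouped[OF fin AS zero])
        also have "{p\<in>A1 \<union> A2. wtp p = \<mu>} = {p\<in>A1. wtp p = \<mu>}"
        proof -
          have "wtp p \<noteq> \<mu>" if p: "p \<in> A2" for p
          proof
            assume "wtp p = \<mu>"
            then have "wtp (fst p, snd p) = wtp (fst q, snd q)" using q by simp
            moreover have "snd p \<in> S" "snd q \<in> S" using AS p q by auto
            ultimately have "wt (snd p) = wt (snd q)" using wtp_eq by blast
            moreover have "snd p \<in> S2" "snd q \<in> S1" using A1(2) A2(2) p q by (auto simp: mem_Times_iff)
            ultimately show False by (auto simp: S1_def S2_def)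
          qed
          then show ?thesis by blast
        qed
        also have "(\<Sum>p\<in>{p\<in>A1. wtp p = \<mu>}. sc (c p) (?f p)) = (\<Sum>p\<in>{p\<in>A1. wtp p = \<mu>}. sc (c1 p) (?f p))"
          by (rule sum.cong) (auto simp: c_def)
        finally show ?thesis .
      qed
      have "w = (\<Sum>\<mu>\<in>wtp ` A1. \<Sum>p\<in>{p\<in>A1. wtp p = \<mu>}. sc (c1 p) (?f p))"
        unfolding A1(3) using A1(1) by (intro sum.group[symmetric]) auto
      also have "\<dots> = 0" using part by simp
      finally show "w \<in> {0}" by simp
    qed
  qed
  moreover have "\<exists>x\<in>?N1. \<exists>y\<in>?N2. w = x + y" if w: "w \<in> J" for w
  proof -
    have "w \<in> span_fam sc ?f (UNIV \<times> S)" using span w by blast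
    then obtain A c where A: "finite A" "A \<subseteq> UNIV \<times> S" "w = (\<Sum>p\<in>A. sc (c p) (?f p))" by (rule span_famE)
    let ?A1 = "A \<inter> UNIV \<times> S1" and ?A2 = "A - UNIV \<times> S1"
    have "w = (\<Sum>p\<in>?A1. sc (c p) (?f p)) + (\<Sum>p\<in>?A2. sc (c p) (?f p))"
      unfolding A(3) by (rule sum.Int_Diff[OF A(1)])
    moreover have "(\<Sum>p\<in>?A1. sc (c p) (?f p)) \<in> ?N1" using A(1) by (intro span_famI) auto
    moreover have "(\<Sum>p\<in>?A2. sc (c p) (?f p)) \<in> ?N2"
      using A(1,2) by (intro span_famI) (auto simp: S1_def S2_def)
    ultimately show ?thesis by blast
  qed
  moreover have "?N1 \<noteq> {0}" using base[of x0 S1] x0 nzS by (auto simp: S1_def)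
  ultimately have N20: "?N2 = {0}" using ind N1 N2 unfolding Jindec_def by blast
  have "wt x = wt x0" if "x \<in> S" for x
  proof (rule ccontr)
    assume "wt x \<noteq> wt x0"
    then have "x \<in> ?N2" using base[of x S2] that by (auto simp: S2_def)
    then show False using N20 nzS that by blast
  qed
  then show thesis by (rule that)
qed

text \<open>The map sends e_m \<otimes> v to e_m v; bijectivity is existence and uniqueness of the
  decomposition into the e_m C.\<close>

lemma Jiso_PhiB:
  fixes U :: "('n, 'g, 'j) Pmod"
  assumes U: "gplus_fdmod sg lb U" "ucar U = fibre" "usc U = sc"
    and D: "\<And>j s v. v \<in> fibre \<Longrightarrow> DU lam U j s v = fibre_D j s v" and G: "\<And>s a v. v \<in> fibre \<Longrightarrow> GU U s a v = fibre_G s a v"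
  shows "Jiso (PhiB lam U) M"
proof -
  interpret U: gplus_module sg lb U by unfold_locales (rule U)
  interpret P: tensor_module sg lb "usc U" "ucar U" "DU lam U" "GU U" "PhiB lam U" lam
    by (rule U.tensor_moduleI[OF U.tensor_shape_PhiB])
  let ?P = "PhiB lam U"
  define \<phi> where "\<phi> w = (\<Sum>m\<in>Poly_Mapping.keys w. E m (lkp w m))" for w
  have car: "w \<in> jcar ?P \<Longrightarrow> lkp w m \<in> fibre" for w m using P.memD U(2) by simp
  have carJ: "w \<in> jcar ?P \<Longrightarrow> lkp w m \<in> J" for w m using car fibre_J by blast
  have \<phi>_sup: "\<phi> w = (\<Sum>m\<in>A. E m (lkp w m))" if "finite A" "Poly_Mapping.keys w \<subseteq> A" for w A
    unfolding \<phi>_def by (rule sum.mono_neutral_left) (use that in \<open>auto simp: in_keys_iff\<close>)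
  have \<phi>J: "\<phi> w \<in> J" if "w \<in> jcar ?P" for w
    unfolding \<phi>_def using carJ[OF that] by (intro sum_in) auto
  have \<phi>_add: "\<phi> (x + y) = \<phi> x + \<phi> y" if xy: "x \<in> jcar ?P" "y \<in> jcar ?P" for x y
  proof -
    let ?A = "Poly_Mapping.keys x \<union> Poly_Mapping.keys y"
    have "\<phi> (x + y) = (\<Sum>m\<in>?A. E m (lkp (x + y) m))" by (rule \<phi>_sup) (auto simp: Poly_Mapping.keys_add)
    also have "\<dots> = (\<Sum>m\<in>?A. E m (lkp x m)) + (\<Sum>m\<in>?A. E m (lkp y m))"
      using carJ[OF xy(1)] carJ[OF xy(2)] by (simp add: lookup_add E.app_add sum.distrib)
    also have "\<dots> = \<phi> x + \<phi> y" by (subst (1 2) \<phi>_sup[of ?A]) auto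
    finally show ?thesis .
  qed
  have \<phi>_sgl: "\<phi> (sgl m v) = E m v" for m v by (simp add: \<phi>_def)
  have \<phi>0: "\<phi> 0 = 0" by (simp add: \<phi>_def)
  have \<phi>_sum: "\<phi> (sum f I) = (\<Sum>i\<in>I. \<phi> (f i))" if "\<And>i. i \<in> I \<Longrightarrow> f i \<in> jcar ?P" for f and I :: "('n \<Rightarrow> int) set"
    using that
  proof (induction I rule: infinite_finite_induct)
    case (insert i I)
    then show ?case using P.M.sum_in[of I f] by (simp add: \<phi>_add)
  qed (auto simp: \<phi>0)
  \<comment> \<open>Linear operators are compared on pure tensors, which for the Lie algebra action
    leaves only \<open>d_E\<close> and \<open>g_E\<close> to be checked.\<close>
  have comm: "\<phi> (T w) = T' (\<phi> w)" if w: "w \<in> jcar ?P" and T: "lin_on (jsc ?P) (jcar ?P) T" and T': "lin_on sc J T'"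
    and gen: "\<And>m v. v \<in> fibre \<Longrightarrow> \<phi> (T (sgl m v)) = T' (E m v)" for T T' w
  proof -
    interpret T: lin "jsc ?P" "jcar ?P" T using P.M.linI[OF T] .
    interpret T': lin sc J T' using linI[OF T'] .
    let ?K = "Poly_Mapping.keys w"
    have sC: "sgl m (lkp w m) \<in> jcar ?P" for m using car[OF w] U(2) by (intro P.sgl_in) simp
    have "T w = (\<Sum>m\<in>?K. T (sgl m (lkp w m)))"
    proof -
      have "T w = T (\<Sum>m\<in>?K. sgl m (lkp w m))" using poly_mapping_sum_single[of w] by simp
      also have "\<dots> = (\<Sum>m\<in>?K. T (sgl m (lkp w m)))" by (rule T.app_sum) (rule sC)
      finally show ?thesis .
    qed
    then have "\<phi> (T w) = (\<Sum>m\<in>?K. \<phi> (T (sgl m (lkp w m))))"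
      by (simp add: \<phi>_sum sC)
    also have "\<dots> = (\<Sum>m\<in>?K. T' (E m (lkp w m)))" using gen car[OF w] by simp
    also have "\<dots> = T' (\<phi> w)" unfolding \<phi>_def by (rule T'.app_sum[symmetric]) (use carJ[OF w] in auto)
    finally show ?thesis .
  qed
  have linP: "lin_on (jsc ?P) (jcar ?P) (jE ?P m)" "lin_on (jsc ?P) (jcar ?P) (jG ?P s a)" for m s a
    using P.catJ unfolding catJ_def by simp_all
  show ?thesis unfolding Jiso_def
  proof (intro exI[of _ \<phi>] conjI ballI allI)
    show "bij_betw \<phi> (jcar ?P) J"
      unfolding bij_betw_def
    proof
      show "inj_on \<phi> (jcar ?P)"
      proof (rule inj_onI)
        fix x y assume xy: "x \<in> jcar ?P" "y \<in> jcar ?P" "\<phi> x = \<phi> y"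
        have z: "x - y \<in> jcar ?P" using xy by simp
        have "\<phi> (x - y) + \<phi> y = \<phi> ((x - y) + y)" using \<phi>_add[OF z xy(2)] by simp
        then have z0: "\<phi> (x - y) = 0" using xy(3) by simp
        have "lkp (x - y) k = 0" for k
        proof (cases "k \<in> Poly_Mapping.keys (x - y)")
          case True
          show ?thesis
            by (rule decompose_unique[OF _ _ z0[unfolded \<phi>_def] True]) (use car[OF z] in auto)
        qed (simp add: in_keys_iff)
        then have "x - y = 0" by (intro poly_mapping_eqI) simp
        then show "x = y" by simp
      qed
      show "\<phi> ` jcar ?P = J"
      proof
        show "\<phi> ` jcar ?P \<subseteq> J" using \<phi>J by auto
        show "J \<subseteq> \<phi> ` jcar ?P"
        proof
          fix w assume "w \<in> J"
          then obtain A c where A: "finite A" "\<And>m. c m \<in> fibre" "w = (\<Sum>m\<in>A. E m (c m))" by (rule decompose) blast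
          have sC: "sgl m (c m) \<in> jcar ?P" for m using A(2) U(2) by (intro P.sgl_in) simp
          have "\<phi> (\<Sum>m\<in>A. sgl m (c m)) = w" unfolding A(3) using sC by (simp add: \<phi>_sum \<phi>_sgl)
          moreover have "(\<Sum>m\<in>A. sgl m (c m)) \<in> jcar ?P" by (rule P.M.sum_in) (rule sC)
          ultimately show "w \<in> \<phi> ` jcar ?P" by blast
        qed
      qed
    qed
    show "\<phi> (x + y) = \<phi> x + \<phi> y" if "x \<in> jcar ?P" "y \<in> jcar ?P" for x y by (rule \<phi>_add[OF that])
    fix x assume x: "x \<in> jcar ?P"
    note act = P.action_sgl[unfolded U(2,3)]
    show "\<phi> (jsc ?P c x) = sc c (\<phi> x)" for c
    proof (rule comm[OF x])
      show "lin_on (jsc ?P) (jcar ?P) (jsc ?P c)" by (rule P.M.lin_sc[OF P.M.lin_id])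
      show "lin_on sc J (sc c)" by (rule lin_sc[OF lin_id])
      show "\<phi> (jsc ?P c (sgl m v)) = sc c (E m v)" if "v \<in> fibre" for m v
        using that fibre_J by (simp add: act \<phi>_sgl E.app_sc)
    qed
    show "\<phi> (jE ?P k x) = E k (\<phi> x)" for k
    proof (rule comm[OF x linP(1) E_lin])
      show "\<phi> (jE ?P k (sgl m v)) = E k (E m v)" if "v \<in> fibre" for m v
        using that fibre_J by (simp add: act \<phi>_sgl E_E add.commute)
    qed
    show "\<phi> (jD ?P j s x) = d j s (\<phi> x)" for j s
    proof (rule comm[OF x P.jD_lin d_lin])
      show "\<phi> (jD ?P j s (sgl m v)) = d j s (E m v)" if v: "v \<in> fibre" for m v
        using fibre_J[OF v] fibre_closed(1)[OF v, THEN fibre_J] by (simp add: act v \<phi>_sgl D d_E E.app_add E.app_sc)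
    qed
    show "\<phi> (jG ?P s a x) = gg s a (\<phi> x)" for s a
    proof (rule comm[OF x linP(2) g_lin])
      show "\<phi> (jG ?P s a (sgl m v)) = gg s a (E m v)" if v: "v \<in> fibre" for m v
        using fibre_J[OF v] by (simp add: act v \<phi>_sgl G g_E)
    qed
  qed
qed

text \<open>With a single weight the operators \<open>fibre_D j 0\<close> are scalars, the condition
  under which difference operators come from a g^+-module.\<close>

lemma indec_iso_PhiB:
  assumes ind: "Jindec M"
  obtains lam and U :: "('n, 'g, 'j) Pmod" where "gplus_fdmod sg lb U" "Jiso (PhiB lam U) M"
proof -
  obtain lam where lam: "\<And>x. x \<in> S \<Longrightarrow> wt x = lam" using single_weight[OF ind] by blast
  have "fibre_D j 0 v = sc (lam j) v" if v: "v \<in> fibre" for j v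
  proof -
    obtain c where c: "v = (\<Sum>x\<in>S. sc (c x) x)" using v fibre_eq by blast
    have x0: "d j 0 x = sc (lam j) x" if "x \<in> S" for x using wtS[OF that] lam[OF that] by (simp add: wtv_def)
    have "d j 0 v = (\<Sum>x\<in>S. d j 0 (sc (c x) x))" unfolding c by (rule d.app_sum) auto
    also have "\<dots> = (\<Sum>x\<in>S. sc (lam j) (sc (c x) x))"
      by (rule sum.cong[OF refl]) (simp add: d.app_sc x0 mult.commute)
    also have "\<dots> = sc (lam j) v" unfolding c by (rule sc_sum[symmetric]) auto
    finally show ?thesis using fibre_J[OF v] by (simp add: fibre_D_def E_0)
  qed
  from DS.gplus_module_of_diff_system[OF this] obtain U where U: "gplus_fdmod sg lb U" "ucar U = fibre" "usc U = sc"
    "\<forall>j s. \<forall>v\<in>fibre. DU lam U j s v = fibre_D j s v" "\<forall>s a. \<forall>v\<in>fibre. GU U s a v = fibre_G s a v" by blast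
  have "Jiso (PhiB lam U) M" by (rule Jiso_PhiB[OF U(1-3)]) (use U(4,5) in auto)
  then show thesis using U(1) by (rule that[rotated])
qed

end

section \<open>Invariance under isomorphism and a carrier type independent of the module\<close>

section \<open>Transport\<close>

lemma iso_preimage:
  assumes bij: "bij_betw \<phi> (jcar M1) (jcar M2)"
    and \<phi>: "\<forall>x\<in>jcar M1. \<forall>y\<in>jcar M1. \<phi> (x + y) = \<phi> x + \<phi> y"
      "\<forall>c. \<forall>x\<in>jcar M1. \<phi> (jsc M1 c x) = jsc M2 c (\<phi> x)"
      "\<forall>m. \<forall>x\<in>jcar M1. \<phi> (jE M1 m x) = jE M2 m (\<phi> x)"
      "\<forall>j s. \<forall>x\<in>jcar M1. \<phi> (jD M1 j s x) = jD M2 j s (\<phi> x)"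
      "\<forall>s a. \<forall>x\<in>jcar M1. \<phi> (jG M1 s a x) = jG M2 s a (\<phi> x)"
    and cat: "catJ sg lb M1" and N: "Jsub M2 N"
  shows "Jsub M1 {x\<in>jcar M1. \<phi> x \<in> N}" "\<phi> ` {x\<in>jcar M1. \<phi> x \<in> N} = N"
proof -
  interpret M1: catJ_module sg lb M1 by unfold_locales (rule cat)
  have closed: "x + y \<in> jcar M1" "jsc M1 c x \<in> jcar M1" "jE M1 m x \<in> jcar M1" "jD M1 j s x \<in> jcar M1" "jG M1 s a x \<in> jcar M1"
    if "x \<in> jcar M1" "y \<in> jcar M1" for x y c m j s a
    using that by simp_all
  have \<phi>0: "\<phi> 0 = 0" using \<phi>(1)[rule_format, of 0 0] by simp
  show "Jsub M1 {x\<in>jcar M1. \<phi> x \<in> N}"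
    using N \<phi> closed \<phi>0 unfolding Jsub_def subsp_def by simp
  have "N \<subseteq> jcar M2" using N by (simp add: Jsub_def subsp_def)
  then show "\<phi> ` {x\<in>jcar M1. \<phi> x \<in> N} = N" using bij by (auto simp: bij_betw_def)
qed

lemma Jirred_iso:
  assumes iso: "Jiso M1 M2" and cat: "catJ sg lb M1" and irr: "Jirred M1"
  shows "Jirred M2"
proof -
  obtain \<phi> where \<phi>: "bij_betw \<phi> (jcar M1) (jcar M2)"
      "\<forall>x\<in>jcar M1. \<forall>y\<in>jcar M1. \<phi> (x + y) = \<phi> x + \<phi> y"
      "\<forall>c. \<forall>x\<in>jcar M1. \<phi> (jsc M1 c x) = jsc M2 c (\<phi> x)"
      "\<forall>m. \<forall>x\<in>jcar M1. \<phi> (jE M1 m x) = jE M2 m (\<phi> x)"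
      "\<forall>j s. \<forall>x\<in>jcar M1. \<phi> (jD M1 j s x) = jD M2 j s (\<phi> x)"
      "\<forall>s a. \<forall>x\<in>jcar M1. \<phi> (jG M1 s a x) = jG M2 s a (\<phi> x)"
    using iso unfolding Jiso_def by blast
  interpret M1: catJ_module sg lb M1 by unfold_locales (rule cat)
  have \<phi>0: "\<phi> 0 = 0" using \<phi>(2)[rule_format, of 0 0] by simp
  have img: "\<phi> ` jcar M1 = jcar M2" using \<phi>(1) by (simp add: bij_betw_def)
  show ?thesis unfolding Jirred_def
  proof (intro conjI allI impI)
    obtain x where "x \<in> jcar M1" "x \<noteq> 0" using irr M1.zero_in unfolding Jirred_def by blast
    moreover from this have "\<phi> x \<noteq> \<phi> 0" using \<phi>(1) M1.zero_in by (auto simp: bij_betw_def inj_on_def)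
    ultimately have "\<phi> x \<in> jcar M2" "\<phi> x \<noteq> 0" using img \<phi>0 by auto
    then show "jcar M2 \<noteq> {0}" by blast
  next
    fix N assume N: "Jsub M2 N"
    let ?N = "{x\<in>jcar M1. \<phi> x \<in> N}"
    have "Jsub M1 ?N" and im: "\<phi> ` ?N = N" using iso_preimage[OF \<phi> cat N] by auto
    then have "?N = {0} \<or> ?N = jcar M1" using irr by (simp add: Jirred_def)
    then show "N = {0} \<or> N = jcar M2"
    proof
      assume "?N = {0}"
      then show ?thesis using im \<phi>0 by auto
    next
      assume "?N = jcar M1"
      then show ?thesis using im img by simp
    qed
  qed
qed

lemma Jindec_iso:
  assumes iso: "Jiso M1 M2" and cat: "catJ sg lb M1" and ind: "Jindec M1"
  shows "Jindec M2"
proof -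
  obtain \<phi> where \<phi>: "bij_betw \<phi> (jcar M1) (jcar M2)"
      "\<forall>x\<in>jcar M1. \<forall>y\<in>jcar M1. \<phi> (x + y) = \<phi> x + \<phi> y"
      "\<forall>c. \<forall>x\<in>jcar M1. \<phi> (jsc M1 c x) = jsc M2 c (\<phi> x)"
      "\<forall>m. \<forall>x\<in>jcar M1. \<phi> (jE M1 m x) = jE M2 m (\<phi> x)"
      "\<forall>j s. \<forall>x\<in>jcar M1. \<phi> (jD M1 j s x) = jD M2 j s (\<phi> x)"
      "\<forall>s a. \<forall>x\<in>jcar M1. \<phi> (jG M1 s a x) = jG M2 s a (\<phi> x)"
    using iso unfolding Jiso_def by blast
  interpret M1: catJ_module sg lb M1 by unfold_locales (rule cat)
  have \<phi>0: "\<phi> 0 = 0" using \<phi>(2)[rule_format, of 0 0] by simp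
  have img: "\<phi> ` jcar M1 = jcar M2" and inj: "inj_on \<phi> (jcar M1)" using \<phi>(1) by (auto simp: bij_betw_def)
  have ker: "x = 0" if "x \<in> jcar M1" "\<phi> x = 0" for x
    using inj_onD[OF inj, of x 0] that \<phi>0 by simp
  show ?thesis unfolding Jindec_def
  proof (intro conjI notI)
    obtain x where "x \<in> jcar M1" "x \<noteq> 0" using ind M1.zero_in unfolding Jindec_def by blast
    then have x: "\<phi> x \<in> jcar M2" "\<phi> x \<noteq> 0" using img ker[of x] by auto
    assume "jcar M2 = {0}"
    then show False using x by simp
  next
    assume "\<exists>N1 N2. Jsub M2 N1 \<and> Jsub M2 N2 \<and> N1 \<noteq> {0} \<and> N2 \<noteq> {0} \<and> N1 \<inter> N2 = {0}
      \<and> (\<forall>w\<in>jcar M2. \<exists>x\<in>N1. \<exists>y\<in>N2. w = x + y)"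
    then obtain N1 N2 where H: "Jsub M2 N1 \<and> Jsub M2 N2 \<and> N1 \<noteq> {0} \<and> N2 \<noteq> {0} \<and> N1 \<inter> N2 = {0}
      \<and> (\<forall>w\<in>jcar M2. \<exists>x\<in>N1. \<exists>y\<in>N2. w = x + y)" by (elim exE) (rule that)
    then have N: "Jsub M2 N1" "Jsub M2 N2" "N1 \<noteq> {0}" "N2 \<noteq> {0}" "N1 \<inter> N2 = {0}"
      and sum: "\<And>w. w \<in> jcar M2 \<Longrightarrow> \<exists>x\<in>N1. \<exists>y\<in>N2. w = x + y" by simp_all
    let ?P = "\<lambda>N. {x\<in>jcar M1. \<phi> x \<in> N}"
    note 1 = iso_preimage[OF \<phi> cat N(1)] and 2 = iso_preimage[OF \<phi> cat N(2)]
    have nz: "?P N1 \<noteq> {0}" "?P N2 \<noteq> {0}" using 1(2) 2(2) N(3,4) \<phi>0 by auto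
    have int: "?P N1 \<inter> ?P N2 = {0}"
    proof
      show "?P N1 \<inter> ?P N2 \<subseteq> {0}"
      proof
        fix x assume x: "x \<in> ?P N1 \<inter> ?P N2"
        then have "\<phi> x \<in> N1 \<inter> N2" by simp
        then have "\<phi> x = 0" unfolding N(5) by simp
        then show "x \<in> {0}" using ker[of x] x by simp
      qed
      show "{0} \<subseteq> ?P N1 \<inter> ?P N2" using N(1,2) \<phi>0 by (simp add: Jsub_def subsp_def)
    qed
    have "\<exists>x\<in>?P N1. \<exists>y\<in>?P N2. w = x + y" if w: "w \<in> jcar M1" for w
    proof -
      have "\<phi> w \<in> jcar M2" using w img by auto
      then obtain x y where xy: "x \<in> N1" "y \<in> N2" "\<phi> w = x + y" using sum by blast
      have "x \<in> \<phi> ` ?P N1" using xy(1) by (simp only: 1(2))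
      then obtain x' where x': "x = \<phi> x'" "x' \<in> ?P N1" by (rule imageE)
      have "y \<in> \<phi> ` ?P N2" using xy(2) by (simp only: 2(2))
      then obtain y' where y': "y = \<phi> y'" "y' \<in> ?P N2" by (rule imageE)
      have "\<phi> w = \<phi> (x' + y')" using \<phi>(2) x' y' xy(3) by simp
      then have "w = x' + y'" using inj_onD[OF inj, of w "x' + y'"] w x' y' by simp
      then show ?thesis using x' y' by blast
    qed
    then have "\<exists>N1 N2. Jsub M1 N1 \<and> Jsub M1 N2 \<and> N1 \<noteq> {0} \<and> N2 \<noteq> {0} \<and> N1 \<inter> N2 = {0}
        \<and> (\<forall>w\<in>jcar M1. \<exists>x\<in>N1. \<exists>y\<in>N2. w = x + y)"
      using nz int 1(1) 2(1) by (intro exI[of _ "?P N1"] exI[of _ "?P N2"]) simp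
    then show False using ind by (simp add: Jindec_def)
  qed
qed

lemma Jirred_Jindec:
  assumes irr: "Jirred M" and cat: "catJ sg lb M" shows "Jindec M"
  unfolding Jindec_def
proof (intro conjI notI)
  show "jcar M = {0} \<Longrightarrow> False" using irr by (simp add: Jirred_def)
  assume "\<exists>N1 N2. Jsub M N1 \<and> Jsub M N2 \<and> N1 \<noteq> {0} \<and> N2 \<noteq> {0} \<and> N1 \<inter> N2 = {0}
      \<and> (\<forall>w\<in>jcar M. \<exists>x\<in>N1. \<exists>y\<in>N2. w = x + y)"
  then obtain N1 N2 where "Jsub M N1 \<and> Jsub M N2 \<and> N1 \<noteq> {0} \<and> N2 \<noteq> {0} \<and> N1 \<inter> N2 = {0}
      \<and> (\<forall>w\<in>jcar M. \<exists>x\<in>N1. \<exists>y\<in>N2. w = x + y)" by (elim exE) (rule that)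
  then have N: "Jsub M N1" "Jsub M N2" "N1 \<noteq> {0}" "N2 \<noteq> {0}" "N1 \<inter> N2 = {0}" by simp_all
  have "K = {0} \<or> K = jcar M" if "Jsub M K" for K using irr that unfolding Jirred_def by blast
  from this[OF N(1)] this[OF N(2)] have "N1 = jcar M" "N2 = jcar M" using N(3,4) by simp_all
  then show False using N by simp
qed

text \<open>The fibre lives in the type of the given module. Coordinates in a basis move it to one
  fixed type that contains a copy of every finite-dimensional space, as the surjectivity statements
  demand.\<close>

lemma coordinate_module:
  fixes U :: "('n::finite, 'g::ab_group_add, 'u::ab_group_add) Pmod"
  assumes U: "gplus_fdmod sg lb U"
  obtains U0 :: "('n, 'g, nat \<Rightarrow>\<^sub>0 complex) Pmod" where "gplus_fdmod sg lb U0" "Piso U0 U"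
proof -
  interpret U: gplus_module sg lb U by unfold_locales (rule U)
  obtain q and b :: "nat \<Rightarrow> 'u" where b: "\<And>i. i < q \<Longrightarrow> b i \<in> ucar U" "indep_fam (usc U) b {..<q}"
      "ucar U \<subseteq> span_fam (usc U) b {..<q}"
    by (rule U.fin_dim_basis[OF U.fd], rule that) simp_all
  define K where "K = {f :: nat \<Rightarrow>\<^sub>0 complex. \<forall>i. q \<le> i \<longrightarrow> lkp f i = 0}"
  \<comment> \<open>Scalar multiplication, written as convolution with a constant.\<close>
  define s0 where "s0 = (\<lambda>(c::complex) (f :: nat \<Rightarrow>\<^sub>0 complex). sgl 0 c * f)"
  define \<psi> where "\<psi> f = (\<Sum>i<q. usc U (lkp f i) (b i))" for f :: "nat \<Rightarrow>\<^sub>0 complex"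
  have l0: "lkp (s0 c f) i = c * lkp f i" for c f i
  proof -
    have "lkp (Poly_Mapping.map ((*) c) f) i = c * lkp f i" by (simp add: Poly_Mapping.map.rep_eq when_def)
    then show ?thesis by (simp add: s0_def mult_map_scale_conv_mult)
  qed
  have vsK: "vs_on s0 K" unfolding vs_on_def
    by (auto simp: K_def l0 lookup_add algebra_simps intro!: poly_mapping_eqI)
  interpret K: vsp s0 K using vsK by (simp add: vsp_def)
  have \<psi>C: "\<psi> f \<in> ucar U" for f unfolding \<psi>_def by (intro U.sum_in U.sc_in) (use b in auto)
  have \<psi>_add: "\<psi> (f + g) = \<psi> f + \<psi> g" for f g
    unfolding \<psi>_def lookup_add sum.distrib[symmetric] by (rule sum.cong[OF refl]) (use b in \<open>auto simp: U.sc_left\<close>)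
  have \<psi>_sc: "\<psi> (s0 c f) = usc U c (\<psi> f)" for c f
  proof -
    have "usc U c (\<psi> f) = (\<Sum>i<q. usc U c (usc U (lkp f i) (b i)))"
      unfolding \<psi>_def by (rule U.sc_sum) (use b in auto)
    also have "\<dots> = \<psi> (s0 c f)" unfolding \<psi>_def l0 by (rule sum.cong[OF refl]) (use b in auto)
    finally show ?thesis ..
  qed
  have bij: "bij_betw \<psi> K (ucar U)"
    unfolding bij_betw_def
  proof
    show "inj_on \<psi> K"
    proof (rule inj_onI)
      fix f g assume fg: "f \<in> K" "g \<in> K" "\<psi> f = \<psi> g"
      have "\<psi> (f - g) + \<psi> g = \<psi> g" using fg(3) \<psi>_add[of "f - g" g] by simp
      then have "(\<Sum>i\<in>{..<q}. usc U (lkp (f - g) i) (b i)) = 0" by (simp add: \<psi>_def)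
      then have z: "\<forall>i\<in>{..<q}. lkp (f - g) i = 0"
        using b(2)[unfolded indep_fam_def, THEN spec, THEN spec, of "{..<q}" "lkp (f - g)"] by simp
      show "f = g"
      proof (rule poly_mapping_eqI)
        fix i
        show "lkp f i = lkp g i"
        proof (cases "i < q")
          case True
          then show ?thesis using z by (simp add: lookup_minus)
        next
          case False
          then show ?thesis using fg(1,2) by (simp add: K_def)
        qed
      qed
    qed
    show "\<psi> ` K = ucar U"
    proof
      show "\<psi> ` K \<subseteq> ucar U" using \<psi>C by auto
      show "ucar U \<subseteq> \<psi> ` K"
      proof
        fix v assume "v \<in> ucar U"
        then obtain c where c: "v = (\<Sum>i<q. usc U (c i) (b i))"
          using U.span_fam_finite[of "{..<q}" b v] b by auto
        let ?f = "\<Sum>i<q. sgl i (c i)"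
        have l: "lkp ?f k = (if k < q then c k else 0)" for k
        proof -
          have "lkp ?f k = (\<Sum>i<q. if i = k then c i else 0)"
            unfolding lookup_sum by (rule sum.cong[OF refl]) (simp add: lookup_single when_def)
          then show ?thesis by simp
        qed
        have "?f \<in> K" using l by (simp add: K_def)
        moreover have "\<psi> ?f = v" unfolding \<psi>_def c by (rule sum.cong[OF refl]) (simp add: l)
        ultimately show "v \<in> \<psi> ` K" by blast
      qed
    qed
  qed
  define \<phi> where "\<phi> = inv_into K \<psi>"
  have \<phi>\<psi>: "\<phi> (\<psi> f) = f" if "f \<in> K" for f using bij that by (simp add: \<phi>_def bij_betw_inv_into_left)
  have \<psi>\<phi>: "\<psi> (\<phi> v) = v" and \<phi>K: "\<phi> v \<in> K" if "v \<in> ucar U" for v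
    using bij that by (auto simp: \<phi>_def bij_betw_inv_into_right bij_betw_def inv_into_into)
  have \<psi>_inj: "f = g" if "\<psi> f = \<psi> g" "f \<in> K" "g \<in> K" for f g
    using bij that by (auto simp: bij_betw_def inj_on_def)
  have \<psi>_diff: "\<psi> (f - g) = \<psi> f - \<psi> g" for f g using \<psi>_add[of "f - g" g] by simp
  \<comment> \<open>The action is transported by \<psi> and its inverse, so each relation is
    verified after applying the injective map \<psi>.\<close>
  define U0 :: "('n, 'g, nat \<Rightarrow>\<^sub>0 complex) Pmod" where
    "U0 = \<lparr>ucar = K, usc = s0, uR = (\<lambda>\<alpha> j f. \<phi> (uR U \<alpha> j (\<psi> f))), uP = (\<lambda>\<beta> a f. \<phi> (uP U \<beta> a (\<psi> f)))\<rparr>"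
  have sel: "ucar U0 = K" "usc U0 = s0" by (simp_all add: U0_def)
  have R: "uR U0 \<alpha> j f \<in> K" "\<psi> (uR U0 \<alpha> j f) = uR U \<alpha> j (\<psi> f)" if "\<alpha> \<noteq> 0" for \<alpha> j f
    using \<phi>K \<psi>\<phi> U.R_in[OF that \<psi>C] by (auto simp: U0_def)
  have P: "uP U0 \<beta> a f \<in> K" "\<psi> (uP U0 \<beta> a f) = uP U \<beta> a (\<psi> f)" for \<beta> a f
    using \<phi>K \<psi>\<phi> U.P_in[OF \<psi>C] by (auto simp: U0_def)
  have finK: "fin_dim s0 K" unfolding fin_dim_def
  proof (intro exI[of _ "(\<lambda>i. sgl i 1) ` {..<q}"] conjI)
    let ?B = "(\<lambda>i. sgl i (1::complex)) ` {..<q}"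
    show "finite ?B" by simp
    show B: "?B \<subseteq> K" by (auto simp: K_def lookup_single when_def)
    show "K \<subseteq> span_fam s0 id ?B"
    proof
      fix f assume f: "f \<in> K"
      have "f = (\<Sum>i<q. s0 (lkp f i) (sgl i 1))"
      proof (rule poly_mapping_eqI)
        fix k
        have "lkp (\<Sum>i<q. s0 (lkp f i) (sgl i 1)) k = (\<Sum>i<q. if i = k then lkp f i else 0)"
          unfolding lookup_sum by (rule sum.cong[OF refl]) (simp add: l0 lookup_single when_def)
        then show "lkp f k = lkp (\<Sum>i<q. s0 (lkp f i) (sgl i 1)) k" using f by (simp add: K_def)
      qed
      moreover have sub: "subsp s0 K (span_fam s0 id ?B)" by (rule K.span_fam_subsp) (use B in auto)
      interpret N: vsp s0 "span_fam s0 id ?B" using subsp_vsp[OF K.vsp_axioms sub] .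
      have "sgl i 1 \<in> span_fam s0 id ?B" if "i < q" for i
        using K.span_fam_base[of "sgl i 1" ?B id] that B by auto
      then have "(\<Sum>i<q. s0 (lkp f i) (sgl i 1)) \<in> span_fam s0 id ?B" by (intro N.sum_in N.sc_in) auto
      ultimately show "f \<in> span_fam s0 id ?B" by simp
    qed
  qed
  have "gplus_fdmod sg lb U0"
    unfolding gplus_fdmod_def sel
  proof (intro conjI allI impI ballI)
    show "lin_on s0 K (uR U0 \<alpha> j)" if \<alpha>: "\<alpha> \<noteq> 0" for \<alpha> j
      unfolding lin_on_def
    proof (intro conjI allI ballI)
      interpret L: lin "usc U" "ucar U" "uR U \<alpha> j" using U.linI[OF U.R_lin[OF \<alpha>]] .
      show "uR U0 \<alpha> j f \<in> K" for f by (rule R(1)[OF \<alpha>])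
      show "uR U0 \<alpha> j (f + g) = uR U0 \<alpha> j f + uR U0 \<alpha> j g" if "f \<in> K" "g \<in> K" for f g
        by (rule \<psi>_inj) (simp_all add: R[OF \<alpha>] \<psi>_add \<psi>C L.app_add)
      show "uR U0 \<alpha> j (s0 c f) = s0 c (uR U0 \<alpha> j f)" if "f \<in> K" for c f
        by (rule \<psi>_inj) (simp_all add: R[OF \<alpha>] \<psi>_sc \<psi>C L.app_sc)
    qed
    show "lin_on s0 K (uP U0 \<beta> a)" for \<beta> a
      unfolding lin_on_def
    proof (intro conjI allI ballI)
      interpret L: lin "usc U" "ucar U" "uP U \<beta> a" using U.linI[OF U.P_lin] .
      show "uP U0 \<beta> a f \<in> K" for f by (rule P(1))
      show "uP U0 \<beta> a (f + g) = uP U0 \<beta> a f + uP U0 \<beta> a g" if "f \<in> K" "g \<in> K" for f g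
        by (rule \<psi>_inj) (simp_all add: P \<psi>_add \<psi>C L.app_add)
      show "uP U0 \<beta> a (s0 c f) = s0 c (uP U0 \<beta> a f)" if "f \<in> K" for c f
        by (rule \<psi>_inj) (simp_all add: P \<psi>_sc \<psi>C L.app_sc)
    qed
    fix f assume f: "f \<in> K"
    show "uP U0 \<beta> (a + a') f = uP U0 \<beta> a f + uP U0 \<beta> a' f" for \<beta> a a'
      by (rule \<psi>_inj) (simp_all add: P \<psi>_add \<psi>C U.P_add)
    show "uP U0 \<beta> (sg c a) f = s0 c (uP U0 \<beta> a f)" for \<beta> c a
      by (rule \<psi>_inj) (simp_all add: P \<psi>_sc \<psi>C U.P_sg)
    show "uR U0 \<alpha> j (uR U0 \<gamma> k f) - uR U0 \<gamma> k (uR U0 \<alpha> j f)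
        = s0 (of_nat (\<gamma> j)) (uR U0 (\<alpha> + \<gamma> - eps j) k f) - s0 (of_nat (\<alpha> k)) (uR U0 (\<alpha> + \<gamma> - eps k) j f)"
      if \<alpha>\<gamma>: "\<alpha> \<noteq> 0" "\<gamma> \<noteq> 0" for \<alpha> \<gamma> j k
    proof -
      \<comment> \<open>The axioms say nothing about \<open>uR\<close> at index 0, so the bracket
        can be transported only once its index is known to be nonzero.\<close>
      have nz: "\<alpha> + \<gamma> - eps i \<noteq> 0" for i
      proof
        assume *: "\<alpha> + \<gamma> - eps i = 0"
        have **: "\<alpha> l + \<gamma> l \<le> (if l = i then 1 else 0)" for l
          using fun_cong[OF *, of l] by (simp add: eps_def)
        from \<alpha>\<gamma> obtain a b where "\<alpha> a \<noteq> 0" "\<gamma> b \<noteq> 0" by (auto simp: fun_eq_iff)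
        then show False using **[of a] **[of b] by (auto split: if_splits)
      qed
      show ?thesis
        by (rule \<psi>_inj) (simp_all add: R \<alpha>\<gamma> nz \<psi>_diff \<psi>_sc \<psi>C U.RR)
    qed
    show "uR U0 \<alpha> j (uP U0 \<beta> a f) - uP U0 \<beta> a (uR U0 \<alpha> j f) = s0 (of_nat (\<beta> j)) (uP U0 (\<alpha> + \<beta> - eps j) a f)"
      if "\<alpha> \<noteq> 0" for \<alpha> \<beta> j a
      by (rule \<psi>_inj) (simp_all add: R that P \<psi>_diff \<psi>_sc \<psi>C U.RP)
    show "uP U0 \<alpha> a (uP U0 \<beta> c f) - uP U0 \<beta> c (uP U0 \<alpha> a f) = uP U0 (\<alpha> + \<beta>) (lb a c) f" for \<alpha> \<beta> a c
      by (rule \<psi>_inj) (simp_all add: P \<psi>_diff \<psi>C U.PP)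
  qed (use vsK finK in auto)
  moreover have "Piso U0 U" unfolding Piso_def sel
    by (intro exI[of _ \<psi>]) (simp add: bij \<psi>_add \<psi>_sc R P)
  ultimately show thesis by (rule that)
qed

lemma indecomposable_PhiB:
  fixes M :: "('n::finite, 'g::ab_group_add, 'j::ab_group_add) Jmod"
  assumes M: "catJ sg lb M" "Jindec M"
  obtains lam and U :: "('n, 'g, nat \<Rightarrow>\<^sub>0 complex) Pmod"
    where "gplus_fdmod sg lb U" "Pindec U" "Jiso M (PhiB lam U)"
proof -
  interpret M: catJ_module sg lb M by unfold_locales (rule M(1))
  obtain S and wt :: "'j \<Rightarrow> 'n \<Rightarrow> complex" where "finite S" "\<And>x. x \<in> S \<Longrightarrow> M.wtv (wt x) x" "\<And>x. x \<in> S \<Longrightarrow> x \<noteq> 0"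
    "\<And>x. x \<in> S \<Longrightarrow> wrep (wt x) = wt x"
    "M.J \<subseteq> span_fam M.sc (\<lambda>(m, x). M.E m x) (UNIV \<times> S)"
    by (rule M.weight_generators) blast
  then interpret W: catJ_generators sg lb M S wt by unfold_locales
  obtain lam and U1 :: "('n, 'g, 'j) Pmod" where U1: "gplus_fdmod sg lb U1" "Jiso (PhiB lam U1) M"
    using W.indec_iso_PhiB[OF M(2)] by blast
  interpret U1: gplus_module sg lb U1 by unfold_locales (rule U1(1))
  obtain U :: "('n, 'g, nat \<Rightarrow>\<^sub>0 complex) Pmod" where U: "gplus_fdmod sg lb U" "Piso U U1"
    using coordinate_module[OF U1(1)] by blast
  interpret U: gplus_module sg lb U by unfold_locales (rule U(1))
  have "Jiso (PhiB lam U) (PhiB lam U1)"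
    by (rule Jiso_iff_Piso(1)[OF U(1) U1(1) U.tensor_shape_PhiB U1.tensor_shape_PhiB]) (simp add: congZ_refl U(2))
  then have "Jiso (PhiB lam U) M" using U1(2) by (rule Jiso_trans)
  then have iso: "Jiso M (PhiB lam U)"
    by (rule Jiso_sym) (rule tensor_module.catJ[OF U.tensor_moduleI[OF U.tensor_shape_PhiB]])
  have "Jindec (PhiB lam U)" by (rule Jindec_iso[OF iso M])
  then have "Pindec U" using U.Jindec_iff_Pindec[OF U.tensor_shape_PhiB] by blast
  then show thesis using U(1) iso by (intro that)
qed

section \<open>The Euler grading and irreducible modules\<close>

section \<open>Irreducible modules\<close>

lemma deg_shift': "\<alpha> k \<noteq> 0 \<Longrightarrow> Suc (deg (\<alpha> + \<gamma> - eps k)) = deg \<alpha> + deg \<gamma>"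
  using deg_shift[of \<alpha> k \<gamma>] by (simp add: add.commute)

context gplus_module
begin

definition Eul :: "'u \<Rightarrow> 'u" where
  "Eul v = (\<Sum>i\<in>UNIV. uR U (eps i) i v)"

lemma Eul_lin: "lin_on sc C Eul"
  unfolding Eul_def[abs_def] by (intro lin_sum R_lin) simp

sublocale Eul: lin sc C Eul by (rule linI[OF Eul_lin])

text \<open>Homogeneity of degree k under ad of the Euler field, formulated for arbitrary operators
  so that products of elements of g^+ are covered.\<close>

definition graded :: "nat \<Rightarrow> ('u \<Rightarrow> 'u) \<Rightarrow> bool" where
  "graded k X \<longleftrightarrow> lin_on sc C X \<and> (\<forall>v\<in>C. Eul (X v) - X (Eul v) = sc (of_nat k) (X v))"

text \<open>Summing over i the eigenvalues of the single fields z_i d/dz_i, which are \<alpha>_i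
  lowered by one for i = j, gives |\<alpha>| - 1.\<close>

lemma graded_R: assumes "\<alpha> \<noteq> 0" shows "graded (deg \<alpha> - 1) (uR U \<alpha> j)"
  unfolding graded_def
proof (intro conjI ballI)
  show "lin_on sc C (uR U \<alpha> j)" by (rule R_lin[OF assms])
  fix v assume v: "v \<in> C"
  interpret R: lin sc C "uR U \<alpha> j" using linI[OF R_lin[OF assms]] .
  have canc: "eps i + \<alpha> - eps i = \<alpha>" for i by (auto simp: fun_eq_iff)
  have trm: "uR U (eps i) i (uR U \<alpha> j v) - uR U \<alpha> j (uR U (eps i) i v)
      = sc (of_nat (\<alpha> i) - (if i = j then 1 else 0)) (uR U \<alpha> j v)" for i
  proof (cases "i = j")
    case True
    then show ?thesis using RR[of "eps i" \<alpha> v i j] assms v by (simp add: canc eps_apply sc_diff_left)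
  next
    case False
    have "eps i + \<alpha> - eps j \<noteq> (0 :: 'n \<Rightarrow> nat)"
    proof
      assume "eps i + \<alpha> - eps j = 0"
      from fun_cong[OF this, of i] False show False by (simp add: eps_apply)
    qed
    then show ?thesis using RR[of "eps i" \<alpha> v i j] assms v False by (simp add: canc eps_apply)
  qed
  have "Eul (uR U \<alpha> j v) - uR U \<alpha> j (Eul v)
      = (\<Sum>i\<in>UNIV. uR U (eps i) i (uR U \<alpha> j v) - uR U \<alpha> j (uR U (eps i) i v))"
    unfolding Eul_def using v by (simp add: R.app_sum sum_subtractf)
  also have "\<dots> = sc (\<Sum>i\<in>UNIV. of_nat (\<alpha> i) - (if i = j then 1 else 0)) (uR U \<alpha> j v)"
    unfolding trm by (rule sc_sum_left[symmetric]) (use assms v in simp)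
  also have "(\<Sum>i\<in>UNIV. of_nat (\<alpha> i) - (if i = j then 1 else 0)) = (of_nat (deg \<alpha> - 1) :: complex)"
  proof -
    have "1 \<le> deg \<alpha>" using assms deg_0_iff[of \<alpha>] by linarith
    then have "(of_nat (deg \<alpha> - 1) :: complex) = of_nat (deg \<alpha>) - 1" by (simp only: of_nat_diff of_nat_1)
    also have "\<dots> = (\<Sum>i\<in>UNIV. of_nat (\<alpha> i) - (if i = j then 1 else 0))" by (simp add: sum_subtractf deg_def)
    finally show ?thesis ..
  qed
  finally show "Eul (uR U \<alpha> j v) - uR U \<alpha> j (Eul v) = sc (of_nat (deg \<alpha> - 1)) (uR U \<alpha> j v)" .
qed

lemma graded_P: "graded (deg \<beta>) (uP U \<beta> a)"
  unfolding graded_def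
proof (intro conjI ballI)
  show "lin_on sc C (uP U \<beta> a)" by (rule P_lin)
  fix v assume v: "v \<in> C"
  interpret P: lin sc C "uP U \<beta> a" using linI[OF P_lin] .
  have canc: "eps i + \<beta> - eps i = \<beta>" for i by (auto simp: fun_eq_iff)
  have trm: "uR U (eps i) i (uP U \<beta> a v) - uP U \<beta> a (uR U (eps i) i v) = sc (of_nat (\<beta> i)) (uP U \<beta> a v)" for i
    using RP[of "eps i" v i \<beta> a] v by (simp add: canc)
  have "Eul (uP U \<beta> a v) - uP U \<beta> a (Eul v)
      = (\<Sum>i\<in>UNIV. uR U (eps i) i (uP U \<beta> a v) - uP U \<beta> a (uR U (eps i) i v))"
    unfolding Eul_def using v by (simp add: P.app_sum sum_subtractf)
  also have "\<dots> = sc (\<Sum>i\<in>UNIV. of_nat (\<beta> i)) (uP U \<beta> a v)"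
    unfolding trm by (rule sc_sum_left[symmetric]) (use v in simp)
  finally show "Eul (uP U \<beta> a v) - uP U \<beta> a (Eul v) = sc (of_nat (deg \<beta>)) (uP U \<beta> a v)"
    by (simp add: deg_def)
qed

lemma graded_comp: assumes X: "graded k X" and Y: "graded l Y" shows "graded (l + k) (\<lambda>v. Y (X v))"
proof -
  have XC: "v \<in> C \<Longrightarrow> X v \<in> C" for v using X by (simp add: graded_def lin_on_def)
  interpret Y: lin sc C Y using Y by (intro linI) (simp add: graded_def)
  have "Eul (Y (X v)) - Y (X (Eul v)) = sc (of_nat (l + k)) (Y (X v))" if v: "v \<in> C" for v
  proof -
    have 1: "Eul (Y (X v)) = Y (Eul (X v)) + sc (of_nat l) (Y (X v))"
      using Y XC[OF v] unfolding graded_def by (simp add: algebra_simps)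
    have 2: "Eul (X v) = X (Eul v) + sc (of_nat k) (X v)"
      using X v unfolding graded_def by (simp add: algebra_simps)
    show ?thesis unfolding 1 2 using XC v by (simp add: Y.app_add Y.app_sc sc_left algebra_simps)
  qed
  then show ?thesis using X Y unfolding graded_def by (simp add: lin_comp)
qed

text \<open>The eigenvalue count is applied to all homogeneous operators at once, so one bound holds
  for products of any length.\<close>

lemma graded_bound: "\<exists>N. \<forall>k X. N \<le> k \<longrightarrow> graded k X \<longrightarrow> (\<forall>v\<in>C. X v = 0)"
proof -
  let ?S = "{x. graded (snd x) (fst x)}"
  have "finite ((\<lambda>x. of_nat (snd x) :: complex) ` {x\<in>?S. \<exists>v\<in>C. fst x v \<noteq> 0})"
    by (rule finite_ad_eigenvalues[OF fd Eul_lin, where X = fst]) (simp_all add: graded_def)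
  then have "finite ((of_nat :: nat \<Rightarrow> complex) ` (snd ` {x\<in>?S. \<exists>v\<in>C. fst x v \<noteq> 0}))"
    by (simp only: image_image)
  then have "finite (snd ` {x\<in>?S. \<exists>v\<in>C. fst x v \<noteq> 0})"
    by (rule finite_imageD) (simp add: inj_on_def)
  then obtain N where "\<forall>k\<in>snd ` {x\<in>?S. \<exists>v\<in>C. fst x v \<noteq> 0}. k < N"
    unfolding finite_nat_set_iff_bounded by (elim exE) (rule that)
  then have N: "k < N" if "k \<in> snd ` {x\<in>?S. \<exists>v\<in>C. fst x v \<noteq> 0}" for k
    using that by (rule bspec)
  have "X v = 0" if "N \<le> k" "graded k X" "v \<in> C" for k X v
  proof (rule ccontr)
    assume "X v \<noteq> 0"
    then have "k \<in> snd ` {x\<in>?S. \<exists>v\<in>C. fst x v \<noteq> 0}" using that by (intro image_eqI[of _ _ "(X, k)"]) auto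
    from N[OF this] that(1) show False by simp
  qed
  then show ?thesis by blast
qed

text \<open>The common kernel of the elements of positive degree: z^\<alpha> d/dz_j has degree
  |\<alpha>| - 1, hence the threshold 2 for it and 1 for z^\<beta> a.\<close>

definition Kill :: "'u set" where
  "Kill = {v\<in>C. (\<forall>\<alpha> j. 2 \<le> deg \<alpha> \<longrightarrow> uR U \<alpha> j v = 0) \<and> (\<forall>\<beta> a. 1 \<le> deg \<beta> \<longrightarrow> uP U \<beta> a v = 0)}"

lemma deg_nz: "1 \<le> deg \<alpha> \<Longrightarrow> \<alpha> \<noteq> 0"
  using deg_0_iff[of \<alpha>] by auto

text \<open>Operators of positive degree are nilpotent as a family, so a longest nonvanishing product
  of them produces a vector they all kill.\<close>
lemma Kill_nonzero: assumes "C \<noteq> {0}" shows "Kill \<noteq> {0}"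
proof
  assume K: "Kill = {0}"
  obtain v0 where v0: "v0 \<in> C" "v0 \<noteq> 0" using assms zero_in by blast
  \<comment> \<open>The induction tracks a lower bound for the degree of a product that does not
    kill v0; each further factor raises it by at least one.\<close>
  have "\<exists>X k. i \<le> k \<and> graded k X \<and> X v0 \<noteq> 0" for i :: nat
  proof (induction i)
    case 0
    have "graded 0 (\<lambda>v. v)" by (simp add: graded_def lin_id)
    then show ?case using v0 by blast
  next
    case (Suc i)
    then obtain X k where X: "i \<le> k" "graded k X" "X v0 \<noteq> 0" by blast
    have XC: "X v0 \<in> C" using X(2) v0(1) by (simp add: graded_def lin_on_def)
    have "X v0 \<notin> Kill" using X(3) K by blast
    then consider \<alpha> j where "2 \<le> deg \<alpha>" "uR U \<alpha> j (X v0) \<noteq> 0" | \<beta> a where "1 \<le> deg \<beta>" "uP U \<beta> a (X v0) \<noteq> 0"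
      using XC unfolding Kill_def by blast
    then show ?case
    proof cases
      case 1
      have "graded ((deg \<alpha> - 1) + k) (\<lambda>v. uR U \<alpha> j (X v))"
        using 1(1) by (intro graded_comp[OF X(2)] graded_R deg_nz) simp
      moreover have "Suc i \<le> (deg \<alpha> - 1) + k" using 1(1) X(1) by linarith
      ultimately show ?thesis using 1(2) by blast
    next
      case 2
      have "graded (deg \<beta> + k) (\<lambda>v. uP U \<beta> a (X v))" by (intro graded_comp[OF X(2)] graded_P)
      moreover have "Suc i \<le> deg \<beta> + k" using 2(1) X(1) by linarith
      ultimately show ?thesis using 2(2) by blast
    qed
  qed
  then show False using graded_bound v0(1) by blast
qed

text \<open>The elements of positive degree form an ideal of g^+: commuting one of them past any
  element produces elements of positive degree, which kill v again.\<close>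

lemma Kill_sub: "Psub U Kill"
  unfolding Psub_def
proof (intro conjI allI impI ballI)
  have R: "lin sc C (uR U \<alpha> j)" if "2 \<le> deg \<alpha>" for \<alpha> j using that by (intro linI R_lin deg_nz) simp
  have P: "lin sc C (uP U \<beta> a)" for \<beta> a by (intro linI P_lin)
  show "subsp sc C Kill"
    unfolding subsp_def Kill_def
    by (auto simp: lin.app_add[OF R] lin.app_sc[OF R] lin.app_0[OF R] lin.app_add[OF P] lin.app_sc[OF P] lin.app_0[OF P])
next
  fix \<alpha> :: "'n \<Rightarrow> nat" and j v assume \<alpha>: "\<alpha> \<noteq> 0" and v: "v \<in> Kill"
  have vC: "v \<in> C" and kR: "\<And>\<gamma> k. 2 \<le> deg \<gamma> \<Longrightarrow> uR U \<gamma> k v = 0" and kP: "\<And>\<beta> a. 1 \<le> deg \<beta> \<Longrightarrow> uP U \<beta> a v = 0"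
    using v by (auto simp: Kill_def)
  have d\<alpha>: "1 \<le> deg \<alpha>" using \<alpha> deg_0_iff[of \<alpha>] by simp
  interpret R: lin sc C "uR U \<alpha> j" using linI[OF R_lin[OF \<alpha>]] .
  show "uR U \<alpha> j v \<in> Kill" unfolding Kill_def
  proof (intro CollectI conjI allI impI)
    show "uR U \<alpha> j v \<in> C" using vC by simp
    fix \<gamma> :: "'n \<Rightarrow> nat" and k assume \<gamma>: "2 \<le> deg \<gamma>"
    have "sc (of_nat (\<gamma> j)) (uR U (\<alpha> + \<gamma> - eps j) k v) = 0"
    proof (cases "\<gamma> j = 0")
      case True
      \<comment> \<open>The coefficient is zero here, but scaling by zero is known to give zero only
        on the carrier, so the index must be seen to be nonzero.\<close>
      have nz: "\<alpha> + \<gamma> - eps j \<noteq> 0"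
      proof
        assume *: "\<alpha> + \<gamma> - eps j = 0"
        have "\<gamma> = 0"
        proof
          fix l show "\<gamma> l = 0 l" using fun_cong[OF *, of l] True by (cases "l = j") (auto simp: eps_apply)
        qed
        then show False using \<gamma> deg_0_iff[of \<gamma>] by simp
      qed
      show ?thesis using True vC nz by simp
    next
      case False
      have "2 \<le> deg (\<alpha> + \<gamma> - eps j)" using deg_shift[of \<gamma> j \<alpha>, OF False] \<gamma> d\<alpha> by linarith
      then show ?thesis by (simp add: kR)
    qed
    moreover have "sc (of_nat (\<alpha> k)) (uR U (\<alpha> + \<gamma> - eps k) j v) = 0"
    proof (cases "\<alpha> k = 0")
      case True
      have nz: "\<alpha> + \<gamma> - eps k \<noteq> 0"
      proof
        assume *: "\<alpha> + \<gamma> - eps k = 0"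
        have "\<alpha> = 0"
        proof
          fix l show "\<alpha> l = 0 l" using fun_cong[OF *, of l] True by (cases "l = k") (auto simp: eps_apply)
        qed
        then show False using \<alpha> by simp
      qed
      show ?thesis using True vC nz by simp
    next
      case False
      have "2 \<le> deg (\<alpha> + \<gamma> - eps k)" using deg_shift'[of \<alpha> k \<gamma>, OF False] \<gamma> d\<alpha> by linarith
      then show ?thesis by (simp add: kR)
    qed
    ultimately have "uR U \<alpha> j (uR U \<gamma> k v) - uR U \<gamma> k (uR U \<alpha> j v) = 0"
      using RR[OF \<alpha> _ vC, of \<gamma> j k] deg_nz[of \<gamma>] \<gamma> by simp
    then show "uR U \<gamma> k (uR U \<alpha> j v) = 0" using kR[OF \<gamma>] by simp
  next
    fix \<beta> :: "'n \<Rightarrow> nat" and a assume \<beta>: "1 \<le> deg \<beta>"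
    have "sc (of_nat (\<beta> j)) (uP U (\<alpha> + \<beta> - eps j) a v) = 0"
    proof (cases "\<beta> j = 0")
      case False
      have "1 \<le> deg (\<alpha> + \<beta> - eps j)" using deg_shift[of \<beta> j \<alpha>, OF False] \<beta> d\<alpha> by linarith
      then show ?thesis by (simp add: kP)
    qed (use vC in simp)
    then have "uR U \<alpha> j (uP U \<beta> a v) - uP U \<beta> a (uR U \<alpha> j v) = 0"
      using RP[OF \<alpha> vC, of j \<beta> a] by simp
    then show "uP U \<beta> a (uR U \<alpha> j v) = 0" using kP[OF \<beta>] by simp
  qed
next
  fix \<beta> :: "'n \<Rightarrow> nat" and a v assume v: "v \<in> Kill"
  have vC: "v \<in> C" and kR: "\<And>\<gamma> k. 2 \<le> deg \<gamma> \<Longrightarrow> uR U \<gamma> k v = 0" and kP: "\<And>\<beta> a. 1 \<le> deg \<beta> \<Longrightarrow> uP U \<beta> a v = 0"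
    using v by (auto simp: Kill_def)
  interpret P: lin sc C "uP U \<beta> a" using linI[OF P_lin] .
  show "uP U \<beta> a v \<in> Kill" unfolding Kill_def
  proof (intro CollectI conjI allI impI)
    show "uP U \<beta> a v \<in> C" using vC by simp
    fix \<gamma> :: "'n \<Rightarrow> nat" and k assume \<gamma>: "2 \<le> deg \<gamma>"
    have "sc (of_nat (\<beta> k)) (uP U (\<gamma> + \<beta> - eps k) a v) = 0"
    proof (cases "\<beta> k = 0")
      case False
      have "1 \<le> deg (\<gamma> + \<beta> - eps k)" using deg_shift[of \<beta> k \<gamma>, OF False] \<gamma> by linarith
      then show ?thesis by (simp add: kP)
    qed (use vC in simp)
    then have "uR U \<gamma> k (uP U \<beta> a v) - uP U \<beta> a (uR U \<gamma> k v) = 0"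
      using RP[OF _ vC, of \<gamma> k \<beta> a] deg_nz[of \<gamma>] \<gamma> by simp
    then show "uR U \<gamma> k (uP U \<beta> a v) = 0" using kR[OF \<gamma>] by simp
  next
    fix \<beta>' :: "'n \<Rightarrow> nat" and b assume \<beta>': "1 \<le> deg \<beta>'"
    have "1 \<le> deg (\<beta>' + \<beta>)" using \<beta>' by (simp add: deg_add)
    then have "uP U \<beta>' b (uP U \<beta> a v) - uP U \<beta> a (uP U \<beta>' b v) = 0" using PP[OF vC, of \<beta>' b \<beta> a] kP by simp
    then show "uP U \<beta>' b (uP U \<beta> a v) = 0" using kP[OF \<beta>'] by simp
  qed
qed

text \<open>By irreducibility the common kernel is everything, so U factors through degree zero and
  is the inflation of its restriction to that part.\<close>

lemma irreducible_UV:
  assumes nz: "C \<noteq> {0}" and irr: "\<And>N. Psub U N \<Longrightarrow> N = {0} \<or> N = C"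
  obtains V :: "('n, 'g, 'u) GLmod" where "gl_fdmod sg lb V" "Piso U (UV V)"
proof -
  have "Kill = C" using irr[OF Kill_sub] Kill_nonzero[OF nz] by blast
  then have kR: "\<And>\<alpha> j v. v \<in> C \<Longrightarrow> 2 \<le> deg \<alpha> \<Longrightarrow> uR U \<alpha> j v = 0"
    and kP: "\<And>\<beta> a v. v \<in> C \<Longrightarrow> 1 \<le> deg \<beta> \<Longrightarrow> uP U \<beta> a v = 0"
    unfolding Kill_def by blast+
  define V :: "('n, 'g, 'u) GLmod" where
    "V = \<lparr>vcar = C, vsc = sc, vA = (\<lambda>p j. uR U (eps p) j), vB = uP U 0\<rparr>"
  have sel: "vcar V = C" "vsc V = sc" "vA V p j = uR U (eps p) j" "vB V a = uP U 0 a" for p j a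
    by (simp_all add: V_def)
  have e: "eps p + eps r - eps r = (eps p :: 'n \<Rightarrow> nat)" "eps p + eps r - eps p = (eps r :: 'n \<Rightarrow> nat)" for p r
    by (auto simp: fun_eq_iff)
  have nz': "eps p + eps r - eps j \<noteq> (0 :: 'n \<Rightarrow> nat)" for p r j
  proof
    assume *: "eps p + eps r - eps j = (0 :: 'n \<Rightarrow> nat)"
    have "(eps p + eps r) l \<le> (if l = j then 1 else 0 :: nat)" for l
      using fun_cong[OF *, of l] by (simp add: eps_apply)
    from this[of p] this[of r] show False by (auto simp: eps_apply split: if_splits)
  qed
  have gl: "gl_fdmod sg lb V"
    unfolding gl_fdmod_def sel
  proof (intro conjI allI ballI)
    show "lin_on sc C (uR U (eps p) q)" for p q by (rule R_lin) simp
    show "lin_on sc C (uP U 0 a)" for a by (rule P_lin)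
    fix v assume v: "v \<in> C"
    show "uP U 0 (a + b) v = uP U 0 a v + uP U 0 b v" for a b by (rule P_add[OF v])
    show "uP U 0 (sg c a) v = sc c (uP U 0 a v)" for c a by (rule P_sg[OF v])
    show "uR U (eps p) q (uR U (eps r) t v) - uR U (eps r) t (uR U (eps p) q v)
      = (if q = r then uR U (eps p) t v else 0) - (if t = p then uR U (eps r) q v else 0)" for p q r t
      using RR[of "eps p" "eps r" v q t] v nz' by (auto simp: eps_apply e)
    show "uR U (eps p) q (uP U 0 a v) - uP U 0 a (uR U (eps p) q v) = 0" for p q a
      using RP[of "eps p" v q 0 a] v by simp
    show "uP U 0 a (uP U 0 b v) - uP U 0 b (uP U 0 a v) = uP U 0 (lb a b) v" for a b
      using PP[OF v, of 0 a 0 b] by simp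
  qed (use vs fd in auto)
  have "uR U \<alpha> j v = uR (UV V) \<alpha> j v" if \<alpha>: "\<alpha> \<noteq> 0" and v: "v \<in> C" for \<alpha> j v
  proof (cases "deg \<alpha> = 1")
    case True
    then obtain p where "\<alpha> = eps p" unfolding deg_1_iff by blast
    then show ?thesis by (simp add: sel)
  next
    case False
    then have "2 \<le> deg \<alpha>" using \<alpha> deg_0_iff[of \<alpha>] by linarith
    moreover have "uR (UV V) \<alpha> j v = 0" by (rule UV_simps(6)) (use False in auto)
    ultimately show ?thesis using kR[OF v] by simp
  qed
  moreover have "uP U \<beta> a v = uP (UV V) \<beta> a v" if v: "v \<in> C" for \<beta> a v
  proof (cases "\<beta> = 0")
    case False
    then have "1 \<le> deg \<beta>" using deg_0_iff[of \<beta>] by simp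
    then show ?thesis using False kP[OF v] by simp
  qed (simp add: sel)
  ultimately have "Piso U (UV V)"
    unfolding Piso_def UV_simps sel by (intro exI[of _ "\<lambda>x. x"]) (auto simp: bij_betw_def)
  with gl show thesis by (rule that)
qed

end

text \<open>Irreducible modules are indecomposable, which yields a g^+-module U first;
  irreducibility then passes along the isomorphisms to U and to V.\<close>

lemma irreducible_PhiC:
  fixes M :: "('n::finite, 'g::ab_group_add, 'j::ab_group_add) Jmod"
  assumes M: "catJ sg lb M" "Jirred M"
  obtains lam and V :: "('n, 'g, nat \<Rightarrow>\<^sub>0 complex) GLmod"
    where "gl_fdmod sg lb V" "GLirred V" "Jiso M (PhiC lam V)"
proof -
  obtain lam and U :: "('n, 'g, nat \<Rightarrow>\<^sub>0 complex) Pmod"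
    where U: "gplus_fdmod sg lb U" "Pindec U" "Jiso M (PhiB lam U)"
    using indecomposable_PhiB[OF M(1) Jirred_Jindec[OF M(2,1)]] by blast
  interpret U: gplus_module sg lb U by unfold_locales (rule U(1))
  have "Jirred (PhiB lam U)" by (rule Jirred_iso[OF U(3) M])
  then have irr: "ucar U \<noteq> {0} \<and> (\<forall>N. Psub U N \<longrightarrow> N = {0} \<or> N = ucar U)"
    using U.Jirred_iff_Psub[OF U.tensor_shape_PhiB] by blast
  obtain V :: "('n, 'g, nat \<Rightarrow>\<^sub>0 complex) GLmod" where V: "gl_fdmod sg lb V" "Piso U (UV V)"
    using U.irreducible_UV irr by blast
  interpret V: gl_module sg lb V by unfold_locales (rule V(1))
  have "Jiso (PhiB lam U) (PhiC lam V)"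
    by (rule Jiso_iff_Piso(1)[OF U(1) V.gplus_UV U.tensor_shape_PhiB V.tensor_shape_PhiC']) (simp add: congZ_refl V(2))
  with U(3) have iso: "Jiso M (PhiC lam V)" by (rule Jiso_trans)
  have "Jirred (PhiC lam V)" by (rule Jirred_iso[OF iso M])
  then have "GLirred V" by (simp add: V.Jirred_PhiC)
  with V(1) show thesis using iso by (rule that)
qed

theorem theorem4:
  fixes sg :: "complex \<Rightarrow> 'g::ab_group_add \<Rightarrow> 'g" and lb :: "'g \<Rightarrow> 'g \<Rightarrow> 'g"
  assumes "lie_algebra sg lb"
  shows
    \<comment> \<open>(a)\<close>
    "(\<forall>M :: ('n::finite, 'g, 'j::ab_group_add) Jmod. catJ sg lb M \<longrightarrow> poly_module M)
     \<comment> \<open>(b): the sums in the formulas have finitely many nonzero terms\<close>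
     \<and> (\<forall>U :: ('n, 'g, 'u::ab_group_add) Pmod. gplus_fdmod sg lb U \<and> Pindec U \<longrightarrow>
          (\<forall>j s. \<forall>v\<in>ucar U. finite {\<beta>. \<beta> \<noteq> 0 \<and> usc U (mpow s \<beta> / mfact \<beta>) (uR U \<beta> j v) \<noteq> 0})
        \<and> (\<forall>g s. \<forall>v\<in>ucar U. finite {\<beta>. usc U (mpow s \<beta> / mfact \<beta>) (uP U \<beta> g v) \<noteq> 0}))
     \<comment> \<open>(b): the construction lands in indecomposables of category J\<close>
     \<and> (\<forall>(lam::'n \<Rightarrow> complex) (U :: ('n, 'g, 'u) Pmod). gplus_fdmod sg lb U \<and> Pindec U \<longrightarrow>
          catJ sg lb (PhiB lam U) \<and> Jindec (PhiB lam U))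
     \<comment> \<open>(b): surjectivity up to isomorphism\<close>
     \<and> (\<forall>M :: ('n, 'g, 'j) Jmod. catJ sg lb M \<and> Jindec M \<longrightarrow>
          (\<exists>(lam::'n \<Rightarrow> complex) (U :: ('n, 'g, nat \<Rightarrow>\<^sub>0 complex) Pmod).
             gplus_fdmod sg lb U \<and> Pindec U \<and> Jiso M (PhiB lam U)))
     \<comment> \<open>(b): injectivity on classes\<close>
     \<and> (\<forall>(lam::'n \<Rightarrow> complex) lam' (U :: ('n, 'g, 'u) Pmod) (U' :: ('n, 'g, 'w::ab_group_add) Pmod).
          gplus_fdmod sg lb U \<and> Pindec U \<and> gplus_fdmod sg lb U' \<and> Pindec U' \<longrightarrow>
          (Jiso (PhiB lam U) (PhiB lam' U') \<longleftrightarrow> congZ lam lam' \<and> Piso U U'))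
     \<comment> \<open>(c): the construction lands in irreducibles of category J\<close>
     \<and> (\<forall>(lam::'n \<Rightarrow> complex) (V :: ('n, 'g, 'v::ab_group_add) GLmod). gl_fdmod sg lb V \<and> GLirred V \<longrightarrow>
          catJ sg lb (PhiC lam V) \<and> Jirred (PhiC lam V))
     \<comment> \<open>(c): surjectivity up to isomorphism\<close>
     \<and> (\<forall>M :: ('n, 'g, 'j) Jmod. catJ sg lb M \<and> Jirred M \<longrightarrow>
          (\<exists>(lam::'n \<Rightarrow> complex) (V :: ('n, 'g, nat \<Rightarrow>\<^sub>0 complex) GLmod).
             gl_fdmod sg lb V \<and> GLirred V \<and> Jiso M (PhiC lam V)))
     \<comment> \<open>(c): injectivity on classes\<close>
     \<and> (\<forall>(lam::'n \<Rightarrow> complex) lam' (V :: ('n, 'g, 'v) GLmod) (V' :: ('n, 'g, 'x::ab_group_add) GLmod).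
          gl_fdmod sg lb V \<and> GLirred V \<and> gl_fdmod sg lb V' \<and> GLirred V' \<longrightarrow>
          (Jiso (PhiC lam V) (PhiC lam' V') \<longleftrightarrow> congZ lam lam' \<and> GLiso V V'))"
proof (intro conjI allI impI)
  fix M :: "('n, 'g, 'j) Jmod" assume M: "catJ sg lb M"
  interpret M: catJ_module sg lb M by unfold_locales (rule M)
  obtain S and wt :: "'j \<Rightarrow> 'n \<Rightarrow> complex" where "finite S" "\<And>x. x \<in> S \<Longrightarrow> M.wtv (wt x) x" "\<And>x. x \<in> S \<Longrightarrow> x \<noteq> 0"
    "\<And>x. x \<in> S \<Longrightarrow> wrep (wt x) = wt x"
    "M.J \<subseteq> span_fam M.sc (\<lambda>(m, x). M.E m x) (UNIV \<times> S)"
    by (rule M.weight_generators) blast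
  then interpret W: catJ_generators sg lb M S wt by unfold_locales
  show "poly_module M" by (rule W.poly_module)
next
  fix U :: "('n, 'g, 'u) Pmod" assume "gplus_fdmod sg lb U \<and> Pindec U"
  then interpret U: gplus_module sg lb U by unfold_locales simp
  show "\<forall>v\<in>ucar U. finite {\<beta>. \<beta> \<noteq> 0 \<and> usc U (mpow s \<beta> / mfact \<beta>) (uR U \<beta> j v) \<noteq> 0}" for j s
    using U.finite_nonzero_terms(1) by blast
  show "\<forall>v\<in>ucar U. finite {\<beta>. usc U (mpow s \<beta> / mfact \<beta>) (uP U \<beta> g v) \<noteq> 0}" for g s
    using U.finite_nonzero_terms(2) by blast
next
  fix lam :: "'n \<Rightarrow> complex" and U :: "('n, 'g, 'u) Pmod" assume U: "gplus_fdmod sg lb U \<and> Pindec U"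
  then interpret U: gplus_module sg lb U by unfold_locales simp
  show "catJ sg lb (PhiB lam U)" by (rule tensor_module.catJ[OF U.tensor_moduleI[OF U.tensor_shape_PhiB]])
  show "Jindec (PhiB lam U)" using U U.Jindec_iff_Pindec[OF U.tensor_shape_PhiB] by blast
next
  fix M :: "('n, 'g, 'j) Jmod" assume M: "catJ sg lb M \<and> Jindec M"
  then obtain lam and U :: "('n, 'g, nat \<Rightarrow>\<^sub>0 complex) Pmod"
    where "gplus_fdmod sg lb U" "Pindec U" "Jiso M (PhiB lam U)"
    using indecomposable_PhiB by blast
  then show "\<exists>lam (U :: ('n, 'g, nat \<Rightarrow>\<^sub>0 complex) Pmod). gplus_fdmod sg lb U \<and> Pindec U \<and> Jiso M (PhiB lam U)"
    by blast
next
  fix lam lam' :: "'n \<Rightarrow> complex" and U :: "('n, 'g, 'u) Pmod" and U' :: "('n, 'g, 'w) Pmod"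
  assume UU': "gplus_fdmod sg lb U \<and> Pindec U \<and> gplus_fdmod sg lb U' \<and> Pindec U'"
  interpret U: gplus_module sg lb U using UU' by unfold_locales simp
  interpret U': gplus_module sg lb U' using UU' by unfold_locales simp
  \<comment> \<open>Recovering the weight class requires a nonzero fibre, which indecomposability
    includes.\<close>
  have "ucar U \<noteq> {0}" using UU' by (simp add: Pindec_def)
  then show "Jiso (PhiB lam U) (PhiB lam' U') \<longleftrightarrow> congZ lam lam' \<and> Piso U U'"
    using Jiso_iff_Piso[OF U.gm U'.gm U.tensor_shape_PhiB U'.tensor_shape_PhiB] by blast
next
  fix lam :: "'n \<Rightarrow> complex" and V :: "('n, 'g, 'v) GLmod" assume V: "gl_fdmod sg lb V \<and> GLirred V"
  then interpret V: gl_module sg lb V by unfold_locales simp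
  show "catJ sg lb (PhiC lam V)" by (rule V.catJ_PhiC)
  show "Jirred (PhiC lam V)" using V by (simp add: V.Jirred_PhiC)
next
  fix M :: "('n, 'g, 'j) Jmod" assume M: "catJ sg lb M \<and> Jirred M"
  then obtain lam and V :: "('n, 'g, nat \<Rightarrow>\<^sub>0 complex) GLmod"
    where "gl_fdmod sg lb V" "GLirred V" "Jiso M (PhiC lam V)"
    using irreducible_PhiC by blast
  then show "\<exists>lam (V :: ('n, 'g, nat \<Rightarrow>\<^sub>0 complex) GLmod). gl_fdmod sg lb V \<and> GLirred V \<and> Jiso M (PhiC lam V)"
    by blast
next
  fix lam lam' :: "'n \<Rightarrow> complex" and V :: "('n, 'g, 'v) GLmod" and V' :: "('n, 'g, 'x) GLmod"
  assume VV': "gl_fdmod sg lb V \<and> GLirred V \<and> gl_fdmod sg lb V' \<and> GLirred V'"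
  interpret V: gl_module sg lb V using VV' by unfold_locales simp
  interpret V': gl_module sg lb V' using VV' by unfold_locales simp
  have "ucar (UV V) \<noteq> {0}" using VV' by (simp add: GLirred_def)
  then have "Jiso (PhiC lam V) (PhiC lam' V') \<longleftrightarrow> congZ lam lam' \<and> Piso (UV V) (UV V')"
    using Jiso_iff_Piso[OF V.gplus_UV V'.gplus_UV V.tensor_shape_PhiC' V'.tensor_shape_PhiC'] by blast
  then show "Jiso (PhiC lam V) (PhiC lam' V') \<longleftrightarrow> congZ lam lam' \<and> GLiso V V'"
    by (simp only: Piso_UV[OF V.gl V'.gl])
qed

end
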